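(* Let $(\Omega,\mathcal E,\mathbb P)$ be a probability space, $\mathcal F\subset\mathcal E$ a sub-$\sigma$-algebra, and $\rho:L^\infty_{\mathcal F}(\mathcal E)\to L^0(\mathcal F)$ a conditional risk measure. Then $\rho$ has the Fatou property if and only if it admits a representation $$\rho(x)=\sup\{\mathbb E_{\mathbb P}[xy|\mathcal F]-\rho^\#(y): y\in L^1_{\mathcal F}(\mathcal E),\ y\le0,\ \mathbb E_{\mathbb P}[y|\mathcal F]=-1\}\quad\text{for all }x\in L^\infty_{\mathcal F}(\mathcal E).$$ In this case, the following are equivalent: 1. $\rho$ attains its representation; 2. $\rho$ has the Lebesgue property; 3. $\rho^\#$ is stably inf-compact w.r.t. $\sigma_s(L^1_{\mathcal F}(\mathcal E),L^\infty_{\mathcal F}(\mathcal E))$.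
   Context: $L^0(\mathcal E)$ is the space of real-valued $\mathcal E$-measurable random variables modulo a.s. equality; $x\le y$, $x<y$ are understood a.s. $L^0(\mathcal F)$ is defined likewise; $L^0_{++}(\mathcal F)$ and $\overline{L^0}(\mathcal F)$ are the (classes of) $\mathcal F$-measurable random variables with values in $(0,\infty)$ and $[-\infty,\infty]$. Suprema of families in $\overline{L^0}(\mathcal F)$ are essential suprema. $\bar{\mathcal F}$ is the Boolean algebra of events of $\mathcal F$ modulo null sets, $I$ its unity (class of $\Omega$), $p(I)$ the set of (countable) partitions of $I$ in $\bar{\mathcal F}$; for $a\in\bar{\mathcal F}$, $1_a$ is the class of the characteristic function of a representative of $a$. For $(a_k)_{k\in\mathbb N}\in p(I)$ and a sequence $(x_k)$, $\sum1_{a_k}x_k:=\lim_k\sum_{i=1}^k1_{a_i}x_i$ a.s. The extended conditional expectation is $\mathbb E_{\mathbb P}[x|\mathcal F]:=\lim_n\mathbb E_{\mathbb P}[x^+\wedge n|\mathcal F]-\lim_n\mathbb E_{\mathbb P}[x^-\wedge n|\mathcal F]\in\overline{L^0}(\mathcal F)$ whenever at least one of the limits is finite. $L^1_{\mathcal F}(\mathcal E):=\{x\in L^0(\mathcal E):\mathbb E_{\mathbb P}[|x||\mathcal F]<\infty\}$ and $L^\infty_{\mathcal F}(\mathcal E):=\{x\in L^0(\mathcal E):|x|\le\eta\text{ for some }\eta\in L^0(\mathcal F)\}$. Write $\mathscr X:=L^\infty_{\mathcal F}(\mathcal E)$; its Köthe dual module $\mathscr X^\#:=\{y\in L^0(\mathcal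 E):xy\in L^1_{\mathcal F}(\mathcal E)\ \forall x\in\mathscr X\}$ is $L^1_{\mathcal F}(\mathcal E)$. A *conditional risk measure* is $\rho:\mathscr X\to L^0(\mathcal F)$ with: $\rho(\eta x+(1-\eta)y)\le\eta\rho(x)+(1-\eta)\rho(y)$ for $\eta\in L^0(\mathcal F)$, $0\le\eta\le1$, $x,y\in\mathscr X$; $x\le y$ implies $\rho(y)\le\rho(x)$; $\rho(x+\eta)=\rho(x)-\eta$ for $\eta\in L^0(\mathcal F)$, $x\in\mathscr X$. Fenchel transform: $\rho^\#(y):=\sup\{\mathbb E_{\mathbb P}[xy|\mathcal F]-\rho(x):x\in\mathscr X\}\in\overline{L^0}(\mathcal F)$ for $y\in\mathscr X^\#$. $\rho$ attains its representation if for every $x\in\mathscr X$ there is $y\in\mathscr X^\#$ with $\rho(x)=\mathbb E_{\mathbb P}[xy|\mathcal F]-\rho^\#(y)$. Fatou (resp. Lebesgue) property: $\lim_nx_n=x$ a.s. ($x_n,x\in\mathscr X$), $y\in\mathscr X$, $|x_n|\le y$ for all $n$ imply $\liminf_n\rho(x_n)\ge\rho(x)$ (resp. $\lim_n\rho(x_n)=\rho(x)$ a.s.). Stable weak topology $\sigma_s(\mathscr X^\#,\mathscr X)$ on $\mathscr X^\#$: it has as base the sets $y+U_{(F_k),(a_k),\varepsilon}$, $y\in\mathscr X^\#$, $(a_k)\in p(I)$, $F_k\subset\mathscr X$ non-empty finite, $\varepsilon\in L^0_{++}(\mathcal F)$, where $U_{(F_k),(a_k),\varepsilon}:=\{y\in\mathscr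 X^\#:\sum1_{a_k}\sup_{x\in F_k}|\mathbb E_{\mathbb P}[xy|\mathcal F]|<\varepsilon\}$. A non-empty $S\subset L^0(\mathcal E)$ is stable if $\sum1_{a_k}x_k\in S$ for all $(x_k)\subset S$, $(a_k)\in p(I)$. A collection $\mathscr B$ of non-empty subsets of $L^0(\mathcal E)$ is stable if $\sum1_{a_k}S_k:=\{\sum1_{a_k}x_k:x_k\in S_k\ \forall k\}\in\mathscr B$ for all sequences $(S_k)$ in $\mathscr B$ and $(a_k)\in p(I)$. A stable filter base is a filter base that is a stable collection consisting of stable sets. A non-empty set $S$ is stably compact if it is stable and every stable filter base on $S$ has a cluster point in $S$. $\rho^\#$ is stably inf-compact w.r.t. $\sigma_s(\mathscr X^\#,\mathscr X)$ if $V_\eta(\rho^\#):=\{y\in\mathscr X^\#:\rho^\#(y)\le\eta\}$ is stably compact w.r.t. this topology for every $\eta\in L^0(\mathcal F)$ with $V_\eta(\rho^\#)\ne\emptyset$. *)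

theory Defs
  imports "HOL-Probability.Probability"
begin

text \<open>
  Throughout, \<open>M\<close> is the probability space \<open>(\<Omega>, \<E>, \<bbbP>)\<close> and \<open>F\<close> is the sub-\<open>\<sigma>\<close>-algebra
  (only the sets of \<open>F\<close> matter, not its measure).  Elements of \<open>L\<^sup>0\<close> are handled through measurable
  representatives: equalities and inequalities are stated almost everywhere, and subsets of
  \<open>L\<^sup>0(\<E>)\<close> are sets of measurable functions that are closed under a.e. equality.
\<close>

section \<open>Extended conditional expectation, essential suprema, spaces\<close>

definition cond_exp_ext :: "'a measure \<Rightarrow> 'a measure \<Rightarrow> ('a \<Rightarrow> real) \<Rightarrow> 'a \<Rightarrow> ereal" where
  "cond_exp_ext M F x \<omega> =
     lim (\<lambda>n. ereal (real_cond_exp M F (\<lambda>w. min (max (x w) 0) (real n)) \<omega>))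
   - lim (\<lambda>n. ereal (real_cond_exp M F (\<lambda>w. min (max (- x w) 0) (real n)) \<omega>))"

definition is_ess_sup_family ::
  "'a measure \<Rightarrow> 'a measure \<Rightarrow> ('a \<Rightarrow> ereal) set \<Rightarrow> ('a \<Rightarrow> ereal) \<Rightarrow> bool" where
  "is_ess_sup_family M F \<H> g \<longleftrightarrow>
     g \<in> borel_measurable F \<and>
     (\<forall>h\<in>\<H>. AE \<omega> in M. h \<omega> \<le> g \<omega>) \<and>
     (\<forall>g'\<in>borel_measurable F. (\<forall>h\<in>\<H>. AE \<omega> in M. h \<omega> \<le> g' \<omega>) \<longrightarrow> (AE \<omega> in M. g \<omega> \<le> g' \<omega>))"

text \<open>The supremum of a family in the complete lattice of \<open>F\<close>-measurable extended real random
  variables modulo a.e. equality; it is determined only up to a.e. equality.\<close>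

definition ess_sup_family ::
  "'a measure \<Rightarrow> 'a measure \<Rightarrow> ('a \<Rightarrow> ereal) set \<Rightarrow> 'a \<Rightarrow> ereal" where
  "ess_sup_family M F \<H> = (SOME g. is_ess_sup_family M F \<H> g)"

definition L1_cond :: "'a measure \<Rightarrow> 'a measure \<Rightarrow> ('a \<Rightarrow> real) set" where
  "L1_cond M F = {x \<in> borel_measurable M. AE \<omega> in M. cond_exp_ext M F (\<lambda>w. \<bar>x w\<bar>) \<omega> < \<infinity>}"

definition Linf_cond :: "'a measure \<Rightarrow> 'a measure \<Rightarrow> ('a \<Rightarrow> real) set" where
  "Linf_cond M F =
     {x \<in> borel_measurable M. \<exists>\<eta>\<in>borel_measurable F. AE \<omega> in M. \<bar>x \<omega>\<bar> \<le> (\<eta> \<omega> :: real)}"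

definition koethe_dual ::
  "'a measure \<Rightarrow> 'a measure \<Rightarrow> ('a \<Rightarrow> real) set \<Rightarrow> ('a \<Rightarrow> real) set" where
  "koethe_dual M F X =
     {y \<in> borel_measurable M. \<forall>x\<in>X. (\<lambda>\<omega>. x \<omega> * y \<omega>) \<in> L1_cond M F}"

lemma cond_exp_ext_nonneg:
  assumes "prob_space M" "subalgebra M F" and x[measurable]: "x \<in> borel_measurable M"
    and nn: "\<And>\<omega>. 0 \<le> x \<omega>"
  shows "AE \<omega> in M. cond_exp_ext M F x \<omega> = enn2ereal (nn_cond_exp M F (\<lambda>w. ennreal (x w)) \<omega>)"
proof -
  interpret prob_space M by fact
  interpret finite_measure_subalgebra M F by unfold_locales fact
  define g where "g n w = min (x w) (real n)" for n :: nat and w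
  have [measurable]: "g n \<in> borel_measurable M" for n unfolding g_def by measurable
  have g0: "0 \<le> g n w" for n w using nn by (simp add: g_def)
  have gmono: "g n w \<le> g m w" if "n \<le> m" for n m w using that by (auto simp: g_def)
  let ?N = "\<lambda>n. nn_cond_exp M F (\<lambda>w. ennreal (g n w))"
  have zero: "AE \<omega> in M. nn_cond_exp M F (\<lambda>w. 0) \<omega> = 0"
    using nn_cond_exp_F_meas[of "\<lambda>_. 0"] by auto
  have bound: "AE \<omega> in M. ?N n \<omega> \<le> ennreal (real n)" for n
  proof -
    have "AE \<omega> in M. ?N n \<omega> \<le> nn_cond_exp M F (\<lambda>_. ennreal (real n)) \<omega>"
      by (rule nn_cond_exp_mono) (auto simp: g_def intro!: ennreal_leI)
    moreover have "AE \<omega> in M. ennreal (real n) = nn_cond_exp M F (\<lambda>_. ennreal (real n)) \<omega>"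
      by (rule nn_cond_exp_F_meas[of "\<lambda>_. ennreal (real n)"]) auto
    ultimately show ?thesis by auto
  qed
  have mono: "AE \<omega> in M. ?N n \<omega> \<le> ?N (Suc n) \<omega>" for n
    by (rule nn_cond_exp_mono) (auto intro!: ennreal_leI gmono)
  have Ng: "AE \<omega> in M. ereal (real_cond_exp M F (\<lambda>w. min (max (x w) 0) (real n)) \<omega>) = enn2ereal (?N n \<omega>)" for n
  proof -
    have e: "(\<lambda>w. min (max (x w) 0) (real n)) = g n" using nn by (simp add: g_def max_absorb1 fun_eq_iff)
    have e2: "(\<lambda>w. ennreal (- g n w)) = (\<lambda>_. 0)" using g0 by (auto simp: ennreal_eq_0_iff)
    show ?thesis using bound[of n] zero unfolding e real_cond_exp_def e2
    proof eventually_elim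
      case (elim \<omega>)
      obtain r where r: "0 \<le> r" "?N n \<omega> = ennreal r"
        using elim(1) by (cases "?N n \<omega>") (auto simp: top_unique)
      then show ?case by (simp add: elim(2) enn2ereal_ennreal)
    qed
  qed
  have sup: "AE \<omega> in M. (SUP n. ?N n \<omega>) = nn_cond_exp M F (\<lambda>w. ennreal (x w)) \<omega>"
  proof (rule nn_cond_exp_charact)
    have xs: "ennreal (x w) = (SUP n. ennreal (g n w))" for w
    proof (rule sym, rule SUP_eqI)
      fix y assume y: "\<And>n. n \<in> UNIV \<Longrightarrow> ennreal (g n w) \<le> y"
      obtain n where "x w \<le> real n" using real_arch_simple by blast
      then show "ennreal (x w) \<le> y" using y[of n] by (simp add: g_def)
    qed (auto simp: g_def intro!: ennreal_leI)
    fix A assume [measurable]: "A \<in> sets F"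
    have [measurable]: "A \<in> sets M" using subalg \<open>A \<in> sets F\<close> by (auto simp: subalgebra_def)
    have "(\<integral>\<^sup>+\<omega>\<in>A. ennreal (x \<omega>) \<partial>M) = (\<integral>\<^sup>+\<omega>. (SUP n. ennreal (g n \<omega>) * indicator A \<omega>) \<partial>M)"
      unfolding xs by (simp add: SUP_mult_right_ennreal)
    also have "\<dots> = (SUP n. \<integral>\<^sup>+\<omega>\<in>A. ennreal (g n \<omega>) \<partial>M)"
      by (rule nn_integral_monotone_convergence_SUP)
         (auto simp: incseq_def le_fun_def intro!: mult_right_mono ennreal_leI gmono)
    also have "\<dots> = (SUP n. \<integral>\<^sup>+\<omega>\<in>A. ?N n \<omega> \<partial>M)"
      using nn_cond_exp_intg[of "indicator A"] by (simp add: mult.commute)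
    also have "\<dots> = (\<integral>\<^sup>+\<omega>. (SUP n. ?N n \<omega> * indicator A \<omega>) \<partial>M)"
    proof (rule nn_integral_monotone_convergence_SUP_AE[symmetric])
      show "AE \<omega> in M. ?N n \<omega> * indicator A \<omega> \<le> ?N (Suc n) \<omega> * indicator A \<omega>" for n
        using mono[of n] by eventually_elim (rule mult_right_mono, auto)
    qed measurable
    finally show "(\<integral>\<^sup>+\<omega>\<in>A. ennreal (x \<omega>) \<partial>M) = (\<integral>\<^sup>+\<omega>\<in>A. (SUP n. ?N n \<omega>) \<partial>M)"
      by (simp add: SUP_mult_right_ennreal)
  qed auto
  have z: "(\<lambda>w. min (max (- x w) 0) (real n)) = (\<lambda>_. 0)" for n
    using nn by (auto simp: max_def fun_eq_iff min_def)
  have rz: "AE \<omega> in M. real_cond_exp M F (\<lambda>_. 0) \<omega> = 0"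
    using zero by (auto simp: real_cond_exp_def)
  have "AE \<omega> in M. \<forall>n. ?N n \<omega> \<le> ?N (Suc n) \<omega>" using mono by (simp add: AE_all_countable)
  moreover have "AE \<omega> in M. \<forall>n. ereal (real_cond_exp M F (\<lambda>w. min (max (x w) 0) (real n)) \<omega>) = enn2ereal (?N n \<omega>)"
    using Ng by (simp add: AE_all_countable)
  ultimately show ?thesis using sup rz
  proof eventually_elim
    case (elim \<omega>)
    have "(\<lambda>n. ?N n \<omega>) \<longlonglongrightarrow> nn_cond_exp M F (\<lambda>w. ennreal (x w)) \<omega>"
      unfolding elim(3)[symmetric] by (rule LIMSEQ_SUP) (use elim in \<open>auto intro: incseq_SucI\<close>)
    then have "(\<lambda>n. enn2ereal (?N n \<omega>)) \<longlonglongrightarrow> enn2ereal (nn_cond_exp M F (\<lambda>w. ennreal (x w)) \<omega>)"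
      by (rule tendsto_enn2erealI)
    then have "lim (\<lambda>n. enn2ereal (?N n \<omega>)) = enn2ereal (nn_cond_exp M F (\<lambda>w. ennreal (x w)) \<omega>)"
      by (rule limI)
    then show ?case using elim by (simp add: cond_exp_ext_def z zero_ereal_def[symmetric])
  qed
qed

lemma L1_cond_iff:
  assumes "prob_space M" "subalgebra M F"
  shows "x \<in> L1_cond M F \<longleftrightarrow> x \<in> borel_measurable M \<and>
    (AE \<omega> in M. nn_cond_exp M F (\<lambda>w. ennreal \<bar>x w\<bar>) \<omega> < \<infinity>)"
proof (cases "x \<in> borel_measurable M")
  case True
  then have "(\<lambda>w. \<bar>x w\<bar>) \<in> borel_measurable M" by measurable
  from cond_exp_ext_nonneg[OF assms this]
  have *: "AE \<omega> in M. cond_exp_ext M F (\<lambda>w. \<bar>x w\<bar>) \<omega> = enn2ereal (nn_cond_exp M F (\<lambda>w. ennreal \<bar>x w\<bar>) \<omega>)" by simp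
  have **: "enn2ereal y < \<infinity> \<longleftrightarrow> y < \<infinity>" for y :: ennreal
    by (simp add: less_ennreal.rep_eq)
  have "(AE \<omega> in M. cond_exp_ext M F (\<lambda>w. \<bar>x w\<bar>) \<omega> < \<infinity>) \<longleftrightarrow>
    (AE \<omega> in M. nn_cond_exp M F (\<lambda>w. ennreal \<bar>x w\<bar>) \<omega> < \<infinity>)"
    by (rule eventually_subst, rule eventually_mono[OF *]) (simp only: **)
  with True show ?thesis by (simp add: L1_cond_def)
qed (simp add: L1_cond_def)

lemma koethe_dual_Linf_cond:
  assumes "prob_space M" "subalgebra M F"
  shows "koethe_dual M F (Linf_cond M F) = L1_cond M F"
proof
  interpret prob_space M by fact
  interpret finite_measure_subalgebra M F by unfold_locales fact
  have "(\<lambda>_. 1) \<in> Linf_cond M F" by (auto simp: Linf_cond_def intro!: bexI[of _ "\<lambda>_. 1"])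
  then show "koethe_dual M F (Linf_cond M F) \<subseteq> L1_cond M F" by (fastforce simp: koethe_dual_def)
  show "L1_cond M F \<subseteq> koethe_dual M F (Linf_cond M F)"
  proof
    fix y assume y: "y \<in> L1_cond M F"
    then have [measurable]: "y \<in> borel_measurable M" by (simp add: L1_cond_def)
    have "(\<lambda>\<omega>. x \<omega> * y \<omega>) \<in> L1_cond M F" if x: "x \<in> Linf_cond M F" for x
    proof -
      have [measurable]: "x \<in> borel_measurable M" using x by (simp add: Linf_cond_def)
      obtain \<eta> :: "'a \<Rightarrow> real" where [measurable]: "\<eta> \<in> borel_measurable F"
        and \<eta>: "AE \<omega> in M. \<bar>x \<omega>\<bar> \<le> \<eta> \<omega>" using x by (auto simp: Linf_cond_def)
      have [measurable]: "\<eta> \<in> borel_measurable M"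
        by (rule measurable_from_subalg[OF subalg]) measurable
      have "AE \<omega> in M. nn_cond_exp M F (\<lambda>w. ennreal \<bar>x w * y w\<bar>) \<omega>
          \<le> nn_cond_exp M F (\<lambda>w. ennreal (\<eta> w) * ennreal \<bar>y w\<bar>) \<omega>"
      proof (rule nn_cond_exp_mono)
        show "AE w in M. ennreal \<bar>x w * y w\<bar> \<le> ennreal (\<eta> w) * ennreal \<bar>y w\<bar>"
          using \<eta> by eventually_elim
            (auto simp: ennreal_mult''[symmetric] abs_mult intro!: ennreal_leI mult_right_mono)
      qed measurable
      moreover have "AE \<omega> in M. ennreal (\<eta> \<omega>) * nn_cond_exp M F (\<lambda>w. ennreal \<bar>y w\<bar>) \<omega>
          = nn_cond_exp M F (\<lambda>w. ennreal (\<eta> w) * ennreal \<bar>y w\<bar>) \<omega>"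
        by (rule nn_cond_exp_prod) measurable
      moreover have "AE \<omega> in M. nn_cond_exp M F (\<lambda>w. ennreal \<bar>y w\<bar>) \<omega> < \<infinity>"
        using y L1_cond_iff[OF assms] by simp
      ultimately have "AE \<omega> in M. nn_cond_exp M F (\<lambda>w. ennreal \<bar>x w * y w\<bar>) \<omega> < \<infinity>"
        by eventually_elim (metis ennreal_less_top ennreal_mult_less_top infinity_ennreal_def le_less_trans)
      then show ?thesis using L1_cond_iff[OF assms] by simp
    qed
    then show "y \<in> koethe_dual M F (Linf_cond M F)" by (simp add: koethe_dual_def)
  qed
qed

section \<open>Conditional risk measures\<close>

text \<open>Compatibility of \<open>\<rho>\<close> with a.e. equality is a consequence of monotonicity.\<close>

definition cond_risk_measure ::
  "'a measure \<Rightarrow> 'a measure \<Rightarrow> ('a \<Rightarrow> real) set \<Rightarrow> (('a \<Rightarrow> real) \<Rightarrow> 'a \<Rightarrow> real) \<Rightarrow> bool" where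
  "cond_risk_measure M F X \<rho> \<longleftrightarrow>
     (\<forall>x\<in>X. \<rho> x \<in> borel_measurable F) \<and>
     (\<forall>\<eta>\<in>borel_measurable F. \<forall>x\<in>X. \<forall>y\<in>X. (AE \<omega> in M. 0 \<le> \<eta> \<omega> \<and> \<eta> \<omega> \<le> 1) \<longrightarrow>
        (AE \<omega> in M. \<rho> (\<lambda>w. \<eta> w * x w + (1 - \<eta> w) * y w) \<omega>
                      \<le> \<eta> \<omega> * \<rho> x \<omega> + (1 - \<eta> \<omega>) * \<rho> y \<omega>)) \<and>
     (\<forall>x\<in>X. \<forall>y\<in>X. (AE \<omega> in M. x \<omega> \<le> y \<omega>) \<longrightarrow> (AE \<omega> in M. \<rho> y \<omega> \<le> \<rho> x \<omega>)) \<and>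
     (\<forall>\<eta>\<in>borel_measurable F. \<forall>x\<in>X. AE \<omega> in M. \<rho> (\<lambda>w. x w + \<eta> w) \<omega> = \<rho> x \<omega> - \<eta> \<omega>)"

definition fenchel ::
  "'a measure \<Rightarrow> 'a measure \<Rightarrow> ('a \<Rightarrow> real) set \<Rightarrow> (('a \<Rightarrow> real) \<Rightarrow> 'a \<Rightarrow> real) \<Rightarrow>
   ('a \<Rightarrow> real) \<Rightarrow> 'a \<Rightarrow> ereal" where
  "fenchel M F X \<rho> y =
     ess_sup_family M F
       {(\<lambda>\<omega>. cond_exp_ext M F (\<lambda>w. x w * y w) \<omega> - ereal (\<rho> x \<omega>)) | x. x \<in> X}"

definition attains_representation ::
  "'a measure \<Rightarrow> 'a measure \<Rightarrow> ('a \<Rightarrow> real) set \<Rightarrow> (('a \<Rightarrow> real) \<Rightarrow> 'a \<Rightarrow> real) \<Rightarrow> bool" where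
  "attains_representation M F X \<rho> \<longleftrightarrow>
     (\<forall>x\<in>X. \<exists>y\<in>koethe_dual M F X.
        AE \<omega> in M. ereal (\<rho> x \<omega>) =
          cond_exp_ext M F (\<lambda>w. x w * y w) \<omega> - fenchel M F X \<rho> y \<omega>)"

definition fatou_property ::
  "'a measure \<Rightarrow> ('a \<Rightarrow> real) set \<Rightarrow> (('a \<Rightarrow> real) \<Rightarrow> 'a \<Rightarrow> real) \<Rightarrow> bool" where
  "fatou_property M X \<rho> \<longleftrightarrow>
     (\<forall>xs x y. (\<forall>n. xs n \<in> X) \<and> x \<in> X \<and> y \<in> X \<and>
        (AE \<omega> in M. (\<lambda>n. xs n \<omega>) \<longlonglongrightarrow> x \<omega>) \<and> (\<forall>n. AE \<omega> in M. \<bar>xs n \<omega>\<bar> \<le> y \<omega>) \<longrightarrow>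
        (AE \<omega> in M. ereal (\<rho> x \<omega>) \<le> liminf (\<lambda>n. ereal (\<rho> (xs n) \<omega>))))"

definition lebesgue_property ::
  "'a measure \<Rightarrow> ('a \<Rightarrow> real) set \<Rightarrow> (('a \<Rightarrow> real) \<Rightarrow> 'a \<Rightarrow> real) \<Rightarrow> bool" where
  "lebesgue_property M X \<rho> \<longleftrightarrow>
     (\<forall>xs x y. (\<forall>n. xs n \<in> X) \<and> x \<in> X \<and> y \<in> X \<and>
        (AE \<omega> in M. (\<lambda>n. xs n \<omega>) \<longlonglongrightarrow> x \<omega>) \<and> (\<forall>n. AE \<omega> in M. \<bar>xs n \<omega>\<bar> \<le> y \<omega>) \<longrightarrow>
        (AE \<omega> in M. (\<lambda>n. \<rho> (xs n) \<omega>) \<longlonglongrightarrow> \<rho> x \<omega>))"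

section \<open>Stability and stable compactness\<close>

text \<open>Every countable partition of unity in the algebra of events modulo null sets has
  representatives that form a genuine partition of \<open>\<Omega>\<close>.  Members may be empty, so finite
  partitions are included.\<close>

definition event_partition :: "'a measure \<Rightarrow> (nat \<Rightarrow> 'a set) \<Rightarrow> bool" where
  "event_partition F a \<longleftrightarrow> range a \<subseteq> sets F \<and> disjoint_family a \<and> (\<Union>k. a k) = space F"

definition concat_rv ::
  "(nat \<Rightarrow> 'a set) \<Rightarrow> (nat \<Rightarrow> 'a \<Rightarrow> 'b) \<Rightarrow> 'a \<Rightarrow>
   'b :: {comm_monoid_add, times, zero_neq_one, topological_space}" where
  "concat_rv a x \<omega> = (\<Sum>k. indicator (a k) \<omega> * x k \<omega>)"

definition L0_subset :: "'a measure \<Rightarrow> ('a \<Rightarrow> real) set \<Rightarrow> bool" where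
  "L0_subset M S \<longleftrightarrow> S \<subseteq> borel_measurable M \<and>
     (\<forall>x\<in>S. \<forall>y\<in>borel_measurable M. (AE \<omega> in M. y \<omega> = x \<omega>) \<longrightarrow> y \<in> S)"

definition stable_set :: "'a measure \<Rightarrow> 'a measure \<Rightarrow> ('a \<Rightarrow> real) set \<Rightarrow> bool" where
  "stable_set M F S \<longleftrightarrow> S \<noteq> {} \<and> L0_subset M S \<and>
     (\<forall>x a. (\<forall>k. x k \<in> S) \<and> event_partition F a \<longrightarrow> concat_rv a x \<in> S)"

text \<open>The a.e. equality keeps the concatenation closed under a.e. equality.\<close>

definition concat_sets ::
  "'a measure \<Rightarrow> (nat \<Rightarrow> 'a set) \<Rightarrow> (nat \<Rightarrow> ('a \<Rightarrow> real) set) \<Rightarrow> ('a \<Rightarrow> real) set" where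
  "concat_sets M a S =
     {z \<in> borel_measurable M. \<exists>x. (\<forall>k. x k \<in> S k) \<and> (AE \<omega> in M. z \<omega> = concat_rv a x \<omega>)}"

definition stable_collection ::
  "'a measure \<Rightarrow> 'a measure \<Rightarrow> ('a \<Rightarrow> real) set set \<Rightarrow> bool" where
  "stable_collection M F \<B> \<longleftrightarrow>
     (\<forall>S\<in>\<B>. S \<noteq> {} \<and> L0_subset M S) \<and>
     (\<forall>S a. (\<forall>k. S k \<in> \<B>) \<and> event_partition F a \<longrightarrow> concat_sets M a S \<in> \<B>)"

definition filter_base :: "'b set set \<Rightarrow> bool" where
  "filter_base \<B> \<longleftrightarrow> \<B> \<noteq> {} \<and> {} \<notin> \<B> \<and> (\<forall>A\<in>\<B>. \<forall>B\<in>\<B>. \<exists>C\<in>\<B>. C \<subseteq> A \<inter> B)"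

definition stable_filter_base ::
  "'a measure \<Rightarrow> 'a measure \<Rightarrow> ('a \<Rightarrow> real) set set \<Rightarrow> bool" where
  "stable_filter_base M F \<B> \<longleftrightarrow>
     filter_base \<B> \<and> stable_collection M F \<B> \<and> (\<forall>S\<in>\<B>. stable_set M F S)"

definition stably_compact ::
  "'a measure \<Rightarrow> 'a measure \<Rightarrow> ('a \<Rightarrow> real) topology \<Rightarrow> ('a \<Rightarrow> real) set \<Rightarrow> bool" where
  "stably_compact M F T S \<longleftrightarrow> stable_set M F S \<and>
     (\<forall>\<B>. stable_filter_base M F \<B> \<and> (\<forall>B\<in>\<B>. B \<subseteq> S) \<longrightarrow>
        (\<exists>x\<in>S. \<forall>B\<in>\<B>. x \<in> T closure_of B))"

definition stable_weak_nhd ::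
  "'a measure \<Rightarrow> 'a measure \<Rightarrow> ('a \<Rightarrow> real) set \<Rightarrow>
   (nat \<Rightarrow> ('a \<Rightarrow> real) set) \<Rightarrow> (nat \<Rightarrow> 'a set) \<Rightarrow> ('a \<Rightarrow> real) \<Rightarrow> ('a \<Rightarrow> real) set" where
  "stable_weak_nhd M F Y \<Phi> a \<epsilon> =
     {y \<in> Y. AE \<omega> in M.
        concat_rv a (\<lambda>k w. SUP x\<in>\<Phi> k. \<bar>cond_exp_ext M F (\<lambda>v. x v * y v) w\<bar>) \<omega> < ereal (\<epsilon> \<omega>)}"

definition stable_weak_base ::
  "'a measure \<Rightarrow> 'a measure \<Rightarrow> ('a \<Rightarrow> real) set \<Rightarrow> ('a \<Rightarrow> real) set \<Rightarrow> ('a \<Rightarrow> real) set set" where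
  "stable_weak_base M F Y X =
     {(\<lambda>u \<omega>. y \<omega> + u \<omega>) ` stable_weak_nhd M F Y \<Phi> a \<epsilon> | y \<Phi> a \<epsilon>.
        y \<in> Y \<and> event_partition F a \<and>
        (\<forall>k. \<Phi> k \<subseteq> X \<and> finite (\<Phi> k) \<and> \<Phi> k \<noteq> {}) \<and>
        \<epsilon> \<in> borel_measurable F \<and> (AE \<omega> in M. 0 < \<epsilon> \<omega>)}"

text \<open>The topology \<open>\<sigma>\<^sub>s(Y, X)\<close>, for \<open>Y\<close> the Koethe dual of \<open>X\<close>.  In that case the generating family is
  a base and not just a subbase (intersect the partitions, unite the finite sets, and take the
  minimum of the slacks).\<close>

definition stable_weak_topology ::
  "'a measure \<Rightarrow> 'a measure \<Rightarrow> ('a \<Rightarrow> real) set \<Rightarrow> ('a \<Rightarrow> real) set \<Rightarrow> ('a \<Rightarrow> real) topology" where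
  "stable_weak_topology M F Y X = topology_generated_by (stable_weak_base M F Y X)"

definition stably_inf_compact ::
  "'a measure \<Rightarrow> 'a measure \<Rightarrow> ('a \<Rightarrow> real) set \<Rightarrow> ('a \<Rightarrow> real) topology \<Rightarrow>
   (('a \<Rightarrow> real) \<Rightarrow> 'a \<Rightarrow> ereal) \<Rightarrow> bool" where
  "stably_inf_compact M F Y T f \<longleftrightarrow>
     (\<forall>\<eta>\<in>borel_measurable F.
        {y \<in> Y. AE \<omega> in M. f y \<omega> \<le> ereal (\<eta> \<omega>)} \<noteq> {} \<longrightarrow>
        stably_compact M F T {y \<in> Y. AE \<omega> in M. f y \<omega> \<le> ereal (\<eta> \<omega>)})"

end

theory Submission
  imports Defs
begin

text \<open>
  The Fatou half is a Krein--Smulian argument on Hilbert space. For fixed \<open>x\<close>, the convex function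
  \<open>\<phi>(u) = E[\<rho>(x + u) - \<rho>(x)]\<close> on bounded \<open>u\<close> is lower semicontinuous along bounded a.e. convergent
  sequences. A functional \<open>u \<mapsto> E[uy]\<close> which lies below \<open>\<phi> + \<delta>\<close> on the ball of radius \<open>r\<close> can be
  corrected, at an \<open>L\<^sup>1\<close>-cost of order \<open>\<delta>/r\<close>, so that it does so on any larger ball, up to an
  arbitrarily small increase of \<open>\<delta>\<close>; the correction is read off a penalised minimisation problem in
  \<open>L\<^sup>2\<close>. Doubling the radius makes the costs summable, so the corrections converge in \<open>L\<^sup>1\<close> to a
  \<open>\<delta>\<close>-subgradient of \<open>\<phi>\<close>, which is a density nearly attaining the supremum at \<open>x\<close>.

  The equivalences run in a circle. Attainment gives continuity from below by Simons' inequality for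
  monotone sequences, hence the Lebesgue property. Given the Lebesgue property, a stable filter base on a
  sublevel set of \<open>\<rho>\<^sup>#\<close> is enlarged to a maximal filter base of stable sets; along it \<open>E[xy|F]\<close>
  converges for each \<open>x\<close>, the limit is a countably additive \<open>L\<^sup>0(F)\<close>-linear functional of \<open>x\<close>, and its
  density is the required cluster point. Finally, compactness applied to the sets of \<open>\<epsilon>\<close>-optimal densities,
  \<open>\<epsilon>\<close> ranging over \<open>L\<^sup>0(F)\<close>, yields an optimal one.
\<close>

section \<open>Conditional expectations on \<open>L\<^sup>1\<close> relative to \<open>F\<close>\<close>

text \<open>Separation in the sup norm would in general give only finitely additive functionals, and
  the Fatou property speaks only of sequences with a common bound, hence of balls; this is why the
  subgradient is built ball by ball from \<open>L\<^sup>1\<close> functions. The problem is made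
  scalar by taking expectations: \<open>\<rho> x\<close> need not be integrable, but
  \<open>\<rho> (x + u) - \<rho> x\<close> is bounded by any constant bound of \<open>|u|\<close>.
  The conditional statement is recovered by locality: on an event of F, \<open>\<rho> x\<close>
  depends only on \<open>x\<close> on that event, so a conditional inequality that fails on such an
  event becomes a bounded perturbation violating the scalar one. Locality and closure under
  countable concatenation also replace upward directedness for essential suprema: approximate
  optimisers on the pieces of a partition are glued into one. In the compactness part a plain
  ultrafilter would not do: scalars and tolerances are random and one neighbourhood carries
  countably many finite test sets, so members chosen on the pieces must concatenate to a
  member.\<close>

locale prob_subalgebra = prob_space M + finite_measure_subalgebra M F for M F :: "'a measure"
begin

abbreviation "CE \<equiv> real_cond_exp M F"
abbreviation "X \<equiv> Linf_cond M F"
abbreviation "L1F \<equiv> L1_cond M F"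

lemma meas_F_M: "f \<in> borel_measurable F \<Longrightarrow> f \<in> borel_measurable M"
  using measurable_from_subalg[OF subalg] .

lemma sets_F_M: "A \<in> sets F \<Longrightarrow> A \<in> sets M"
  using subalg by (auto simp: subalgebra_def)

lemma space_F: "space F = space M"
  using subalg by (auto simp: subalgebra_def)

lemma L1F_iff:
  "z \<in> L1F \<longleftrightarrow> z \<in> borel_measurable M \<and> (AE \<omega> in M. nn_cond_exp M F (\<lambda>w. ennreal \<bar>z w\<bar>) \<omega> < \<infinity>)"
  by (rule L1_cond_iff[OF prob_space_axioms subalg])

lemma L1F_meas: "z \<in> L1F \<Longrightarrow> z \<in> borel_measurable M"
  by (simp add: L1F_iff)

lemma X_meas: "x \<in> X \<Longrightarrow> x \<in> borel_measurable M"
  by (simp add: Linf_cond_def)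

lemma L1F_bound:
  assumes "z \<in> borel_measurable M" "w \<in> L1F" "AE \<omega> in M. \<bar>z \<omega>\<bar> \<le> w \<omega>"
  shows "z \<in> L1F"
proof -
  note [measurable] = assms(1) L1F_meas[OF assms(2)]
  have "AE \<omega> in M. nn_cond_exp M F (\<lambda>w. ennreal \<bar>z w\<bar>) \<omega> \<le> nn_cond_exp M F (\<lambda>v. ennreal \<bar>w v\<bar>) \<omega>"
    by (rule nn_cond_exp_mono) (use assms(3) in \<open>auto intro!: ennreal_leI\<close>)
  then show ?thesis using assms(1,2) unfolding L1F_iff by (auto simp: le_less_trans)
qed

text \<open>\<open>CE\<close> is the difference of two nonnegative conditional expectations, and
  each commutes with a nonnegative F-measurable factor. \<open>enn2real\<close> sends infinite
  values to 0 on both sides, so the identity can undo a scaling of any measurable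
  \<open>u\<close>.\<close>

lemma CE_scale:
  assumes [measurable]: "g \<in> borel_measurable F" "u \<in> borel_measurable M"
    and g: "\<And>\<omega>. 0 \<le> g \<omega>"
  shows "AE \<omega> in M. CE (\<lambda>w. g w * u w) \<omega> = g \<omega> * CE u \<omega>"
proof -
  have 1: "AE \<omega> in M. ennreal (g \<omega>) * nn_cond_exp M F (\<lambda>w. ennreal (u w)) \<omega>
      = nn_cond_exp M F (\<lambda>w. ennreal (g w) * ennreal (u w)) \<omega>"
    by (rule nn_cond_exp_prod) measurable
  have 2: "AE \<omega> in M. ennreal (g \<omega>) * nn_cond_exp M F (\<lambda>w. ennreal (- u w)) \<omega>
      = nn_cond_exp M F (\<lambda>w. ennreal (g w) * ennreal (- u w)) \<omega>"
    by (rule nn_cond_exp_prod) measurable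
  have e: "ennreal (g w * u w) = ennreal (g w) * ennreal (u w)"
    "ennreal (- (g w * u w)) = ennreal (g w) * ennreal (- u w)" for w
    using g[of w] ennreal_mult'[of "g w" "u w"] ennreal_mult'[of "g w" "- u w"] by simp_all
  show ?thesis using 1 2
  proof eventually_elim
    case (elim \<omega>)
    show ?case unfolding real_cond_exp_def e elim[symmetric]
      using g[of \<omega>] by (simp add: enn2real_mult algebra_simps)
  qed
qed

text \<open>With \<open>g = 1 + E[|z| | F]\<close> the conditional mean of \<open>|z| / g\<close>
  has the form r / (1 + r), so \<open>z / g\<close> has \<open>L\<^sup>1\<close> norm at most 1.
  Facts about integrable functions thus pass to \<open>L1F\<close>: divide by a scale, apply them,
  and multiply back by \<open>CE_unscale\<close>.\<close>

lemma L1F_scale: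
  assumes "z \<in> L1F"
  shows "\<exists>g\<in>borel_measurable F. (\<forall>\<omega>. 1 \<le> g \<omega>) \<and> integrable M (\<lambda>\<omega>. z \<omega> / g \<omega>)"
proof -
  have [measurable]: "z \<in> borel_measurable M" using assms by (rule L1F_meas)
  let ?N = "nn_cond_exp M F (\<lambda>w. ennreal \<bar>z w\<bar>)"
  define g where "g \<omega> = 1 + enn2real (?N \<omega>)" for \<omega>
  have gF[measurable]: "g \<in> borel_measurable F" unfolding g_def by measurable
  have [measurable]: "g \<in> borel_measurable M" by (rule meas_F_M) measurable
  have g1: "1 \<le> g \<omega>" for \<omega> by (simp add: g_def)
  have e: "ennreal (norm (z \<omega> / g \<omega>)) = ennreal (1 / g \<omega>) * ennreal \<bar>z \<omega>\<bar>" for \<omega>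
    using g1[of \<omega>] by (subst ennreal_mult[symmetric]) (auto simp: abs_div)
  have "(\<integral>\<^sup>+ \<omega>. ennreal (1 / g \<omega>) * ennreal \<bar>z \<omega>\<bar> \<partial>M) = (\<integral>\<^sup>+ \<omega>. ennreal (1 / g \<omega>) * ?N \<omega> \<partial>M)"
    by (rule nn_cond_exp_intg[symmetric]) measurable
  also have "\<dots> \<le> (\<integral>\<^sup>+ \<omega>. 1 \<partial>M)"
  proof (rule nn_integral_mono_AE)
    show "AE \<omega> in M. ennreal (1 / g \<omega>) * ?N \<omega> \<le> 1"
      using assms[unfolded L1F_iff, THEN conjunct2]
    proof eventually_elim
      case (elim \<omega>)
      then obtain r where r: "0 \<le> r" "?N \<omega> = ennreal r" by (cases "?N \<omega>") auto
      then have "ennreal (1 / g \<omega>) * ?N \<omega> = ennreal (r / (1 + r))"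
        by (simp add: g_def ennreal_mult[symmetric])
      also have "\<dots> \<le> 1" using r by simp
      finally show ?case .
    qed
  qed
  also have "\<dots> < \<infinity>" by (simp add: emeasure_space_1)
  finally have "integrable M (\<lambda>\<omega>. z \<omega> / g \<omega>)"
    by (intro integrableI_bounded) (measurable, simp only: e)
  with gF g1 show ?thesis by blast
qed

lemma integrable_L1F: "integrable M z \<Longrightarrow> z \<in> L1F"
proof -
  assume z: "integrable M z"
  then have [measurable]: "z \<in> borel_measurable M" by auto
  have "(\<integral>\<^sup>+ \<omega>. nn_cond_exp M F (\<lambda>w. ennreal \<bar>z w\<bar>) \<omega> \<partial>M) = (\<integral>\<^sup>+ \<omega>. ennreal \<bar>z \<omega>\<bar> \<partial>M)"
    using nn_cond_exp_intg[of "\<lambda>_. 1" "\<lambda>w. ennreal \<bar>z w\<bar>"] by simp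
  also have "\<dots> < \<infinity>" using z by (simp add: integrable_iff_bounded)
  finally have "AE \<omega> in M. nn_cond_exp M F (\<lambda>w. ennreal \<bar>z w\<bar>) \<omega> \<noteq> \<infinity>"
    by (intro nn_integral_PInf_AE) auto
  then show ?thesis by (auto simp: L1F_iff top.not_eq_extremum)
qed

lemma L1F_multF:
  assumes [measurable]: "g \<in> borel_measurable F" and z: "z \<in> L1F"
  shows "(\<lambda>\<omega>. g \<omega> * z \<omega>) \<in> L1F"
proof -
  note [measurable] = L1F_meas[OF z] meas_F_M[OF assms(1)]
  have "AE \<omega> in M. ennreal \<bar>g \<omega>\<bar> * nn_cond_exp M F (\<lambda>w. ennreal \<bar>z w\<bar>) \<omega>
     = nn_cond_exp M F (\<lambda>w. ennreal \<bar>g w\<bar> * ennreal \<bar>z w\<bar>) \<omega>"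
    by (rule nn_cond_exp_prod) measurable
  then have "AE \<omega> in M. ennreal \<bar>g \<omega>\<bar> * nn_cond_exp M F (\<lambda>w. ennreal \<bar>z w\<bar>) \<omega>
     = nn_cond_exp M F (\<lambda>w. ennreal \<bar>g w * z w\<bar>) \<omega>"
    by (simp add: abs_mult ennreal_mult)
  moreover have "AE \<omega> in M. nn_cond_exp M F (\<lambda>w. ennreal \<bar>z w\<bar>) \<omega> < \<infinity>"
    using z by (simp add: L1F_iff)
  ultimately have "AE \<omega> in M. nn_cond_exp M F (\<lambda>w. ennreal \<bar>g w * z w\<bar>) \<omega> < \<infinity>"
  proof eventually_elim
    case (elim \<omega>)
    show ?case using elim(2) unfolding elim(1)[symmetric] by (simp add: ennreal_mult_less_top)
  qed
  then show ?thesis by (simp add: L1F_iff)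
qed

lemma CE_mult:
  assumes gF[measurable]: "g \<in> borel_measurable F" and z: "z \<in> L1F"
  shows "AE \<omega> in M. CE (\<lambda>w. g w * z w) \<omega> = g \<omega> * CE z \<omega>"
proof -
  note [measurable] = L1F_meas[OF z] meas_F_M[OF gF]
  obtain h where hF[measurable]: "h \<in> borel_measurable F" and h1: "\<And>\<omega>. 1 \<le> h \<omega>"
    and i: "integrable M (\<lambda>\<omega>. z \<omega> / h \<omega>)" using L1F_scale[OF z] by blast
  note [measurable] = meas_F_M[OF hF]
  let ?u = "\<lambda>\<omega>. z \<omega> / h \<omega>"
  \<comment> \<open>The bounded factor \<open>k\<close> keeps the product with \<open>z / h\<close>
    integrable, as the product rule for \<open>CE\<close> demands. The remaining factors
    \<open>h\<close> and \<open>1 + |g|\<close> are nonnegative and are restored by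
    \<open>CE_scale\<close>.\<close>
  define k where "k \<omega> = g \<omega> / (1 + \<bar>g \<omega>\<bar>)" for \<omega>
  have [measurable]: "k \<in> borel_measurable F" unfolding k_def by measurable
  note [measurable] = meas_F_M[OF this]
  have kb: "\<bar>k \<omega>\<bar> \<le> 1" for \<omega> by (auto simp: k_def abs_div)
  have ki: "integrable M (\<lambda>\<omega>. k \<omega> * ?u \<omega>)"
  proof (rule Bochner_Integration.integrable_bound[OF i])
    show "(\<lambda>\<omega>. k \<omega> * ?u \<omega>) \<in> borel_measurable M" by measurable
    show "AE \<omega> in M. norm (k \<omega> * ?u \<omega>) \<le> norm (?u \<omega>)"
      by (rule AE_I2) (simp only: real_norm_def abs_mult, intro mult_left_le_one_le abs_ge_zero kb)
  qed
  have h0: "h \<omega> \<noteq> 0" "0 \<le> h \<omega>" for \<omega> using h1[of \<omega>] by auto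
  have g0: "1 + \<bar>g \<omega>\<bar> \<noteq> 0" for \<omega> using abs_ge_zero[of "g \<omega>"] by linarith
  have A: "AE \<omega> in M. CE (\<lambda>w. h w * ?u w) \<omega> = h \<omega> * CE ?u \<omega>"
    by (rule CE_scale) (use h0 in auto)
  have B: "AE \<omega> in M. CE (\<lambda>w. (h w * (1 + \<bar>g w\<bar>)) * (k w * ?u w)) \<omega> = (h \<omega> * (1 + \<bar>g \<omega>\<bar>)) * CE (\<lambda>w. k w * ?u w) \<omega>"
    by (rule CE_scale) (use h0 in \<open>auto intro!: mult_nonneg_nonneg\<close>)
  have C: "AE \<omega> in M. CE (\<lambda>w. k w * ?u w) \<omega> = k \<omega> * CE ?u \<omega>"
    by (rule real_cond_exp_mult) (use ki in auto)
  have e1: "(\<lambda>w. h w * ?u w) = z" using h0 by auto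
  have e2: "(\<lambda>w. (h w * (1 + \<bar>g w\<bar>)) * (k w * ?u w)) = (\<lambda>w. g w * z w)"
    using h0 g0 by (auto simp: k_def fun_eq_iff)
  show ?thesis using A B C unfolding e1 e2
  proof eventually_elim
    case (elim \<omega>)
    show ?case unfolding elim(2) elim(1) elim(3) using g0[of \<omega>] by (simp add: k_def)
  qed
qed

lemma L1F_common_scale:
  assumes "z \<in> L1F" "z' \<in> L1F"
  obtains g where "g \<in> borel_measurable F" "\<And>\<omega>. 1 \<le> g \<omega>"
    "integrable M (\<lambda>\<omega>. z \<omega> / g \<omega>)" "integrable M (\<lambda>\<omega>. z' \<omega> / g \<omega>)"
proof -
  note [measurable] = L1F_meas[OF assms(1)] L1F_meas[OF assms(2)]
  obtain h where hF[measurable]: "h \<in> borel_measurable F" and h1: "\<And>\<omega>. 1 \<le> h \<omega>"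
    and i: "integrable M (\<lambda>\<omega>. z \<omega> / h \<omega>)" using L1F_scale[OF assms(1)] by blast
  obtain k where kF[measurable]: "k \<in> borel_measurable F" and k1: "\<And>\<omega>. 1 \<le> k \<omega>"
    and j: "integrable M (\<lambda>\<omega>. z' \<omega> / k \<omega>)" using L1F_scale[OF assms(2)] by blast
  note [measurable] = meas_F_M[OF hF] meas_F_M[OF kF]
  have A: "\<bar>a / (b + c)\<bar> \<le> \<bar>a / b\<bar>" if "1 \<le> b" "1 \<le> c" for a b c :: real
    using that by (auto simp: abs_div intro!: divide_left_mono mult_pos_pos)
  show thesis
  proof (rule that)
    show "(\<lambda>\<omega>. h \<omega> + k \<omega>) \<in> borel_measurable F" by measurable
    show "1 \<le> h \<omega> + k \<omega>" for \<omega> using h1[of \<omega>] k1[of \<omega>] by simp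
    show "integrable M (\<lambda>\<omega>. z \<omega> / (h \<omega> + k \<omega>))"
      by (rule Bochner_Integration.integrable_bound[OF i])
         (use A h1 k1 in \<open>auto simp del: abs_divide\<close>)
    show "integrable M (\<lambda>\<omega>. z' \<omega> / (h \<omega> + k \<omega>))"
      by (rule Bochner_Integration.integrable_bound[OF j])
         (use A h1 k1 in \<open>auto simp del: abs_divide simp: add.commute[of "h _"]\<close>)
  qed
qed

lemma CE_unscale:
  assumes "g \<in> borel_measurable F" "\<And>\<omega>. 1 \<le> g \<omega>" "z \<in> borel_measurable M"
  shows "AE \<omega> in M. CE z \<omega> = g \<omega> * CE (\<lambda>w. z w / g w) \<omega>"
proof -
  have g0: "g \<omega> \<noteq> 0" "0 \<le> g \<omega>" for \<omega> using assms(2)[of \<omega>] by auto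
  note [measurable] = assms(1,3) meas_F_M[OF assms(1)]
  have "AE \<omega> in M. CE (\<lambda>w. g w * (z w / g w)) \<omega> = g \<omega> * CE (\<lambda>w. z w / g w) \<omega>"
    by (rule CE_scale) (use g0 in auto)
  then show ?thesis using g0 by simp
qed

lemma L1F_add:
  assumes "z \<in> L1F" "z' \<in> L1F"
  shows "(\<lambda>\<omega>. z \<omega> + z' \<omega>) \<in> L1F"
proof -
  obtain g where g: "g \<in> borel_measurable F" "\<And>\<omega>. 1 \<le> g \<omega>"
    "integrable M (\<lambda>\<omega>. z \<omega> / g \<omega>)" "integrable M (\<lambda>\<omega>. z' \<omega> / g \<omega>)" by (rule L1F_common_scale[OF assms(1,2)]) blast
  have "(\<lambda>\<omega>. g \<omega> * (z \<omega> / g \<omega> + z' \<omega> / g \<omega>)) \<in> L1F"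
    using g by (intro L1F_multF integrable_L1F) auto
  moreover have "g \<omega> \<noteq> 0" for \<omega> using g(2)[of \<omega>] by auto
  then have "g \<omega> * (z \<omega> / g \<omega> + z' \<omega> / g \<omega>) = z \<omega> + z' \<omega>" for \<omega>
    by (simp add: field_simps)
  ultimately show ?thesis by simp
qed

lemma L1F_diff:
  assumes "z \<in> L1F" "z' \<in> L1F"
  shows "(\<lambda>\<omega>. z \<omega> - z' \<omega>) \<in> L1F"
  using L1F_add[OF assms(1) L1F_multF[of "\<lambda>_. -1", OF _ assms(2)]] by simp

lemma CE_add:
  assumes "z \<in> L1F" "z' \<in> L1F"
  shows "AE \<omega> in M. CE (\<lambda>w. z w + z' w) \<omega> = CE z \<omega> + CE z' \<omega>"
proof -
  note [measurable] = L1F_meas[OF assms(1)] L1F_meas[OF assms(2)]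
  obtain g where g: "g \<in> borel_measurable F" "\<And>\<omega>. 1 \<le> g \<omega>"
    "integrable M (\<lambda>\<omega>. z \<omega> / g \<omega>)" "integrable M (\<lambda>\<omega>. z' \<omega> / g \<omega>)" by (rule L1F_common_scale[OF assms(1,2)]) blast
  have "AE \<omega> in M. CE (\<lambda>w. z w + z' w) \<omega> = g \<omega> * CE (\<lambda>w. (z w + z' w) / g w) \<omega>"
    by (rule CE_unscale[OF g(1,2)]) measurable
  moreover have "AE \<omega> in M. CE (\<lambda>w. z w / g w + z' w / g w) \<omega> = CE (\<lambda>w. z w / g w) \<omega> + CE (\<lambda>w. z' w / g w) \<omega>"
    by (rule real_cond_exp_add[OF g(3,4)])
  moreover have "AE \<omega> in M. CE z \<omega> = g \<omega> * CE (\<lambda>w. z w / g w) \<omega>"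
    by (rule CE_unscale[OF g(1,2)]) measurable
  moreover have "AE \<omega> in M. CE z' \<omega> = g \<omega> * CE (\<lambda>w. z' w / g w) \<omega>"
    by (rule CE_unscale[OF g(1,2)]) measurable
  ultimately show ?thesis
    by eventually_elim (simp add: add_divide_distrib distrib_left)
qed

lemma CE_diff:
  assumes "z \<in> L1F" "z' \<in> L1F"
  shows "AE \<omega> in M. CE (\<lambda>w. z w - z' w) \<omega> = CE z \<omega> - CE z' \<omega>"
  using CE_add[OF assms(1) L1F_multF[of "\<lambda>_. -1", OF _ assms(2)]]
    CE_mult[of "\<lambda>_. -1", OF _ assms(2)] by auto

lemma CE_mono:
  assumes "z \<in> L1F" "z' \<in> L1F" "AE \<omega> in M. z \<omega> \<le> z' \<omega>"
  shows "AE \<omega> in M. CE z \<omega> \<le> CE z' \<omega>"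
proof -
  note [measurable] = L1F_meas[OF assms(1)] L1F_meas[OF assms(2)]
  obtain g where g: "g \<in> borel_measurable F" "\<And>\<omega>. 1 \<le> g \<omega>"
    "integrable M (\<lambda>\<omega>. z \<omega> / g \<omega>)" "integrable M (\<lambda>\<omega>. z' \<omega> / g \<omega>)" by (rule L1F_common_scale[OF assms(1,2)]) blast
  have g0: "0 < g \<omega>" for \<omega> using g(2)[of \<omega>] by auto
  have "AE \<omega> in M. CE (\<lambda>w. z w / g w) \<omega> \<le> CE (\<lambda>w. z' w / g w) \<omega>"
    by (rule real_cond_exp_mono[OF _ g(3,4)])
      (use assms(3) in eventually_elim, use g0 in \<open>simp add: divide_right_mono less_imp_le\<close>)
  moreover have "AE \<omega> in M. CE z \<omega> = g \<omega> * CE (\<lambda>w. z w / g w) \<omega>"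
    by (rule CE_unscale[OF g(1,2)]) measurable
  moreover have "AE \<omega> in M. CE z' \<omega> = g \<omega> * CE (\<lambda>w. z' w / g w) \<omega>"
    by (rule CE_unscale[OF g(1,2)]) measurable
  ultimately show ?thesis
    by eventually_elim (use g0 in \<open>simp add: less_imp_le mult_left_mono\<close>)
qed

lemma CE_const: "AE \<omega> in M. CE (\<lambda>_. c) \<omega> = c"
  by (rule real_cond_exp_F_meas) auto

lemma CE_abs_le:
  assumes "z \<in> borel_measurable M" "w \<in> L1F" "AE \<omega> in M. \<bar>z \<omega>\<bar> \<le> w \<omega>"
  shows "AE \<omega> in M. \<bar>CE z \<omega>\<bar> \<le> CE w \<omega>"
proof -
  have z: "z \<in> L1F" by (rule L1F_bound[OF assms])
  have zm: "(\<lambda>\<omega>. -1 * z \<omega>) \<in> L1F" by (rule L1F_multF[OF _ z]) auto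
  have "AE \<omega> in M. CE (\<lambda>w. -1 * z w) \<omega> = -1 * CE z \<omega>" by (rule CE_mult[OF _ z]) auto
  moreover have "AE \<omega> in M. CE z \<omega> \<le> CE w \<omega>" by (rule CE_mono[OF z assms(2)]) (use assms(3) in auto)
  moreover have "AE \<omega> in M. CE (\<lambda>w. -1 * z w) \<omega> \<le> CE w \<omega>" by (rule CE_mono[OF zm assms(2)]) (use assms(3) in auto)
  ultimately show ?thesis by eventually_elim auto
qed

lemma CE_local:
  assumes z: "z \<in> L1F" "z' \<in> L1F" and A[measurable]: "A \<in> sets F"
    and e: "AE \<omega> in M. \<omega> \<in> A \<longrightarrow> z \<omega> = z' \<omega>"
  shows "AE \<omega> in M. \<omega> \<in> A \<longrightarrow> CE z \<omega> = CE z' \<omega>"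
proof -
  note [measurable] = L1F_meas[OF z(1)] L1F_meas[OF z(2)] sets_F_M[OF A]
  have "AE \<omega> in M. CE (\<lambda>w. indicator A w * z w) \<omega> = indicator A \<omega> * CE z \<omega>"
    by (rule CE_mult[OF _ z(1)]) measurable
  moreover have "AE \<omega> in M. CE (\<lambda>w. indicator A w * z' w) \<omega> = indicator A \<omega> * CE z' \<omega>"
    by (rule CE_mult[OF _ z(2)]) measurable
  moreover have "AE \<omega> in M. CE (\<lambda>w. indicator A w * z w) \<omega> = CE (\<lambda>w. indicator A w * z' w) \<omega>"
    by (rule real_cond_exp_cong) (use e in \<open>auto elim!: eventually_mono simp: indicator_def\<close>)
  ultimately show ?thesis by eventually_elim auto
qed

section \<open>From the extended conditional expectation to \<open>CE\<close>, and dominated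
  convergence\<close>

text \<open>The limits of the truncated parts are the nonnegative conditional expectations of the
  positive and the negative part. Both are finite on \<open>L1F\<close>, so converting them to reals
  before subtracting changes nothing; later arguments can calculate with \<open>CE\<close>
  throughout.\<close>

lemma cond_exp_ext_eq:
  assumes z: "z \<in> L1F"
  shows "AE \<omega> in M. cond_exp_ext M F z \<omega> = ereal (CE z \<omega>)"
proof -
  note zm[measurable] = L1F_meas[OF z]
  have fin: "AE \<omega> in M. nn_cond_exp M F (\<lambda>w. ennreal (s * z w)) \<omega> < \<infinity>" if "s = 1 \<or> s = -1" for s
  proof -
    have "AE \<omega> in M. nn_cond_exp M F (\<lambda>w. ennreal (s * z w)) \<omega> \<le> nn_cond_exp M F (\<lambda>w. ennreal \<bar>z w\<bar>) \<omega>"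
      by (rule nn_cond_exp_mono) (use that in \<open>auto intro!: ennreal_leI\<close>)
    then show ?thesis using z[unfolded L1F_iff, THEN conjunct2] by eventually_elim auto
  qed
  have P: "AE \<omega> in M. lim (\<lambda>n. ereal (CE (\<lambda>w. min (max (s * z w) 0) (real n)) \<omega>))
      = enn2ereal (nn_cond_exp M F (\<lambda>w. ennreal (s * z w)) \<omega>)" for s
  proof -
    have ext: "AE \<omega> in M. cond_exp_ext M F (\<lambda>w. max (s * z w) 0) \<omega> = enn2ereal (nn_cond_exp M F (\<lambda>w. ennreal (max (s * z w) 0)) \<omega>)"
      by (rule cond_exp_ext_nonneg[OF prob_space_axioms subalg]) auto
    have e: "ennreal (max (s * z w) 0) = ennreal (s * z w)" for w
      by (auto simp: max_def ennreal_neg)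
    have e2: "min (max (max (s * z w) 0) 0) (real n) = min (max (s * z w) 0) (real n)"
      "min (max (- max (s * z w) 0) 0) (real n) = 0" for w n by auto
    show ?thesis using ext CE_const[of 0] unfolding cond_exp_ext_def e e2
      by eventually_elim (simp add: zero_ereal_def[symmetric])
  qed
  show ?thesis using P[of 1] P[of "-1"] fin[of 1, simplified] fin[of "-1", simplified]
  proof eventually_elim
    case (elim \<omega>)
    obtain r where r: "0 \<le> r" "nn_cond_exp M F (\<lambda>w. ennreal (z w)) \<omega> = ennreal r"
      using elim(3) by (cases "nn_cond_exp M F (\<lambda>w. ennreal (z w)) \<omega>") auto
    obtain s where s: "0 \<le> s" "nn_cond_exp M F (\<lambda>w. ennreal (- z w)) \<omega> = ennreal s"
      using elim(4) by (cases "nn_cond_exp M F (\<lambda>w. ennreal (- z w)) \<omega>") auto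
    show ?case using elim(1,2) r s by (simp add: cond_exp_ext_def real_cond_exp_def enn2ereal_ennreal)
  qed
qed

text \<open>Scaling makes the dominating function integrable. Since a.e. convergence is wanted and
  not merely convergence in \<open>L\<^sup>1\<close>, the errors are controlled by one decreasing
  sequence of majorants.\<close>

lemma CE_dominated_convergence:
  assumes z: "\<And>n. zs n \<in> borel_measurable M" "z \<in> borel_measurable M" and w: "w \<in> L1F"
    and lim: "AE \<omega> in M. (\<lambda>n. zs n \<omega>) \<longlonglongrightarrow> z \<omega>" and bd: "\<And>n. AE \<omega> in M. \<bar>zs n \<omega>\<bar> \<le> w \<omega>"
  shows "AE \<omega> in M. (\<lambda>n. CE (zs n) \<omega>) \<longlonglongrightarrow> CE z \<omega>"
proof -
  note [measurable] = z L1F_meas[OF w]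
  obtain g where gF[measurable]: "g \<in> borel_measurable F" and g1: "\<And>\<omega>. 1 \<le> g \<omega>"
    and v: "integrable M (\<lambda>\<omega>. w \<omega> / g \<omega>)" using L1F_scale[OF w] by blast
  note [measurable] = meas_F_M[OF gF]
  have g0: "0 < g \<omega>" for \<omega> using g1[of \<omega>] by auto
  define u where "u n \<omega> = zs n \<omega> / g \<omega>" for n \<omega>
  define u' where "u' \<omega> = z \<omega> / g \<omega>" for \<omega>
  have [measurable]: "u n \<in> borel_measurable M" "u' \<in> borel_measurable M" for n
    unfolding u_def u'_def by measurable
  have bd': "AE \<omega> in M. \<forall>n. \<bar>u n \<omega>\<bar> \<le> w \<omega> / g \<omega>"
    unfolding AE_all_countable
  proof
    fix n show "AE \<omega> in M. \<bar>u n \<omega>\<bar> \<le> w \<omega> / g \<omega>"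
      using bd[of n] by eventually_elim (use g0 in \<open>simp add: u_def abs_of_pos divide_right_mono less_imp_le\<close>)
  qed
  have lim': "AE \<omega> in M. (\<lambda>n. u n \<omega>) \<longlonglongrightarrow> u' \<omega>"
    using lim by eventually_elim (use g0 in \<open>auto simp: u_def u'_def intro!: tendsto_divide less_imp_neq[symmetric]\<close>)
  have bd'': "AE \<omega> in M. \<bar>u' \<omega>\<bar> \<le> w \<omega> / g \<omega>"
    using bd' lim' by eventually_elim (rule LIMSEQ_le_const2[OF tendsto_rabs], auto)
  have iu: "integrable M (u n)" for n
    by (rule Bochner_Integration.integrable_bound[OF v]) (measurable, use bd' in \<open>eventually_elim, auto simp del: abs_divide intro: order_trans[OF _ abs_ge_self]\<close>)
  have iu': "integrable M u'"
    by (rule Bochner_Integration.integrable_bound[OF v]) (measurable, use bd'' in \<open>eventually_elim, auto simp del: abs_divide intro: order_trans[OF _ abs_ge_self]\<close>)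
  \<comment> \<open>The tail suprema decrease in \<open>n\<close> and dominate all errors of index
    at least \<open>n\<close>. Their integrals tend to 0, so the infimum of their conditional
    expectations has integral 0 and vanishes a.e.\<close>
  define H where "H n \<omega> = (SUP k\<in>{n..}. ennreal \<bar>u k \<omega> - u' \<omega>\<bar>)" for n \<omega>
  have [measurable]: "H n \<in> borel_measurable M" for n unfolding H_def by measurable
  have Hdec: "H (Suc n) \<omega> \<le> H n \<omega>" for n \<omega> unfolding H_def by (rule SUP_subset_mono) auto
  have Hb: "AE \<omega> in M. H n \<omega> \<le> ennreal (2 * (w \<omega> / g \<omega>))" for n
    using bd' bd''
  proof eventually_elim
    case (elim \<omega>)
    have "\<bar>u k \<omega> - u' \<omega>\<bar> \<le> 2 * (w \<omega> / g \<omega>)" for k using elim(1)[rule_format, of k] elim(2) by linarith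
    then show ?case unfolding H_def by (intro SUP_least ennreal_leI) auto
  qed
  have Hlim: "AE \<omega> in M. (INF n. H n \<omega>) = 0"
    using lim'
  proof eventually_elim
    case (elim \<omega>)
    have le: "(INF n. H n \<omega>) \<le> ennreal e" if "e > 0" for e
    proof -
      obtain N where N: "\<And>k. k \<ge> N \<Longrightarrow> \<bar>u k \<omega> - u' \<omega>\<bar> < e" using elim \<open>e > 0\<close> unfolding LIMSEQ_def dist_real_def by blast
      have "(INF n. H n \<omega>) \<le> H N \<omega>" by (rule INF_lower) auto
      also have "\<dots> \<le> ennreal e" unfolding H_def by (intro SUP_least ennreal_leI) (use N in \<open>auto intro: less_imp_le\<close>)
      finally show ?thesis .
    qed
    have "(INF n. H n \<omega>) \<le> 0" by (rule ennreal_le_epsilon) (use le in simp)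
    then show ?case by simp
  qed
  have "(\<integral>\<^sup>+\<omega>. (INF n. H n \<omega>) \<partial>M) = (INF n. \<integral>\<^sup>+\<omega>. H n \<omega> \<partial>M)"
  proof (rule nn_integral_monotone_convergence_INF_AE')
    show "AE x in M. H (Suc i) x \<le> H i x" for i using Hdec by auto
    have "(\<integral>\<^sup>+ x. H 0 x \<partial>M) \<le> (\<integral>\<^sup>+ \<omega>. ennreal (2 * (w \<omega> / g \<omega>)) \<partial>M)" by (rule nn_integral_mono_AE[OF Hb])
    also have "\<dots> \<le> (\<integral>\<^sup>+ \<omega>. ennreal (norm (2 * (w \<omega> / g \<omega>))) \<partial>M)"
      unfolding real_norm_def by (intro nn_integral_mono ennreal_leI abs_ge_self)
    also have "\<dots> < \<infinity>"
      using integrable_mult_right[OF v, of 2] unfolding integrable_iff_bounded by blast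
    finally show "(\<integral>\<^sup>+ x. H 0 x \<partial>M) < \<infinity>" .
  qed measurable
  then have I0: "(INF n. \<integral>\<^sup>+\<omega>. H n \<omega> \<partial>M) = 0"
    using Hlim nn_integral_cong_AE[OF Hlim] by simp
  let ?N = "\<lambda>n. nn_cond_exp M F (H n)"
  have "(\<integral>\<^sup>+\<omega>. (INF n. ?N n \<omega>) \<partial>M) \<le> (INF n. \<integral>\<^sup>+\<omega>. H n \<omega> \<partial>M)"
  proof (rule INF_greatest)
    fix n
    have "(\<integral>\<^sup>+\<omega>. (INF n. ?N n \<omega>) \<partial>M) \<le> (\<integral>\<^sup>+\<omega>. ?N n \<omega> \<partial>M)"
      by (intro nn_integral_mono INF_lower) auto
    also have "\<dots> = (\<integral>\<^sup>+\<omega>. H n \<omega> \<partial>M)" using nn_cond_exp_intg[of "\<lambda>_. 1" "H n"] by simp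
    finally show "(\<integral>\<^sup>+\<omega>. (INF n. ?N n \<omega>) \<partial>M) \<le> (\<integral>\<^sup>+\<omega>. H n \<omega> \<partial>M)" .
  qed
  then have "AE \<omega> in M. (INF n. ?N n \<omega>) = 0"
    unfolding I0 by (subst nn_integral_0_iff_AE[symmetric]) auto
  moreover have "AE \<omega> in M. \<forall>n. \<bar>CE (u n) \<omega> - CE u' \<omega>\<bar> \<le> enn2real (nn_cond_exp M F (\<lambda>w. ennreal \<bar>u n w - u' w\<bar>) \<omega>)"
    unfolding AE_all_countable
  proof
    fix n
    have d: "integrable M (\<lambda>w. \<bar>u n w - u' w\<bar>)" using iu iu' by auto
    have "AE \<omega> in M. \<bar>CE (\<lambda>w. u n w - u' w) \<omega>\<bar> \<le> CE (\<lambda>w. \<bar>u n w - u' w\<bar>) \<omega>"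
      by (rule CE_abs_le[OF _ integrable_L1F[OF d]]) auto
    moreover have "AE \<omega> in M. CE (\<lambda>w. u n w - u' w) \<omega> = CE (u n) \<omega> - CE u' \<omega>"
      by (rule CE_diff[OF integrable_L1F[OF iu] integrable_L1F[OF iu']])
    ultimately show "AE \<omega> in M. \<bar>CE (u n) \<omega> - CE u' \<omega>\<bar> \<le> enn2real (nn_cond_exp M F (\<lambda>w. ennreal \<bar>u n w - u' w\<bar>) \<omega>)"
    proof eventually_elim
      case (elim \<omega>)
      have "CE (\<lambda>w. \<bar>u n w - u' w\<bar>) \<omega> \<le> enn2real (nn_cond_exp M F (\<lambda>w. ennreal \<bar>u n w - u' w\<bar>) \<omega>)"
        by (simp add: real_cond_exp_def)
      then show ?case using elim by linarith
    qed
  qed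
  moreover have "AE \<omega> in M. \<forall>n. \<forall>k\<in>{n..}. nn_cond_exp M F (\<lambda>w. ennreal \<bar>u k w - u' w\<bar>) \<omega> \<le> ?N n \<omega>"
    unfolding AE_all_countable
  proof (rule allI, rule AE_ball_countable'[OF _ countableI_type])
    fix n k :: nat assume "k \<in> {n..}"
    then show "AE \<omega> in M. nn_cond_exp M F (\<lambda>w. ennreal \<bar>u k w - u' w\<bar>) \<omega> \<le> ?N n \<omega>"
      by (intro nn_cond_exp_mono) (auto simp: H_def intro: SUP_upper)
  qed
  moreover have "AE \<omega> in M. \<forall>n. CE (zs n) \<omega> = g \<omega> * CE (u n) \<omega>"
    unfolding AE_all_countable u_def using CE_unscale[OF gF g1 z(1)] by blast
  moreover have "AE \<omega> in M. CE z \<omega> = g \<omega> * CE u' \<omega>"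
    unfolding u'_def using CE_unscale[OF gF g1 z(2)] by blast
  ultimately show ?thesis
  proof eventually_elim
    case (elim \<omega>)
    have "(\<lambda>n. CE (u n) \<omega>) \<longlonglongrightarrow> CE u' \<omega>"
    proof (rule LIMSEQ_I)
      fix e :: real assume "e > 0"
      then have "(INF n. ?N n \<omega>) < ennreal e" using elim(1) by simp
      then obtain N where N: "?N N \<omega> < ennreal e" unfolding INF_less_iff by blast
      have "norm (CE (u k) \<omega> - CE u' \<omega>) < e" if "k \<ge> N" for k
      proof -
        have "nn_cond_exp M F (\<lambda>w. ennreal \<bar>u k w - u' w\<bar>) \<omega> < ennreal e"
          using elim(3) that N by (metis atLeast_iff le_less_trans)
        then have "enn2real (nn_cond_exp M F (\<lambda>w. ennreal \<bar>u k w - u' w\<bar>) \<omega>) < e"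
          using \<open>e > 0\<close> by (cases "nn_cond_exp M F (\<lambda>w. ennreal \<bar>u k w - u' w\<bar>) \<omega>") (auto simp: ennreal_less_iff)
        then show ?thesis using elim(2) by (auto intro: le_less_trans)
      qed
      then show "\<exists>no. \<forall>n\<ge>no. norm (CE (u n) \<omega> - CE u' \<omega>) < e" by blast
    qed
    then show ?case using elim(4,5) by (auto intro: tendsto_mult)
  qed
qed

end

section \<open>Concatenation, essential suprema and the Fenchel transform\<close>

lemma concat_rv_eq:
  fixes x :: "nat \<Rightarrow> 'a \<Rightarrow> real"
  assumes "disjoint_family a" "\<omega> \<in> a k"
  shows "concat_rv a x \<omega> = x k \<omega>"
proof -
  have "indicator (a j) \<omega> * x j \<omega> = (if j = k then x j \<omega> else 0)" for j
    using assms by (auto simp: disjoint_family_on_def indicator_def)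
  then show ?thesis unfolding concat_rv_def using sums_unique[OF sums_single[of k "\<lambda>j. x j \<omega>"]] by simp
qed

lemma concat_rv_ereal_eq:
  fixes x :: "nat \<Rightarrow> 'a \<Rightarrow> ereal"
  assumes "disjoint_family a" "\<omega> \<in> a k"
  shows "concat_rv a x \<omega> = x k \<omega>"
proof -
  have "indicator (a j) \<omega> * x j \<omega> = (if j = k then x j \<omega> else 0)" for j
    using assms by (auto simp: disjoint_family_on_def indicator_def)
  then show ?thesis unfolding concat_rv_def using sums_unique[OF sums_single[of k "\<lambda>j. x j \<omega>"]] by simp
qed

lemma le_zero_of_multiples_bounded:
  fixes a b :: real
  assumes "\<And>n::nat. real n * a \<le> b"
  shows "a \<le> 0"
proof (rule ccontr)
  assume "\<not> a \<le> 0"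
  then obtain n where "b < real n * a" using reals_Archimedean3[of a] by (auto simp: not_le)
  then show False using assms[of n] by simp
qed

context prob_subalgebra
begin

section \<open>Partitions and concatenation\<close>

lemma event_partitionD:
  assumes "event_partition F a"
  shows "a k \<in> sets F" "disjoint_family a" "\<omega> \<in> space M \<Longrightarrow> \<exists>k. \<omega> \<in> a k"
  using assms by (auto simp: event_partition_def space_F)

lemma concat_rv_on:
  fixes x :: "nat \<Rightarrow> 'a \<Rightarrow> real"
  assumes "event_partition F a" "\<omega> \<in> a k"
  shows "concat_rv a x \<omega> = x k \<omega>"
  using assms by (intro concat_rv_eq) (auto simp: event_partition_def)

lemma partition_AE:
  assumes "event_partition F a" "\<And>k. AE \<omega> in M. \<omega> \<in> a k \<longrightarrow> P \<omega>"
  shows "AE \<omega> in M. P \<omega>"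
proof -
  have "AE \<omega> in M. \<forall>k. \<omega> \<in> a k \<longrightarrow> P \<omega>" unfolding AE_all_countable using assms(2) by blast
  then show ?thesis using AE_space
    by eventually_elim (use event_partitionD(3)[OF assms(1)] in blast)
qed

lemma concat_rv_meas_F:
  fixes x :: "nat \<Rightarrow> 'a \<Rightarrow> real"
  assumes "event_partition F a" "\<And>k. x k \<in> borel_measurable F"
  shows "concat_rv a x \<in> borel_measurable F"
proof -
  note [measurable] = assms(2) event_partitionD(1)[OF assms(1)]
  show ?thesis unfolding concat_rv_def by measurable
qed

lemma concat_rv_meas:
  fixes x :: "nat \<Rightarrow> 'a \<Rightarrow> real"
  assumes "event_partition F a" "\<And>k. x k \<in> borel_measurable M"
  shows "concat_rv a x \<in> borel_measurable M"
proof -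
  note [measurable] = assms(2) sets_F_M[OF event_partitionD(1)[OF assms(1)]]
  show ?thesis unfolding concat_rv_def by measurable
qed

text \<open>Finiteness of a conditional expectation can be checked on each piece separately, so
  arbitrarily large pieces may be glued. Ordinary integrability would not survive this, which is why
  the dual is a module over the F-measurable functions.\<close>

lemma L1F_concat:
  assumes a: "event_partition F a" and z: "\<And>k. z k \<in> L1F"
  shows "concat_rv a z \<in> L1F"
proof -
  have [measurable]: "concat_rv a z \<in> borel_measurable M" "\<And>k. z k \<in> borel_measurable M"
    using concat_rv_meas[OF a] L1F_meas[OF z] by auto
  let ?N = "\<lambda>z. nn_cond_exp M F (\<lambda>w. ennreal \<bar>z w\<bar>)"
  have "AE \<omega> in M. ?N (concat_rv a z) \<omega> < \<infinity>"
  proof (rule partition_AE[OF a])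
    fix k
    note akF[measurable] = event_partitionD(1)[OF a, of k]
    note [measurable] = sets_F_M[OF akF]
    have 1: "AE \<omega> in M. indicator (a k) \<omega> * ?N (concat_rv a z) \<omega> = nn_cond_exp M F (\<lambda>w. indicator (a k) w * ennreal \<bar>concat_rv a z w\<bar>) \<omega>"
      by (rule nn_cond_exp_prod) measurable
    have 2: "AE \<omega> in M. indicator (a k) \<omega> * ?N (z k) \<omega> = nn_cond_exp M F (\<lambda>w. indicator (a k) w * ennreal \<bar>z k w\<bar>) \<omega>"
      by (rule nn_cond_exp_prod) measurable
    have e: "indicator (a k) w * ennreal \<bar>concat_rv a z w\<bar> = indicator (a k) w * ennreal \<bar>z k w\<bar>" for w
      using concat_rv_on[OF a, of w k z] by (simp split: split_indicator)
    have "AE \<omega> in M. ?N (z k) \<omega> < \<infinity>" using z by (simp add: L1F_iff)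
    with 1 2 show "AE \<omega> in M. \<omega> \<in> a k \<longrightarrow> ?N (concat_rv a z) \<omega> < \<infinity>"
      unfolding e by eventually_elim (auto split: split_indicator_asm)
  qed
  then show ?thesis by (simp add: L1F_iff)
qed

lemma L1F_AE: "z \<in> L1F \<Longrightarrow> z' \<in> borel_measurable M \<Longrightarrow> AE \<omega> in M. z' \<omega> = z \<omega> \<Longrightarrow> z' \<in> L1F"
proof -
  assume z: "z \<in> L1F" "z' \<in> borel_measurable M" "AE \<omega> in M. z' \<omega> = z \<omega>"
  have "AE \<omega> in M. nn_cond_exp M F (\<lambda>w. ennreal \<bar>z' w\<bar>) \<omega> = nn_cond_exp M F (\<lambda>w. ennreal \<bar>z w\<bar>) \<omega>"
    by (rule nn_cond_exp_cong) (use z L1F_meas[OF z(1)] in auto)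
  then show ?thesis using z unfolding L1F_iff by auto
qed

lemma L1F_glue:
  assumes "z \<in> L1F" "z' \<in> L1F" and [measurable]: "A \<in> sets F"
  shows "(\<lambda>w. if w \<in> A then z w else z' w) \<in> L1F"
proof -
  have "(\<lambda>w. indicator A w * z w + (1 - indicator A w) * z' w) \<in> L1F"
    by (intro L1F_add L1F_multF assms(1,2)) measurable
  moreover have "(\<lambda>w. indicator A w * z w + (1 - indicator A w) * z' w) = (\<lambda>w. if w \<in> A then z w else z' w)"
    by (auto simp: fun_eq_iff)
  ultimately show ?thesis by simp
qed

section \<open>Module operations on \<open>X\<close>\<close>

lemma X_bound:
  assumes "x \<in> X"
  obtains \<eta> :: "'a \<Rightarrow> real" where "\<eta> \<in> borel_measurable F" "\<And>\<omega>. 0 \<le> \<eta> \<omega>" "AE \<omega> in M. \<bar>x \<omega>\<bar> \<le> \<eta> \<omega>"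
proof -
  from assms obtain h :: "'a \<Rightarrow> real" where [measurable]: "h \<in> borel_measurable F" and h: "AE \<omega> in M. \<bar>x \<omega>\<bar> \<le> h \<omega>"
    by (auto simp: Linf_cond_def)
  have "(\<lambda>\<omega>. \<bar>h \<omega>\<bar>) \<in> borel_measurable F" by measurable
  moreover have "AE \<omega> in M. \<bar>x \<omega>\<bar> \<le> \<bar>h \<omega>\<bar>" using h by eventually_elim auto
  ultimately show thesis using that[of "\<lambda>\<omega>. \<bar>h \<omega>\<bar>"] by auto
qed

lemma X_I: "x \<in> borel_measurable M \<Longrightarrow> \<eta> \<in> borel_measurable F \<Longrightarrow> AE \<omega> in M. \<bar>x \<omega>\<bar> \<le> \<eta> \<omega> \<Longrightarrow> x \<in> X"
  by (auto simp: Linf_cond_def)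

lemma X_bounded: "x \<in> borel_measurable M \<Longrightarrow> (\<And>\<omega>. \<bar>x \<omega>\<bar> \<le> R) \<Longrightarrow> x \<in> X"
  by (rule X_I[of x "\<lambda>_. R"]) auto

lemma X_F: "\<eta> \<in> borel_measurable F \<Longrightarrow> \<eta> \<in> X"
  by (rule X_I[of \<eta> "\<lambda>\<omega>. \<bar>\<eta> \<omega>\<bar>"]) (auto intro: meas_F_M)

lemma X_dom: "x \<in> borel_measurable M \<Longrightarrow> y \<in> X \<Longrightarrow> AE \<omega> in M. \<bar>x \<omega>\<bar> \<le> \<bar>y \<omega>\<bar> \<Longrightarrow> x \<in> X"
proof -
  assume x: "x \<in> borel_measurable M" "y \<in> X" "AE \<omega> in M. \<bar>x \<omega>\<bar> \<le> \<bar>y \<omega>\<bar>"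
  obtain \<eta> where "\<eta> \<in> borel_measurable F" "AE \<omega> in M. \<bar>y \<omega>\<bar> \<le> \<eta> \<omega>" using X_bound[OF x(2)] by blast
  then show "x \<in> X" using x by (intro X_I[of x \<eta>]) auto
qed

lemma X_add: "x \<in> X \<Longrightarrow> y \<in> X \<Longrightarrow> (\<lambda>\<omega>. x \<omega> + y \<omega>) \<in> X"
proof -
  assume x: "x \<in> X" "y \<in> X"
  obtain h where h: "h \<in> borel_measurable F" "AE \<omega> in M. \<bar>x \<omega>\<bar> \<le> h \<omega>" using X_bound[OF x(1)] by blast
  obtain k where k: "k \<in> borel_measurable F" "AE \<omega> in M. \<bar>y \<omega>\<bar> \<le> k \<omega>" using X_bound[OF x(2)] by blast
  note [measurable] = X_meas[OF x(1)] X_meas[OF x(2)] h(1) k(1)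
  show ?thesis by (rule X_I[of _ "\<lambda>\<omega>. h \<omega> + k \<omega>"]) (use h(2) k(2) in \<open>auto elim: AE_mp\<close>)
qed

lemma X_multF: "g \<in> borel_measurable F \<Longrightarrow> x \<in> X \<Longrightarrow> (\<lambda>\<omega>. g \<omega> * x \<omega>) \<in> X"
proof -
  assume x: "g \<in> borel_measurable F" "x \<in> X"
  obtain h where h: "h \<in> borel_measurable F" "AE \<omega> in M. \<bar>x \<omega>\<bar> \<le> h \<omega>" using X_bound[OF x(2)] by blast
  note [measurable] = x(1) X_meas[OF x(2)] h(1) meas_F_M[OF x(1)]
  show ?thesis
  proof (rule X_I[of _ "\<lambda>\<omega>. \<bar>g \<omega>\<bar> * h \<omega>"])
    show "AE \<omega> in M. \<bar>g \<omega> * x \<omega>\<bar> \<le> \<bar>g \<omega>\<bar> * h \<omega>"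
      using h(2) by eventually_elim (simp add: abs_mult mult_left_mono)
  qed measurable
qed

lemma X_diff: "x \<in> X \<Longrightarrow> y \<in> X \<Longrightarrow> (\<lambda>\<omega>. x \<omega> - y \<omega>) \<in> X"
  using X_add[OF _ X_multF[of "\<lambda>_. -1"]] by simp

lemma X_concat:
  assumes a: "event_partition F a" and x: "\<And>k. x k \<in> X"
  shows "concat_rv a x \<in> X"
proof -
  have "\<forall>k. \<exists>h\<in>borel_measurable F. AE \<omega> in M. \<bar>x k \<omega>\<bar> \<le> (h \<omega> :: real)" using x by (simp add: Linf_cond_def)
  then obtain h :: "nat \<Rightarrow> 'a \<Rightarrow> real" where h: "\<And>k. h k \<in> borel_measurable F" "\<And>k. AE \<omega> in M. \<bar>x k \<omega>\<bar> \<le> h k \<omega>" by metis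
  show ?thesis
  proof (rule X_I[of _ "concat_rv a h"])
    show "AE \<omega> in M. \<bar>concat_rv a x \<omega>\<bar> \<le> concat_rv a h \<omega>"
    proof (rule partition_AE[OF a])
      fix k show "AE \<omega> in M. \<omega> \<in> a k \<longrightarrow> \<bar>concat_rv a x \<omega>\<bar> \<le> concat_rv a h \<omega>"
        using h(2)[of k] by eventually_elim (simp add: concat_rv_on[OF a])
    qed
  qed (use concat_rv_meas[OF a] concat_rv_meas_F[OF a] X_meas[OF x] h in auto)
qed

lemma L1F_multX: "x \<in> X \<Longrightarrow> y \<in> L1F \<Longrightarrow> (\<lambda>\<omega>. x \<omega> * y \<omega>) \<in> L1F"
  using koethe_dual_Linf_cond[OF prob_space_axioms subalg] by (auto simp: koethe_dual_def)

section \<open>Measurable selection and essential suprema\<close>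

text \<open>Each point is assigned the least index that is admissible for it; countability makes
  this choice F-measurable.\<close>

lemma partition_select:
  assumes P: "\<And>i::nat. {\<omega> \<in> space M. P i \<omega>} \<in> sets F" and ex: "AE \<omega> in M. \<exists>i. P i \<omega>"
  shows "\<exists>a. event_partition F a \<and> (AE \<omega> in M. \<forall>k. \<omega> \<in> a k \<longrightarrow> P k \<omega>)"
proof -
  define S where "S i = {\<omega> \<in> space M. P i \<omega>}" for i
  have [measurable]: "S i \<in> sets F" for i using P by (simp add: S_def)
  \<comment> \<open>The null set where no index is admissible is added to \<open>a 0\<close>,
    because the pieces must cover the whole space. This is the reason why the second conclusion
    holds only a.e.\<close>
  define a where "a k = (if k = 0 then S 0 \<union> (space F - (\<Union>i. S i)) else S k - (\<Union>i<k. S i))" for k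
  have sub: "S i \<subseteq> space F" for i by (auto simp: S_def space_F)
  have a_sets: "a k \<in> sets F" for k unfolding a_def by simp
  have disj: "a i \<inter> a j = {}" if "i < j" for i j
    using that unfolding a_def by (cases "i = 0") auto
  have "event_partition F a"
    unfolding event_partition_def
  proof (intro conjI)
    show "range a \<subseteq> sets F" using a_sets by auto
    show "disjoint_family a"
      unfolding disjoint_family_on_def using disj by (metis inf_commute nat_neq_iff)
    show "(\<Union>k. a k) = space F"
    proof
      show "(\<Union>k. a k) \<subseteq> space F" using a_sets sets.sets_into_space by blast
      show "space F \<subseteq> (\<Union>k. a k)"
      proof
        fix \<omega> assume w: "\<omega> \<in> space F"
        show "\<omega> \<in> (\<Union>k. a k)"
        proof (cases "\<exists>i. \<omega> \<in> S i")
          case True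
          define k where "k = (LEAST i. \<omega> \<in> S i)"
          have "\<omega> \<in> S k" "\<And>i. i < k \<Longrightarrow> \<omega> \<notin> S i"
            using True unfolding k_def by (auto intro: LeastI_ex dest: not_less_Least)
          then have "\<omega> \<in> a k" by (cases "k = 0") (auto simp: a_def)
          then show ?thesis by blast
        next
          case False
          then have "\<omega> \<in> a 0" using w by (simp add: a_def)
          then show ?thesis by blast
        qed
      qed
    qed
  qed
  moreover have "AE \<omega> in M. \<forall>k. \<omega> \<in> a k \<longrightarrow> P k \<omega>"
    using ex AE_space
  proof eventually_elim
    case (elim \<omega>)
    then show ?case by (auto simp: a_def S_def split: if_splits)
  qed
  ultimately show ?thesis by blast
qed

text \<open>Exhaustion: countable subfamilies are chosen whose unions have probability close to the
  supremum \<open>s\<close> over all countable subfamilies. Their union \<open>D\<close> attains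
  \<open>s\<close>, so adding a set not essentially covered by it would exceed
  \<open>s\<close>.\<close>

lemma ess_union:
  assumes "\<A> \<subseteq> sets M"
  shows "\<exists>C\<subseteq>\<A>. countable C \<and> (\<forall>A\<in>\<A>. A - \<Union>C \<in> null_sets M)"
proof -
  define K where "K = {C. C \<subseteq> \<A> \<and> countable C}"
  define s where "s = (SUP C\<in>K. prob (\<Union>C))"
  have Kne: "{} \<in> K" by (simp add: K_def)
  have bdd: "bdd_above ((\<lambda>C. prob (\<Union>C)) ` K)" by (rule bdd_aboveI2[of _ _ 1]) simp
  have up: "prob (\<Union>C) \<le> s" if "C \<in> K" for C unfolding s_def using that bdd by (rule cSUP_upper)
  have "\<exists>C\<in>K. s - 1 / real (Suc n) < prob (\<Union>C)" for n
    using less_cSUP_iff[OF _ bdd, of "s - 1 / real (Suc n)"] Kne unfolding s_def[symmetric] by auto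
  then obtain C where C: "\<And>n. C n \<in> K" "\<And>n. s - 1 / real (Suc n) < prob (\<Union>(C n))" by metis
  define D where "D = (\<Union>n. C n)"
  have D: "D \<subseteq> \<A>" "countable D" using C(1) by (auto simp: D_def K_def)
  have mD: "\<Union>D \<in> sets M" using D assms by (intro sets.countable_Union) auto
  have sD: "s \<le> prob (\<Union>D)"
  proof (rule field_le_epsilon)
    fix e :: real assume "e > 0"
    then obtain n where n: "1 / real (Suc n) < e" using nat_approx_posE by blast
    have "prob (\<Union>(C n)) \<le> prob (\<Union>D)" by (rule finite_measure_mono[OF _ mD]) (auto simp: D_def)
    then show "s \<le> prob (\<Union>D) + e" using C(2)[of n] n by linarith
  qed
  have "A - \<Union>D \<in> null_sets M" if A: "A \<in> \<A>" for A
  proof -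
    have mA: "A \<in> sets M" using A assms by auto
    have "insert A D \<in> K" using D A by (simp add: K_def)
    from up[OF this] have "prob (A \<union> \<Union>D) \<le> s" by simp
    moreover have "prob (A \<union> \<Union>D) = prob (A - \<Union>D) + prob (\<Union>D)"
      using finite_measure_Union[of "A - \<Union>D" "\<Union>D"] mA mD by (simp add: Diff_disjoint Int_commute)
    ultimately have "prob (A - \<Union>D) = 0" using sD measure_nonneg[of M "A - \<Union>D"] by linarith
    then show ?thesis using mA mD by (auto simp: null_sets_def emeasure_eq_measure)
  qed
  with D show ?thesis by blast
qed

text \<open>\<open>ess_union\<close> is applied to the level sets \<open>{H c > q}\<close> for each
  rational \<open>q\<close>, and the resulting countable index sets are united. Wherever some
  \<open>H c\<close> exceeds the countable supremum, a rational lies strictly between, and the point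
  belongs to one of countably many null sets.\<close>

lemma ess_sup_seq:
  fixes H :: "'b \<Rightarrow> 'a \<Rightarrow> ereal"
  assumes ne: "S \<noteq> {}" and m: "\<And>b. b \<in> S \<Longrightarrow> H b \<in> borel_measurable M"
  shows "\<exists>b. (\<forall>k::nat. b k \<in> S) \<and> (\<forall>c\<in>S. AE \<omega> in M. H c \<omega> \<le> (SUP k. H (b k) \<omega>))"
proof -
  define E where "E q c = {\<omega> \<in> space M. ereal (real_of_rat q) < H c \<omega>}" for q c
  have Em: "E q c \<in> sets M" if "c \<in> S" for q c
  proof -
    note [measurable] = m[OF that]
    show ?thesis unfolding E_def by measurable
  qed
  have "\<exists>T\<subseteq>S. countable T \<and> (\<forall>c\<in>S. E q c - (\<Union>t\<in>T. E q t) \<in> null_sets M)" for q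
  proof -
    have "E q ` S \<subseteq> sets M" using Em by auto
    from ess_union[OF this] obtain C where C: "C \<subseteq> E q ` S" "countable C"
      "\<And>c. c \<in> S \<Longrightarrow> E q c - \<Union>C \<in> null_sets M" by auto
    obtain T where "T \<subseteq> S" "countable T" "C = E q ` T"
      using C(1,2) by (metis countable_subset_image)
    then show ?thesis using C(3) by auto
  qed
  then obtain T where T: "\<And>q. T q \<subseteq> S" "\<And>q. countable (T q)"
    "\<And>q c. c \<in> S \<Longrightarrow> E q c - (\<Union>t\<in>T q. E q t) \<in> null_sets M" by metis
  obtain b0 where "b0 \<in> S" using ne by auto
  define U where "U = insert b0 (\<Union>q. T q)"
  have U: "U \<subseteq> S" "countable U" "U \<noteq> {}" using T(1,2) \<open>b0 \<in> S\<close> by (auto simp: U_def)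
  define b where "b = from_nat_into U"
  have b: "range b = U" unfolding b_def by (rule range_from_nat_into[OF U(3,2)])
  have "AE \<omega> in M. H c \<omega> \<le> (SUP k. H (b k) \<omega>)" if c: "c \<in> S" for c
  proof -
    have "AE \<omega> in M. \<forall>q. \<omega> \<notin> E q c - (\<Union>t\<in>T q. E q t)"
      unfolding AE_all_countable using AE_not_in[OF T(3)[OF c]] by blast
    then show ?thesis using AE_space
    proof eventually_elim
      case (elim \<omega>)
      show ?case
      proof (rule ccontr)
        assume "\<not> ?case"
        then obtain q where q: "(SUP k. H (b k) \<omega>) < ereal (real_of_rat q)" "ereal (real_of_rat q) < H c \<omega>"
          using ereal_dense3 by (auto simp: not_le)
        then have "\<omega> \<in> E q c" using elim(2) by (simp add: E_def)
        then obtain t where t: "t \<in> T q" "\<omega> \<in> E q t" using elim(1) by blast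
        then have "t \<in> range b" unfolding b by (auto simp: U_def)
        then obtain k where "t = b k" by auto
        then have "H t \<omega> \<le> (SUP k. H (b k) \<omega>)" by (auto intro: SUP_upper)
        then show False using q(1) t(2) by (auto simp: E_def)
      qed
    qed
  qed
  then show ?thesis using b U(1) by (intro exI[of _ b]) auto
qed

text \<open>\<open>H\<close> is a family as the definitions write it, with
  \<open>cond_exp_ext\<close>; \<open>H'\<close> is the a.e. equal F-measurable family in which
  proofs calculate. A countable supremum shows that an essential supremum exists, so the choice in
  \<open>ess_sup_family\<close> returns a genuine one.\<close>

lemma ess_sup_family_props:
  fixes H H' :: "'b \<Rightarrow> 'a \<Rightarrow> ereal"
  assumes ne: "S \<noteq> {}" and m: "\<And>b. b \<in> S \<Longrightarrow> H' b \<in> borel_measurable F"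
    and e: "\<And>b. b \<in> S \<Longrightarrow> AE \<omega> in M. H b \<omega> = H' b \<omega>"
  defines "g \<equiv> ess_sup_family M F (H ` S)"
  shows ess_sup_family_meas: "g \<in> borel_measurable F"
    and ess_sup_family_ge: "\<And>b. b \<in> S \<Longrightarrow> AE \<omega> in M. H' b \<omega> \<le> g \<omega>"
    and ess_sup_family_le: "\<And>g'. g' \<in> borel_measurable F \<Longrightarrow> (\<And>b. b \<in> S \<Longrightarrow> AE \<omega> in M. H' b \<omega> \<le> g' \<omega>) \<Longrightarrow> AE \<omega> in M. g \<omega> \<le> g' \<omega>"
    and ess_sup_family_seq: "\<exists>b. (\<forall>k::nat. b k \<in> S) \<and> (AE \<omega> in M. g \<omega> = (SUP k. H' (b k) \<omega>))"
proof -
  have eq: "(AE \<omega> in M. H b \<omega> \<le> f \<omega>) \<longleftrightarrow> (AE \<omega> in M. H' b \<omega> \<le> f \<omega>)" if "b \<in> S" for b f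
    by (rule eventually_subst) (use e[OF that] in \<open>auto elim: eventually_mono\<close>)
  have iff: "is_ess_sup_family M F (H ` S) f \<longleftrightarrow> f \<in> borel_measurable F \<and> (\<forall>b\<in>S. AE \<omega> in M. H' b \<omega> \<le> f \<omega>) \<and>
     (\<forall>g'\<in>borel_measurable F. (\<forall>b\<in>S. AE \<omega> in M. H' b \<omega> \<le> g' \<omega>) \<longrightarrow> (AE \<omega> in M. f \<omega> \<le> g' \<omega>))" for f
    unfolding is_ess_sup_family_def by (simp add: eq)
  obtain b where b: "\<And>k::nat. b k \<in> S" "\<And>c. c \<in> S \<Longrightarrow> AE \<omega> in M. H' c \<omega> \<le> (SUP k. H' (b k) \<omega>)"
    using ess_sup_seq[OF ne, of H'] meas_F_M[OF m] by blast
  have bm: "(\<lambda>\<omega>. SUP k. H' (b k) \<omega>) \<in> borel_measurable F" using m b(1) by (intro borel_measurable_SUP) auto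
  have least: "AE \<omega> in M. (SUP k. H' (b k) \<omega>) \<le> g' \<omega>" if "\<And>b. b \<in> S \<Longrightarrow> AE \<omega> in M. H' b \<omega> \<le> g' \<omega>" for g'
  proof -
    have "AE \<omega> in M. \<forall>k. H' (b k) \<omega> \<le> g' \<omega>" unfolding AE_all_countable using that b(1) by blast
    then show ?thesis by eventually_elim (auto intro: SUP_least)
  qed
  have "is_ess_sup_family M F (H ` S) (\<lambda>\<omega>. SUP k. H' (b k) \<omega>)"
    unfolding iff using bm b(2) least by blast
  then have "is_ess_sup_family M F (H ` S) g" unfolding g_def ess_sup_family_def by (rule someI[of "is_ess_sup_family M F (H ` S)"])
  then show gm: "g \<in> borel_measurable F" and g1: "\<And>b. b \<in> S \<Longrightarrow> AE \<omega> in M. H' b \<omega> \<le> g \<omega>"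
    and g2: "\<And>g'. g' \<in> borel_measurable F \<Longrightarrow> (\<And>b. b \<in> S \<Longrightarrow> AE \<omega> in M. H' b \<omega> \<le> g' \<omega>) \<Longrightarrow> AE \<omega> in M. g \<omega> \<le> g' \<omega>"
    unfolding iff by auto
  have "AE \<omega> in M. g \<omega> \<le> (SUP k. H' (b k) \<omega>)" by (rule g2[OF bm b(2)])
  moreover have "AE \<omega> in M. (SUP k. H' (b k) \<omega>) \<le> g \<omega>" by (rule least[OF g1])
  ultimately have "AE \<omega> in M. g \<omega> = (SUP k. H' (b k) \<omega>)" by eventually_elim auto
  then show "\<exists>b. (\<forall>k::nat. b k \<in> S) \<and> (AE \<omega> in M. g \<omega> = (SUP k. H' (b k) \<omega>))" using b(1) by blast
qed

text \<open>Substitute for upward directedness: a strict bound below the essential supremum is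
  realised by members of the family piece by piece. If the family is closed under concatenation, a
  single member realises it.\<close>

lemma ess_sup_family_select:
  fixes H H' :: "'b \<Rightarrow> 'a \<Rightarrow> ereal"
  assumes ne: "S \<noteq> {}" and m: "\<And>b. b \<in> S \<Longrightarrow> H' b \<in> borel_measurable F"
    and e: "\<And>b. b \<in> S \<Longrightarrow> AE \<omega> in M. H b \<omega> = H' b \<omega>"
    and f[measurable]: "f \<in> borel_measurable F" and less: "AE \<omega> in M. f \<omega> < ess_sup_family M F (H ` S) \<omega>"
  shows "\<exists>a b. event_partition F a \<and> (\<forall>k. b k \<in> S) \<and> (AE \<omega> in M. \<forall>k. \<omega> \<in> a k \<longrightarrow> f \<omega> < H' (b k) \<omega>)"
proof -
  obtain b where b: "\<And>k::nat. b k \<in> S" "AE \<omega> in M. ess_sup_family M F (H ` S) \<omega> = (SUP k. H' (b k) \<omega>)"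
    using ess_sup_family_seq[where H = H and H' = H' and S = S, OF ne m e] by blast
  have [measurable]: "H' (b k) \<in> borel_measurable F" for k using m b(1) by auto
  have "\<exists>a. event_partition F a \<and> (AE \<omega> in M. \<forall>k. \<omega> \<in> a k \<longrightarrow> f \<omega> < H' (b k) \<omega>)"
  proof (rule partition_select)
    show "{\<omega> \<in> space M. f \<omega> < H' (b i) \<omega>} \<in> sets F" for i
      unfolding space_F[symmetric] by measurable
    show "AE \<omega> in M. \<exists>i. f \<omega> < H' (b i) \<omega>"
      using less b(2) by eventually_elim (auto simp: less_SUP_iff)
  qed
  then show ?thesis using b(1) by blast
qed

text \<open>For \<open>y \<le> 0\<close> the conditional mean of \<open>|y|\<close> is
  \<open>- CE y = 1\<close>, and this integrates to 1. Densities are therefore ordinary integrable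
  functions.\<close>

lemma L1F_nonpos_integrable:
  assumes y: "y \<in> L1F" and y0: "AE \<omega> in M. y \<omega> \<le> 0" and y1: "AE \<omega> in M. CE y \<omega> = -1"
  shows "integrable M y"
proof -
  note [measurable] = L1F_meas[OF y]
  let ?N = "nn_cond_exp M F"
  have z: "AE \<omega> in M. ?N (\<lambda>w. ennreal (y w)) \<omega> = 0"
  proof -
    have "AE \<omega> in M. ?N (\<lambda>w. ennreal (y w)) \<omega> = ?N (\<lambda>_. 0) \<omega>"
      by (rule nn_cond_exp_cong) (use y0 in \<open>auto elim!: eventually_mono simp: ennreal_neg\<close>)
    moreover have "AE \<omega> in M. 0 = ?N (\<lambda>_. 0) \<omega>" using nn_cond_exp_F_meas[of "\<lambda>_. 0"] by simp
    ultimately show ?thesis by eventually_elim simp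
  qed
  have c: "AE \<omega> in M. ?N (\<lambda>w. ennreal (- y w)) \<omega> = ?N (\<lambda>w. ennreal \<bar>y w\<bar>) \<omega>"
    by (rule nn_cond_exp_cong) (use y0 in \<open>auto elim!: eventually_mono\<close>)
  have one: "AE \<omega> in M. ?N (\<lambda>w. ennreal \<bar>y w\<bar>) \<omega> = 1"
    using z c y1 y[unfolded L1F_iff, THEN conjunct2]
  proof eventually_elim
    case (elim \<omega>)
    then have "enn2real (?N (\<lambda>w. ennreal \<bar>y w\<bar>) \<omega>) = 1" by (simp add: real_cond_exp_def)
    then show ?case using elim(4) by (cases "?N (\<lambda>w. ennreal \<bar>y w\<bar>) \<omega>") auto
  qed
  have "(\<integral>\<^sup>+ \<omega>. ennreal \<bar>y \<omega>\<bar> \<partial>M) = (\<integral>\<^sup>+ \<omega>. ?N (\<lambda>w. ennreal \<bar>y w\<bar>) \<omega> \<partial>M)"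
    using nn_cond_exp_intg[of "\<lambda>_. 1" "\<lambda>w. ennreal \<bar>y w\<bar>"] by simp
  also have "\<dots> = (\<integral>\<^sup>+ \<omega>. 1 \<partial>M)" by (rule nn_integral_cong_AE[OF one])
  also have "\<dots> < \<infinity>" by (simp add: emeasure_space_1)
  finally show ?thesis by (intro integrableI_bounded) auto
qed

text \<open>Because \<open>y \<le> 0\<close>, the product is dominated by \<open>- \<eta> y\<close>,
  whose conditional expectation is \<open>\<eta>\<close>.\<close>

lemma CE_mult_bound:
  assumes x: "x \<in> X" and \<eta>[measurable]: "\<eta> \<in> borel_measurable F" and b: "AE \<omega> in M. \<bar>x \<omega>\<bar> \<le> \<eta> \<omega>"
    and y: "y \<in> L1F" and y0: "AE \<omega> in M. y \<omega> \<le> 0" and y1: "AE \<omega> in M. CE y \<omega> = -1"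
  shows "AE \<omega> in M. \<bar>CE (\<lambda>w. x w * y w) \<omega>\<bar> \<le> \<eta> \<omega>"
proof -
  note [measurable] = L1F_meas[OF y] X_meas[OF x]
  have w: "(\<lambda>w. (- \<eta> w) * y w) \<in> L1F" by (rule L1F_multF[OF _ y]) measurable
  have "AE \<omega> in M. \<bar>CE (\<lambda>w. x w * y w) \<omega>\<bar> \<le> CE (\<lambda>w. (- \<eta> w) * y w) \<omega>"
  proof (rule CE_abs_le[OF _ w])
    show "AE \<omega> in M. \<bar>x \<omega> * y \<omega>\<bar> \<le> - \<eta> \<omega> * y \<omega>"
      using b y0 by eventually_elim (simp add: abs_mult mult_right_mono_neg)
  qed measurable
  moreover have "AE \<omega> in M. CE (\<lambda>w. (- \<eta> w) * y w) \<omega> = (- \<eta> \<omega>) * CE y \<omega>"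
    by (rule CE_mult[OF _ y]) measurable
  ultimately show ?thesis using y1 by eventually_elim simp
qed

end

locale conditional_risk = prob_subalgebra M F for M F :: "'a measure" +
  fixes \<rho> :: "('a \<Rightarrow> real) \<Rightarrow> 'a \<Rightarrow> real"
  assumes risk: "cond_risk_measure M F (Linf_cond M F) \<rho>"
begin

abbreviation "fen \<equiv> fenchel M F X \<rho>"

section \<open>Locality of \<open>\<rho>\<close> and of its Fenchel transform\<close>

lemma rho_meas: "x \<in> X \<Longrightarrow> \<rho> x \<in> borel_measurable F"
  using risk by (simp add: cond_risk_measure_def)

lemma rho_meas_M: "x \<in> X \<Longrightarrow> \<rho> x \<in> borel_measurable M"
  by (rule meas_F_M[OF rho_meas])

lemma rho_convex: "\<eta> \<in> borel_measurable F \<Longrightarrow> x \<in> X \<Longrightarrow> y \<in> X \<Longrightarrow> AE \<omega> in M. 0 \<le> \<eta> \<omega> \<and> \<eta> \<omega> \<le> 1 \<Longrightarrow>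
  AE \<omega> in M. \<rho> (\<lambda>w. \<eta> w * x w + (1 - \<eta> w) * y w) \<omega> \<le> \<eta> \<omega> * \<rho> x \<omega> + (1 - \<eta> \<omega>) * \<rho> y \<omega>"
  using risk unfolding cond_risk_measure_def by blast

lemma rho_mono: "x \<in> X \<Longrightarrow> y \<in> X \<Longrightarrow> AE \<omega> in M. x \<omega> \<le> y \<omega> \<Longrightarrow> AE \<omega> in M. \<rho> y \<omega> \<le> \<rho> x \<omega>"
  using risk unfolding cond_risk_measure_def by blast

lemma rho_cash: "\<eta> \<in> borel_measurable F \<Longrightarrow> x \<in> X \<Longrightarrow> AE \<omega> in M. \<rho> (\<lambda>w. x w + \<eta> w) \<omega> = \<rho> x \<omega> - \<eta> \<omega>"
  using risk unfolding cond_risk_measure_def by blast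

lemma rho_cong: "x \<in> X \<Longrightarrow> y \<in> X \<Longrightarrow> AE \<omega> in M. x \<omega> = y \<omega> \<Longrightarrow> AE \<omega> in M. \<rho> x \<omega> = \<rho> y \<omega>"
proof -
  assume a: "x \<in> X" "y \<in> X" "AE \<omega> in M. x \<omega> = y \<omega>"
  have "AE \<omega> in M. \<rho> y \<omega> \<le> \<rho> x \<omega>" by (rule rho_mono[OF a(1,2)]) (use a(3) in auto)
  moreover have "AE \<omega> in M. \<rho> x \<omega> \<le> \<rho> y \<omega>" by (rule rho_mono[OF a(2,1)]) (use a(3) in auto)
  ultimately show ?thesis by eventually_elim auto
qed

text \<open>Monotonicity combined with translation by \<open>\<eta>\<close>. For constant
  \<open>\<eta>\<close> it gives Lipschitz continuity in the sup norm.\<close>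

lemma rho_lip:
  assumes "x \<in> X" "y \<in> X" "\<eta> \<in> borel_measurable F" "AE \<omega> in M. x \<omega> \<le> y \<omega> + \<eta> \<omega>"
  shows "AE \<omega> in M. \<rho> y \<omega> \<le> \<rho> x \<omega> + \<eta> \<omega>"
  using rho_mono[OF assms(1) X_add[OF assms(2) X_F[OF assms(3)]] assms(4)] rho_cash[OF assms(3,2)]
  by eventually_elim simp

text \<open>Convexity with the indicator of \<open>A\<close> as the coefficient: the combination
  \<open>1\<^sub>A x + (1 - 1\<^sub>A) y\<close> is a.e. equal to \<open>y\<close>, and on
  \<open>A\<close> the convexity bound reads \<open>\<rho> y \<le> \<rho> x\<close>. Exchanging the
  roles gives equality.\<close>

lemma rho_local:
  assumes x: "x \<in> X" "y \<in> X" and A[measurable]: "A \<in> sets F" and e: "AE \<omega> in M. \<omega> \<in> A \<longrightarrow> x \<omega> = y \<omega>"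
  shows "AE \<omega> in M. \<omega> \<in> A \<longrightarrow> \<rho> x \<omega> = \<rho> y \<omega>"
proof -
  have half: "AE \<omega> in M. \<omega> \<in> A \<longrightarrow> \<rho> y \<omega> \<le> \<rho> x \<omega>"
    if x: "x \<in> X" "y \<in> X" and e: "AE \<omega> in M. \<omega> \<in> A \<longrightarrow> x \<omega> = y \<omega>" for x y
  proof -
    have c: "AE \<omega> in M. \<rho> (\<lambda>w. indicator A w * x w + (1 - indicator A w) * y w) \<omega>
        \<le> indicator A \<omega> * \<rho> x \<omega> + (1 - indicator A \<omega>) * \<rho> y \<omega>"
      by (rule rho_convex[OF _ x]) (auto split: split_indicator)
    have m: "(\<lambda>w. indicator A w * x w + (1 - indicator A w) * y w) \<in> X"
      by (intro X_add X_multF x) measurable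
    have "AE \<omega> in M. \<rho> (\<lambda>w. indicator A w * x w + (1 - indicator A w) * y w) \<omega> = \<rho> y \<omega>"
      by (rule rho_cong[OF m x(2)]) (use e in \<open>auto elim!: eventually_mono split: split_indicator\<close>)
    with c show ?thesis by eventually_elim (auto split: split_indicator)
  qed
  have e': "AE \<omega> in M. \<omega> \<in> A \<longrightarrow> y \<omega> = x \<omega>" using e by eventually_elim auto
  from half[OF x e] half[OF x(2,1) e'] show ?thesis by eventually_elim auto
qed

lemma rho_concat:
  assumes "event_partition F a" "\<And>k. x k \<in> X"
  shows "AE \<omega> in M. \<omega> \<in> a k \<longrightarrow> \<rho> (concat_rv a x) \<omega> = \<rho> (x k) \<omega>"
  by (rule rho_local[OF X_concat[OF assms] assms(2) event_partitionD(1)[OF assms(1)]])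
     (auto simp: concat_rv_on[OF assms(1)])

lemma zero_X: "(\<lambda>_. c) \<in> X"
  by (rule X_F) auto

lemma cond_exp_ext_mult_eq:
  "x \<in> X \<Longrightarrow> y \<in> L1F \<Longrightarrow> AE \<omega> in M. cond_exp_ext M F (\<lambda>w. x w * y w) \<omega> = ereal (CE (\<lambda>w. x w * y w) \<omega>)"
  by (rule cond_exp_ext_eq[OF L1F_multX])

text \<open>The first three claims are the properties of an essential supremum. For the last one,
  the near-maximisers on the pieces of a partition merge into one element, since \<open>X\<close> is
  closed under concatenation and both \<open>CE\<close> and \<open>\<rho>\<close> are local.\<close>

lemma fen_facts:
  assumes y: "y \<in> L1F"
  shows fen_meas: "fen y \<in> borel_measurable F"
    and fen_ge: "\<And>x. x \<in> X \<Longrightarrow> AE \<omega> in M. ereal (CE (\<lambda>w. x w * y w) \<omega> - \<rho> x \<omega>) \<le> fen y \<omega>"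
    and fen_le: "\<And>g. g \<in> borel_measurable F \<Longrightarrow> (\<And>x. x \<in> X \<Longrightarrow> AE \<omega> in M. ereal (CE (\<lambda>w. x w * y w) \<omega> - \<rho> x \<omega>) \<le> g \<omega>) \<Longrightarrow>
       AE \<omega> in M. fen y \<omega> \<le> g \<omega>"
    and fen_select: "\<And>f. f \<in> borel_measurable F \<Longrightarrow> AE \<omega> in M. f \<omega> < fen y \<omega> \<Longrightarrow>
       \<exists>x\<in>X. AE \<omega> in M. f \<omega> < ereal (CE (\<lambda>w. x w * y w) \<omega> - \<rho> x \<omega>)"
proof -
  define H where "H x \<omega> = cond_exp_ext M F (\<lambda>w. x w * y w) \<omega> - ereal (\<rho> x \<omega>)" for x \<omega>
  define H' where "H' x \<omega> = ereal (CE (\<lambda>w. x w * y w) \<omega> - \<rho> x \<omega>)" for x \<omega>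
  have fen: "fen y = ess_sup_family M F (H ` X)"
    unfolding fenchel_def H_def setcompr_eq_image Collect_mem_eq ..
  have ne: "X \<noteq> {}" using zero_X by blast
  have m: "H' x \<in> borel_measurable F" if "x \<in> X" for x
  proof -
    note [measurable] = rho_meas[OF that]
    show ?thesis unfolding H'_def by measurable
  qed
  have e: "AE \<omega> in M. H x \<omega> = H' x \<omega>" if "x \<in> X" for x
    using cond_exp_ext_mult_eq[OF that y] by eventually_elim (simp add: H_def H'_def)
  show "fen y \<in> borel_measurable F" unfolding fen by (rule ess_sup_family_meas[where H = H and H' = H' and S = X, OF ne m e])
  show "AE \<omega> in M. ereal (CE (\<lambda>w. x w * y w) \<omega> - \<rho> x \<omega>) \<le> fen y \<omega>" if "x \<in> X" for x
    unfolding fen using ess_sup_family_ge[where H = H and H' = H' and S = X, OF ne m e that] by (simp add: H'_def)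
  show "AE \<omega> in M. fen y \<omega> \<le> g \<omega>" if "g \<in> borel_measurable F" "\<And>x. x \<in> X \<Longrightarrow> AE \<omega> in M. ereal (CE (\<lambda>w. x w * y w) \<omega> - \<rho> x \<omega>) \<le> g \<omega>" for g
    unfolding fen by (rule ess_sup_family_le[where H = H and H' = H' and S = X, OF ne m e that(1)]) (use that(2) in \<open>simp_all add: H'_def\<close>)
  show "\<exists>x\<in>X. AE \<omega> in M. f \<omega> < ereal (CE (\<lambda>w. x w * y w) \<omega> - \<rho> x \<omega>)"
    if f: "f \<in> borel_measurable F" "AE \<omega> in M. f \<omega> < fen y \<omega>" for f
  proof -
    from ess_sup_family_select[where H = H and H' = H' and S = X, OF ne m e f(1) f(2)[unfolded fen]]
    obtain a x where a: "event_partition F a" "\<And>k. x k \<in> X"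
      and l: "AE \<omega> in M. \<forall>k. \<omega> \<in> a k \<longrightarrow> f \<omega> < H' (x k) \<omega>" by blast
    have c: "concat_rv a x \<in> X" by (rule X_concat[OF a])
    have "AE \<omega> in M. f \<omega> < H' (concat_rv a x) \<omega>"
    proof (rule partition_AE[OF a(1)])
      fix k
      have "AE \<omega> in M. \<omega> \<in> a k \<longrightarrow> CE (\<lambda>w. concat_rv a x w * y w) \<omega> = CE (\<lambda>w. x k w * y w) \<omega>"
        by (rule CE_local[OF L1F_multX[OF c y] L1F_multX[OF a(2) y] event_partitionD(1)[OF a(1)]])
          (auto simp: concat_rv_on[OF a(1)])
      with rho_concat[where x = x and k = k, OF a] l show "AE \<omega> in M. \<omega> \<in> a k \<longrightarrow> f \<omega> < H' (concat_rv a x) \<omega>"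
        by eventually_elim (auto simp: H'_def)
    qed
    then show ?thesis using c unfolding H'_def by blast
  qed
qed

lemma fen_local:
  assumes y: "y \<in> L1F" "y' \<in> L1F" and A[measurable]: "A \<in> sets F" and e: "AE \<omega> in M. \<omega> \<in> A \<longrightarrow> y \<omega> = y' \<omega>"
  shows "AE \<omega> in M. \<omega> \<in> A \<longrightarrow> fen y \<omega> = fen y' \<omega>"
proof -
  have half: "AE \<omega> in M. \<omega> \<in> A \<longrightarrow> fen y \<omega> \<le> fen y' \<omega>"
    if y: "y \<in> L1F" "y' \<in> L1F" and e: "AE \<omega> in M. \<omega> \<in> A \<longrightarrow> y \<omega> = y' \<omega>" for y y'
  proof -
    note [measurable] = fen_meas[OF y(2)]
    \<comment> \<open>The bound equals \<infinity> off \<open>A\<close>, so admissibility has to be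
      checked on \<open>A\<close> only; leastness of the essential supremum then yields the
      inequality there.\<close>
    have "AE \<omega> in M. fen y \<omega> \<le> (if \<omega> \<in> A then fen y' \<omega> else \<infinity>)"
    proof (rule fen_le[OF y(1)])
      fix x assume x: "x \<in> X"
      have "AE \<omega> in M. \<omega> \<in> A \<longrightarrow> CE (\<lambda>w. x w * y w) \<omega> = CE (\<lambda>w. x w * y' w) \<omega>"
        by (rule CE_local[OF L1F_multX[OF x y(1)] L1F_multX[OF x y(2)] A]) (use e in auto)
      with fen_ge[OF y(2) x] show "AE \<omega> in M. ereal (CE (\<lambda>w. x w * y w) \<omega> - \<rho> x \<omega>) \<le> (if \<omega> \<in> A then fen y' \<omega> else \<infinity>)"
        by eventually_elim auto
    qed measurable
    then show ?thesis by eventually_elim (auto split: if_splits)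
  qed
  have e': "AE \<omega> in M. \<omega> \<in> A \<longrightarrow> y' \<omega> = y \<omega>" using e by eventually_elim auto
  from half[OF y e] half[OF y(2,1) e'] show ?thesis by eventually_elim auto
qed

lemma fen_concat:
  assumes "event_partition F a" "\<And>k. y k \<in> L1F"
  shows "AE \<omega> in M. \<omega> \<in> a k \<longrightarrow> fen (concat_rv a y) \<omega> = fen (y k) \<omega>"
  by (rule fen_local[OF L1F_concat[OF assms] assms(2) event_partitionD(1)[OF assms(1)]])
     (auto simp: concat_rv_on[OF assms(1)])

lemma fen_gt_MInf:
  assumes "y \<in> L1F" shows "AE \<omega> in M. fen y \<omega> > -\<infinity>"
  using fen_ge[OF assms zero_X[of 0]] by eventually_elim (metis MInfty_neq_ereal(1) ereal_infty_less(2) ereal_infty_less_eq(2))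

text \<open>Tests with large multiples. For \<open>n\<close> times the indicator of
  \<open>{y > 0}\<close> monotonicity keeps \<open>\<rho>\<close> below \<open>\<rho> 0\<close>
  while the pairing grows linearly unless \<open>y \<le> 0\<close>; for the constants
  \<open>n\<close> and \<open>- n\<close> the translation rule forces \<open>CE y + 1\<close> to
  vanish.\<close>

lemma fen_finite_imp:
  assumes y: "y \<in> L1F" and fin: "AE \<omega> in M. fen y \<omega> < \<infinity>"
  shows "AE \<omega> in M. y \<omega> \<le> 0" and "AE \<omega> in M. CE y \<omega> = -1"
proof -
  note [measurable] = L1F_meas[OF y]
  define \<eta> where "\<eta> \<omega> = real_of_ereal (fen y \<omega>)" for \<omega>
  have le: "AE \<omega> in M. CE (\<lambda>w. x w * y w) \<omega> \<le> \<rho> x \<omega> + \<eta> \<omega>" if "x \<in> X" for x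
    using fen_ge[OF y that] fin
  proof eventually_elim
    case (elim \<omega>)
    then show ?case by (cases "fen y \<omega>") (auto simp: \<eta>_def)
  qed
  show "AE \<omega> in M. y \<omega> \<le> 0"
  proof -
    define p where "p w = max (y w) 0" for w
    have [measurable]: "p \<in> borel_measurable M" unfolding p_def by measurable
    have p: "p \<in> L1F"
    proof -
      have "(\<lambda>w. (indicator {w\<in>space M. 0 < y w} w :: real) * y w) \<in> L1F"
        by (rule L1F_multX[OF X_bounded[of _ 1] y]) (auto split: split_indicator)
      then show ?thesis by (rule L1F_AE) (auto simp: p_def max_def split: split_indicator)
    qed
    have "AE \<omega> in M. \<forall>n::nat. real n * CE p \<omega> \<le> \<rho> (\<lambda>_. 0) \<omega> + \<eta> \<omega>"
      unfolding AE_all_countable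
    proof
      fix n :: nat
      define x where "x w = real n * indicator {w\<in>space M. 0 < y w} w" for w
      have x: "x \<in> X" unfolding x_def by (rule X_bounded[of _ "real n"]) (auto split: split_indicator)
      have "AE \<omega> in M. CE (\<lambda>w. x w * y w) \<omega> = CE (\<lambda>w. real n * p w) \<omega>"
        by (rule real_cond_exp_cong) (use X_meas[OF x] in \<open>auto simp: x_def p_def split: split_indicator\<close>)
      moreover have "AE \<omega> in M. CE (\<lambda>w. real n * p w) \<omega> = real n * CE p \<omega>" by (rule CE_mult[OF _ p]) auto
      moreover have "AE \<omega> in M. \<rho> x \<omega> \<le> \<rho> (\<lambda>_. 0) \<omega>"
        by (rule rho_mono[OF zero_X x]) (auto simp: x_def)
      ultimately show "AE \<omega> in M. real n * CE p \<omega> \<le> \<rho> (\<lambda>_. 0) \<omega> + \<eta> \<omega>"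
        using le[OF x] by eventually_elim linarith
    qed
    then have CEp: "AE \<omega> in M. CE p \<omega> \<le> 0"
      by eventually_elim (rule le_zero_of_multiples_bounded, auto)
    \<comment> \<open>To conclude \<open>p = 0\<close> from \<open>CE p \<le> 0\<close> one
      integrates; \<open>p\<close> itself may fail to be integrable, hence the division by
      \<open>g\<close>.\<close>
    obtain g where g: "g \<in> borel_measurable F" "\<And>\<omega>. 1 \<le> g \<omega>" "integrable M (\<lambda>\<omega>. p \<omega> / g \<omega>)"
      using L1F_scale[OF p] by blast
    have g0: "0 < g \<omega>" for \<omega> using g(2)[of \<omega>] by simp
    have "AE \<omega> in M. CE p \<omega> = g \<omega> * CE (\<lambda>w. p w / g w) \<omega>" by (rule CE_unscale[OF g(1,2)]) measurable
    with CEp have "AE \<omega> in M. CE (\<lambda>w. p w / g w) \<omega> \<le> 0"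
      by eventually_elim (use g0 in \<open>auto simp: mult_le_0_iff dest: less_imp_le\<close>, metis g0 not_less)
    then have "(\<integral>\<omega>. CE (\<lambda>w. p w / g w) \<omega> \<partial>M) \<le> 0"
      using integral_nonneg_AE[of "\<lambda>\<omega>. - CE (\<lambda>w. p w / g w) \<omega>" M] by auto
    then have "(\<integral>\<omega>. p \<omega> / g \<omega> \<partial>M) \<le> 0" using real_cond_exp_int(2)[OF g(3)] by simp
    moreover have nn: "AE \<omega> in M. 0 \<le> p \<omega> / g \<omega>" using g0 by (auto simp: p_def intro!: divide_nonneg_pos)
    ultimately have "(\<integral>\<omega>. p \<omega> / g \<omega> \<partial>M) = 0" using integral_nonneg_AE[OF nn] by simp
    then have "AE \<omega> in M. p \<omega> / g \<omega> = 0" using integral_nonneg_eq_0_iff_AE[OF g(3) nn] by simp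
    then show ?thesis by eventually_elim (use g0 in \<open>auto simp: p_def max_def split: if_splits\<close>, metis g0 less_irrefl)
  qed
  show "AE \<omega> in M. CE y \<omega> = -1"
  proof -
    have *: "AE \<omega> in M. \<forall>n::nat. real n * (s * (CE y \<omega> + 1)) \<le> \<rho> (\<lambda>_. 0) \<omega> + \<eta> \<omega>" for s :: real
      unfolding AE_all_countable
    proof
      fix n :: nat
      let ?c = "real n * s"
      have "AE \<omega> in M. \<rho> (\<lambda>w. 0 + ?c) \<omega> = \<rho> (\<lambda>_. 0) \<omega> - ?c" by (rule rho_cash[OF _ zero_X]) auto
      moreover have "AE \<omega> in M. CE (\<lambda>w. ?c * y w) \<omega> = ?c * CE y \<omega>" by (rule CE_mult[OF _ y]) auto
      ultimately show "AE \<omega> in M. real n * (s * (CE y \<omega> + 1)) \<le> \<rho> (\<lambda>_. 0) \<omega> + \<eta> \<omega>"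
        using le[OF zero_X[of ?c]] by eventually_elim (simp add: algebra_simps)
    qed
    have "AE \<omega> in M. 1 * (CE y \<omega> + 1) \<le> 0" using *[of 1] by eventually_elim (rule le_zero_of_multiples_bounded, blast)
    moreover have "AE \<omega> in M. (-1) * (CE y \<omega> + 1) \<le> 0" using *[of "-1"] by eventually_elim (rule le_zero_of_multiples_bounded, blast)
    ultimately show ?thesis by eventually_elim simp
  qed
qed

end

section \<open>Convex minimisation on bounded functions\<close>

text \<open>For \<open>r \<ge> 0\<close> this is the signed distance of \<open>s\<close> from the
  interval [-r, r]. Half its square is a convex penalty whose derivative is
  \<open>clip_dist r\<close> again.\<close>

definition clip_dist :: "real \<Rightarrow> real \<Rightarrow> real" where
  "clip_dist r s = s - max (- r) (min r s)"

lemma clip_dist_meas[measurable]: "clip_dist r \<in> borel_measurable borel"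
  unfolding clip_dist_def by measurable

text \<open>The clipped value is the nearest point of the interval. Both the convexity of the
  penalty and its quadratic upper bound will be drawn from this inequality.\<close>

lemma clip_dist_sq_le: "\<bar>c\<bar> \<le> r \<Longrightarrow> (clip_dist r s)\<^sup>2 \<le> (s - c)\<^sup>2"
  unfolding clip_dist_def abs_le_square_iff[symmetric] by (auto simp: max_def min_def)

text \<open>Where the distance is nonzero, \<open>s\<close> has its sign and \<open>|s|\<close>
  equals \<open>r\<close> plus its modulus. Pairing the derivative of the penalty with
  \<open>s\<close> thus controls \<open>r\<close> times its modulus, the source of the bound of
  order 1/r on the cost.\<close>

lemma clip_dist_mult: "0 \<le> r \<Longrightarrow> clip_dist r s * s = (clip_dist r s)\<^sup>2 + r * \<bar>clip_dist r s\<bar>"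
  unfolding clip_dist_def by (auto simp: max_def min_def power2_eq_square algebra_simps)

lemma clip_dist_abs_le: "0 \<le> r \<Longrightarrow> \<bar>clip_dist r s\<bar> \<le> \<bar>s\<bar>"
  unfolding clip_dist_def by (auto simp: max_def min_def)

text \<open>Extracts a first-order condition at a minimiser: \<open>a\<close> is the directional
  derivative and \<open>t * b\<close> the quadratic remainder after division by
  \<open>t\<close>.\<close>

lemma nonneg_of_linear_perturbation:
  fixes a b :: real
  assumes "\<And>t. 0 < t \<Longrightarrow> t \<le> 1 \<Longrightarrow> 0 \<le> a + t * b"
  shows "0 \<le> a"
proof (rule ccontr)
  assume "\<not> 0 \<le> a"
  then have a: "a < 0" by simp
  define t where "t = min 1 (- a / (2 * (\<bar>b\<bar> + 1)))"
  have "0 < - a / (2 * (\<bar>b\<bar> + 1))" using a by (intro divide_pos_pos) auto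
  then have t: "0 < t" "t \<le> 1" by (auto simp: t_def)
  have "t * b \<le> t * (\<bar>b\<bar> + 1)" using t by (intro mult_left_mono) auto
  also have "\<dots> \<le> (- a / (2 * (\<bar>b\<bar> + 1))) * (\<bar>b\<bar> + 1)" by (intro mult_right_mono) (auto simp: t_def)
  also have "\<dots> = - a / 2" by (simp add: field_simps)
  finally show False using assms[OF t] a by linarith
qed

lemma norm_sq_le: "\<bar>d\<bar> \<le> c \<Longrightarrow> norm (d\<^sup>2) \<le> c\<^sup>2" for c d :: real
  by (metis abs_ge_zero abs_power2 power2_abs power_mono real_norm_def)

context prob_space
begin

text \<open>The bound is required everywhere rather than a.e., so that pointwise estimates under the
  integral carry no exceptional sets.\<close>

definition bnd :: "real \<Rightarrow> ('a \<Rightarrow> real) set" where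
  "bnd R = {x \<in> borel_measurable M. \<forall>\<omega>. \<bar>x \<omega>\<bar> \<le> R}"

text \<open>The last clause is lower semicontinuity, phrased as closedness of sublevel sets under
  bounded a.e. convergence; for constant sequences it also makes the sublevels insensitive to null
  sets. The linear growth bound provides the slack on the first small ball.\<close>

definition lsc_convex :: "(('a \<Rightarrow> real) \<Rightarrow> real) \<Rightarrow> bool" where
  "lsc_convex \<phi> \<longleftrightarrow> \<phi> (\<lambda>_. 0) = 0 \<and> (\<exists>K\<ge>0. \<forall>R. \<forall>x\<in>bnd R. \<bar>\<phi> x\<bar> \<le> K * R) \<and>
    (\<forall>R. \<forall>x\<in>bnd R. \<forall>y\<in>bnd R. \<forall>t. 0 \<le> t \<longrightarrow> t \<le> 1 \<longrightarrow>
        \<phi> (\<lambda>\<omega>. (1 - t) * x \<omega> + t * y \<omega>) \<le> (1 - t) * \<phi> x + t * \<phi> y) \<and>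
    (\<forall>R xs x c. (\<forall>n::nat. xs n \<in> bnd R) \<longrightarrow> x \<in> bnd R \<longrightarrow> (AE \<omega> in M. (\<lambda>n. xs n \<omega>) \<longlonglongrightarrow> x \<omega>) \<longrightarrow>
        (\<forall>n. \<phi> (xs n) \<le> c) \<longrightarrow> \<phi> x \<le> c)"

lemma bndD: "x \<in> bnd R \<Longrightarrow> x \<in> borel_measurable M" "x \<in> bnd R \<Longrightarrow> \<bar>x \<omega>\<bar> \<le> R"
  by (auto simp: bnd_def)

lemma bndI: "x \<in> borel_measurable M \<Longrightarrow> (\<And>\<omega>. \<bar>x \<omega>\<bar> \<le> R) \<Longrightarrow> x \<in> bnd R"
  by (auto simp: bnd_def)

lemma bnd_mono: "x \<in> bnd R \<Longrightarrow> R \<le> R' \<Longrightarrow> x \<in> bnd R'"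
  by (auto simp: bnd_def intro: order_trans)

lemma bnd_nonneg: "x \<in> bnd R \<Longrightarrow> 0 \<le> R"
  using bndD(2)[of x R undefined] by linarith

lemma bnd_integrable: "x \<in> bnd R \<Longrightarrow> integrable M x"
  by (rule integrable_const_bound[of _ R]) (auto simp: bnd_def)

lemma bnd_mult_integrable: "x \<in> bnd R \<Longrightarrow> integrable M y \<Longrightarrow> integrable M (\<lambda>\<omega>. x \<omega> * y \<omega>)"
proof -
  assume x: "x \<in> bnd R" and y: "integrable M y"
  note [measurable] = bndD(1)[OF x]
  show ?thesis
  proof (rule Bochner_Integration.integrable_bound)
    show "integrable M (\<lambda>\<omega>. R * y \<omega>)" using y by simp
    show "AE \<omega> in M. norm (x \<omega> * y \<omega>) \<le> norm (R * y \<omega>)"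
      using bndD(2)[OF x] bnd_nonneg[OF x] by (auto simp: abs_mult intro!: mult_right_mono)
  qed (use y in measurable)
qed

lemma bnd_comb: "x \<in> bnd R \<Longrightarrow> y \<in> bnd R \<Longrightarrow> 0 \<le> t \<Longrightarrow> t \<le> 1 \<Longrightarrow> (\<lambda>\<omega>. (1 - t) * x \<omega> + t * y \<omega>) \<in> bnd R"
proof (rule bndI)
  assume a: "x \<in> bnd R" "y \<in> bnd R" "0 \<le> t" "t \<le> 1"
  note [measurable] = bndD(1)[OF a(1)] bndD(1)[OF a(2)]
  show "(\<lambda>\<omega>. (1 - t) * x \<omega> + t * y \<omega>) \<in> borel_measurable M" by measurable
  fix \<omega>
  have "\<bar>(1 - t) * x \<omega> + t * y \<omega>\<bar> \<le> (1 - t) * \<bar>x \<omega>\<bar> + t * \<bar>y \<omega>\<bar>"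
    using a(3,4) abs_triangle_ineq[of "(1 - t) * x \<omega>" "t * y \<omega>"] by (simp add: abs_mult)
  also have "\<dots> \<le> (1 - t) * R + t * R"
    using a by (intro add_mono mult_left_mono bndD(2)) auto
  finally show "\<bar>(1 - t) * x \<omega> + t * y \<omega>\<bar> \<le> R" by (simp add: algebra_simps)
qed

lemma lsc_convex_zero: "lsc_convex \<phi> \<Longrightarrow> \<phi> (\<lambda>_. 0) = 0"
  by (simp add: lsc_convex_def)

lemma lsc_convex_bound:
  assumes "lsc_convex \<phi>"
  obtains K where "0 \<le> K" "\<And>R x. x \<in> bnd R \<Longrightarrow> \<bar>\<phi> x\<bar> \<le> K * R"
  using assms unfolding lsc_convex_def by (elim conjE exE) blast

lemma lsc_convex_comb:
  assumes "lsc_convex \<phi>" "x \<in> bnd R" "y \<in> bnd R" "0 \<le> t" "t \<le> 1"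
  shows "\<phi> (\<lambda>\<omega>. (1 - t) * x \<omega> + t * y \<omega>) \<le> (1 - t) * \<phi> x + t * \<phi> y"
  using assms(1)[unfolded lsc_convex_def, THEN conjunct2, THEN conjunct2, THEN conjunct1, rule_format, OF assms(2-)] .

lemma lsc_convex_lim:
  assumes \<phi>: "lsc_convex \<phi>" and xs: "\<And>n. xs n \<in> bnd R" "x \<in> bnd R" "AE \<omega> in M. (\<lambda>n. xs n \<omega>) \<longlonglongrightarrow> x \<omega>"
    and a: "\<And>n. \<phi> (xs n) \<le> a n" "a \<longlonglongrightarrow> c"
  shows "\<phi> x \<le> c"
proof (rule field_le_epsilon)
  fix e :: real assume "e > 0"
  then have "eventually (\<lambda>n. a n < c + e) sequentially" using a(2) by (intro order_tendstoD) auto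
  then obtain N where N: "\<And>n. n \<ge> N \<Longrightarrow> a n < c + e" unfolding eventually_sequentially by blast
  have "AE \<omega> in M. (\<lambda>n. xs (n + N) \<omega>) \<longlonglongrightarrow> x \<omega>"
    using xs(3) by eventually_elim (rule LIMSEQ_ignore_initial_segment)
  moreover have "\<phi> (xs (n + N)) \<le> c + e" for n using a(1)[of "n + N"] N[of "n + N"] by simp
  ultimately show "\<phi> x \<le> c + e"
    using \<phi> xs(1,2) unfolding lsc_convex_def by (elim conjE) (erule allE[of _ R], erule allE[of _ "\<lambda>n. xs (n + N)"], blast)
qed

text \<open>The semicontinuity clause survives because the subtracted functional is continuous by
  dominated convergence. Absorbing the current functional into \<open>\<phi>\<close> in this way is
  what allows the correction to be repeated.\<close>

lemma lsc_convex_sub: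
  assumes \<phi>: "lsc_convex \<phi>" and y: "integrable M y"
  shows "lsc_convex (\<lambda>x. \<phi> x - (\<integral>\<omega>. x \<omega> * y \<omega> \<partial>M))"
proof -
  note [measurable] = borel_measurable_integrable[OF y]
  obtain K where K: "0 \<le> K" "\<And>R x. x \<in> bnd R \<Longrightarrow> \<bar>\<phi> x\<bar> \<le> K * R"
    using lsc_convex_bound[OF \<phi>] by blast
  note z = lsc_convex_zero[OF \<phi>] and cv = lsc_convex_comb[OF \<phi>]
  let ?I = "\<lambda>x. \<integral>\<omega>. x \<omega> * y \<omega> \<partial>M"
  have b: "\<bar>?I x\<bar> \<le> (\<integral>\<omega>. \<bar>y \<omega>\<bar> \<partial>M) * R" if x: "x \<in> bnd R" for x R
  proof -
    have "\<bar>?I x\<bar> \<le> (\<integral>\<omega>. \<bar>x \<omega> * y \<omega>\<bar> \<partial>M)" by (rule integral_abs_bound)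
    also have "\<dots> \<le> (\<integral>\<omega>. \<bar>y \<omega>\<bar> * R \<partial>M)"
    proof (rule integral_mono)
      show "integrable M (\<lambda>\<omega>. \<bar>x \<omega> * y \<omega>\<bar>)" using bnd_mult_integrable[OF x y] by (rule integrable_abs)
      show "\<bar>x \<omega> * y \<omega>\<bar> \<le> \<bar>y \<omega>\<bar> * R" for \<omega>
        unfolding abs_mult mult.commute[of "\<bar>x \<omega>\<bar>"] by (rule mult_left_mono[OF bndD(2)[OF x]]) simp
    qed (use y in simp)
    finally show ?thesis by simp
  qed
  show ?thesis unfolding lsc_convex_def
  proof (intro conjI)
    show "\<phi> (\<lambda>_. 0) - ?I (\<lambda>_. 0) = 0" using z by simp
    show "\<exists>K\<ge>0. \<forall>R. \<forall>x\<in>bnd R. \<bar>\<phi> x - ?I x\<bar> \<le> K * R"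
    proof (intro exI[of _ "K + (\<integral>\<omega>. \<bar>y \<omega>\<bar> \<partial>M)"] conjI allI ballI)
      show "0 \<le> K + (\<integral>\<omega>. \<bar>y \<omega>\<bar> \<partial>M)" using K by simp
      fix R x assume x: "x \<in> bnd R"
      show "\<bar>\<phi> x - ?I x\<bar> \<le> (K + (\<integral>\<omega>. \<bar>y \<omega>\<bar> \<partial>M)) * R"
        using K(2)[OF x] b[OF x] unfolding distrib_right by linarith
    qed
    show "\<forall>R. \<forall>x\<in>bnd R. \<forall>u\<in>bnd R. \<forall>t. 0 \<le> t \<longrightarrow> t \<le> 1 \<longrightarrow>
        \<phi> (\<lambda>\<omega>. (1 - t) * x \<omega> + t * u \<omega>) - ?I (\<lambda>\<omega>. (1 - t) * x \<omega> + t * u \<omega>) \<le> (1 - t) * (\<phi> x - ?I x) + t * (\<phi> u - ?I u)"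
    proof (intro allI ballI impI)
      fix R x u and t :: real assume a: "x \<in> bnd R" "u \<in> bnd R" "0 \<le> t" "t \<le> 1"
      have "?I (\<lambda>\<omega>. (1 - t) * x \<omega> + t * u \<omega>) = (\<integral>\<omega>. (1 - t) * (x \<omega> * y \<omega>) + t * (u \<omega> * y \<omega>) \<partial>M)"
        by (simp add: algebra_simps)
      also have "\<dots> = (1 - t) * ?I x + t * ?I u"
        using bnd_mult_integrable[OF a(1) y] bnd_mult_integrable[OF a(2) y] by simp
      finally show "\<phi> (\<lambda>\<omega>. (1 - t) * x \<omega> + t * u \<omega>) - ?I (\<lambda>\<omega>. (1 - t) * x \<omega> + t * u \<omega>) \<le> (1 - t) * (\<phi> x - ?I x) + t * (\<phi> u - ?I u)"
        using cv[OF a] by (simp add: algebra_simps)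
    qed
    show "\<forall>R xs x c. (\<forall>n::nat. xs n \<in> bnd R) \<longrightarrow> x \<in> bnd R \<longrightarrow> (AE \<omega> in M. (\<lambda>n. xs n \<omega>) \<longlonglongrightarrow> x \<omega>) \<longrightarrow>
        (\<forall>n. \<phi> (xs n) - ?I (xs n) \<le> c) \<longrightarrow> \<phi> x - ?I x \<le> c"
    proof (intro allI impI)
      fix R xs x and c :: real
      assume a: "\<forall>n::nat. xs n \<in> bnd R" "x \<in> bnd R" "AE \<omega> in M. (\<lambda>n. xs n \<omega>) \<longlonglongrightarrow> x \<omega>" "\<forall>n. \<phi> (xs n) - ?I (xs n) \<le> c"
      note [measurable] = bndD(1)[OF a(2)] bndD(1)[OF a(1)[rule_format]]
      have "(\<lambda>n. ?I (xs n)) \<longlonglongrightarrow> ?I x"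
      proof (rule integral_dominated_convergence)
        show "integrable M (\<lambda>\<omega>. R * \<bar>y \<omega>\<bar>)" using y by simp
        show "AE \<omega> in M. (\<lambda>n. xs n \<omega> * y \<omega>) \<longlonglongrightarrow> x \<omega> * y \<omega>" using a(3) by eventually_elim (intro tendsto_intros)
        show "AE \<omega> in M. norm (xs n \<omega> * y \<omega>) \<le> R * \<bar>y \<omega>\<bar>" for n
          using bndD(2)[OF a(1)[rule_format]] by (auto simp: abs_mult intro!: mult_right_mono)
      qed measurable
      then have "(\<lambda>n. c + ?I (xs n)) \<longlonglongrightarrow> c + ?I x" by (intro tendsto_intros)
      then have "\<phi> x \<le> c + ?I x"
        using lsc_convex_lim[OF \<phi> _ a(2,3), of "\<lambda>n. c + ?I (xs n)"] a(1,4) by (auto simp: algebra_simps)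
      then show "\<phi> x - ?I x \<le> c" by simp
    qed
  qed
qed

text \<open>Mean-square Cauchy implies Cauchy in \<open>L\<^sup>1\<close>, which yields an a.e.
  Cauchy subsequence. The limit is wanted pointwise and inside the ball because the semicontinuity
  of \<open>lsc_convex\<close> is stated for such sequences.\<close>

lemma bnd_L2_cauchy_limit:
  assumes xs: "\<And>n. xs n \<in> bnd R"
    and cau: "\<And>e. e > 0 \<Longrightarrow> \<exists>N. \<forall>i\<ge>N. \<forall>j\<ge>N. (\<integral>\<omega>. (xs i \<omega> - xs j \<omega>)\<^sup>2 \<partial>M) < e"
  shows "\<exists>r x. strict_mono (r :: nat \<Rightarrow> nat) \<and> x \<in> bnd R \<and> (AE \<omega> in M. (\<lambda>k. xs (r k) \<omega>) \<longlonglongrightarrow> x \<omega>)"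
proof -
  note [measurable] = bndD(1)[OF xs]
  have int: "integrable M (xs n)" for n using bnd_integrable[OF xs] .
  have intsq: "integrable M (\<lambda>\<omega>. (xs i \<omega> - xs j \<omega>)\<^sup>2)" for i j
  proof (rule integrable_const_bound[of _ "(2 * R)\<^sup>2"])
    have "\<bar>xs i \<omega> - xs j \<omega>\<bar> \<le> 2 * R" for \<omega> using bndD(2)[OF xs, of i \<omega>] bndD(2)[OF xs, of j \<omega>] by linarith
    then show "AE \<omega> in M. norm ((xs i \<omega> - xs j \<omega>)\<^sup>2) \<le> (2 * R)\<^sup>2"
      by (intro AE_I2 norm_sq_le)
  qed measurable
  have L1: "\<exists>N. \<forall>i\<ge>N. \<forall>j\<ge>N. (LINT \<omega>|M. norm (xs i \<omega> - xs j \<omega>)) < e" if e: "e > 0" for e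
  proof -
    from e have "0 < e\<^sup>2 / 2" by simp
    from cau[OF this] obtain N where N: "\<And>i j. i \<ge> N \<Longrightarrow> j \<ge> N \<Longrightarrow> (\<integral>\<omega>. (xs i \<omega> - xs j \<omega>)\<^sup>2 \<partial>M) < e\<^sup>2 / 2" by blast
    \<comment> \<open>Young's inequality, weighted so that a mean square below
      \<open>e\<^sup>2 / 2\<close> leaves a mean modulus below \<open>3 * e / 4\<close>.\<close>
    have am: "\<bar>d\<bar> \<le> e / 4 + d\<^sup>2 / e" for d
    proof -
      have "0 \<le> (\<bar>d\<bar> - e / 2)\<^sup>2" by simp
      then have "e * \<bar>d\<bar> \<le> e * (e / 4 + d\<^sup>2 / e)" using e by (simp add: power2_diff algebra_simps power2_eq_square)
      then show ?thesis using e by simp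
    qed
    have "(LINT \<omega>|M. norm (xs i \<omega> - xs j \<omega>)) < e" if "i \<ge> N" "j \<ge> N" for i j
    proof -
      have "(LINT \<omega>|M. norm (xs i \<omega> - xs j \<omega>)) \<le> (LINT \<omega>|M. e / 4 + (xs i \<omega> - xs j \<omega>)\<^sup>2 / e)"
        using int intsq am by (intro integral_mono) auto
      also have "\<dots> = e / 4 + (\<integral>\<omega>. (xs i \<omega> - xs j \<omega>)\<^sup>2 \<partial>M) / e"
        using intsq by (simp add: prob_space)
      also have "\<dots> < e / 4 + (e\<^sup>2 / 2) / e" using N[OF that] e by (intro add_strict_left_mono divide_strict_right_mono) auto
      also have "\<dots> = 3 * e / 4" using e by (simp add: power2_eq_square field_simps)
      finally show ?thesis using e by simp
    qed
    then show ?thesis by blast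
  qed
  obtain r where r: "strict_mono (r :: nat \<Rightarrow> nat)" and C: "AE \<omega> in M. Cauchy (\<lambda>i. xs (r i) \<omega>)"
    using cauchy_L1_AE_cauchy_subseq[OF int L1] by blast
  \<comment> \<open>Clipping enforces the bound also at points where the subsequence diverges; where
    it converges, nothing is changed.\<close>
  define x where "x \<omega> = max (- R) (min R (lim (\<lambda>k. xs (r k) \<omega>)))" for \<omega>
  have R0: "0 \<le> R" using bnd_nonneg[OF xs] .
  have "x \<in> bnd R"
  proof (rule bndI)
    show "x \<in> borel_measurable M" unfolding x_def by measurable
  qed (use R0 in \<open>auto simp: x_def\<close>)
  moreover have "AE \<omega> in M. (\<lambda>k. xs (r k) \<omega>) \<longlonglongrightarrow> x \<omega>" using C
  proof eventually_elim
    case (elim \<omega>)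
    then have l: "(\<lambda>k. xs (r k) \<omega>) \<longlonglongrightarrow> lim (\<lambda>k. xs (r k) \<omega>)"
      by (simp add: Cauchy_convergent_iff convergent_LIMSEQ_iff)
    have "\<bar>lim (\<lambda>k. xs (r k) \<omega>)\<bar> \<le> R"
      by (rule LIMSEQ_le_const2[OF tendsto_rabs[OF l]]) (use bndD(2)[OF xs] in auto)
    then have "x \<omega> = lim (\<lambda>k. xs (r k) \<omega>)" by (auto simp: x_def max_def min_def)
    then show ?case using l by simp
  qed
  ultimately show ?thesis using r by blast
qed

text \<open>The argument of the Hilbert space projection theorem: by \<open>mid\<close> the midpoint
  of two near-minimisers would undercut the infimum unless they are close in mean square, so a
  minimising sequence is Cauchy. For the penalty \<open>\<epsilon> / 2\<close> times the square the
  midpoint gain is exactly \<open>\<epsilon> / 8\<close> times the squared difference. The midpoint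
  estimate is exported because minimisers of different problems are compared later.\<close>

lemma lsc_convex_minimizer:
  assumes \<phi>: "lsc_convex \<phi>" and R: "0 \<le> R" and \<epsilon>: "0 < \<epsilon>"
    and \<theta>: "continuous_on UNIV \<theta>" "\<And>s. 0 \<le> \<theta> s" "\<And>s. \<bar>s\<bar> \<le> R \<Longrightarrow> \<theta> s \<le> B"
    and mid: "\<And>s t. \<theta> ((s + t) / 2) \<le> (\<theta> s + \<theta> t) / 2 - \<epsilon> / 8 * (s - t)\<^sup>2"
  shows "\<exists>x\<in>bnd R. \<forall>u\<in>bnd R. \<phi> x + (\<integral>\<omega>. \<theta> (x \<omega>) \<partial>M) \<le> \<phi> u + (\<integral>\<omega>. \<theta> (u \<omega>) \<partial>M)"
    and "\<And>x u. x \<in> bnd R \<Longrightarrow> u \<in> bnd R \<Longrightarrow> 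
      \<phi> (\<lambda>\<omega>. (x \<omega> + u \<omega>) / 2) + (\<integral>\<omega>. \<theta> ((x \<omega> + u \<omega>) / 2) \<partial>M) \<le>
      ((\<phi> x + (\<integral>\<omega>. \<theta> (x \<omega>) \<partial>M)) + (\<phi> u + (\<integral>\<omega>. \<theta> (u \<omega>) \<partial>M))) / 2 - \<epsilon> / 8 * (\<integral>\<omega>. (x \<omega> - u \<omega>)\<^sup>2 \<partial>M)"
proof -
  have [measurable]: "\<theta> \<in> borel_measurable borel" using \<theta>(1) by (rule borel_measurable_continuous_onI)
  let ?J = "\<lambda>x. \<phi> x + (\<integral>\<omega>. \<theta> (x \<omega>) \<partial>M)"
  have inth: "integrable M (\<lambda>\<omega>. \<theta> (x \<omega>))" if x: "x \<in> bnd R" for x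
  proof -
    note [measurable] = bndD(1)[OF x]
    show ?thesis by (rule integrable_const_bound[of _ B]) (use \<theta> bndD(2)[OF x] in auto)
  qed
  have intsq: "integrable M (\<lambda>\<omega>. (x \<omega> - u \<omega>)\<^sup>2)" if xs: "x \<in> bnd R" "u \<in> bnd R" for x u
  proof -
    note [measurable] = bndD(1)[OF xs(1)] bndD(1)[OF xs(2)]
    have "\<bar>x \<omega> - u \<omega>\<bar> \<le> 2 * R" for \<omega> using bndD(2)[OF xs(1), of \<omega>] bndD(2)[OF xs(2), of \<omega>] by linarith
    then have "AE \<omega> in M. norm ((x \<omega> - u \<omega>)\<^sup>2) \<le> (2 * R)\<^sup>2"
      by (intro AE_I2 norm_sq_le)
    then show ?thesis by (rule integrable_const_bound) measurable
  qed
  have half: "(\<lambda>\<omega>. (1 - 1/2) * x \<omega> + (1/2) * u \<omega>) = (\<lambda>\<omega>. (x \<omega> + u \<omega>) / 2)" for x u :: "'a \<Rightarrow> real"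
    by (auto simp: field_simps)
  have midb: "(\<lambda>\<omega>. (x \<omega> + u \<omega>) / 2) \<in> bnd R" if "x \<in> bnd R" "u \<in> bnd R" for x u
    using bnd_comb[OF that, of "1/2"] unfolding half by simp
  show midJ: "?J (\<lambda>\<omega>. (x \<omega> + u \<omega>) / 2) \<le> (?J x + ?J u) / 2 - \<epsilon> / 8 * (\<integral>\<omega>. (x \<omega> - u \<omega>)\<^sup>2 \<partial>M)"
    if xu: "x \<in> bnd R" "u \<in> bnd R" for x u
  proof -
    have "\<phi> (\<lambda>\<omega>. (1 - 1/2) * x \<omega> + (1/2) * u \<omega>) \<le> (1 - 1/2) * \<phi> x + (1/2) * \<phi> u"
      by (rule lsc_convex_comb[OF \<phi> xu]) auto
    then have 1: "\<phi> (\<lambda>\<omega>. (x \<omega> + u \<omega>) / 2) \<le> (\<phi> x + \<phi> u) / 2" unfolding half by simp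
    have "(\<integral>\<omega>. \<theta> ((x \<omega> + u \<omega>) / 2) \<partial>M) \<le> (\<integral>\<omega>. (\<theta> (x \<omega>) + \<theta> (u \<omega>)) / 2 - \<epsilon> / 8 * (x \<omega> - u \<omega>)\<^sup>2 \<partial>M)"
      using inth[OF midb[OF xu]] inth[OF xu(1)] inth[OF xu(2)] intsq[OF xu] mid by (intro integral_mono) auto
    also have "\<dots> = ((\<integral>\<omega>. \<theta> (x \<omega>) \<partial>M) + (\<integral>\<omega>. \<theta> (u \<omega>) \<partial>M)) / 2 - \<epsilon> / 8 * (\<integral>\<omega>. (x \<omega> - u \<omega>)\<^sup>2 \<partial>M)"
      using inth[OF xu(1)] inth[OF xu(2)] intsq[OF xu] by simp
    finally show ?thesis using 1 by argo
  qed
  obtain K where K: "0 \<le> K" "\<And>R x. x \<in> bnd R \<Longrightarrow> \<bar>\<phi> x\<bar> \<le> K * R"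
    using lsc_convex_bound[OF \<phi>] by blast
  define m where "m = (INF x\<in>bnd R. ?J x)"
  have z: "(\<lambda>_. 0) \<in> bnd R" using R by (auto simp: bnd_def)
  have bdd: "bdd_below (?J ` bnd R)"
  proof (rule bdd_belowI2[of _ "- K * R"])
    fix x assume x: "x \<in> bnd R"
    have "0 \<le> (\<integral>\<omega>. \<theta> (x \<omega>) \<partial>M)" using \<theta>(2) by simp
    then show "- K * R \<le> ?J x" using K(2)[OF x] by simp
  qed
  have low: "m \<le> ?J x" if "x \<in> bnd R" for x unfolding m_def by (rule cINF_lower[OF bdd that])
  have "\<exists>x\<in>bnd R. ?J x < m + 1 / real (Suc n)" for n
    using cINF_less_iff[OF _ bdd, of "m + 1 / real (Suc n)"] z unfolding m_def[symmetric] by auto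
  then obtain xs where xs: "\<And>n. xs n \<in> bnd R" "\<And>n. ?J (xs n) < m + 1 / real (Suc n)" by metis
  have arith: "s < t" if "a < m + t" "b < m + t" "c \<le> (a + b) / 2 - s" "m \<le> c" for a b c s t :: real
    using that by (simp add: field_simps)
  have "\<exists>N. \<forall>i\<ge>N. \<forall>j\<ge>N. (\<integral>\<omega>. (xs i \<omega> - xs j \<omega>)\<^sup>2 \<partial>M) < e" if e: "e > 0" for e
  proof -
    obtain N where N: "1 / real (Suc N) < \<epsilon> / 8 * e" using nat_approx_posE[of "\<epsilon> / 8 * e"] e \<epsilon> by auto
    have "(\<integral>\<omega>. (xs i \<omega> - xs j \<omega>)\<^sup>2 \<partial>M) < e" if "i \<ge> N" "j \<ge> N" for i j
    proof -
      have "1 / real (Suc i) \<le> 1 / real (Suc N)" "1 / real (Suc j) \<le> 1 / real (Suc N)"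
        using that by (auto simp: field_simps)
      then have "?J (xs i) < m + \<epsilon> / 8 * e" "?J (xs j) < m + \<epsilon> / 8 * e"
        using xs(2)[of i] xs(2)[of j] N by linarith+
      then have "\<epsilon> / 8 * (\<integral>\<omega>. (xs i \<omega> - xs j \<omega>)\<^sup>2 \<partial>M) < \<epsilon> / 8 * e"
        by (rule arith[OF _ _ midJ[OF xs(1)[of i] xs(1)[of j]] low[OF midb[OF xs(1)[of i] xs(1)[of j]]]])
      then show ?thesis using \<epsilon> by simp
    qed
    then show ?thesis by blast
  qed
  from bnd_L2_cauchy_limit[OF xs(1) this] obtain r x where r: "strict_mono (r :: nat \<Rightarrow> nat)" and x: "x \<in> bnd R"
    and lim: "AE \<omega> in M. (\<lambda>k. xs (r k) \<omega>) \<longlonglongrightarrow> x \<omega>" by blast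
  note [measurable] = bndD(1)[OF x] bndD(1)[OF xs(1)]
  have "(\<lambda>k. \<integral>\<omega>. \<theta> (xs (r k) \<omega>) \<partial>M) \<longlonglongrightarrow> (\<integral>\<omega>. \<theta> (x \<omega>) \<partial>M)"
  proof (rule integral_dominated_convergence[where w = "\<lambda>_. B"])
    show "AE \<omega> in M. (\<lambda>k. \<theta> (xs (r k) \<omega>)) \<longlonglongrightarrow> \<theta> (x \<omega>)" using lim
      by eventually_elim (rule continuous_on_tendsto_compose[OF \<theta>(1)], auto)
    show "AE \<omega> in M. norm (\<theta> (xs (r k) \<omega>)) \<le> B" for k using \<theta>(2,3) bndD(2)[OF xs(1)] by auto
  qed auto
  moreover have "(\<lambda>k. 1 / real (Suc (r k))) \<longlonglongrightarrow> 0"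
    using LIMSEQ_subseq_LIMSEQ[OF LIMSEQ_Suc[OF lim_1_over_n] r] by (simp add: o_def)
  ultimately have "(\<lambda>k. m + 1 / real (Suc (r k)) - (\<integral>\<omega>. \<theta> (xs (r k) \<omega>) \<partial>M)) \<longlonglongrightarrow> m + 0 - (\<integral>\<omega>. \<theta> (x \<omega>) \<partial>M)"
    by (intro tendsto_intros)
  then have "\<phi> x \<le> m + 0 - (\<integral>\<omega>. \<theta> (x \<omega>) \<partial>M)"
    by (rule lsc_convex_lim[OF \<phi> xs(1) x lim, rotated]) (use xs(2) in \<open>simp add: less_imp_le less_diff_eq\<close>)
  then have "?J x \<le> m" by simp
  then show "\<exists>x\<in>bnd R. \<forall>u\<in>bnd R. ?J x \<le> ?J u" using x low by (meson order_trans)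
qed

end

section \<open>Approximate subgradients in \<open>L\<^sup>1\<close>\<close>

context prob_space
begin

lemma bnd_fun_integrable:
  assumes x: "x \<in> bnd R" and f: "f \<in> borel_measurable borel" "\<And>s. \<bar>s\<bar> \<le> R \<Longrightarrow> \<bar>f s\<bar> \<le> B"
  shows "integrable M (\<lambda>\<omega>. f (x \<omega>) :: real)"
proof -
  note [measurable] = bndD(1)[OF x] f(1)
  show ?thesis by (rule integrable_const_bound[of _ B]) (use f(2) bndD(2)[OF x] in auto)
qed

text \<open>Minimise \<open>\<phi>(x) + n/2 E[dist(x, [-r, r])\<^sup>2] + \<epsilon>/2 E[x\<^sup>2]\<close> over the ball of radius \<open>R\<close> and take for \<open>v\<close> the
  negative derivative of the penalty at the minimiser. The increasing minima are bounded, so strong convexity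
  makes the minimisers Cauchy as \<open>n\<close> grows; their limit lies in the ball of radius \<open>r\<close>, where \<open>\<phi> \<ge> - \<delta>\<close>.\<close>

lemma lsc_convex_step:
  assumes \<phi>: "lsc_convex \<phi>" and r: "0 < r" and rR: "r \<le> R" and \<delta>: "0 \<le> \<delta>" "\<delta> < \<delta>'"
    and low: "\<And>x. x \<in> bnd r \<Longrightarrow> - \<delta> \<le> \<phi> x"
  shows "\<exists>v B. v \<in> bnd B \<and> (\<integral>\<omega>. \<bar>v \<omega>\<bar> \<partial>M) \<le> 2 * \<delta>' / r \<and> (\<forall>x\<in>bnd R. - \<delta>' \<le> \<phi> x - (\<integral>\<omega>. x \<omega> * v \<omega> \<partial>M))"
proof -
  \<comment> \<open>Chosen so that \<open>\<epsilon> * R = \<delta>' / r\<close>: the quadratic term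
    then costs at most \<open>\<delta>' / r\<close> in \<open>L\<^sup>1\<close>, as much as the
    distance penalty, which explains the factor 2 in the claim.\<close>
  define \<epsilon> where "\<epsilon> = \<delta>' / (r * R)"
  have \<delta>'0: "0 < \<delta>'" and R0: "0 < R" using \<delta> r rR by auto
  have \<epsilon>: "0 < \<epsilon>" unfolding \<epsilon>_def using \<delta>'0 r R0 by (intro divide_pos_pos mult_pos_pos)
  define D where "D = clip_dist r"
  have [measurable]: "D \<in> borel_measurable borel" unfolding D_def by measurable
  have Dc: "continuous_on UNIV D" unfolding D_def clip_dist_def by (intro continuous_intros)
  have Dle: "(D s)\<^sup>2 \<le> (s - c)\<^sup>2" if "\<bar>c\<bar> \<le> r" for s c unfolding D_def by (rule clip_dist_sq_le[OF that])
  have Dab: "\<bar>D s\<bar> \<le> \<bar>s\<bar>" for s unfolding D_def using r by (intro clip_dist_abs_le) auto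
  have Dm: "D s * s = (D s)\<^sup>2 + r * \<bar>D s\<bar>" for s unfolding D_def using r by (intro clip_dist_mult) auto
  have cl: "\<bar>s - D s\<bar> \<le> r" for s unfolding D_def clip_dist_def using r by auto
  define \<theta> where "\<theta> n s = real (Suc n) / 2 * (D s)\<^sup>2 + \<epsilon> / 2 * s\<^sup>2" for n s
  have \<theta>c: "continuous_on UNIV (\<theta> n)" for n unfolding \<theta>_def by (intro continuous_intros Dc)
  have [measurable]: "\<theta> n \<in> borel_measurable borel" for n using \<theta>c by (rule borel_measurable_continuous_onI)
  have \<theta>0: "0 \<le> \<theta> n s" for n s using \<epsilon> by (simp add: \<theta>_def)
  define B where "B n = real (Suc n) / 2 * R\<^sup>2 + \<epsilon> / 2 * R\<^sup>2" for n
  have \<theta>B: "\<theta> n s \<le> B n" if "\<bar>s\<bar> \<le> R" for n s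
  proof -
    have "s\<^sup>2 \<le> R\<^sup>2" using that by (metis abs_ge_zero power2_abs power_mono)
    moreover have "(D s)\<^sup>2 \<le> s\<^sup>2" using Dle[of 0 s] r by simp
    ultimately show ?thesis unfolding \<theta>_def B_def using \<epsilon>
      by (intro add_mono mult_left_mono) (auto intro: order_trans)
  qed
  \<comment> \<open>The midpoint of the two clipped values lies in the interval, so it may replace
    the nearest point of the midpoint; convexity of the square finishes the penalty part.\<close>
  have \<theta>mid: "\<theta> n ((s + t) / 2) \<le> (\<theta> n s + \<theta> n t) / 2 - \<epsilon> / 8 * (s - t)\<^sup>2" for n s t
  proof -
    have "\<bar>((s - D s) + (t - D t)) / 2\<bar> \<le> r" using abs_triangle_ineq[of "s - D s" "t - D t"] cl[of s] cl[of t] by simp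
    from Dle[OF this] have "(D ((s + t) / 2))\<^sup>2 \<le> ((s + t) / 2 - ((s - D s) + (t - D t)) / 2)\<^sup>2" .
    also have "\<dots> = ((D s + D t) / 2)\<^sup>2" by (simp add: power2_eq_square field_simps)
    also have "\<dots> \<le> ((D s)\<^sup>2 + (D t)\<^sup>2) / 2"
    proof -
      have "0 \<le> ((D s - D t) / 2)\<^sup>2" by simp
      then show ?thesis by (simp add: power2_eq_square field_simps)
    qed
    finally have "real (Suc n) / 2 * (D ((s + t) / 2))\<^sup>2 \<le> real (Suc n) / 2 * (((D s)\<^sup>2 + (D t)\<^sup>2) / 2)"
      by (rule mult_left_mono) simp
    moreover have "\<epsilon> / 2 * ((s + t) / 2)\<^sup>2 = (\<epsilon> / 2 * s\<^sup>2 + \<epsilon> / 2 * t\<^sup>2) / 2 - \<epsilon> / 8 * (s - t)\<^sup>2"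
      by (simp add: power2_eq_square field_simps)
    ultimately show ?thesis unfolding \<theta>_def by argo
  qed
  define J where "J n x = \<phi> x + (\<integral>\<omega>. \<theta> n (x \<omega>) \<partial>M)" for n x
  have inth: "integrable M (\<lambda>\<omega>. \<theta> n (x \<omega>))" if "x \<in> bnd R" for n x
    by (rule bnd_fun_integrable[OF that, of _ "B n"]) (use \<theta>0 \<theta>B in auto)
  have "\<exists>x\<in>bnd R. \<forall>u\<in>bnd R. J n x \<le> J n u" for n unfolding J_def
    by (rule lsc_convex_minimizer(1)[OF \<phi> less_imp_le[OF R0] \<epsilon> \<theta>c \<theta>0 _ \<theta>mid]) (rule \<theta>B)
  then obtain xh where xh: "\<And>n. xh n \<in> bnd R" "\<And>n u. u \<in> bnd R \<Longrightarrow> J n (xh n) \<le> J n u" by metis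
  note [measurable] = bndD(1)[OF xh(1)]
  have midJ: "J n (\<lambda>\<omega>. (x \<omega> + u \<omega>) / 2) \<le> (J n x + J n u) / 2 - \<epsilon> / 8 * (\<integral>\<omega>. (x \<omega> - u \<omega>)\<^sup>2 \<partial>M)"
    if xu: "x \<in> bnd R" "u \<in> bnd R" for n x u unfolding J_def
    by (rule lsc_convex_minimizer(2)[OF \<phi> less_imp_le[OF R0] \<epsilon> \<theta>c \<theta>0 _ \<theta>mid xu]) (rule \<theta>B)
  have midb: "(\<lambda>\<omega>. (x \<omega> + u \<omega>) / 2) \<in> bnd R" if "x \<in> bnd R" "u \<in> bnd R" for x u
  proof -
    have "(\<lambda>\<omega>. (1 - 1/2) * x \<omega> + (1/2) * u \<omega>) = (\<lambda>\<omega>. (x \<omega> + u \<omega>) / 2)" by (auto simp: field_simps)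
    then show ?thesis using bnd_comb[OF that, of "1/2"] by simp
  qed
  have Jmono: "J m x \<le> J n x" if "m \<le> n" "x \<in> bnd R" for m n x
  proof -
    have "\<theta> m s \<le> \<theta> n s" for s using that unfolding \<theta>_def by (intro add_right_mono mult_right_mono) auto
    then show ?thesis unfolding J_def using inth[OF that(2)] by (intro add_left_mono integral_mono) auto
  qed
  define j where "j n = J n (xh n)" for n
  have jmono: "j m \<le> j n" if "m \<le> n" for m n
    unfolding j_def using xh(2)[OF xh(1), of m n] Jmono[OF that xh(1), of n] by linarith
  have z: "(\<lambda>_. 0) \<in> bnd R" using R0 by (auto simp: bnd_def)
  have D0: "D 0 = 0" using Dab[of 0] by simp
  have j0: "j n \<le> 0" for n
    using xh(2)[OF z, of n] unfolding j_def by (simp add: J_def \<theta>_def D0 lsc_convex_zero[OF \<phi>])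
  \<comment> \<open>The problem with the smaller weight is tested at the midpoint of both
    minimisers: its value there is at least \<open>j m\<close>, while
    \<open>J m (xh n) \<le> j n\<close>. Hence the increments of \<open>j\<close> control the
    squared distances.\<close>
  have dist: "\<epsilon> / 4 * (\<integral>\<omega>. (xh m \<omega> - xh n \<omega>)\<^sup>2 \<partial>M) \<le> j n - j m" if "m \<le> n" for m n
  proof -
    have arith: "e / 4 * s \<le> c - a" if "a \<le> d" "d \<le> (a + b) / 2 - e / 8 * s" "b \<le> c" for a b c d e s :: real
      using that by (simp add: field_simps)
    show ?thesis
      by (rule arith[OF _ midJ[OF xh(1)[of m] xh(1)[of n], of m, folded j_def]])
        (use xh(2)[OF midb[OF xh(1)[of m] xh(1)[of n]], of m] Jmono[OF that xh(1)[of n]] in \<open>simp_all add: j_def\<close>)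
  qed
  have "Cauchy j"
  proof -
    have "incseq j" using jmono by (simp add: incseq_def)
    then obtain L where "j \<longlonglongrightarrow> L" using incseq_convergent[of j 0] j0 by blast
    then show ?thesis by (rule LIMSEQ_imp_Cauchy)
  qed
  then have cau: "\<exists>N. \<forall>k\<ge>N. \<forall>l\<ge>N. (\<integral>\<omega>. (xh k \<omega> - xh l \<omega>)\<^sup>2 \<partial>M) < e" if "e > 0" for e
  proof -
    have "0 < \<epsilon> / 4 * e" using that \<epsilon> by simp
    from metric_CauchyD[OF \<open>Cauchy j\<close> this] obtain N where N: "\<And>k l. k \<ge> N \<Longrightarrow> l \<ge> N \<Longrightarrow> \<bar>j k - j l\<bar> < \<epsilon> / 4 * e"
      unfolding dist_real_def by blast
    have *: "(\<integral>\<omega>. (xh k \<omega> - xh l \<omega>)\<^sup>2 \<partial>M) < e" if "k \<ge> N" "l \<ge> N" "k \<le> l" for k l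
    proof -
      have "\<epsilon> / 4 * (\<integral>\<omega>. (xh k \<omega> - xh l \<omega>)\<^sup>2 \<partial>M) < \<epsilon> / 4 * e"
        using dist[OF that(3)] N[OF that(2,1)] by linarith
      then show ?thesis using \<epsilon> by simp
    qed
    have "(\<integral>\<omega>. (xh k \<omega> - xh l \<omega>)\<^sup>2 \<partial>M) < e" if "k \<ge> N" "l \<ge> N" for k l
      using *[of k l] *[of l k] that by (cases "k \<le> l") (auto simp: power2_commute[of "xh l _"])
    then show ?thesis by blast
  qed
  obtain K where K: "0 \<le> K" "\<And>R x. x \<in> bnd R \<Longrightarrow> \<bar>\<phi> x\<bar> \<le> K * R" using lsc_convex_bound[OF \<phi>] by blast
  have Dint: "integrable M (\<lambda>\<omega>. (D (x \<omega>))\<^sup>2)" if "x \<in> bnd R" for x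
  proof (rule bnd_fun_integrable[OF that, of _ "R\<^sup>2"])
    fix s :: real assume "\<bar>s\<bar> \<le> R"
    then show "\<bar>(D s)\<^sup>2\<bar> \<le> R\<^sup>2" using norm_sq_le[of "D s" R] Dab[of s] by simp
  qed measurable
  have sint: "integrable M (\<lambda>\<omega>. (x \<omega>)\<^sup>2)" if "x \<in> bnd R" for x
    by (rule bnd_fun_integrable[OF that, of _ "R\<^sup>2"]) (use norm_sq_le in auto)
  have "\<exists>n. - \<delta>' < \<phi> (xh n)"
  proof (rule ccontr)
    assume "\<nexists>n. - \<delta>' < \<phi> (xh n)"
    then have neg: "\<phi> (xh n) \<le> - \<delta>'" for n by (auto simp: not_less)
    from bnd_L2_cauchy_limit[OF xh(1) cau] obtain s x where s: "strict_mono (s :: nat \<Rightarrow> nat)" and x: "x \<in> bnd R"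
      and lim: "AE \<omega> in M. (\<lambda>k. xh (s k) \<omega>) \<longlonglongrightarrow> x \<omega>" by blast
    note [measurable] = bndD(1)[OF x]
    have \<phi>x: "\<phi> x \<le> - \<delta>'" by (rule lsc_convex_lim[OF \<phi> xh(1) x lim neg tendsto_const])
    \<comment> \<open>The minimum is at most 0, the value at the zero function, and
      \<open>\<phi> \<ge> - K R\<close> on the ball. The penalty integral is therefore bounded and
      the mean squared distance is of order 1/n.\<close>
    have I: "(\<integral>\<omega>. (D (xh n \<omega>))\<^sup>2 \<partial>M) \<le> 2 * (K * R) * (1 / real (Suc n))" for n
    proof -
      have "\<phi> (xh n) + (\<integral>\<omega>. \<theta> n (xh n \<omega>) \<partial>M) \<le> 0" using j0[of n] by (simp add: j_def J_def)
      moreover have "(\<integral>\<omega>. \<theta> n (xh n \<omega>) \<partial>M) = real (Suc n) / 2 * (\<integral>\<omega>. (D (xh n \<omega>))\<^sup>2 \<partial>M) + \<epsilon> / 2 * (\<integral>\<omega>. (xh n \<omega>)\<^sup>2 \<partial>M)"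
        unfolding \<theta>_def using Dint[OF xh(1)[of n]] sint[OF xh(1)[of n]] by simp
      moreover have "0 \<le> \<epsilon> / 2 * (\<integral>\<omega>. (xh n \<omega>)\<^sup>2 \<partial>M)" using \<epsilon> by simp
      ultimately have "real (Suc n) / 2 * (\<integral>\<omega>. (D (xh n \<omega>))\<^sup>2 \<partial>M) \<le> K * R" using K(2)[OF xh(1)[of n]] by linarith
      then show ?thesis by (simp add: field_simps)
    qed
    have "(\<lambda>k. \<integral>\<omega>. (D (xh (s k) \<omega>))\<^sup>2 \<partial>M) \<longlonglongrightarrow> (\<integral>\<omega>. (D (x \<omega>))\<^sup>2 \<partial>M)"
    proof (rule integral_dominated_convergence[where w = "\<lambda>_. R\<^sup>2"])
      show "AE \<omega> in M. (\<lambda>k. (D (xh (s k) \<omega>))\<^sup>2) \<longlonglongrightarrow> (D (x \<omega>))\<^sup>2" using lim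
        by eventually_elim (intro tendsto_power continuous_on_tendsto_compose[OF Dc], auto)
      show "AE \<omega> in M. norm ((D (xh (s k) \<omega>))\<^sup>2) \<le> R\<^sup>2" for k
        using order_trans[OF Dab bndD(2)[OF xh(1)]] by (intro AE_I2 norm_sq_le) auto
    qed auto
    moreover have "(\<lambda>k. 2 * (K * R) * (1 / real (Suc (s k)))) \<longlonglongrightarrow> 2 * (K * R) * 0"
      using LIMSEQ_subseq_LIMSEQ[OF LIMSEQ_Suc[OF lim_1_over_n] s] by (intro tendsto_intros) (simp add: o_def)
    ultimately have "(\<integral>\<omega>. (D (x \<omega>))\<^sup>2 \<partial>M) \<le> 2 * (K * R) * 0"
      by (rule LIMSEQ_le) (use I in blast)
    then have "(\<integral>\<omega>. (D (x \<omega>))\<^sup>2 \<partial>M) = 0" by (intro antisym integral_nonneg_AE) simp_all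
    then have "AE \<omega> in M. (D (x \<omega>))\<^sup>2 = 0" using integral_nonneg_eq_0_iff_AE[OF Dint[OF x]] by simp
    then have Dx: "AE \<omega> in M. D (x \<omega>) = 0" by simp
    \<comment> \<open>\<open>x\<close> lies in the ball of radius \<open>r\<close> only up to a null
      set; \<open>u\<close> is its clipping, and semicontinuity along the constant sequence
      \<open>x\<close> carries the value over.\<close>
    define u where "u \<omega> = x \<omega> - D (x \<omega>)" for \<omega>
    have u: "u \<in> bnd r"
    proof (rule bndI)
      show "u \<in> borel_measurable M" unfolding u_def by measurable
    qed (use cl in \<open>simp add: u_def\<close>)
    have "\<phi> u \<le> - \<delta>'"
      by (rule lsc_convex_lim[OF \<phi>, of "\<lambda>_. x" R u "\<lambda>_. - \<delta>'"])
        (use x bnd_mono[OF u rR] \<phi>x Dx in \<open>auto simp: u_def elim!: eventually_mono\<close>)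
    then show False using low[OF u] \<delta> by simp
  qed
  then obtain n where n: "- \<delta>' < \<phi> (xh n)" by blast
  define c where "c = real (Suc n)"
  have c0: "0 < c" by (simp add: c_def)
  define y where "y = xh n"
  have y: "y \<in> bnd R" "\<And>u. u \<in> bnd R \<Longrightarrow> J n y \<le> J n u" using xh by (auto simp: y_def)
  note [measurable] = bndD(1)[OF y(1)]
  define v where "v \<omega> = - (c * D (y \<omega>) + \<epsilon> * y \<omega>)" for \<omega>
  have [measurable]: "v \<in> borel_measurable M" unfolding v_def by measurable
  have vab: "\<bar>v \<omega>\<bar> \<le> c * \<bar>D (y \<omega>)\<bar> + \<epsilon> * R" for \<omega>
  proof -
    have "\<bar>v \<omega>\<bar> \<le> c * \<bar>D (y \<omega>)\<bar> + \<epsilon> * \<bar>y \<omega>\<bar>"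
      using abs_triangle_ineq[of "c * D (y \<omega>)" "\<epsilon> * y \<omega>"] c0 \<epsilon> by (simp add: v_def abs_mult)
    also have "\<epsilon> * \<bar>y \<omega>\<bar> \<le> \<epsilon> * R" using \<epsilon> bndD(2)[OF y(1)] by (intro mult_left_mono) auto
    finally show ?thesis by simp
  qed
  have vb: "v \<in> bnd (c * R + \<epsilon> * R)"
  proof (rule bndI)
    fix \<omega>
    have "c * \<bar>D (y \<omega>)\<bar> \<le> c * R" using c0 order_trans[OF Dab bndD(2)[OF y(1)]] by (intro mult_left_mono) auto
    then show "\<bar>v \<omega>\<bar> \<le> c * R + \<epsilon> * R" using vab[of \<omega>] by linarith
  qed measurable
  have vi: "integrable M v" by (rule bnd_integrable[OF vb])
  \<comment> \<open>The minimiser of the penalised functional also minimises \<open>\<phi>\<close>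
    minus the pairing with \<open>v\<close>. One moves from \<open>y\<close> towards
    \<open>x\<close> by the fraction \<open>t\<close>, uses convexity of \<open>\<phi>\<close> and
    the quadratic upper bound of the penalty, divides by \<open>t\<close> and lets it tend to
    0.\<close>
  have opt: "\<phi> y - (\<integral>\<omega>. y \<omega> * v \<omega> \<partial>M) \<le> \<phi> x - (\<integral>\<omega>. x \<omega> * v \<omega> \<partial>M)" if x: "x \<in> bnd R" for x
  proof -
    note [measurable] = bndD(1)[OF x]
    define h where "h \<omega> = x \<omega> - y \<omega>" for \<omega>
    have hb: "h \<in> bnd (2 * R)"
    proof (rule bndI)
      show "\<bar>h \<omega>\<bar> \<le> 2 * R" for \<omega> using bndD(2)[OF x, of \<omega>] bndD(2)[OF y(1), of \<omega>] unfolding h_def by linarith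
    qed (unfold h_def, measurable)
    have hv: "integrable M (\<lambda>\<omega>. h \<omega> * v \<omega>)" by (rule bnd_mult_integrable[OF hb vi])
    have hh: "integrable M (\<lambda>\<omega>. (h \<omega>)\<^sup>2)"
      by (rule bnd_fun_integrable[OF hb, of _ "(2 * R)\<^sup>2"]) (measurable, use norm_sq_le[of _ "2 * R"] in simp)
    define C where "C = (c + \<epsilon>) / 2 * (\<integral>\<omega>. (h \<omega>)\<^sup>2 \<partial>M)"
    \<comment> \<open>The distance of \<open>s + h\<close> is estimated with the clipped value of
      \<open>s\<close> in place of its own nearest point; this gives
      \<open>(D s + h)\<^sup>2\<close> and so the tangent plus a quadratic remainder.\<close>
    have up: "\<theta> n (s + h) \<le> \<theta> n s + (c * D s + \<epsilon> * s) * h + (c + \<epsilon>) / 2 * h\<^sup>2" for s h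
    proof -
      have "(D (s + h))\<^sup>2 \<le> (s + h - (s - D s))\<^sup>2" by (rule Dle[OF cl])
      also have "\<dots> = (D s)\<^sup>2 + 2 * D s * h + h\<^sup>2" by (simp add: power2_eq_square algebra_simps)
      finally have "c / 2 * (D (s + h))\<^sup>2 \<le> c / 2 * ((D s)\<^sup>2 + 2 * D s * h + h\<^sup>2)" using c0 by (intro mult_left_mono) auto
      then have "\<theta> n (s + h) \<le> c / 2 * ((D s)\<^sup>2 + 2 * D s * h + h\<^sup>2) + \<epsilon> / 2 * (s + h)\<^sup>2"
        unfolding \<theta>_def c_def[symmetric] by (rule add_right_mono)
      also have "\<dots> = \<theta> n s + (c * D s + \<epsilon> * s) * h + (c + \<epsilon>) / 2 * h\<^sup>2"
        unfolding \<theta>_def c_def[symmetric] by (simp add: power2_eq_square field_simps)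
      finally show ?thesis .
    qed
    have "0 \<le> (\<phi> x - \<phi> y - (\<integral>\<omega>. h \<omega> * v \<omega> \<partial>M)) + t * C" if t: "0 < t" "t \<le> 1" for t
    proof -
      let ?z = "\<lambda>\<omega>. (1 - t) * y \<omega> + t * x \<omega>"
      have zb: "?z \<in> bnd R" using bnd_comb[OF y(1) x] t by simp
      have 1: "\<phi> ?z \<le> (1 - t) * \<phi> y + t * \<phi> x" using lsc_convex_comb[OF \<phi> y(1) x] t by simp
      have ze: "?z \<omega> = y \<omega> + t * h \<omega>" for \<omega> by (simp add: h_def algebra_simps)
      have zle: "\<theta> n (?z \<omega>) \<le> \<theta> n (y \<omega>) - t * (h \<omega> * v \<omega>) + t\<^sup>2 * ((c + \<epsilon>) / 2 * (h \<omega>)\<^sup>2)" for \<omega>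
        unfolding ze using up[of "y \<omega>" "t * h \<omega>"] by (simp add: v_def power2_eq_square algebra_simps)
      have "(\<integral>\<omega>. \<theta> n (?z \<omega>) \<partial>M) \<le> (\<integral>\<omega>. \<theta> n (y \<omega>) - t * (h \<omega> * v \<omega>) + t\<^sup>2 * ((c + \<epsilon>) / 2 * (h \<omega>)\<^sup>2) \<partial>M)"
        using inth[OF zb] inth[OF y(1)] hv hh zle by (intro integral_mono) auto
      also have "\<dots> = (\<integral>\<omega>. \<theta> n (y \<omega>) \<partial>M) - t * (\<integral>\<omega>. h \<omega> * v \<omega> \<partial>M) + t\<^sup>2 * C"
        using inth[OF y(1)] hv hh by (simp add: C_def)
      finally have "0 \<le> t * ((\<phi> x - \<phi> y - (\<integral>\<omega>. h \<omega> * v \<omega> \<partial>M)) + t * C)"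
        using 1 y(2)[OF zb] unfolding J_def by (simp add: power2_eq_square algebra_simps)
      then show ?thesis using t by (simp add: zero_le_mult_iff)
    qed
    then have "0 \<le> \<phi> x - \<phi> y - (\<integral>\<omega>. h \<omega> * v \<omega> \<partial>M)" by (rule nonneg_of_linear_perturbation)
    moreover have "(\<integral>\<omega>. h \<omega> * v \<omega> \<partial>M) = (\<integral>\<omega>. x \<omega> * v \<omega> \<partial>M) - (\<integral>\<omega>. y \<omega> * v \<omega> \<partial>M)"
      unfolding h_def left_diff_distrib
      by (rule Bochner_Integration.integral_diff[OF bnd_mult_integrable[OF x vi] bnd_mult_integrable[OF y(1) vi]])
    ultimately show ?thesis by simp
  qed
  have Dabi: "integrable M (\<lambda>\<omega>. \<bar>D (y \<omega>)\<bar>)"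
    by (rule bnd_fun_integrable[OF y(1), of _ R]) (measurable, use Dab order_trans in auto)
  \<comment> \<open>By \<open>clip_dist_mult\<close> the pairing of the minimiser with
    \<open>- v\<close> dominates \<open>c * r\<close> times the mean distance. Comparing the
    minimiser with the zero function in \<open>opt\<close> then bounds this quantity by
    \<open>\<delta>'\<close>.\<close>
  have yv: "c * r * (\<integral>\<omega>. \<bar>D (y \<omega>)\<bar> \<partial>M) \<le> - (\<integral>\<omega>. y \<omega> * v \<omega> \<partial>M)"
  proof -
    have "c * r * \<bar>D (y \<omega>)\<bar> \<le> - (y \<omega> * v \<omega>)" for \<omega>
    proof -
      have "- (y \<omega> * v \<omega>) = c * (D (y \<omega>) * y \<omega>) + \<epsilon> * (y \<omega>)\<^sup>2" by (simp add: v_def power2_eq_square algebra_simps)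
      also have "\<dots> = c * r * \<bar>D (y \<omega>)\<bar> + (c * (D (y \<omega>))\<^sup>2 + \<epsilon> * (y \<omega>)\<^sup>2)" unfolding Dm by (simp add: algebra_simps)
      finally show ?thesis using c0 \<epsilon> by simp
    qed
    then have "(\<integral>\<omega>. c * r * \<bar>D (y \<omega>)\<bar> \<partial>M) \<le> (\<integral>\<omega>. - (y \<omega> * v \<omega>) \<partial>M)"
      using Dabi bnd_mult_integrable[OF y(1) vi] by (intro integral_mono) auto
    then show ?thesis by simp
  qed
  have Dn: "0 \<le> (\<integral>\<omega>. \<bar>D (y \<omega>)\<bar> \<partial>M)" by simp
  have "0 \<le> c * r * (\<integral>\<omega>. \<bar>D (y \<omega>)\<bar> \<partial>M)" using c0 r Dn by (intro mult_nonneg_nonneg) auto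
  then have A: "- \<delta>' \<le> \<phi> x - (\<integral>\<omega>. x \<omega> * v \<omega> \<partial>M)" if "x \<in> bnd R" for x
    using opt[OF that] yv n unfolding y_def[symmetric] by linarith
  have "c * r * (\<integral>\<omega>. \<bar>D (y \<omega>)\<bar> \<partial>M) \<le> \<delta>'"
    using opt[OF z] yv n unfolding y_def[symmetric] by (simp add: lsc_convex_zero[OF \<phi>])
  then have B1: "c * (\<integral>\<omega>. \<bar>D (y \<omega>)\<bar> \<partial>M) \<le> \<delta>' / r" using r by (simp add: field_simps)
  have "(\<integral>\<omega>. \<bar>v \<omega>\<bar> \<partial>M) \<le> (\<integral>\<omega>. c * \<bar>D (y \<omega>)\<bar> + \<epsilon> * R \<partial>M)"
    using vi Dabi vab by (intro integral_mono) auto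
  also have "\<dots> = c * (\<integral>\<omega>. \<bar>D (y \<omega>)\<bar> \<partial>M) + \<epsilon> * R" using Dabi by (simp add: prob_space)
  also have "\<epsilon> * R = \<delta>' / r" using R0 by (simp add: \<epsilon>_def)
  finally have "(\<integral>\<omega>. \<bar>v \<omega>\<bar> \<partial>M) \<le> 2 * \<delta>' / r" using B1 by simp
  then show ?thesis using vb A by blast
qed

lemma AE_summable_of_summable_L1:
  fixes v :: "nat \<Rightarrow> 'a \<Rightarrow> real"
  assumes v: "\<And>k. integrable M (v k)" and s: "summable (\<lambda>k. \<integral>\<omega>. \<bar>v k \<omega>\<bar> \<partial>M)"
  shows "AE \<omega> in M. summable (\<lambda>k. \<bar>v k \<omega>\<bar>)"
proof -
  note [measurable] = borel_measurable_integrable[OF v]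
  have "(\<integral>\<^sup>+\<omega>. (\<Sum>k. ennreal \<bar>v k \<omega>\<bar>) \<partial>M) = (\<Sum>k. \<integral>\<^sup>+\<omega>. ennreal \<bar>v k \<omega>\<bar> \<partial>M)"
    by (rule nn_integral_suminf) measurable
  also have "\<dots> = (\<Sum>k. ennreal (\<integral>\<omega>. \<bar>v k \<omega>\<bar> \<partial>M))"
    using v by (intro suminf_cong nn_integral_eq_integral) auto
  also have "\<dots> < \<infinity>" using s by (simp add: ennreal_suminf_neq_top less_top[symmetric])
  finally have "AE \<omega> in M. (\<Sum>k. ennreal \<bar>v k \<omega>\<bar>) \<noteq> \<infinity>" by (intro nn_integral_PInf_AE) auto
  then show ?thesis by eventually_elim (rule summable_suminf_not_top, auto)
qed

theorem lsc_convex_subgradient: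
  assumes \<phi>: "lsc_convex \<phi>" and \<delta>: "0 < \<delta>"
  shows "\<exists>y. integrable M y \<and> (\<forall>R. \<forall>x\<in>bnd R. (\<integral>\<omega>. x \<omega> * y \<omega> \<partial>M) \<le> \<phi> x + \<delta>)"
proof -
  obtain K where K: "0 \<le> K" "\<And>R x. x \<in> bnd R \<Longrightarrow> \<bar>\<phi> x\<bar> \<le> K * R" using lsc_convex_bound[OF \<phi>] by blast
  define d where "d = \<delta> / 2"
  \<comment> \<open>With this radius \<open>K * r \<le> d\<close>, so the zero functional already
    works on the first ball with slack \<open>d\<close>.\<close>
  define r where "r = d / (K + 1)"
  have d: "0 < d" using \<delta> by (simp add: d_def)
  have r: "0 < r" using d K by (simp add: r_def)
  define \<psi> where "\<psi> y x = \<phi> x - (\<integral>\<omega>. x \<omega> * y \<omega> \<partial>M)" for x y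
  \<comment> \<open>The slack on the ball of radius \<open>r * 2 ^ k\<close> grows from
    \<open>d\<close> at the start towards \<open>2 * d = \<delta>\<close>. Since it stays below
    \<open>2 * d\<close>, the cost of passing to the next ball is at most \<open>4 * d / r\<close>
    times 2^-k, which is summable.\<close>
  define P where "P k y \<longleftrightarrow> integrable M y \<and> (\<forall>x\<in>bnd (r * 2 ^ k). - (d * (2 - (1/2) ^ k)) \<le> \<psi> y x)" for k :: nat and y
  define Q where "Q k y y' \<longleftrightarrow> (\<integral>\<omega>. \<bar>y' \<omega> - y \<omega>\<bar> \<partial>M) \<le> 4 * d / r * (1/2) ^ k" for k :: nat and y y' :: "'a \<Rightarrow> real"
  have P0: "P 0 (\<lambda>_. 0)"
  proof -
    have "- d \<le> \<phi> x" if x: "x \<in> bnd r" for x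
    proof -
      have "K * r \<le> (K + 1) * r" using r by simp
      also have "\<dots> = d" using K by (simp add: r_def)
      finally show ?thesis using K(2)[OF x] by linarith
    qed
    then show ?thesis by (simp add: P_def \<psi>_def)
  qed
  have "\<exists>f. (\<forall>k. P k (f k)) \<and> f 0 = (\<lambda>_. 0) \<and> (\<forall>k. Q k (f k) (f (Suc k)))"
  proof -
    \<comment> \<open>The start at the zero function is carried in the invariant, because the choice
      principle returns a sequence without naming its first member.\<close>
    define P' where "P' k y \<longleftrightarrow> P k y \<and> (k = 0 \<longrightarrow> y = (\<lambda>_. 0))" for k y
    have "\<exists>f. \<forall>k. P' k (f k) \<and> Q k (f k) (f (Suc k))"
    proof (rule dependent_nat_choice)
      show "\<exists>y. P' 0 y" using P0 by (auto simp: P'_def)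
      fix y k assume "P' k y"
      then have y: "integrable M y" and lo: "\<And>x. x \<in> bnd (r * 2 ^ k) \<Longrightarrow> - (d * (2 - (1/2) ^ k)) \<le> \<psi> y x"
        by (auto simp: P'_def P_def)
      have pw: "(1/2::real) ^ k \<le> 1" by (simp add: power_le_one)
      have "\<exists>v B. v \<in> bnd B \<and> (\<integral>\<omega>. \<bar>v \<omega>\<bar> \<partial>M) \<le> 2 * (d * (2 - (1/2) ^ Suc k)) / (r * 2 ^ k) \<and>
         (\<forall>x\<in>bnd (r * 2 ^ Suc k). - (d * (2 - (1/2) ^ Suc k)) \<le> \<psi> y x - (\<integral>\<omega>. x \<omega> * v \<omega> \<partial>M))"
      proof (rule lsc_convex_step)
        show "lsc_convex (\<psi> y)" unfolding \<psi>_def by (rule lsc_convex_sub[OF \<phi> y])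
        show "0 \<le> d * (2 - (1/2) ^ k)" using d pw by simp
        show "d * (2 - (1/2) ^ k) < d * (2 - (1/2) ^ Suc k)" using d by simp
      qed (use r lo in auto)
      then obtain v B where v: "v \<in> bnd B" "(\<integral>\<omega>. \<bar>v \<omega>\<bar> \<partial>M) \<le> 2 * (d * (2 - (1/2) ^ Suc k)) / (r * 2 ^ k)"
         "\<And>x. x\<in>bnd (r * 2 ^ Suc k) \<Longrightarrow> - (d * (2 - (1/2) ^ Suc k)) \<le> \<psi> y x - (\<integral>\<omega>. x \<omega> * v \<omega> \<partial>M)" by blast
      have vi: "integrable M v" by (rule bnd_integrable[OF v(1)])
      let ?y = "\<lambda>\<omega>. y \<omega> + v \<omega>"
      have "\<psi> ?y x = \<psi> y x - (\<integral>\<omega>. x \<omega> * v \<omega> \<partial>M)" if x: "x \<in> bnd R" for x R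
        using bnd_mult_integrable[OF x y] bnd_mult_integrable[OF x vi] by (simp add: \<psi>_def distrib_left)
      then have "P (Suc k) ?y" unfolding P_def using y vi v(3) by auto
      moreover have "Q k y ?y"
      proof -
        have "2 * (d * (2 - (1/2) ^ Suc k)) / (r * 2 ^ k) \<le> 2 * (d * 2) / (r * 2 ^ k)"
          using d r by (intro divide_right_mono mult_left_mono) auto
        also have "\<dots> = 4 * d / r * (1/2) ^ k" by (simp add: power_divide)
        finally show ?thesis using v(2) by (simp add: Q_def)
      qed
      ultimately show "\<exists>y'. P' (Suc k) y' \<and> Q k y y'" by (auto simp: P'_def)
    qed
    then obtain f where f: "\<And>k. P' k (f k)" "\<And>k. Q k (f k) (f (Suc k))" by blast
    have "f 0 = (\<lambda>_. 0)" using f(1)[of 0] by (simp add: P'_def)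
    then show ?thesis using f by (intro exI[of _ f]) (auto simp: P'_def)
  qed
  then obtain f where f: "\<And>k. P k (f k)" "f 0 = (\<lambda>_. 0)" "\<And>k. Q k (f k) (f (Suc k))" by blast
  define v where "v k \<omega> = f (Suc k) \<omega> - f k \<omega>" for k \<omega>
  have fi: "integrable M (f k)" for k using f(1) by (simp add: P_def)
  have vi: "integrable M (v k)" for k unfolding v_def using fi by simp
  have vs: "summable (\<lambda>k. \<integral>\<omega>. \<bar>v k \<omega>\<bar> \<partial>M)"
  proof (rule summable_comparison_test')
    show "summable (\<lambda>k. 4 * d / r * (1/2) ^ k)" by (intro summable_mult summable_geometric) simp
    show "norm (\<integral>\<omega>. \<bar>v k \<omega>\<bar> \<partial>M) \<le> 4 * d / r * (1/2) ^ k" for k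
      using f(3)[of k] by (simp add: Q_def v_def)
  qed
  have sumv: "(\<Sum>k<n. v k \<omega>) = f n \<omega>" for n \<omega>
    by (induction n) (auto simp: v_def f(2))
  have AEs: "AE \<omega> in M. summable (\<lambda>k. \<bar>v k \<omega>\<bar>)" by (rule AE_summable_of_summable_L1[OF vi vs])
  define y where "y \<omega> = (\<Sum>k. v k \<omega>)" for \<omega>
  have yi: "integrable M y" unfolding y_def
    by (rule integrable_suminf[OF vi]) (use AEs vs in simp_all)
  have "(\<integral>\<omega>. x \<omega> * y \<omega> \<partial>M) \<le> \<phi> x + \<delta>" if x: "x \<in> bnd R" for x R
  proof -
    have xv: "integrable M (\<lambda>\<omega>. x \<omega> * v k \<omega>)" for k by (rule bnd_mult_integrable[OF x vi])
    have le: "\<bar>x \<omega> * v k \<omega>\<bar> \<le> R * \<bar>v k \<omega>\<bar>" for k \<omega> using bndD(2)[OF x] by (simp add: abs_mult mult_right_mono)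
    have "AE \<omega> in M. summable (\<lambda>k. norm (x \<omega> * v k \<omega>))"
      using AEs by eventually_elim (rule summable_comparison_test'[OF summable_mult[of _ R]], use le in auto)
    moreover have "summable (\<lambda>k. \<integral>\<omega>. norm (x \<omega> * v k \<omega>) \<partial>M)"
    proof (rule summable_comparison_test'[OF summable_mult[OF vs, of R]])
      fix k
      have "(\<integral>\<omega>. \<bar>x \<omega> * v k \<omega>\<bar> \<partial>M) \<le> (\<integral>\<omega>. R * \<bar>v k \<omega>\<bar> \<partial>M)"
      proof (rule integral_mono)
        show "integrable M (\<lambda>\<omega>. \<bar>x \<omega> * v k \<omega>\<bar>)" using xv by (rule integrable_abs)
      qed (use vi le in auto)
      then show "norm (\<integral>\<omega>. norm (x \<omega> * v k \<omega>) \<partial>M) \<le> R * (\<integral>\<omega>. \<bar>v k \<omega>\<bar> \<partial>M)" by simp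
    qed
    ultimately have "(\<lambda>k. \<integral>\<omega>. x \<omega> * v k \<omega> \<partial>M) sums (\<integral>\<omega>. (\<Sum>k. x \<omega> * v k \<omega>) \<partial>M)"
      by (rule sums_integral[OF xv])
    moreover have "(\<integral>\<omega>. (\<Sum>k. x \<omega> * v k \<omega>) \<partial>M) = (\<integral>\<omega>. x \<omega> * y \<omega> \<partial>M)"
    proof (rule integral_cong_AE)
      note [measurable] = bndD(1)[OF x] borel_measurable_integrable[OF vi] borel_measurable_integrable[OF yi]
      show "(\<lambda>\<omega>. \<Sum>k. x \<omega> * v k \<omega>) \<in> borel_measurable M" "(\<lambda>\<omega>. x \<omega> * y \<omega>) \<in> borel_measurable M" by measurable
      show "AE \<omega> in M. (\<Sum>k. x \<omega> * v k \<omega>) = x \<omega> * y \<omega>" using AEs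
        by eventually_elim (simp add: y_def suminf_mult summable_rabs_cancel)
    qed
    moreover have "(\<Sum>k<n. \<integral>\<omega>. x \<omega> * v k \<omega> \<partial>M) = (\<integral>\<omega>. x \<omega> * f n \<omega> \<partial>M)" for n
      using xv by (subst Bochner_Integration.integral_sum[symmetric]) (auto simp: sum_distrib_left[symmetric] sumv)
    ultimately have lim: "(\<lambda>n. \<integral>\<omega>. x \<omega> * f n \<omega> \<partial>M) \<longlonglongrightarrow> (\<integral>\<omega>. x \<omega> * y \<omega> \<partial>M)" by (simp add: sums_def)
    \<comment> \<open>A fixed bounded \<open>x\<close> lies in all balls from stage \<open>N\<close>
      on, so its inequality holds for almost all members of the sequence and hence in the
      limit.\<close>
    obtain N where N: "R / r < 2 ^ N" using real_arch_pow[of 2 "R / r"] by auto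
    have "(\<integral>\<omega>. x \<omega> * f n \<omega> \<partial>M) \<le> \<phi> x + \<delta>" if "n \<ge> N" for n
    proof -
      have "R \<le> r * 2 ^ N" using N r by (simp add: field_simps)
      also have "\<dots> \<le> r * 2 ^ n" using r that by (intro mult_left_mono power_increasing) auto
      finally have "- (d * (2 - (1/2) ^ n)) \<le> \<psi> (f n) x" using f(1)[of n] bnd_mono[OF x] unfolding P_def by blast
      moreover have "d * (2 - (1/2) ^ n) \<le> d * 2" using d by (intro mult_left_mono) auto
      ultimately show ?thesis by (simp add: \<psi>_def d_def)
    qed
    then show ?thesis by (intro LIMSEQ_le_const2[OF lim]) auto
  qed
  then show ?thesis using yi by blast
qed

end

section \<open>The Fatou property and the representation\<close>

text \<open>Fatou's lemma is applied to nonnegative integrands; adding a constant \<open>k\<close>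
  moves the Fatou inequality of \<open>\<rho>\<close> into \<open>ennreal\<close>, where values
  below 0 are cut off harmlessly.\<close>

lemma ennreal_le_liminf_shift:
  fixes a :: "nat \<Rightarrow> real"
  assumes "ereal b \<le> liminf (\<lambda>n. ereal (a n))"
  shows "ennreal (b + k) \<le> liminf (\<lambda>n. ennreal (a n + k))"
  unfolding le_Liminf_iff
proof (intro allI impI)
  fix y assume y: "y < ennreal (b + k)"
  then obtain r where r: "0 \<le> r" "y = ennreal r" by (cases y) auto
  with y have "r < b + k" by (simp add: ennreal_less_iff)
  then have "ereal (r - k) < ereal b" by simp
  then have "eventually (\<lambda>n. ereal (r - k) < ereal (a n)) sequentially"
    using assms unfolding le_Liminf_iff by blast
  then show "eventually (\<lambda>n. y < ennreal (a n + k)) sequentially"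
    by eventually_elim (use r in \<open>simp add: ennreal_less_iff\<close>)
qed

context conditional_risk
begin

definition densities :: "('a \<Rightarrow> real) set" where
  "densities = {y \<in> L1F. (AE \<omega> in M. y \<omega> \<le> 0) \<and> (AE \<omega> in M. CE y \<omega> = -1)}"

definition rep_value :: "('a \<Rightarrow> real) \<Rightarrow> ('a \<Rightarrow> real) \<Rightarrow> 'a \<Rightarrow> ereal" where
  "rep_value x y \<omega> = ereal (CE (\<lambda>w. x w * y w) \<omega>) - fen y \<omega>"

text \<open>Written exactly as in the theorem, with \<open>cond_exp_ext\<close>, so that it can be
  unfolded at the end; \<open>densities\<close> and \<open>rep_value\<close> are the counterparts in
  terms of \<open>CE\<close>.\<close>

definition rep_sup :: "('a \<Rightarrow> real) \<Rightarrow> 'a \<Rightarrow> ereal" where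
  "rep_sup x = ess_sup_family M F
     {(\<lambda>w. cond_exp_ext M F (\<lambda>v. x v * y v) w - fen y w) | y.
        y \<in> L1F \<and> (AE w in M. y w \<le> 0) \<and> (AE w in M. cond_exp_ext M F y w = -1)}"

lemma densitiesD: 
  assumes "y \<in> densities"
  shows "y \<in> L1F" "AE \<omega> in M. y \<omega> \<le> 0" "AE \<omega> in M. CE y \<omega> = -1" "integrable M y"
  using assms L1F_nonpos_integrable by (auto simp: densities_def)

lemma rep_value_meas: "y \<in> L1F \<Longrightarrow> rep_value x y \<in> borel_measurable F"
proof -
  assume "y \<in> L1F"
  note [measurable] = fen_meas[OF this]
  show ?thesis unfolding rep_value_def by measurable
qed

lemma rep_value_le:
  assumes "x \<in> X" "y \<in> L1F"
  shows "AE \<omega> in M. rep_value x y \<omega> \<le> ereal (\<rho> x \<omega>)"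
  using fen_ge[OF assms(2,1)] fen_gt_MInf[OF assms(2)]
proof eventually_elim
  case (elim \<omega>)
  then show ?case by (cases "fen y \<omega>") (auto simp: rep_value_def)
qed

lemma cond_exp_ext_eq_m1_iff:
  assumes "y \<in> L1F"
  shows "(AE w in M. cond_exp_ext M F y w = -1) \<longleftrightarrow> (AE w in M. CE y w = -1)"
  by (rule eventually_subst, rule eventually_mono[OF cond_exp_ext_eq[OF assms]])
     (simp add: one_ereal_def)

lemma rep_sup_facts:
  assumes x: "x \<in> X"
  shows rep_sup_meas: "rep_sup x \<in> borel_measurable F"
    and rep_sup_ge: "\<And>y. y \<in> densities \<Longrightarrow> AE \<omega> in M. rep_value x y \<omega> \<le> rep_sup x \<omega>"
    and rep_sup_le: "\<And>g. g \<in> borel_measurable F \<Longrightarrow> (\<And>y. y \<in> densities \<Longrightarrow> AE \<omega> in M. rep_value x y \<omega> \<le> g \<omega>) \<Longrightarrow>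
       AE \<omega> in M. rep_sup x \<omega> \<le> g \<omega>"
    and rep_sup_select: "\<And>f. f \<in> borel_measurable F \<Longrightarrow> AE \<omega> in M. f \<omega> < rep_sup x \<omega> \<Longrightarrow>
       \<exists>a y. event_partition F a \<and> (\<forall>k. y k \<in> densities) \<and> (AE \<omega> in M. \<forall>k. \<omega> \<in> a k \<longrightarrow> f \<omega> < rep_value x (y k) \<omega>)"
proof -
  define H where "H y w = cond_exp_ext M F (\<lambda>v. x v * y v) w - fen y w" for y w
  have "{y. y \<in> L1F \<and> (AE w in M. y w \<le> 0) \<and> (AE w in M. cond_exp_ext M F y w = -1)} = densities"
    unfolding densities_def by (rule Collect_cong) (use cond_exp_ext_eq_m1_iff in blast)
  then have eq: "rep_sup x = ess_sup_family M F (H ` densities)"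
    unfolding rep_sup_def setcompr_eq_image H_def by simp
  have "(\<lambda>_. -1) \<in> densities" using CE_const[of "-1"] by (simp add: densities_def integrable_L1F)
  then have ne: "densities \<noteq> {}" by blast
  have m: "rep_value x y \<in> borel_measurable F" if "y \<in> densities" for y
    by (rule rep_value_meas[OF densitiesD(1)[OF that]])
  have e: "AE \<omega> in M. H y \<omega> = rep_value x y \<omega>" if "y \<in> densities" for y
    using cond_exp_ext_mult_eq[OF x densitiesD(1)[OF that]] by eventually_elim (simp add: H_def rep_value_def)
  note p = ne m e
  show "rep_sup x \<in> borel_measurable F" unfolding eq
    by (rule ess_sup_family_meas[where H = H and H' = "rep_value x" and S = densities, OF p])
  show "AE \<omega> in M. rep_value x y \<omega> \<le> rep_sup x \<omega>" if "y \<in> densities" for y unfolding eq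
    by (rule ess_sup_family_ge[where H = H and H' = "rep_value x" and S = densities, OF p that])
  show "AE \<omega> in M. rep_sup x \<omega> \<le> g \<omega>" if "g \<in> borel_measurable F" "\<And>y. y \<in> densities \<Longrightarrow> AE \<omega> in M. rep_value x y \<omega> \<le> g \<omega>" for g
    unfolding eq by (rule ess_sup_family_le[where H = H and H' = "rep_value x" and S = densities, OF p that])
  show "\<exists>a y. event_partition F a \<and> (\<forall>k. y k \<in> densities) \<and> (AE \<omega> in M. \<forall>k. \<omega> \<in> a k \<longrightarrow> f \<omega> < rep_value x (y k) \<omega>)"
    if "f \<in> borel_measurable F" "AE \<omega> in M. f \<omega> < rep_sup x \<omega>" for f
    using ess_sup_family_select[where H = H and H' = "rep_value x" and S = densities, OF p that(1) that(2)[unfolded eq]] .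
qed

text \<open>Each density gives a value that is continuous along dominated sequences, and a supremum
  of such functions is lower semicontinuous. Here the limes inferior of \<open>\<rho> (xs n)\<close>
  is F-measurable and bounds every value at \<open>x\<close>, so leastness of the essential supremum
  applies.\<close>

lemma representation_imp_fatou:
  assumes rep: "\<And>x. x \<in> X \<Longrightarrow> AE \<omega> in M. ereal (\<rho> x \<omega>) = rep_sup x \<omega>"
  shows "fatou_property M X \<rho>"
  unfolding fatou_property_def
proof (intro allI impI, elim conjE)
  fix xs x y
  assume xs: "\<forall>n. xs n \<in> X" and x: "x \<in> X" and y: "y \<in> X"
    and lim: "AE \<omega> in M. (\<lambda>n. xs n \<omega>) \<longlonglongrightarrow> x \<omega>" and bd: "\<forall>n. AE \<omega> in M. \<bar>xs n \<omega>\<bar> \<le> y \<omega>"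
  note [measurable] = X_meas[OF x] X_meas[OF y] X_meas[OF xs[rule_format]] rho_meas[OF xs[rule_format]]
  have "AE \<omega> in M. rep_sup x \<omega> \<le> liminf (\<lambda>n. ereal (\<rho> (xs n) \<omega>))"
  proof (rule rep_sup_le[OF x])
    show "(\<lambda>\<omega>. liminf (\<lambda>n. ereal (\<rho> (xs n) \<omega>))) \<in> borel_measurable F" by measurable
    fix z assume z: "z \<in> densities"
    note [measurable] = L1F_meas[OF densitiesD(1)[OF z]]
    have w: "(\<lambda>\<omega>. y \<omega> * (- 1 * z \<omega>)) \<in> L1F"
      by (rule L1F_multX[OF y L1F_multF[of "\<lambda>_. -1", OF _ densitiesD(1)[OF z]]]) simp
    have "AE \<omega> in M. (\<lambda>n. CE (\<lambda>w. xs n w * z w) \<omega>) \<longlonglongrightarrow> CE (\<lambda>w. x w * z w) \<omega>"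
    proof (rule CE_dominated_convergence[OF _ _ w])
      show "AE \<omega> in M. (\<lambda>n. xs n \<omega> * z \<omega>) \<longlonglongrightarrow> x \<omega> * z \<omega>"
        using lim by eventually_elim (intro tendsto_intros)
      show "AE \<omega> in M. \<bar>xs n \<omega> * z \<omega>\<bar> \<le> y \<omega> * (- 1 * z \<omega>)" for n
        using bd[rule_format, of n] densitiesD(2)[OF z]
        by eventually_elim (auto simp: abs_mult mult_right_mono_neg)
    qed measurable
    moreover have "AE \<omega> in M. \<forall>n. rep_value (xs n) z \<omega> \<le> ereal (\<rho> (xs n) \<omega>)"
      unfolding AE_all_countable using rep_value_le[OF xs[rule_format] densitiesD(1)[OF z]] by blast
    ultimately show "AE \<omega> in M. rep_value x z \<omega> \<le> liminf (\<lambda>n. ereal (\<rho> (xs n) \<omega>))"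
      using fen_gt_MInf[OF densitiesD(1)[OF z]]
    proof eventually_elim
      case (elim \<omega>)
      have "(\<lambda>n. rep_value (xs n) z \<omega>) \<longlonglongrightarrow> rep_value x z \<omega>"
        using elim(1,3) by (cases "fen z \<omega>") (auto simp: rep_value_def intro!: tendsto_intros)
      then have "rep_value x z \<omega> = liminf (\<lambda>n. rep_value (xs n) z \<omega>)" by (simp add: lim_imp_Liminf)
      also have "\<dots> \<le> liminf (\<lambda>n. ereal (\<rho> (xs n) \<omega>))" using elim(2) by (intro Liminf_mono always_eventually)
      finally show ?case .
    qed
  qed
  with rep[OF x] show "AE \<omega> in M. ereal (\<rho> x \<omega>) \<le> liminf (\<lambda>n. ereal (\<rho> (xs n) \<omega>))"
    by eventually_elim simp
qed

section \<open>The mean excess as a lower semicontinuous convex function\<close>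

text \<open>\<open>\<rho> x\<close> need not be integrable; subtracting it leaves a function bounded
  by any constant bound of \<open>|u|\<close>.\<close>

definition excess :: "('a \<Rightarrow> real) \<Rightarrow> ('a \<Rightarrow> real) \<Rightarrow> 'a \<Rightarrow> real" where
  "excess x u \<omega> = \<rho> (\<lambda>w. x w + u w) \<omega> - \<rho> x \<omega>"

lemma bnd_X: "u \<in> bnd R \<Longrightarrow> u \<in> X"
  by (rule X_bounded[of u R]) (auto simp: bnd_def)

lemma excess_bound:
  assumes x: "x \<in> X" and u: "u \<in> bnd R"
  shows "AE \<omega> in M. \<bar>excess x u \<omega>\<bar> \<le> R"
proof -
  have xu: "(\<lambda>w. x w + u w) \<in> X" by (rule X_add[OF x bnd_X[OF u]])
  have "AE \<omega> in M. \<rho> (\<lambda>w. x w + u w) \<omega> \<le> \<rho> x \<omega> + R"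
  proof (rule rho_lip[OF x xu, of "\<lambda>_. R"], simp, rule AE_I2)
    show "x \<omega> \<le> x \<omega> + u \<omega> + R" for \<omega> using bndD(2)[OF u, of \<omega>] by linarith
  qed
  moreover have "AE \<omega> in M. \<rho> x \<omega> \<le> \<rho> (\<lambda>w. x w + u w) \<omega> + R"
  proof (rule rho_lip[OF xu x, of "\<lambda>_. R"], simp, rule AE_I2)
    show "x \<omega> + u \<omega> \<le> x \<omega> + R" for \<omega> using bndD(2)[OF u, of \<omega>] by linarith
  qed
  ultimately show ?thesis by eventually_elim (auto simp: excess_def)
qed

lemma excess_meas: "x \<in> X \<Longrightarrow> u \<in> X \<Longrightarrow> excess x u \<in> borel_measurable M"
proof -
  assume a: "x \<in> X" "u \<in> X"
  note [measurable] = rho_meas_M[OF a(1)] rho_meas_M[OF X_add[OF a]]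
  show ?thesis unfolding excess_def by measurable
qed

lemma excess_integrable: "x \<in> X \<Longrightarrow> u \<in> bnd R \<Longrightarrow> integrable M (excess x u)"
  by (rule integrable_const_bound[of _ R]) (use excess_bound excess_meas bnd_X in auto)

text \<open>The Fatou property gives lower semicontinuity pointwise a.e., and Fatou's lemma, applied
  after adding the bound \<open>R\<close>, carries it to the expectation.\<close>

lemma excess_lsc_convex:
  assumes fatou: "fatou_property M X \<rho>" and x: "x \<in> X"
  shows "lsc_convex (\<lambda>u. \<integral>\<omega>. excess x u \<omega> \<partial>M)"
  unfolding lsc_convex_def
proof (intro conjI)
  show "(\<integral>\<omega>. excess x (\<lambda>_. 0) \<omega> \<partial>M) = 0" by (simp add: excess_def)
  show "\<exists>K\<ge>0. \<forall>R. \<forall>u\<in>bnd R. \<bar>\<integral>\<omega>. excess x u \<omega> \<partial>M\<bar> \<le> K * R"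
  proof (intro exI[of _ 1] conjI allI ballI)
    fix R u assume u: "u \<in> bnd R"
    have "\<bar>\<integral>\<omega>. excess x u \<omega> \<partial>M\<bar> \<le> (\<integral>\<omega>. \<bar>excess x u \<omega>\<bar> \<partial>M)" by (rule integral_abs_bound)
    also have "\<dots> \<le> (\<integral>\<omega>. R \<partial>M)"
      by (rule integral_mono_AE) (use excess_integrable[OF x u] excess_bound[OF x u] in auto)
    finally show "\<bar>\<integral>\<omega>. excess x u \<omega> \<partial>M\<bar> \<le> 1 * R" by (simp add: prob_space)
  qed simp
  show "\<forall>R. \<forall>u\<in>bnd R. \<forall>v\<in>bnd R. \<forall>t. 0 \<le> t \<longrightarrow> t \<le> 1 \<longrightarrow>
        (\<integral>\<omega>. excess x (\<lambda>\<omega>. (1 - t) * u \<omega> + t * v \<omega>) \<omega> \<partial>M) \<le> (1 - t) * (\<integral>\<omega>. excess x u \<omega> \<partial>M) + t * (\<integral>\<omega>. excess x v \<omega> \<partial>M)"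
  proof (intro allI ballI impI)
    fix R u v and t :: real assume a: "u \<in> bnd R" "v \<in> bnd R" "0 \<le> t" "t \<le> 1"
    have "(\<lambda>w. (1 - t) * (x w + u w) + (1 - (1 - t)) * (x w + v w)) = (\<lambda>w. x w + ((1 - t) * u w + t * v w))"
      by (auto simp: algebra_simps)
    with rho_convex[of "\<lambda>_. 1 - t", OF _ X_add[OF x bnd_X[OF a(1)]] X_add[OF x bnd_X[OF a(2)]]] a
    have "AE \<omega> in M. \<rho> (\<lambda>w. x w + ((1 - t) * u w + t * v w)) \<omega>
       \<le> (1 - t) * \<rho> (\<lambda>w. x w + u w) \<omega> + (1 - (1 - t)) * \<rho> (\<lambda>w. x w + v w) \<omega>" by simp
    then have "AE \<omega> in M. excess x (\<lambda>\<omega>. (1 - t) * u \<omega> + t * v \<omega>) \<omega> \<le> (1 - t) * excess x u \<omega> + t * excess x v \<omega>"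
      by eventually_elim (simp add: excess_def algebra_simps)
    then have "(\<integral>\<omega>. excess x (\<lambda>\<omega>. (1 - t) * u \<omega> + t * v \<omega>) \<omega> \<partial>M) \<le> (\<integral>\<omega>. (1 - t) * excess x u \<omega> + t * excess x v \<omega> \<partial>M)"
      using excess_integrable[OF x bnd_comb[OF a]] excess_integrable[OF x a(1)] excess_integrable[OF x a(2)]
      by (intro integral_mono_AE) auto
    also have "\<dots> = (1 - t) * (\<integral>\<omega>. excess x u \<omega> \<partial>M) + t * (\<integral>\<omega>. excess x v \<omega> \<partial>M)"
      using excess_integrable[OF x a(1)] excess_integrable[OF x a(2)] by simp
    finally show "(\<integral>\<omega>. excess x (\<lambda>\<omega>. (1 - t) * u \<omega> + t * v \<omega>) \<omega> \<partial>M) \<le> (1 - t) * (\<integral>\<omega>. excess x u \<omega> \<partial>M) + t * (\<integral>\<omega>. excess x v \<omega> \<partial>M)" .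
  qed
  show "\<forall>R us u c. (\<forall>n::nat. us n \<in> bnd R) \<longrightarrow> u \<in> bnd R \<longrightarrow> (AE \<omega> in M. (\<lambda>n. us n \<omega>) \<longlonglongrightarrow> u \<omega>) \<longrightarrow>
        (\<forall>n. (\<integral>\<omega>. excess x (us n) \<omega> \<partial>M) \<le> c) \<longrightarrow> (\<integral>\<omega>. excess x u \<omega> \<partial>M) \<le> c"
  proof (intro allI impI)
    fix R us u and c :: real
    assume a: "\<forall>n::nat. us n \<in> bnd R" "u \<in> bnd R" "AE \<omega> in M. (\<lambda>n. us n \<omega>) \<longlonglongrightarrow> u \<omega>"
      "\<forall>n. (\<integral>\<omega>. excess x (us n) \<omega> \<partial>M) \<le> c"
    note us = a(1)[rule_format]
    note [measurable] = excess_meas[OF x bnd_X[OF us]] excess_meas[OF x bnd_X[OF a(2)]] rho_meas_M[OF x] X_meas[OF x]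
    have y: "(\<lambda>\<omega>. \<bar>x \<omega>\<bar> + R) \<in> X" by (rule X_add[OF X_dom[OF _ x] zero_X]) auto
    have "AE \<omega> in M. ereal (\<rho> (\<lambda>w. x w + u w) \<omega>) \<le> liminf (\<lambda>n. ereal (\<rho> (\<lambda>w. x w + us n w) \<omega>))"
    proof (rule fatou[unfolded fatou_property_def, rule_format], intro conjI allI)
      show "AE \<omega> in M. (\<lambda>n. x \<omega> + us n \<omega>) \<longlonglongrightarrow> x \<omega> + u \<omega>" using a(3) by eventually_elim (intro tendsto_intros)
      show "AE \<omega> in M. \<bar>x \<omega> + us n \<omega>\<bar> \<le> \<bar>x \<omega>\<bar> + R" for n
      proof (rule AE_I2)
        show "\<bar>x \<omega> + us n \<omega>\<bar> \<le> \<bar>x \<omega>\<bar> + R" for \<omega> using bndD(2)[OF us[of n], of \<omega>] by linarith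
      qed
    qed (use x y us a(2) X_add bnd_X in blast)+
    then have "AE \<omega> in M. ennreal (excess x u \<omega> + R) \<le> liminf (\<lambda>n. ennreal (excess x (us n) \<omega> + R))"
    proof eventually_elim
      case (elim \<omega>)
      from ennreal_le_liminf_shift[OF this, of "R - \<rho> x \<omega>"] show ?case by (simp add: excess_def algebra_simps)
    qed
    then have "(\<integral>\<^sup>+\<omega>. ennreal (excess x u \<omega> + R) \<partial>M) \<le> (\<integral>\<^sup>+\<omega>. liminf (\<lambda>n. ennreal (excess x (us n) \<omega> + R)) \<partial>M)"
      by (rule nn_integral_mono_AE)
    also have "\<dots> \<le> liminf (\<lambda>n. \<integral>\<^sup>+\<omega>. ennreal (excess x (us n) \<omega> + R) \<partial>M)"
      by (rule nn_integral_liminf) measurable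
    also have "\<dots> \<le> liminf (\<lambda>n. ennreal (c + R))"
    proof (intro Liminf_mono always_eventually allI)
      fix n
      have "(\<integral>\<^sup>+\<omega>. ennreal (excess x (us n) \<omega> + R) \<partial>M) = ennreal (\<integral>\<omega>. excess x (us n) \<omega> + R \<partial>M)"
        using excess_integrable[OF x us] excess_bound[OF x us[of n]]
        by (intro nn_integral_eq_integral) (auto elim!: eventually_mono)
      also have "(\<integral>\<omega>. excess x (us n) \<omega> + R \<partial>M) = (\<integral>\<omega>. excess x (us n) \<omega> \<partial>M) + R"
        using excess_integrable[OF x us] by (simp add: prob_space)
      also have "ennreal \<dots> \<le> ennreal (c + R)" using a(4) by (intro ennreal_leI) auto
      finally show "(\<integral>\<^sup>+\<omega>. ennreal (excess x (us n) \<omega> + R) \<partial>M) \<le> ennreal (c + R)" .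
    qed
    also have "\<dots> = ennreal (c + R)" by (simp add: Liminf_const)
    also have "(\<integral>\<^sup>+\<omega>. ennreal (excess x u \<omega> + R) \<partial>M) = ennreal (\<integral>\<omega>. excess x u \<omega> + R \<partial>M)"
      using excess_integrable[OF x a(2)] excess_bound[OF x a(2)]
      by (intro nn_integral_eq_integral) (auto elim!: eventually_mono)
    also have "(\<integral>\<omega>. excess x u \<omega> + R \<partial>M) = (\<integral>\<omega>. excess x u \<omega> \<partial>M) + R"
      using excess_integrable[OF x a(2)] by (simp add: prob_space)
    finally have le: "ennreal ((\<integral>\<omega>. excess x u \<omega> \<partial>M) + R) \<le> ennreal (c + R)" .
    \<comment> \<open>Ensures \<open>0 \<le> c + R\<close>, without which the inequality in
      \<open>ennreal\<close> could not be read back as one between reals.\<close>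
    have "- R \<le> (\<integral>\<omega>. excess x (us 0) \<omega> \<partial>M)"
    proof -
      have "(\<integral>\<omega>. - R \<partial>M) \<le> (\<integral>\<omega>. excess x (us 0) \<omega> \<partial>M)"
        using excess_integrable[OF x us] excess_bound[OF x us[of 0]]
        by (intro integral_mono_AE) (auto elim!: eventually_mono)
      then show ?thesis by (simp add: prob_space)
    qed
    then have "0 \<le> c + R" using a(4)[rule_format, of 0] by linarith
    then show "(\<integral>\<omega>. excess x u \<omega> \<partial>M) \<le> c" using le by (simp add: ennreal_le_iff)
  qed
qed

text \<open>The slack \<open>\<delta>\<close> stays fixed while the tests are scaled by
  \<open>n\<close>: multiples of the indicator of \<open>{y > 0}\<close> force
  \<open>y \<le> 0\<close>, and multiples of both signs of indicators of events of F force
  \<open>CE y = -1\<close>.\<close>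

lemma subgradient_density:
  assumes x: "x \<in> X" and y: "integrable M y"
    and le: "\<And>R u. u \<in> bnd R \<Longrightarrow> (\<integral>\<omega>. u \<omega> * y \<omega> \<partial>M) \<le> (\<integral>\<omega>. excess x u \<omega> \<partial>M) + \<delta>"
  shows "y \<in> densities"
proof -
  note [measurable] = borel_measurable_integrable[OF y]
  have "AE \<omega> in M. y \<omega> \<le> 0"
  proof -
    let ?p = "\<lambda>\<omega>. max (y \<omega>) 0"
    have pi: "integrable M ?p" using y by simp
    have "real n * (\<integral>\<omega>. ?p \<omega> \<partial>M) \<le> \<delta>" for n
    proof -
      define u where "u \<omega> = (if 0 < y \<omega> \<and> \<omega> \<in> space M then real n else 0)" for \<omega>
      have "u = (\<lambda>\<omega>. real n * indicator {\<omega> \<in> space M. 0 < y \<omega>} \<omega>)" by (auto simp: u_def indicator_def)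
      then have [measurable]: "u \<in> borel_measurable M" by simp
      have u: "u \<in> bnd (real n)" by (rule bndI) (auto simp: u_def)
      have "AE \<omega> in M. excess x u \<omega> \<le> 0"
        using rho_mono[OF x X_add[OF x bnd_X[OF u]]] by (auto simp: excess_def u_def)
      then have "(\<integral>\<omega>. excess x u \<omega> \<partial>M) \<le> (\<integral>\<omega>. 0 \<partial>M)"
        using excess_integrable[OF x u] by (intro integral_mono_AE) auto
      moreover have "(\<integral>\<omega>. u \<omega> * y \<omega> \<partial>M) = (\<integral>\<omega>. real n * ?p \<omega> \<partial>M)"
        by (rule Bochner_Integration.integral_cong) (auto simp: u_def)
      ultimately show ?thesis using le[OF u] pi by simp
    qed
    then have "(\<integral>\<omega>. ?p \<omega> \<partial>M) \<le> 0" by (rule le_zero_of_multiples_bounded)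
    moreover have nn: "AE \<omega> in M. 0 \<le> ?p \<omega>" by simp
    ultimately have "(\<integral>\<omega>. ?p \<omega> \<partial>M) = 0" using integral_nonneg_AE[OF nn] by linarith
    then have "AE \<omega> in M. ?p \<omega> = 0" using integral_nonneg_eq_0_iff_AE[OF pi nn] by simp
    then show ?thesis by eventually_elim (simp add: max_def split: if_splits)
  qed
  moreover have "AE \<omega> in M. CE y \<omega> = -1"
  proof (rule real_cond_exp_charact[OF _ y])
    fix A assume AF[measurable]: "A \<in> sets F"
    note [measurable] = sets_F_M[OF AF]
    \<comment> \<open>\<open>q = 0\<close> for all \<open>A\<close> in F is the defining property of
      \<open>CE y = -1\<close>; tests with both signs bound all multiples of \<open>q\<close> and of
      \<open>- q\<close>.\<close>
    define q where "q = (\<integral>\<omega>\<in>A. y \<omega> \<partial>M) + prob A"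
    have *: "real n * (s * q) \<le> \<delta>" if s: "\<bar>s\<bar> \<le> 1" for n and s :: real
    proof -
      define c where "c = real n * s"
      define u where "u \<omega> = c * indicator A \<omega>" for \<omega>
      have uF: "u \<in> borel_measurable F" unfolding u_def by measurable
      have u: "u \<in> bnd \<bar>c\<bar>"
        by (rule bndI) (use meas_F_M[OF uF] in \<open>auto simp: u_def split: split_indicator\<close>)
      have "AE \<omega> in M. excess x u \<omega> = - u \<omega>" using rho_cash[OF uF x] by eventually_elim (simp add: excess_def)
      then have "(\<integral>\<omega>. excess x u \<omega> \<partial>M) = (\<integral>\<omega>. - u \<omega> \<partial>M)"
        using excess_meas[OF x bnd_X[OF u]] bndD(1)[OF u] by (intro integral_cong_AE) auto
      also have "\<dots> = - c * prob A" by (simp add: u_def)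
      finally have "(\<integral>\<omega>. u \<omega> * y \<omega> \<partial>M) \<le> - c * prob A + \<delta>" using le[OF u] by simp
      moreover have "(\<integral>\<omega>. u \<omega> * y \<omega> \<partial>M) = c * (\<integral>\<omega>\<in>A. y \<omega> \<partial>M)"
        by (simp add: u_def set_lebesgue_integral_def mult.assoc)
      ultimately show ?thesis by (simp add: q_def c_def algebra_simps)
    qed
    have "1 * q \<le> 0" by (rule le_zero_of_multiples_bounded[of _ \<delta>]) (use *[of 1] in simp)
    moreover have "- 1 * q \<le> 0" by (rule le_zero_of_multiples_bounded[of _ \<delta>]) (use *[of "-1"] in simp)
    ultimately have "q = 0" by simp
    then show "(\<integral>\<omega>\<in>A. y \<omega> \<partial>M) = (\<integral>\<omega>\<in>A. -1 \<partial>M)" by (simp add: q_def set_lebesgue_integral_def)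
  qed auto
  ultimately show ?thesis using integrable_L1F[OF y] by (simp add: densities_def)
qed

text \<open>Suppose the supremum stays below \<open>\<rho> x\<close> by more than \<open>c\<close>
  on an event \<open>G n\<close> of probability \<open>p\<close>. A subgradient with slack
  \<open>c * p / 2\<close> is a density, so its value is too small there as well and
  \<open>fen y\<close> exceeds \<open>CE (x y) - \<rho> x + c\<close> on \<open>G n\<close>. A test
  \<open>x'\<close> realising this becomes, after truncation, a bounded perturbation of
  \<open>x\<close> whose expected violation is larger than the slack.\<close>

lemma fatou_imp_representation:
  assumes fatou: "fatou_property M X \<rho>" and x: "x \<in> X"
  shows "AE \<omega> in M. ereal (\<rho> x \<omega>) = rep_sup x \<omega>"
proof -
  note xm[measurable] = rho_meas[OF x]
  note gm[measurable] = rep_sup_meas[OF x]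
  have up: "AE \<omega> in M. rep_sup x \<omega> \<le> ereal (\<rho> x \<omega>)"
    by (rule rep_sup_le[OF x]) (use rep_value_le[OF x] densitiesD(1) in auto)
  have "AE \<omega> in M. ereal (\<rho> x \<omega>) \<le> rep_sup x \<omega>"
  proof (rule ccontr)
    assume neg: "\<not> (AE \<omega> in M. ereal (\<rho> x \<omega>) \<le> rep_sup x \<omega>)"
    define G where "G n = {\<omega> \<in> space F. rep_sup x \<omega> + ereal (1 / real (Suc n)) < ereal (\<rho> x \<omega>)}" for n
    have GF[measurable]: "G n \<in> sets F" for n unfolding G_def by measurable
    have "\<exists>n. 0 < prob (G n)"
    proof (rule ccontr)
      assume "\<nexists>n. 0 < prob (G n)"
      then have "prob (G n) = 0" for n using measure_nonneg[of M "G n"] by (meson antisym_conv not_less)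
      then have "G n \<in> null_sets M" for n using sets_F_M[OF GF[of n]] by (simp add: null_sets_def emeasure_eq_measure)
      then have "AE \<omega> in M. \<forall>n. \<omega> \<notin> G n" unfolding AE_all_countable using AE_not_in by blast
      then have "AE \<omega> in M. ereal (\<rho> x \<omega>) \<le> rep_sup x \<omega>" using AE_space
      proof eventually_elim
        case (elim \<omega>)
        then have le: "ereal (\<rho> x \<omega>) \<le> rep_sup x \<omega> + ereal (1 / real (Suc n))" for n
          by (auto simp: G_def space_F not_less)
        show ?case
        proof (rule ereal_le_epsilon2)
          fix e :: real assume "0 < e"
          then obtain n where "1 / real (Suc n) < e" using nat_approx_posE by blast
          then have "rep_sup x \<omega> + ereal (1 / real (Suc n)) \<le> rep_sup x \<omega> + ereal e" by (intro add_left_mono) simp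
          then show "ereal (\<rho> x \<omega>) \<le> rep_sup x \<omega> + ereal e" using le[of n] by (rule order_trans[rotated])
        qed
      qed
      then show False using neg by simp
    qed
    then obtain n where n: "0 < prob (G n)" by blast
    define c where "c = 1 / real (Suc n)"
    have c: "0 < c" by (simp add: c_def)
    define p where "p = prob (G n)"
    obtain y where yi: "integrable M y" and yle: "\<And>R u. u \<in> bnd R \<Longrightarrow> (\<integral>\<omega>. u \<omega> * y \<omega> \<partial>M) \<le> (\<integral>\<omega>. excess x u \<omega> \<partial>M) + c * p / 2"
      using lsc_convex_subgradient[OF excess_lsc_convex[OF fatou x], of "c * p / 2"] c n by (auto simp: p_def)
    have yd: "y \<in> densities" by (rule subgradient_density[OF x yi yle])
    note yL = densitiesD(1)[OF yd]
    note [measurable] = L1F_meas[OF yL] X_meas[OF x]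
    \<comment> \<open>The value -\<infinity> off \<open>G n\<close> asks for nothing there, so that
      \<open>f < fen y\<close> holds a.e. and a single test \<open>x'\<close> can be
      selected.\<close>
    define f where "f \<omega> = (if \<omega> \<in> G n then ereal (CE (\<lambda>w. x w * y w) \<omega> - \<rho> x \<omega> + c) else -\<infinity>)" for \<omega>
    have fF: "f \<in> borel_measurable F" unfolding f_def by measurable
    have "AE \<omega> in M. f \<omega> < fen y \<omega>"
      using rep_sup_ge[OF x yd] fen_gt_MInf[OF yL]
    proof eventually_elim
      case (elim \<omega>)
      show ?case
      proof (cases "\<omega> \<in> G n")
        case True
        then have "rep_sup x \<omega> + ereal c < ereal (\<rho> x \<omega>)" by (simp add: G_def c_def)
        with elim True show ?thesis unfolding rep_value_def f_def
          by (cases "fen y \<omega>"; cases "rep_sup x \<omega>") auto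
      qed (use elim in \<open>simp add: f_def\<close>)
    qed
    from fen_select[OF yL fF this] obtain x' where x': "x' \<in> X"
      and l: "AE \<omega> in M. f \<omega> < ereal (CE (\<lambda>w. x' w * y w) \<omega> - \<rho> x' \<omega>)" by blast
    obtain \<eta> where \<eta>[measurable]: "\<eta> \<in> borel_measurable F" and \<eta>b: "AE \<omega> in M. \<bar>x' \<omega> - x \<omega>\<bar> \<le> \<eta> \<omega>"
      using X_bound[OF X_diff[OF x' x]] by blast
    \<comment> \<open>On \<open>E k\<close> the truncation at \<open>k\<close> leaves
      \<open>x' - x\<close> unchanged a.e. These events increase to \<open>G n\<close>, so for large
      \<open>k\<close> more than half of the probability \<open>p\<close> is retained.\<close>
    define E where "E k = {\<omega> \<in> space F. \<omega> \<in> G n \<and> \<eta> \<omega> \<le> real k}" for k :: nat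
    have EF[measurable]: "E k \<in> sets F" for k unfolding E_def by measurable
    have Un: "(\<Union>k. E k) = G n"
    proof
      show "G n \<subseteq> (\<Union>k. E k)"
      proof
        fix \<omega> assume w: "\<omega> \<in> G n"
        obtain k :: nat where "\<eta> \<omega> \<le> real k" using real_arch_simple by blast
        then show "\<omega> \<in> (\<Union>k. E k)" using w by (auto simp: E_def G_def)
      qed
    qed (auto simp: E_def)
    have "(\<lambda>k. prob (E k)) \<longlonglongrightarrow> prob (\<Union>k. E k)"
      by (rule finite_Lim_measure_incseq) (auto simp: incseq_def E_def sets_F_M[OF EF, unfolded E_def])
    then have "eventually (\<lambda>k. p / 2 < prob (E k)) sequentially"
      unfolding Un p_def using n by (intro order_tendstoD(1)) auto
    then obtain k where k: "p / 2 < prob (E k)" unfolding eventually_sequentially by blast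
    note [measurable] = X_meas[OF x'] sets_F_M[OF EF]
    define u where "u \<omega> = (if \<omega> \<in> E k then max (- real k) (min (real k) (x' \<omega> - x \<omega>)) else 0)" for \<omega>
    have u: "u \<in> bnd (real k)"
    proof (rule bndI)
      show "u \<in> borel_measurable M" unfolding u_def by measurable
    qed (auto simp: u_def)
    have uE: "AE \<omega> in M. \<omega> \<in> E k \<longrightarrow> x \<omega> + u \<omega> = x' \<omega>"
      using \<eta>b by eventually_elim (auto simp: u_def E_def max_def min_def)
    have xu: "(\<lambda>w. x w + u w) \<in> X" by (rule X_add[OF x bnd_X[OF u]])
    have uy: "integrable M (\<lambda>w. u w * y w)" by (rule bnd_mult_integrable[OF u yi])
    have r1: "AE \<omega> in M. \<omega> \<in> E k \<longrightarrow> \<rho> (\<lambda>w. x w + u w) \<omega> = \<rho> x' \<omega>" by (rule rho_local[OF xu x' EF uE])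
    have r2: "AE \<omega> in M. \<omega> \<in> space F - E k \<longrightarrow> \<rho> (\<lambda>w. x w + u w) \<omega> = \<rho> x \<omega>"
      by (rule rho_local[OF xu x]) (auto simp: u_def)
    have e1: "AE \<omega> in M. CE (\<lambda>w. (x w + u w) * y w) \<omega> = CE (\<lambda>w. x w * y w) \<omega> + CE (\<lambda>w. u w * y w) \<omega>"
      using CE_add[OF L1F_multX[OF x yL] L1F_multX[OF bnd_X[OF u] yL]] by (simp add: distrib_right)
    have e2: "AE \<omega> in M. \<omega> \<in> E k \<longrightarrow> CE (\<lambda>w. (x w + u w) * y w) \<omega> = CE (\<lambda>w. x' w * y w) \<omega>"
      by (rule CE_local[OF L1F_multX[OF xu yL] L1F_multX[OF x' yL] EF]) (use uE in auto)
    have e3: "AE \<omega> in M. \<omega> \<in> space F - E k \<longrightarrow> CE (\<lambda>w. (x w + u w) * y w) \<omega> = CE (\<lambda>w. x w * y w) \<omega>"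
      by (rule CE_local[OF L1F_multX[OF xu yL] L1F_multX[OF x yL]]) (auto simp: u_def)
    have key: "AE \<omega> in M. c * indicator (E k) \<omega> \<le> CE (\<lambda>w. u w * y w) \<omega> - excess x u \<omega>"
      using r1 r2 e1 e2 e3 l AE_space
    proof eventually_elim
      case (elim \<omega>)
      show ?case
      proof (cases "\<omega> \<in> E k")
        case True
        then have "\<omega> \<in> G n" by (simp add: E_def)
        then have "CE (\<lambda>w. x w * y w) \<omega> - \<rho> x \<omega> + c < CE (\<lambda>w. x' w * y w) \<omega> - \<rho> x' \<omega>"
          using elim(6) by (simp add: f_def)
        then show ?thesis using elim True by (simp add: excess_def)
      next
        case False
        then show ?thesis using elim by (simp add: excess_def space_F)
      qed
    qed
    have Ei: "integrable M (\<lambda>\<omega>. c * indicator (E k) \<omega>)"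
      by (rule integrable_const_bound[of _ c]) (use c in \<open>auto split: split_indicator\<close>)
    have "c * prob (E k) = (\<integral>\<omega>. c * indicator (E k) \<omega> \<partial>M)" by simp
    also have "\<dots> \<le> (\<integral>\<omega>. CE (\<lambda>w. u w * y w) \<omega> - excess x u \<omega> \<partial>M)"
      using key Ei real_cond_exp_int(1)[OF uy] excess_integrable[OF x u] by (intro integral_mono_AE) auto
    also have "\<dots> = (\<integral>\<omega>. u \<omega> * y \<omega> \<partial>M) - (\<integral>\<omega>. excess x u \<omega> \<partial>M)"
      using real_cond_exp_int[OF uy] excess_integrable[OF x u] by simp
    also have "\<dots> \<le> c * p / 2" using yle[OF u] by simp
    finally have "c * prob (E k) \<le> c * (p / 2)" by simp
    then show False using k c by simp
  qed
  with up show ?thesis by eventually_elim auto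
qed

end

section \<open>Attainment and the Lebesgue property\<close>

lemma tendsto_of_liminf_ge:
  fixes a b :: "nat \<Rightarrow> real"
  assumes "ereal l \<le> liminf (\<lambda>n. ereal (a n))" "\<And>n. a n \<le> b n" "b \<longlonglongrightarrow> l"
  shows "a \<longlonglongrightarrow> l"
proof (rule order_tendstoI)
  fix r assume "r < l"
  then have "eventually (\<lambda>n. ereal r < ereal (a n)) sequentially"
    using assms(1) unfolding le_Liminf_iff by (elim allE[of _ "ereal r"]) simp
  then show "eventually (\<lambda>n. r < a n) sequentially" by simp
next
  fix r assume "l < r"
  then have "eventually (\<lambda>n. b n < r) sequentially" using assms(3) by (intro order_tendstoD)
  then show "eventually (\<lambda>n. a n < r) sequentially"
    by eventually_elim (use assms(2) in \<open>auto intro: le_less_trans\<close>)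
qed

text \<open>The weights sum to 1, so the series is an infinite convex combination.\<close>

lemma half_weighted_sum_bounds:
  fixes g :: "nat \<Rightarrow> real"
  assumes "\<And>j. l \<le> g j" "\<And>j. g j \<le> u"
  shows "summable (\<lambda>j. (1/2) ^ Suc j * g j)" "l \<le> (\<Sum>j. (1/2) ^ Suc j * g j)" "(\<Sum>j. (1/2) ^ Suc j * g j) \<le> u"
proof -
  have s: "(\<lambda>j. (1/2) ^ Suc j * c) sums c" for c :: real
    using sums_mult2[OF power_half_series, of c] by simp
  have b: "\<bar>g j\<bar> \<le> max \<bar>l\<bar> \<bar>u\<bar>" for j using assms[of j] by linarith
  show sm: "summable (\<lambda>j. (1/2) ^ Suc j * g j)"
  proof (rule summable_comparison_test'[OF sums_summable[OF s[of "max \<bar>l\<bar> \<bar>u\<bar>"]]])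
    show "norm ((1/2) ^ Suc j * g j) \<le> (1/2) ^ Suc j * max \<bar>l\<bar> \<bar>u\<bar>" for j
      using b[of j] by (simp only: real_norm_def abs_mult) (intro mult_mono, auto)
  qed
  have "(\<Sum>j. (1/2) ^ Suc j * l) \<le> (\<Sum>j. (1/2) ^ Suc j * g j)"
    using assms by (intro suminf_le sm sums_summable[OF s] mult_left_mono) auto
  then show "l \<le> (\<Sum>j. (1/2) ^ Suc j * g j)" using sums_unique[OF s[of l]] by simp
  have "(\<Sum>j. (1/2) ^ Suc j * g j) \<le> (\<Sum>j. (1/2) ^ Suc j * u)"
    using assms by (intro suminf_le sm sums_summable[OF s] mult_left_mono) auto
  then show "(\<Sum>j. (1/2) ^ Suc j * g j) \<le> u" using sums_unique[OF s[of u]] by simp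
qed

context conditional_risk
begin

text \<open>A \<open>y\<close> attaining the representation at \<open>x\<close> has finite
  \<open>fen y\<close>, because \<open>\<rho> x\<close> is finite; hence it is a density. The
  Fenchel inequality at \<open>u\<close> minus the equality at \<open>x\<close> is the subgradient
  inequality.\<close>

lemma attains_subgradient:
  assumes att: "attains_representation M F X \<rho>" and x: "x \<in> X"
  shows "\<exists>y\<in>densities. \<forall>u\<in>X. AE \<omega> in M. \<rho> x \<omega> + CE (\<lambda>w. (u w - x w) * y w) \<omega> \<le> \<rho> u \<omega>"
proof -
  obtain y where y: "y \<in> L1F" and e: "AE \<omega> in M. ereal (\<rho> x \<omega>) = cond_exp_ext M F (\<lambda>w. x w * y w) \<omega> - fen y \<omega>"
    using att x unfolding attains_representation_def koethe_dual_Linf_cond[OF prob_space_axioms subalg] by blast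
  have e': "AE \<omega> in M. ereal (\<rho> x \<omega>) = ereal (CE (\<lambda>w. x w * y w) \<omega>) - fen y \<omega>"
    using e cond_exp_ext_mult_eq[OF x y] by eventually_elim simp
  then have fin: "AE \<omega> in M. fen y \<omega> < \<infinity>"
  proof eventually_elim
    case (elim \<omega>)
    then show ?case by (cases "fen y \<omega>") auto
  qed
  have "y \<in> densities" using y fen_finite_imp[OF y fin] by (simp add: densities_def)
  moreover have "AE \<omega> in M. \<rho> x \<omega> + CE (\<lambda>w. (u w - x w) * y w) \<omega> \<le> \<rho> u \<omega>" if u: "u \<in> X" for u
  proof -
    have "AE \<omega> in M. CE (\<lambda>w. (u w - x w) * y w) \<omega> = CE (\<lambda>w. u w * y w) \<omega> - CE (\<lambda>w. x w * y w) \<omega>"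
      using CE_diff[OF L1F_multX[OF u y] L1F_multX[OF x y]] by (simp add: left_diff_distrib)
    with fen_ge[OF y u] e' fin show ?thesis
    proof eventually_elim
      case (elim \<omega>)
      then show ?case by (cases "fen y \<omega>") auto
    qed
  qed
  ultimately show ?thesis by blast
qed

section \<open>Simons' inequality for the mean risk\<close>

text \<open>The expectation is taken of the excess over \<open>\<rho> 0\<close>, for integrability.
  A scalar functional has near-minimisers among the members of a sequence; the conditional statement
  is recovered afterwards by monotonicity.\<close>

definition mean_risk :: "('a \<Rightarrow> real) \<Rightarrow> real" where
  "mean_risk z = (\<integral>\<omega>. excess (\<lambda>_. 0) z \<omega> \<partial>M)"

lemma mean_risk_mono:
  assumes "z \<in> bnd R" "z' \<in> bnd R" "AE \<omega> in M. z \<omega> \<le> z' \<omega>"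
  shows "mean_risk z' \<le> mean_risk z"
  unfolding mean_risk_def
  using rho_mono[OF bnd_X[OF assms(1)] bnd_X[OF assms(2)] assms(3)]
    excess_integrable[OF zero_X assms(1)] excess_integrable[OF zero_X assms(2)]
  by (intro integral_mono_AE) (auto simp: excess_def)

lemma mean_risk_bound:
  assumes "z \<in> bnd R"
  shows "\<bar>mean_risk z\<bar> \<le> R"
proof -
  have "\<bar>mean_risk z\<bar> \<le> (\<integral>\<omega>. \<bar>excess (\<lambda>_. 0) z \<omega>\<bar> \<partial>M)" unfolding mean_risk_def by (rule integral_abs_bound)
  also have "\<dots> \<le> (\<integral>\<omega>. R \<partial>M)"
    by (rule integral_mono_AE) (use excess_integrable[OF zero_X assms] excess_bound[OF zero_X assms] in auto)
  finally show ?thesis by (simp add: prob_space)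
qed

lemma mean_risk_lip:
  assumes z: "z \<in> bnd R" "z' \<in> bnd R" and d: "\<And>\<omega>. \<bar>z \<omega> - z' \<omega>\<bar> \<le> d"
  shows "mean_risk z \<le> mean_risk z' + d"
proof -
  have "AE \<omega> in M. \<rho> z \<omega> \<le> \<rho> z' \<omega> + d"
  proof (rule rho_lip[OF bnd_X[OF z(2)] bnd_X[OF z(1)], of "\<lambda>_. d"], simp, rule AE_I2)
    show "z' \<omega> \<le> z \<omega> + d" for \<omega> using d[of \<omega>] by linarith
  qed
  then have "AE \<omega> in M. excess (\<lambda>_. 0) z \<omega> \<le> excess (\<lambda>_. 0) z' \<omega> + d"
    by eventually_elim (simp add: excess_def)
  then have "mean_risk z \<le> (\<integral>\<omega>. excess (\<lambda>_. 0) z' \<omega> + d \<partial>M)" unfolding mean_risk_def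
    using excess_integrable[OF zero_X z(1)] excess_integrable[OF zero_X z(2)]
    by (intro integral_mono_AE) auto
  also have "\<dots> = mean_risk z' + d"
    using excess_integrable[OF zero_X z(2)] by (simp add: mean_risk_def prob_space)
  finally show ?thesis .
qed

lemma mean_risk_subgradient:
  assumes att: "attains_representation M F X \<rho>" and x: "x \<in> bnd R"
  shows "\<exists>y. integrable M y \<and> (\<forall>R. \<forall>u\<in>bnd R. mean_risk x + (\<integral>\<omega>. (u \<omega> - x \<omega>) * y \<omega> \<partial>M) \<le> mean_risk u)"
proof -
  obtain y where y: "y \<in> densities" and le: "\<And>u. u \<in> X \<Longrightarrow> AE \<omega> in M. \<rho> x \<omega> + CE (\<lambda>w. (u w - x w) * y w) \<omega> \<le> \<rho> u \<omega>"
    using attains_subgradient[OF att bnd_X[OF x]] by blast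
  have yi: "integrable M y" by (rule densitiesD(4)[OF y])
  have "mean_risk x + (\<integral>\<omega>. (u \<omega> - x \<omega>) * y \<omega> \<partial>M) \<le> mean_risk u" if u: "u \<in> bnd R" for u R
  proof -
    have i: "integrable M (\<lambda>w. (u w - x w) * y w)"
      using bnd_mult_integrable[OF u yi] bnd_mult_integrable[OF x yi] by (simp add: left_diff_distrib)
    have "mean_risk x + (\<integral>\<omega>. (u \<omega> - x \<omega>) * y \<omega> \<partial>M) = (\<integral>\<omega>. excess (\<lambda>_. 0) x \<omega> + CE (\<lambda>w. (u w - x w) * y w) \<omega> \<partial>M)"
      using excess_integrable[OF zero_X x] real_cond_exp_int[OF i] by (simp add: mean_risk_def)
    also have "\<dots> \<le> mean_risk u" unfolding mean_risk_def
    proof (rule integral_mono_AE)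
      show "AE \<omega> in M. excess (\<lambda>_. 0) x \<omega> + CE (\<lambda>w. (u w - x w) * y w) \<omega> \<le> excess (\<lambda>_. 0) u \<omega>"
        using le[OF bnd_X[OF u]] by eventually_elim (simp add: excess_def)
    qed (use excess_integrable[OF zero_X x] excess_integrable[OF zero_X u] real_cond_exp_int(1)[OF i] in auto)
    finally show ?thesis .
  qed
  with yi show ?thesis by blast
qed

text \<open>Simons' argument: choose \<open>z\<^sub>n\<close> from the sequence so that the mean risk of \<open>W\<^sub>n + 2\<^sup>-\<^sup>n z\<^sub>n\<close> is almost minimal, where
  \<open>W\<^sub>n = \<Sum>\<^sub>k\<^sub><\<^sub>n 2\<^sup>-\<^sup>k\<^sup>-\<^sup>1 z\<^sub>k\<close>. A subgradient at the full sum \<open>t\<^sub>0\<close> is then almost increasing along the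
  tails \<open>t\<^sub>n\<close>, which converge to \<open>x\<close>.\<close>

lemma mean_risk_continuous_from_below:
  assumes att: "attains_representation M F X \<rho>"
    and xs: "\<And>n. xs n \<in> bnd R" and x: "x \<in> bnd R" and inc: "\<And>n \<omega>. xs n \<omega> \<le> xs (Suc n) \<omega>"
    and lim: "AE \<omega> in M. (\<lambda>n. xs n \<omega>) \<longlonglongrightarrow> x \<omega>" and c: "\<And>n. c \<le> mean_risk (xs n)"
  shows "c \<le> mean_risk x"
proof (rule field_le_epsilon)
  fix e :: real assume e: "0 < e"
  \<comment> \<open>After division by the weight 2^-n the subgradient estimate leaves the error
    \<open>2 * (e / 6)\<close> times 2^-n, which sums to \<open>4 * (e / 6)\<close>. The comparison
    at the start loses another \<open>2 * (e / 6)\<close>, and the total is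
    \<open>e\<close>.\<close>
  define \<epsilon> where "\<epsilon> n = e / 6 * (1/4) ^ n" for n :: nat
  have \<epsilon>0: "0 < \<epsilon> n" for n using e by (simp add: \<epsilon>_def)
  have R0: "0 \<le> R" by (rule bnd_nonneg[OF x])
  have mono: "xs n \<omega> \<le> xs m \<omega>" if "n \<le> m" for n m \<omega>
    using lift_Suc_mono_le[of "\<lambda>n. xs n \<omega>"] inc that by blast
  note [measurable] = bndD(1)[OF xs] bndD(1)[OF x]
  define tail where "tail n W z = (\<lambda>\<omega>. W \<omega> + (1/2) ^ n * z \<omega> :: real)" for n :: nat and W z :: "'a \<Rightarrow> real"
  \<comment> \<open>The state is the partial sum together with the index of the next term. That term
    is nearly optimal when it receives the whole remaining weight 2^-n; the bound on the partial sum
    leaves exactly this much room in the ball.\<close>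
  define P where "P n S \<longleftrightarrow> fst S \<in> bnd (R * (1 - (1/2) ^ n)) \<and>
     (\<forall>k. mean_risk (tail n (fst S) (xs (snd S))) \<le> mean_risk (tail n (fst S) (xs k)) + \<epsilon> n) \<and> (n = 0 \<longrightarrow> fst S = (\<lambda>_. 0))"
    for n and S :: "('a \<Rightarrow> real) \<times> nat"
  define Q where "Q n S S' \<longleftrightarrow> fst S' = tail (Suc n) (fst S) (xs (snd S)) \<and> snd S < snd S'"
    for n and S S' :: "('a \<Rightarrow> real) \<times> nat"
  have tailb: "tail n W z \<in> bnd R" if "W \<in> bnd (R * (1 - (1/2) ^ n))" "z \<in> bnd R" for n W z
  proof (rule bndI)
    note [measurable] = bndD(1)[OF that(1)] bndD(1)[OF that(2)]
    show "tail n W z \<in> borel_measurable M" unfolding tail_def by measurable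
    fix \<omega>
    have "\<bar>tail n W z \<omega>\<bar> \<le> \<bar>W \<omega>\<bar> + (1/2) ^ n * \<bar>z \<omega>\<bar>"
      unfolding tail_def using abs_triangle_ineq[of "W \<omega>" "(1/2) ^ n * z \<omega>"] by (simp add: abs_mult)
    also have "\<dots> \<le> R * (1 - (1/2) ^ n) + (1/2) ^ n * R"
      using bndD(2)[OF that(1)] bndD(2)[OF that(2)] by (intro add_mono mult_left_mono) auto
    finally show "\<bar>tail n W z \<omega>\<bar> \<le> R" by (simp add: algebra_simps)
  qed
  \<comment> \<open>The mean risk decreases along the increasing sequence, so a near-minimiser
    remains one when its index is raised. The chosen indices can therefore increase strictly, which
    makes the chosen terms a subsequence with limit \<open>x\<close>.\<close>
  have pick: "\<exists>m>m0. \<forall>k. mean_risk (tail n W (xs m)) \<le> mean_risk (tail n W (xs k)) + \<epsilon> n"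
    if W: "W \<in> bnd (R * (1 - (1/2) ^ n))" for n W m0
  proof -
    let ?g = "\<lambda>k. mean_risk (tail n W (xs k))"
    have bdd: "bdd_below (range ?g)"
      by (rule bdd_belowI2[of _ "- R"]) (use mean_risk_bound[OF tailb[OF W xs]] in \<open>auto simp: abs_le_iff\<close>, smt (verit))
    have "(INF k. ?g k) < (INF k. ?g k) + \<epsilon> n" using \<epsilon>0 by simp
    then obtain m1 where m1: "?g m1 < (INF k. ?g k) + \<epsilon> n" using cINF_less_iff[OF _ bdd, of "(INF k. ?g k) + \<epsilon> n"] by auto
    define m where "m = max m1 (Suc m0)"
    have "?g m \<le> ?g m1"
      by (rule mean_risk_mono[OF tailb[OF W xs] tailb[OF W xs]], rule AE_I2)
        (auto simp: tail_def m_def intro!: mult_left_mono mono)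
    moreover have "(INF k. ?g k) \<le> ?g k" for k by (rule cINF_lower[OF bdd]) simp
    ultimately have "?g m \<le> ?g k + \<epsilon> n" for k using m1 by (smt (verit))
    moreover have "m > m0" by (simp add: m_def)
    ultimately show ?thesis by blast
  qed
  have "\<exists>S. \<forall>n. P n (S n) \<and> Q n (S n) (S (Suc n))"
  proof (rule dependent_nat_choice)
    have z: "(\<lambda>_. 0) \<in> bnd (R * (1 - (1/2) ^ 0))" by (auto simp: bnd_def)
    from pick[OF z, of 0] obtain m where "\<forall>k. mean_risk (tail 0 (\<lambda>_. 0) (xs m)) \<le> mean_risk (tail 0 (\<lambda>_. 0) (xs k)) + \<epsilon> 0" by blast
    with z show "\<exists>S. P 0 S" by (intro exI[of _ "(\<lambda>_. 0, m)"]) (simp add: P_def)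
    fix S n assume "P n S"
    then have W: "fst S \<in> bnd (R * (1 - (1/2) ^ n))" by (simp add: P_def)
    let ?W = "tail (Suc n) (fst S) (xs (snd S))"
    have W': "?W \<in> bnd (R * (1 - (1/2) ^ Suc n))"
    proof (rule bndI)
      note [measurable] = bndD(1)[OF W]
      show "?W \<in> borel_measurable M" unfolding tail_def by measurable
      fix \<omega>
      have "\<bar>?W \<omega>\<bar> \<le> \<bar>fst S \<omega>\<bar> + (1/2) ^ Suc n * \<bar>xs (snd S) \<omega>\<bar>"
        unfolding tail_def using abs_triangle_ineq[of "fst S \<omega>" "(1/2) ^ Suc n * xs (snd S) \<omega>"] by (simp add: abs_mult)
      also have "\<dots> \<le> R * (1 - (1/2) ^ n) + (1/2) ^ Suc n * R"
        using bndD(2)[OF W] bndD(2)[OF xs] by (intro add_mono mult_left_mono) auto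
      finally show "\<bar>?W \<omega>\<bar> \<le> R * (1 - (1/2) ^ Suc n)" by (simp add: algebra_simps)
    qed
    from pick[OF W', of "snd S"] obtain m where "m > snd S" "\<forall>k. mean_risk (tail (Suc n) ?W (xs m)) \<le> mean_risk (tail (Suc n) ?W (xs k)) + \<epsilon> (Suc n)" by blast
    with W' show "\<exists>S'. P (Suc n) S' \<and> Q n S S'" by (intro exI[of _ "(?W, m)"]) (simp add: P_def Q_def)
  qed
  then obtain S where S: "\<And>n. P n (S n)" "\<And>n. Q n (S n) (S (Suc n))" by blast
  define W where "W n = fst (S n)" for n
  define m where "m n = snd (S n)" for n
  define z where "z n = xs (m n)" for n
  have Wb: "W n \<in> bnd (R * (1 - (1/2) ^ n))" for n using S(1)[of n] by (simp add: P_def W_def)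
  have near: "mean_risk (tail n (W n) (z n)) \<le> mean_risk (tail n (W n) (xs k)) + \<epsilon> n" for n k
    using S(1)[of n] by (simp add: P_def W_def z_def m_def)
  have W0: "W 0 = (\<lambda>_. 0)" using S(1)[of 0] by (simp add: P_def W_def)
  have WS: "W (Suc n) = tail (Suc n) (W n) (z n)" for n using S(2)[of n] by (simp add: Q_def W_def z_def m_def)
  have mS: "strict_mono m" unfolding strict_mono_Suc_iff using S(2) by (simp add: Q_def m_def)
  have zb: "z n \<in> bnd R" for n unfolding z_def by (rule xs)
  have zmono: "z n \<omega> \<le> z k \<omega>" if "n \<le> k" for n k \<omega>
    unfolding z_def using mS that by (intro mono) (simp add: strict_mono_less_eq)
  define t where "t n \<omega> = (\<Sum>j. (1/2) ^ Suc j * z (n + j) \<omega>)" for n \<omega>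
  have zle: "- R \<le> z n \<omega>" "z n \<omega> \<le> R" for n \<omega> using bndD(2)[OF zb, of n \<omega>] by (auto simp: abs_le_iff)
  note sumb = half_weighted_sum_bounds[where l = "- R" and u = R]
  have tm[measurable]: "t n \<in> borel_measurable M" for n
  proof -
    have [measurable]: "z n \<in> borel_measurable M" for n by (rule bndD(1)[OF zb])
    show ?thesis unfolding t_def by measurable
  qed
  have tb: "t n \<in> bnd R" for n
  proof (rule bndI[OF tm])
    show "\<bar>t n \<omega>\<bar> \<le> R" for \<omega> unfolding t_def abs_le_iff
      using sumb(2,3)[where g = "\<lambda>j. z (n + j) \<omega>"] zle by (simp add: minus_le_iff)
  qed
  have tz: "z n \<omega> \<le> t n \<omega>" for n \<omega>
    unfolding t_def by (rule half_weighted_sum_bounds(2)[where u = R]) (use zmono zle in auto)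
  have trec: "t n \<omega> = z n \<omega> / 2 + t (Suc n) \<omega> / 2" for n \<omega>
  proof -
    have s: "summable (\<lambda>j. (1/2) ^ Suc j * z (n + j) \<omega>)" for n using sumb(1)[where g = "\<lambda>j. z (n + j) \<omega>"] zle by blast
    have "t n \<omega> = (\<Sum>j. (1/2) ^ Suc (Suc j) * z (n + Suc j) \<omega>) + (1/2) ^ Suc 0 * z (n + 0) \<omega>"
      unfolding t_def by (rule suminf_split_head[OF s[of n], THEN eq_diff_eq[THEN iffD1], symmetric])
    also have "(\<Sum>j. (1/2) ^ Suc (Suc j) * z (n + Suc j) \<omega>) = (\<Sum>j. 1/2 * ((1/2) ^ Suc j * z (Suc n + j) \<omega>))"
      by (simp add: mult.assoc)
    also have "\<dots> = 1/2 * t (Suc n) \<omega>" unfolding t_def by (rule suminf_mult[OF s[of "Suc n"]])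
    finally show ?thesis by simp
  qed
  have Wt: "W n \<omega> + (1/2) ^ n * t n \<omega> = t 0 \<omega>" for n \<omega>
  proof (induction n)
    case 0 show ?case by (simp add: W0)
  next
    case (Suc n)
    have "W (Suc n) \<omega> + (1/2) ^ Suc n * t (Suc n) \<omega> = W n \<omega> + (1/2) ^ n * (z n \<omega> / 2 + t (Suc n) \<omega> / 2)"
      unfolding WS tail_def by (simp add: algebra_simps)
    then show ?case using Suc trec[of n \<omega>] by simp
  qed
  define h where "h n = tail n (W n) (z n)" for n
  have hb: "h n \<in> bnd R" for n unfolding h_def by (rule tailb[OF Wb zb])
  \<comment> \<open>In \<open>h (Suc n)\<close> the remaining weight is split evenly between
    \<open>z n\<close> and \<open>z (Suc n)\<close>. Putting all of it on \<open>z (Suc n)\<close>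
    gives a larger function, hence a smaller mean risk, and near-optimality of \<open>z n\<close>
    compares it with \<open>h n\<close>.\<close>
  have hstep: "mean_risk (h n) \<le> mean_risk (h (Suc n)) + \<epsilon> n" for n
  proof -
    have "mean_risk (tail n (W n) (z (Suc n))) \<le> mean_risk (h (Suc n))"
    proof (rule mean_risk_mono[OF hb tailb[OF Wb zb]], rule AE_I2)
      fix \<omega>
      have "(1/2::real) ^ Suc n * z n \<omega> \<le> (1/2) ^ Suc n * z (Suc n) \<omega>" by (intro mult_left_mono zmono) auto
      moreover have "(1/2) ^ n * z (Suc n) \<omega> = (1/2) ^ Suc n * z (Suc n) \<omega> + (1/2) ^ Suc n * z (Suc n) \<omega>" by simp
      ultimately show "h (Suc n) \<omega> \<le> tail n (W n) (z (Suc n)) \<omega>"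
        unfolding h_def WS tail_def by linarith
    qed
    then show ?thesis using near[of n "m (Suc n)"] unfolding h_def z_def by simp
  qed
  \<comment> \<open>The term \<open>- 2 * \<epsilon> (n + j)\<close> closes the induction: it
    changes by three halves of \<open>\<epsilon> (n + j)\<close>, since the tolerances shrink by the
    factor 4, and this pays for the loss of one step.\<close>
  have hsteps: "mean_risk (h n) \<le> mean_risk (h (n + j)) + 2 * \<epsilon> n - 2 * \<epsilon> (n + j)" for n j
  proof (induction j)
    case (Suc j)
    have "\<epsilon> (Suc (n + j)) = \<epsilon> (n + j) / 4" by (simp add: \<epsilon>_def)
    then show ?case using Suc hstep[of "n + j"] \<epsilon>0[of "n + j"] by simp
  qed simp
  have w: "t 0 \<in> bnd R" by (rule tb)
  have hw: "h n \<omega> - t 0 \<omega> = (1/2) ^ n * (z n \<omega> - t n \<omega>)" for n \<omega>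
    using Wt[of n \<omega>] by (simp add: h_def tail_def algebra_simps)
  have hlim: "mean_risk (h n) \<le> mean_risk (t 0) + 2 * \<epsilon> n" for n
  proof (rule LIMSEQ_le_const)
    show "(\<lambda>j. mean_risk (t 0) + (1/2) ^ (n + j) * (2 * R) + 2 * \<epsilon> n) \<longlonglongrightarrow> mean_risk (t 0) + 2 * \<epsilon> n"
      using LIMSEQ_ignore_initial_segment[OF LIMSEQ_power_zero[of "1/2 :: real"], of n]
      by (auto intro!: tendsto_eq_intros simp: add.commute)
    have "mean_risk (h n) \<le> mean_risk (t 0) + (1/2) ^ (n + j) * (2 * R) + 2 * \<epsilon> n" for j
    proof -
      have "mean_risk (h (n + j)) \<le> mean_risk (t 0) + (1/2) ^ (n + j) * (2 * R)"
      proof (rule mean_risk_lip[OF hb w])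
        fix \<omega>
        have "\<bar>z (n + j) \<omega> - t (n + j) \<omega>\<bar> \<le> 2 * R" using bndD(2)[OF zb, of "n + j" \<omega>] bndD(2)[OF tb, of "n + j" \<omega>] by linarith
        then show "\<bar>h (n + j) \<omega> - t 0 \<omega>\<bar> \<le> (1/2) ^ (n + j) * (2 * R)"
          unfolding hw abs_mult by (simp add: mult_left_mono)
      qed
      then show ?thesis using hsteps[of n j] \<epsilon>0[of "n + j"] by linarith
    qed
    then show "\<exists>N. \<forall>j\<ge>N. mean_risk (h n) \<le> mean_risk (t 0) + (1/2) ^ (n + j) * (2 * R) + 2 * \<epsilon> n" by blast
  qed
  obtain y where yi: "integrable M y" and sub: "\<And>R u. u \<in> bnd R \<Longrightarrow> mean_risk (t 0) + (\<integral>\<omega>. (u \<omega> - t 0 \<omega>) * y \<omega> \<partial>M) \<le> mean_risk u"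
    using mean_risk_subgradient[OF att w] by blast
  have ti: "integrable M (\<lambda>\<omega>. t n \<omega> * y \<omega>)" for n by (rule bnd_mult_integrable[OF tb yi])
  have zi: "integrable M (\<lambda>\<omega>. z n \<omega> * y \<omega>)" for n by (rule bnd_mult_integrable[OF zb yi])
  define q where "q n = (\<integral>\<omega>. t n \<omega> * y \<omega> \<partial>M)" for n
  \<comment> \<open>The subgradient at the full sum is tested with \<open>h n\<close>, whose
    difference from it is 2^-n times \<open>z n - t n\<close>. The recursion
    \<open>t (Suc n) = t n - (z n - t n)\<close> turns the bound on that pairing into a lower bound
    for the next tail.\<close>
  have qstep: "q n - 2 * (e / 6) * (1/2) ^ n \<le> q (Suc n)" for n
  proof -
    have "(\<integral>\<omega>. (h n \<omega> - t 0 \<omega>) * y \<omega> \<partial>M) \<le> 2 * \<epsilon> n" using sub[OF hb[of n]] hlim[of n] by simp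
    then have "(1/2) ^ n * (\<integral>\<omega>. (z n \<omega> - t n \<omega>) * y \<omega> \<partial>M) \<le> 2 * \<epsilon> n" unfolding hw mult.assoc by simp
    then have "2 ^ n * ((1/2) ^ n * (\<integral>\<omega>. (z n \<omega> - t n \<omega>) * y \<omega> \<partial>M)) \<le> 2 ^ n * (2 * \<epsilon> n)" by (rule mult_left_mono) simp
    moreover have "2 ^ n * ((1/2) ^ n * a) = a" for a :: real by (simp add: mult.assoc[symmetric] power_mult_distrib[symmetric])
    moreover have "2 ^ n * (2 * \<epsilon> n) = 2 * (e / 6) * (1/2) ^ n"
    proof -
      have "(2::real) ^ n * (1/4) ^ n = (1/2) ^ n" by (simp add: power_mult_distrib[symmetric])
      then show ?thesis by (simp add: \<epsilon>_def algebra_simps)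
    qed
    ultimately have d: "(\<integral>\<omega>. (z n \<omega> - t n \<omega>) * y \<omega> \<partial>M) \<le> 2 * (e / 6) * (1/2) ^ n" by simp
    have "t (Suc n) \<omega> * y \<omega> = t n \<omega> * y \<omega> - (z n \<omega> - t n \<omega>) * y \<omega>" for \<omega>
    proof -
      have "t (Suc n) \<omega> = t n \<omega> - (z n \<omega> - t n \<omega>)" using trec[of n \<omega>] by simp
      then show ?thesis by (simp add: left_diff_distrib)
    qed
    moreover have "integrable M (\<lambda>\<omega>. (z n \<omega> - t n \<omega>) * y \<omega>)"
      unfolding left_diff_distrib using ti[of n] zi[of n] by (rule Bochner_Integration.integrable_diff[rotated])
    ultimately have "q (Suc n) = q n - (\<integral>\<omega>. (z n \<omega> - t n \<omega>) * y \<omega> \<partial>M)"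
      unfolding q_def by (simp only: Bochner_Integration.integral_diff[OF ti])
    then show ?thesis using d by simp
  qed
  have qge: "q 0 - 4 * (e / 6) * (1 - (1/2) ^ n) \<le> q n" for n
  proof (induction n)
    case (Suc n)
    have "4 * (e / 6) * (1 - (1/2) ^ Suc n) = 4 * (e / 6) * (1 - (1/2) ^ n) + 2 * (e / 6) * (1/2) ^ n"
      by (simp add: field_simps)
    then show ?case using Suc qstep[of n] by linarith
  qed simp
  have "q \<longlonglongrightarrow> (\<integral>\<omega>. x \<omega> * y \<omega> \<partial>M)" unfolding q_def
  proof (rule integral_dominated_convergence)
    note [measurable] = borel_measurable_integrable[OF yi]
    show "(\<lambda>\<omega>. x \<omega> * y \<omega>) \<in> borel_measurable M" "\<And>n. (\<lambda>\<omega>. t n \<omega> * y \<omega>) \<in> borel_measurable M" by measurable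
    show "integrable M (\<lambda>\<omega>. R * \<bar>y \<omega>\<bar>)" using yi by simp
    show "AE \<omega> in M. norm (t n \<omega> * y \<omega>) \<le> R * \<bar>y \<omega>\<bar>" for n
      using bndD(2)[OF tb] by (auto simp: abs_mult intro!: mult_right_mono)
    show "AE \<omega> in M. (\<lambda>n. t n \<omega> * y \<omega>) \<longlonglongrightarrow> x \<omega> * y \<omega>" using lim
    proof eventually_elim
      case (elim \<omega>)
      have le: "xs n \<omega> \<le> x \<omega>" for n by (rule incseq_le[OF _ elim]) (simp add: incseq_def mono)
      have zl: "(\<lambda>n. z n \<omega>) \<longlonglongrightarrow> x \<omega>" using LIMSEQ_subseq_LIMSEQ[OF elim mS] by (simp add: o_def z_def)
      have "t n \<omega> \<le> x \<omega>" for n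
        unfolding t_def by (rule half_weighted_sum_bounds(3)[where l = "- R"]) (use zle le in \<open>auto simp: z_def\<close>)
      then have "(\<lambda>n. t n \<omega>) \<longlonglongrightarrow> x \<omega>"
        by (intro tendsto_sandwich[OF _ _ zl tendsto_const] always_eventually) (use tz in auto)
      then show ?case by (intro tendsto_intros)
    qed
  qed
  then have "q 0 - 4 * (e / 6) \<le> (\<integral>\<omega>. x \<omega> * y \<omega> \<partial>M)"
  proof (rule LIMSEQ_le_const)
    have "4 * (e / 6) * (1 - (1/2) ^ n) \<le> 4 * (e / 6)" for n using e by (simp add: mult_left_le)
    then show "\<exists>N. \<forall>n\<ge>N. q 0 - 4 * (e / 6) \<le> q n" using qge by (smt (verit))
  qed
  moreover have "(\<integral>\<omega>. (x \<omega> - t 0 \<omega>) * y \<omega> \<partial>M) = (\<integral>\<omega>. x \<omega> * y \<omega> \<partial>M) - q 0"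
    unfolding q_def left_diff_distrib by (rule Bochner_Integration.integral_diff[OF bnd_mult_integrable[OF x yi] ti])
  ultimately have "mean_risk (t 0) - 4 * (e / 6) \<le> mean_risk x" using sub[OF x] by linarith
  moreover have "h 0 = xs (m 0)" by (simp add: h_def tail_def W0 z_def fun_eq_iff)
  then have "c \<le> mean_risk (t 0) + 2 * (e / 6)" using hlim[of 0] c[of "m 0"] by (simp add: \<epsilon>_def)
  ultimately show "c \<le> mean_risk x + e" by linarith
qed

section \<open>From the mean risk to the Lebesgue property\<close>

text \<open>The differences \<open>\<rho> (xs n) - \<rho> x\<close> are nonnegative and decreasing
  in \<open>n\<close>, and their expectations tend to 0 by the scalar result. Their pointwise limit
  is nonnegative with integral 0.\<close>

lemma risk_continuous_from_below:
  assumes att: "attains_representation M F X \<rho>"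
    and xs: "\<And>n. xs n \<in> bnd R" and x: "x \<in> bnd R" and inc: "\<And>n \<omega>. xs n \<omega> \<le> xs (Suc n) \<omega>"
    and lim: "AE \<omega> in M. (\<lambda>n. xs n \<omega>) \<longlonglongrightarrow> x \<omega>"
  shows "AE \<omega> in M. (\<lambda>n. \<rho> (xs n) \<omega>) \<longlonglongrightarrow> \<rho> x \<omega>"
proof -
  have le: "AE \<omega> in M. \<forall>n. xs n \<omega> \<le> x \<omega>" using lim
    by eventually_elim (auto intro!: incseq_le incseq_SucI inc)
  define D where "D n \<omega> = excess (\<lambda>_. 0) (xs n) \<omega> - excess (\<lambda>_. 0) x \<omega>" for n \<omega>
  note ei = excess_integrable[OF zero_X xs] excess_integrable[OF zero_X x]
  have Di: "integrable M (D n)" for n unfolding D_def using ei by simp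
  have Deq: "D n \<omega> = \<rho> (xs n) \<omega> - \<rho> x \<omega>" for n \<omega> by (simp add: D_def excess_def)
  have Dint: "(\<integral>\<omega>. D n \<omega> \<partial>M) = mean_risk (xs n) - mean_risk x" for n
    unfolding D_def mean_risk_def using ei by simp
  have D0: "AE \<omega> in M. \<forall>n. 0 \<le> D n \<omega>" unfolding AE_all_countable Deq
  proof
    fix n
    have "AE \<omega> in M. xs n \<omega> \<le> x \<omega>" using le by eventually_elim blast
    from rho_mono[OF bnd_X[OF xs] bnd_X[OF x] this] show "AE \<omega> in M. 0 \<le> \<rho> (xs n) \<omega> - \<rho> x \<omega>"
      by eventually_elim simp
  qed
  have Ddec: "AE \<omega> in M. \<forall>n. D (Suc n) \<omega> \<le> D n \<omega>" unfolding AE_all_countable Deq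
  proof
    fix n
    from rho_mono[OF bnd_X[OF xs] bnd_X[OF xs] AE_I2[OF inc]]
    show "AE \<omega> in M. \<rho> (xs (Suc n)) \<omega> - \<rho> x \<omega> \<le> \<rho> (xs n) \<omega> - \<rho> x \<omega>"
      by eventually_elim simp
  qed
  have mle: "mean_risk x \<le> mean_risk (xs n)" for n
    by (rule mean_risk_mono[OF xs x]) (use le in \<open>auto elim!: eventually_mono\<close>)
  have mdec: "decseq (\<lambda>n. mean_risk (xs n))"
    by (intro decseq_SucI mean_risk_mono[OF xs xs]) (use inc in auto)
  obtain L where L: "(\<lambda>n. mean_risk (xs n)) \<longlonglongrightarrow> L" "\<And>n. L \<le> mean_risk (xs n)"
    using decseq_convergent[OF mdec, of "mean_risk x"] mle by blast
  have "L \<le> mean_risk x" by (rule mean_risk_continuous_from_below[OF att xs x inc lim L(2)])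
  moreover have "mean_risk x \<le> L" by (rule LIMSEQ_le_const[OF L(1)]) (use mle in blast)
  ultimately have D_int0: "(\<lambda>n. \<integral>\<omega>. D n \<omega> \<partial>M) \<longlonglongrightarrow> 0"
    unfolding Dint using tendsto_diff[OF L(1) tendsto_const[of "mean_risk x"]] by simp
  note [measurable] = borel_measurable_integrable[OF Di]
  define d where "d \<omega> = lim (\<lambda>n. D n \<omega>)" for \<omega>
  have [measurable]: "d \<in> borel_measurable M" unfolding d_def by measurable
  have dl: "AE \<omega> in M. (\<lambda>n. D n \<omega>) \<longlonglongrightarrow> d \<omega> \<and> 0 \<le> d \<omega> \<and> (\<forall>n. d \<omega> \<le> D n \<omega>)" using D0 Ddec
  proof eventually_elim
    case (elim \<omega>)
    have "decseq (\<lambda>n. D n \<omega>)" using elim by (intro decseq_SucI) auto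
    then obtain l where l: "(\<lambda>n. D n \<omega>) \<longlonglongrightarrow> l" "\<And>n. l \<le> D n \<omega>" using decseq_convergent[of "\<lambda>n. D n \<omega>" 0] elim by auto
    have "d \<omega> = l" unfolding d_def using l(1) by (rule limI)
    moreover have "0 \<le> l" by (rule LIMSEQ_le_const[OF l(1)]) (use elim in blast)
    ultimately show ?case using l by simp
  qed
  have di: "integrable M d" by (rule Bochner_Integration.integrable_bound[OF Di[of 0]]) (measurable, use dl in \<open>eventually_elim, auto intro: order_trans[OF _ abs_ge_self]\<close>)
  have "(\<integral>\<omega>. d \<omega> \<partial>M) \<le> 0"
  proof (rule LIMSEQ_le_const[OF D_int0])
    have "(\<integral>\<omega>. d \<omega> \<partial>M) \<le> (\<integral>\<omega>. D n \<omega> \<partial>M)" for n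
      by (rule integral_mono_AE[OF di Di]) (use dl in \<open>eventually_elim, simp\<close>)
    then show "\<exists>N. \<forall>n\<ge>N. (\<integral>\<omega>. d \<omega> \<partial>M) \<le> (\<integral>\<omega>. D n \<omega> \<partial>M)" by blast
  qed
  moreover have dn: "AE \<omega> in M. 0 \<le> d \<omega>" using dl by eventually_elim simp
  ultimately have "(\<integral>\<omega>. d \<omega> \<partial>M) = 0" using integral_nonneg_AE[OF dn] by linarith
  then have "AE \<omega> in M. d \<omega> = 0" using integral_nonneg_eq_0_iff_AE[OF di dn] by simp
  with dl show ?thesis
  proof eventually_elim
    case (elim \<omega>)
    then have "(\<lambda>n. D n \<omega> + \<rho> x \<omega>) \<longlonglongrightarrow> 0 + \<rho> x \<omega>" by (intro tendsto_intros) auto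
    then show ?case by (simp add: Deq)
  qed
qed

text \<open>The tail infima increase to \<open>x\<close> and lie below the sequence, so
  \<open>\<rho> (xs n)\<close> is bounded above by values tending to \<open>\<rho> x\<close>. The
  Fatou property supplies the lower bound.\<close>

lemma attains_imp_lebesgue_bounded:
  assumes fatou: "fatou_property M X \<rho>" and att: "attains_representation M F X \<rho>"
    and xs: "\<And>n. xs n \<in> bnd R" and x: "x \<in> bnd R"
    and lim: "AE \<omega> in M. (\<lambda>n. xs n \<omega>) \<longlonglongrightarrow> x \<omega>"
  shows "AE \<omega> in M. (\<lambda>n. \<rho> (xs n) \<omega>) \<longlonglongrightarrow> \<rho> x \<omega>"
proof -
  note [measurable] = bndD(1)[OF xs] bndD(1)[OF x]
  define u where "u n \<omega> = (INF j\<in>{n..}. xs j \<omega>)" for n \<omega>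
  have bl: "- R \<le> xs j \<omega>" "xs j \<omega> \<le> R" for j \<omega> using bndD(2)[OF xs, of j \<omega>] by (auto simp: abs_le_iff)
  have bdd: "bdd_below ((\<lambda>j. xs j \<omega>) ` {n..})" for n \<omega> by (rule bdd_belowI2[of _ "- R"]) (use bl in auto)
  have ule: "u n \<omega> \<le> xs j \<omega>" if "n \<le> j" for n j \<omega> unfolding u_def by (rule cINF_lower[OF bdd]) (use that in auto)
  have uge: "b \<le> u n \<omega>" if "\<And>j. n \<le> j \<Longrightarrow> b \<le> xs j \<omega>" for b n \<omega>
    unfolding u_def by (rule cINF_greatest) (use that in auto)
  have ub: "u n \<in> bnd R" for n
  proof (rule bndI)
    show "u n \<in> borel_measurable M" unfolding u_def by (rule borel_measurable_cINF) (use bdd in auto)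
    show "\<bar>u n \<omega>\<bar> \<le> R" for \<omega>
      using uge[of n "- R" \<omega>] bl order_trans[OF ule[of n n \<omega>] bl(2)] by (auto simp: abs_le_iff minus_le_iff)
  qed
  have uinc: "u n \<omega> \<le> u (Suc n) \<omega>" for n \<omega> by (rule uge) (use ule in auto)
  have ulim: "AE \<omega> in M. (\<lambda>n. u n \<omega>) \<longlonglongrightarrow> x \<omega>" using lim
  proof eventually_elim
    case (elim \<omega>)
    show ?case
    proof (rule LIMSEQ_I)
      fix e :: real assume "0 < e"
      then obtain N where N: "\<And>j. j \<ge> N \<Longrightarrow> \<bar>xs j \<omega> - x \<omega>\<bar> < e / 2" using LIMSEQ_D[OF elim, of "e / 2"] by auto
      have "norm (u n \<omega> - x \<omega>) < e" if "n \<ge> N" for n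
      proof -
        have "x \<omega> - e / 2 \<le> u n \<omega>" by (rule uge) (use N that in \<open>smt (verit) order_trans\<close>)
        moreover have "u n \<omega> \<le> xs n \<omega>" by (rule ule) simp
        ultimately show ?thesis using N[OF that] \<open>0 < e\<close> unfolding real_norm_def by linarith
      qed
      then show "\<exists>N. \<forall>n\<ge>N. norm (u n \<omega> - x \<omega>) < e" by blast
    qed
  qed
  have 1: "AE \<omega> in M. (\<lambda>n. \<rho> (u n) \<omega>) \<longlonglongrightarrow> \<rho> x \<omega>"
    by (rule risk_continuous_from_below[OF att ub x uinc ulim])
  have 2: "AE \<omega> in M. \<forall>n. \<rho> (xs n) \<omega> \<le> \<rho> (u n) \<omega>" unfolding AE_all_countable
    using rho_mono[OF bnd_X[OF ub] bnd_X[OF xs]] ule by auto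
  have 3: "AE \<omega> in M. ereal (\<rho> x \<omega>) \<le> liminf (\<lambda>n. ereal (\<rho> (xs n) \<omega>))"
    using fatou[unfolded fatou_property_def, rule_format, of xs x "\<lambda>_. R"] bnd_X[OF xs] bnd_X[OF x] zero_X lim bndD(2)[OF xs]
    by auto
  from 1 2 3 show ?thesis
    by eventually_elim (rule tendsto_of_liminf_ge, auto)
qed

text \<open>On the event where the F-measurable bound is at most \<open>k\<close>, clipping at
  \<open>k\<close> changes nothing, and by locality the bounded case decides there. These events
  exhaust the space.\<close>

lemma attains_imp_lebesgue:
  assumes fatou: "fatou_property M X \<rho>" and att: "attains_representation M F X \<rho>"
  shows "lebesgue_property M X \<rho>"
  unfolding lebesgue_property_def
proof (intro allI impI, elim conjE)
  fix xs x y
  assume xs': "\<forall>n. xs n \<in> X" and x: "x \<in> X" and y: "y \<in> X"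
    and lim: "AE \<omega> in M. (\<lambda>n. xs n \<omega>) \<longlonglongrightarrow> x \<omega>" and bd: "\<forall>n. AE \<omega> in M. \<bar>xs n \<omega>\<bar> \<le> y \<omega>"
  note xs = xs'[rule_format]
  note [measurable] = X_meas[OF x] X_meas[OF xs]
  obtain \<eta> where \<eta>[measurable]: "\<eta> \<in> borel_measurable F" and \<eta>b: "AE \<omega> in M. \<bar>y \<omega>\<bar> \<le> \<eta> \<omega>" using X_bound[OF y] by blast
  have bd': "AE \<omega> in M. \<forall>n. \<bar>xs n \<omega>\<bar> \<le> \<eta> \<omega>"
  proof -
    have "AE \<omega> in M. \<forall>n. \<bar>xs n \<omega>\<bar> \<le> y \<omega>" unfolding AE_all_countable using bd by blast
    with \<eta>b show ?thesis by eventually_elim (auto intro: order_trans[OF _ order_trans[OF abs_ge_self]])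
  qed
  have bdx: "AE \<omega> in M. \<bar>x \<omega>\<bar> \<le> \<eta> \<omega>"
    using bd' lim by eventually_elim (rule LIMSEQ_le_const2[OF tendsto_rabs], auto)
  define cl where "cl k s = max (- real k) (min (real k) s)" for k :: nat and s
  have [measurable]: "cl k \<in> borel_measurable borel" for k unfolding cl_def by measurable
  have clb: "\<bar>cl k s\<bar> \<le> real k" for k s by (auto simp: cl_def)
  have cleq: "cl k s = s" if "\<bar>s\<bar> \<le> real k" for k s using that by (auto simp: cl_def max_def min_def)
  have cb: "(\<lambda>\<omega>. cl k (v \<omega>)) \<in> bnd (real k)" if "v \<in> borel_measurable M" for k v
    by (rule bndI) (use that clb in auto)
  have "AE \<omega> in M. \<forall>k. \<eta> \<omega> \<le> real k \<longrightarrow> (\<lambda>n. \<rho> (xs n) \<omega>) \<longlonglongrightarrow> \<rho> x \<omega>"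
    unfolding AE_all_countable
  proof
    fix k
    define A where "A = {\<omega> \<in> space F. \<eta> \<omega> \<le> real k}"
    have AF: "A \<in> sets F" unfolding A_def by measurable
    note bx = cb[OF X_meas[OF x], of k] and bxs = cb[OF X_meas[OF xs], of k]
    have "AE \<omega> in M. (\<lambda>n. \<rho> (\<lambda>\<omega>. cl k (xs n \<omega>)) \<omega>) \<longlonglongrightarrow> \<rho> (\<lambda>\<omega>. cl k (x \<omega>)) \<omega>"
    proof (rule attains_imp_lebesgue_bounded[OF fatou att bxs bx])
      show "AE \<omega> in M. (\<lambda>n. cl k (xs n \<omega>)) \<longlonglongrightarrow> cl k (x \<omega>)"
        using lim by eventually_elim (unfold cl_def, intro tendsto_intros)
    qed
    moreover have "AE \<omega> in M. \<forall>n. \<omega> \<in> A \<longrightarrow> \<rho> (\<lambda>\<omega>. cl k (xs n \<omega>)) \<omega> = \<rho> (xs n) \<omega>"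
      unfolding AE_all_countable
      by (intro allI rho_local[OF bnd_X[OF bxs] xs AF])
        (use bd' in \<open>eventually_elim, auto simp: A_def intro!: cleq intro: order_trans\<close>)
    moreover have "AE \<omega> in M. \<omega> \<in> A \<longrightarrow> \<rho> (\<lambda>\<omega>. cl k (x \<omega>)) \<omega> = \<rho> x \<omega>"
      by (rule rho_local[OF bnd_X[OF bx] x AF])
        (use bdx in \<open>eventually_elim, auto simp: A_def intro!: cleq intro: order_trans\<close>)
    ultimately show "AE \<omega> in M. \<eta> \<omega> \<le> real k \<longrightarrow> (\<lambda>n. \<rho> (xs n) \<omega>) \<longlonglongrightarrow> \<rho> x \<omega>"
      using AE_space by eventually_elim (auto simp: A_def space_F)
  qed
  then show "AE \<omega> in M. (\<lambda>n. \<rho> (xs n) \<omega>) \<longlonglongrightarrow> \<rho> x \<omega>"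
    by eventually_elim (use real_arch_simple in blast)
qed

end

section \<open>Stable sets and conditional linear functionals\<close>

text \<open>The factor \<open>t\<close> is fixed before \<open>n\<close> tends to infinity: for
  given \<open>e\<close> it is taken so large that \<open>c + 1 < t * e\<close>.\<close>

lemma tendsto_zero_of_scaled_bounds:
  fixes a :: "nat \<Rightarrow> real"
  assumes nn: "\<And>n. 0 \<le> a n" and le: "\<And>t n. real t * a n \<le> b t n" and lim: "\<And>t. b t \<longlonglongrightarrow> c"
  shows "a \<longlonglongrightarrow> 0"
proof (rule order_tendstoI)
  fix e :: real assume e: "0 < e"
  obtain t :: nat where t: "\<bar>c + 1\<bar> / e < real t" using reals_Archimedean2 by blast
  have "eventually (\<lambda>n. b t n < c + 1) sequentially" using lim[of t] by (intro order_tendstoD) auto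
  then show "eventually (\<lambda>n. a n < e) sequentially"
  proof eventually_elim
    case (elim n)
    have "real t * a n < real t * e" using le[of t n] elim t e by (simp add: field_simps)
    then show ?case by (simp add: mult_less_cancel_left)
  qed
next
  fix e :: real assume "e < 0"
  then have "e < a n" for n using nn[of n] by linarith
  then show "eventually (\<lambda>n. e < a n) sequentially" by simp
qed

context prob_subalgebra
begin

lemma AE_eq_of_arbitrarily_close:
  fixes f g :: "'a \<Rightarrow> real"
  assumes "\<And>e. 0 < e \<Longrightarrow> AE \<omega> in M. \<bar>f \<omega> - g \<omega>\<bar> \<le> e"
  shows "AE \<omega> in M. f \<omega> = g \<omega>"
proof -
  have "AE \<omega> in M. \<forall>n. \<bar>f \<omega> - g \<omega>\<bar> \<le> 1 / real (Suc n)"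
    unfolding AE_all_countable using assms by simp
  then show ?thesis
  proof eventually_elim
    case (elim \<omega>)
    have "\<bar>f \<omega> - g \<omega>\<bar> \<le> 0"
    proof (rule field_le_epsilon)
      fix e :: real assume "0 < e"
      then obtain n where "1 / real (Suc n) < e" using nat_approx_posE by blast
      then show "\<bar>f \<omega> - g \<omega>\<bar> \<le> 0 + e" using elim[rule_format, of n] by linarith
    qed
    then show ?case by simp
  qed
qed

lemma AE_le_of_arbitrarily_close:
  fixes f g :: "'a \<Rightarrow> real"
  assumes "\<And>e. 0 < e \<Longrightarrow> AE \<omega> in M. f \<omega> \<le> g \<omega> + e"
  shows "AE \<omega> in M. f \<omega> \<le> g \<omega>"
proof -
  have "AE \<omega> in M. \<bar>max (f \<omega> - g \<omega>) 0 - 0\<bar> \<le> e" if "0 < e" for e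
    using assms[OF that] by eventually_elim (use that in auto)
  then have "AE \<omega> in M. max (f \<omega> - g \<omega>) 0 = 0" by (rule AE_eq_of_arbitrarily_close)
  then show ?thesis by eventually_elim (simp add: max_def split: if_splits)
qed

section \<open>Stable sets and maximal filter bases\<close>

lemma stable_setD:
  assumes "stable_set M F S"
  shows "S \<noteq> {}" "S \<subseteq> borel_measurable M"
    "\<And>x y. x \<in> S \<Longrightarrow> y \<in> borel_measurable M \<Longrightarrow> AE \<omega> in M. y \<omega> = x \<omega> \<Longrightarrow> y \<in> S"
    "\<And>a x. event_partition F a \<Longrightarrow> (\<And>k. x k \<in> S) \<Longrightarrow> concat_rv a x \<in> S"
  using assms unfolding stable_set_def L0_subset_def by auto

lemma stable_setI:
  assumes "S \<noteq> {}" "S \<subseteq> borel_measurable M"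
    "\<And>x y. x \<in> S \<Longrightarrow> y \<in> borel_measurable M \<Longrightarrow> AE \<omega> in M. y \<omega> = x \<omega> \<Longrightarrow> y \<in> S"
    "\<And>a x. event_partition F a \<Longrightarrow> (\<And>k. x k \<in> S) \<Longrightarrow> concat_rv a x \<in> S"
  shows "stable_set M F S"
  using assms unfolding stable_set_def L0_subset_def by auto

lemma stable_set_Int:
  assumes "stable_set M F S" "stable_set M F T" "S \<inter> T \<noteq> {}"
  shows "stable_set M F (S \<inter> T)"
proof (rule stable_setI)
  show "S \<inter> T \<subseteq> borel_measurable M" using stable_setD(2)[OF assms(1)] by blast
  show "y \<in> S \<inter> T" if "x \<in> S \<inter> T" "y \<in> borel_measurable M" "AE \<omega> in M. y \<omega> = x \<omega>" for x y
    using that stable_setD(3)[OF assms(1), of x y] stable_setD(3)[OF assms(2), of x y] by blast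
  show "concat_rv a x \<in> S \<inter> T" if "event_partition F a" "\<And>k. x k \<in> S \<inter> T" for a x
    using that stable_setD(4)[OF assms(1), of a x] stable_setD(4)[OF assms(2), of a x] by blast
qed (rule assms(3))

text \<open>The two partitions commute: concatenating along \<open>b\<close> elements that are
  themselves concatenations along \<open>a\<close> may be done in each coordinate first.\<close>

lemma concat_sets_stable:
  assumes S: "\<And>k. stable_set M F (S k)" and a: "event_partition F a"
  shows "stable_set M F (concat_sets M a S)"
proof (rule stable_setI)
  have "\<forall>k. \<exists>x. x \<in> S k" using stable_setD(1)[OF S] by blast
  then obtain x where x: "\<And>k. x k \<in> S k" by metis
  have "concat_rv a x \<in> borel_measurable M"
    using concat_rv_meas[OF a] x stable_setD(2)[OF S] by (meson subsetD)
  then have "concat_rv a x \<in> concat_sets M a S" using x by (auto simp: concat_sets_def)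
  then show "concat_sets M a S \<noteq> {}" by blast
  show "concat_sets M a S \<subseteq> borel_measurable M" by (auto simp: concat_sets_def)
  show "y \<in> concat_sets M a S"
    if z: "z \<in> concat_sets M a S" and y: "y \<in> borel_measurable M" and e: "AE \<omega> in M. y \<omega> = z \<omega>" for z y
  proof -
    from z obtain x where x: "\<And>k. x k \<in> S k" "AE \<omega> in M. z \<omega> = concat_rv a x \<omega>" by (auto simp: concat_sets_def)
    from e x(2) have "AE \<omega> in M. y \<omega> = concat_rv a x \<omega>" by eventually_elim simp
    then show ?thesis using x(1) y by (auto simp: concat_sets_def)
  qed
  show "concat_rv b z \<in> concat_sets M a S" if b: "event_partition F b" and z: "\<And>k. z k \<in> concat_sets M a S" for b z
  proof -
    have "\<forall>k. \<exists>x. (\<forall>j. x j \<in> S j) \<and> (AE \<omega> in M. z k \<omega> = concat_rv a x \<omega>)" using z by (auto simp: concat_sets_def)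
    then obtain x where x: "\<And>k j. x k j \<in> S j" "\<And>k. AE \<omega> in M. z k \<omega> = concat_rv a (x k) \<omega>" by metis
    have zm: "z k \<in> borel_measurable M" for k using z[of k] by (simp add: concat_sets_def)
    define x' where "x' j = concat_rv b (\<lambda>k. x k j)" for j
    have "x' j \<in> S j" for j unfolding x'_def by (rule stable_setD(4)[OF S b]) (rule x(1))
    moreover have "AE \<omega> in M. concat_rv b z \<omega> = concat_rv a x' \<omega>"
    proof (rule partition_AE[OF b])
      fix k
      show "AE \<omega> in M. \<omega> \<in> b k \<longrightarrow> concat_rv b z \<omega> = concat_rv a x' \<omega>" using x(2)[of k] AE_space
      proof eventually_elim
        case (elim \<omega>)
        obtain j where j: "\<omega> \<in> a j" using event_partitionD(3)[OF a elim(2)] by blast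
        show ?case using elim(1) j by (auto simp: x'_def concat_rv_on[OF b] concat_rv_on[OF a])
      qed
    qed
    ultimately show ?thesis using concat_rv_meas[OF b zm] by (auto simp: concat_sets_def)
  qed
qed

text \<open>Closure under concatenation comes for free from maximality, so Zorn's lemma is applied to filter bases of
  stable sets that need not be stable collections; for those, unions of chains are harmless.\<close>

lemma maximal_stable_filter:
  assumes B: "filter_base \<B>" "\<forall>S\<in>\<B>. stable_set M F S \<and> S \<subseteq> V" and V: "stable_set M F V"
  shows "\<exists>\<G>. \<B> \<subseteq> \<G> \<and> filter_base \<G> \<and> (\<forall>S\<in>\<G>. stable_set M F S \<and> S \<subseteq> V) \<and>
    (\<forall>T. stable_set M F T \<and> T \<subseteq> V \<and> (\<forall>G\<in>\<G>. T \<inter> G \<noteq> {}) \<longrightarrow> T \<in> \<G>) \<and>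
    (\<forall>S a. (\<forall>k. S k \<in> \<G>) \<and> event_partition F a \<longrightarrow> concat_sets M a S \<in> \<G>)"
proof -
  define \<AA> where "\<AA> = {\<G>. \<B> \<subseteq> \<G> \<and> filter_base \<G> \<and> (\<forall>S\<in>\<G>. stable_set M F S \<and> S \<subseteq> V)}"
  have "\<exists>\<G>\<in>\<AA>. \<forall>\<H>\<in>\<AA>. \<G> \<subseteq> \<H> \<longrightarrow> \<H> = \<G>"
  proof (rule subset_Zorn_nonempty)
    show "\<AA> \<noteq> {}" using B by (auto simp: \<AA>_def)
    fix \<CC> assume C: "\<CC> \<noteq> {}" "subset.chain \<AA> \<CC>"
    then have sub: "\<CC> \<subseteq> \<AA>" and ch: "\<And>a b. a \<in> \<CC> \<Longrightarrow> b \<in> \<CC> \<Longrightarrow> a \<subseteq> b \<or> b \<subseteq> a"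
      unfolding subset.chain_def by auto
    obtain \<G>0 where G0: "\<G>0 \<in> \<CC>" using C by blast
    have "filter_base (\<Union>\<CC>)" unfolding filter_base_def
    proof (intro conjI ballI)
      have "\<G>0 \<noteq> {}" using G0 sub by (auto simp: \<AA>_def filter_base_def)
      then show "\<Union>\<CC> \<noteq> {}" using G0 by blast
      show "{} \<notin> \<Union>\<CC>" using sub by (auto simp: \<AA>_def filter_base_def)
      fix A B assume "A \<in> \<Union>\<CC>" "B \<in> \<Union>\<CC>"
      then obtain a b where ab: "a \<in> \<CC>" "b \<in> \<CC>" "A \<in> a" "B \<in> b" by blast
      then obtain c where c: "c \<in> \<CC>" "A \<in> c" "B \<in> c" using ch[of a b] by blast
      then have "filter_base c" using sub by (auto simp: \<AA>_def)
      then show "\<exists>C\<in>\<Union>\<CC>. C \<subseteq> A \<inter> B" using c unfolding filter_base_def by blast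
    qed
    moreover have "\<B> \<subseteq> \<G>0" using sub G0 by (auto simp: \<AA>_def)
    moreover have "stable_set M F S \<and> S \<subseteq> V" if "S \<in> \<Union>\<CC>" for S using sub that by (auto simp: \<AA>_def)
    ultimately show "\<Union>\<CC> \<in> \<AA>" using G0 unfolding \<AA>_def by blast
  qed
  then obtain \<G> where G: "\<G> \<in> \<AA>" and mx: "\<And>\<H>. \<H> \<in> \<AA> \<Longrightarrow> \<G> \<subseteq> \<H> \<Longrightarrow> \<H> = \<G>" by blast
  have fb: "filter_base \<G>" and st: "\<And>S. S \<in> \<G> \<Longrightarrow> stable_set M F S" and sv: "\<And>S. S \<in> \<G> \<Longrightarrow> S \<subseteq> V" and BG: "\<B> \<subseteq> \<G>"
    using G by (auto simp: \<AA>_def)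
  have mem: "T \<in> \<G>" if T: "stable_set M F T" "T \<subseteq> V" "\<And>G. G \<in> \<G> \<Longrightarrow> T \<inter> G \<noteq> {}" for T
  proof -
    \<comment> \<open>The filter obtained by adjoining \<open>T\<close>: all stable subsets of
      \<open>V\<close> that contain some \<open>T \<inter> G\<close>. It extends the maximal one and
      contains \<open>T\<close>, so both coincide.\<close>
    define \<H> where "\<H> = {S. stable_set M F S \<and> S \<subseteq> V \<and> (\<exists>G\<in>\<G>. T \<inter> G \<subseteq> S)}"
    have GH: "\<G> \<subseteq> \<H>" using st sv by (auto simp: \<H>_def)
    obtain G0 where "G0 \<in> \<G>" using fb by (auto simp: filter_base_def)
    then have TH: "T \<in> \<H>" using T(1,2) by (auto simp: \<H>_def)
    have "filter_base \<H>" unfolding filter_base_def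
    proof (intro conjI ballI)
      show "\<H> \<noteq> {}" using TH by blast
      show "{} \<notin> \<H>" using stable_setD(1) by (auto simp: \<H>_def)
      fix A B assume "A \<in> \<H>" "B \<in> \<H>"
      then obtain G1 G2 where g: "G1 \<in> \<G>" "G2 \<in> \<G>" "T \<inter> G1 \<subseteq> A" "T \<inter> G2 \<subseteq> B" by (auto simp: \<H>_def)
      then obtain G3 where g3: "G3 \<in> \<G>" "G3 \<subseteq> G1 \<inter> G2" using fb unfolding filter_base_def by meson
      have "T \<inter> G3 \<in> \<H>" using stable_set_Int[OF T(1) st[OF g3(1)] T(3)[OF g3(1)]] T(2) g3(1) by (auto simp: \<H>_def)
      moreover have "T \<inter> G3 \<subseteq> A \<inter> B" using g(3,4) g3(2) by auto
      ultimately show "\<exists>C\<in>\<H>. C \<subseteq> A \<inter> B" by (rule bexI[rotated])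
    qed
    then have "\<H> \<in> \<AA>" using GH BG by (auto simp: \<AA>_def \<H>_def)
    from mx[OF this GH] TH show ?thesis by simp
  qed
  \<comment> \<open>Every member \<open>G\<close> meets the concatenation: choose a point of
    \<open>S k \<inter> G\<close> for each \<open>k\<close>; the points concatenate inside
    \<open>G\<close> because \<open>G\<close> is stable. The criterion \<open>mem\<close> then
    applies.\<close>
  have cc: "concat_sets M a S \<in> \<G>" if S: "\<And>k. S k \<in> \<G>" and a: "event_partition F a" for S a
  proof (rule mem)
    show "stable_set M F (concat_sets M a S)" by (rule concat_sets_stable[OF st[OF S] a])
    show "concat_sets M a S \<subseteq> V"
    proof
      fix z assume "z \<in> concat_sets M a S"
      then obtain x where x: "\<And>k. x k \<in> S k" "AE \<omega> in M. z \<omega> = concat_rv a x \<omega>" and z: "z \<in> borel_measurable M"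
        by (auto simp: concat_sets_def)
      have "concat_rv a x \<in> V" by (rule stable_setD(4)[OF V a]) (use x(1) sv[OF S] in blast)
      then show "z \<in> V" using stable_setD(3)[OF V _ z x(2)] by blast
    qed
    fix G assume g: "G \<in> \<G>"
    have "\<forall>k. \<exists>c. c \<in> S k \<inter> G"
    proof
      fix k
      obtain C where "C \<in> \<G>" "C \<subseteq> S k \<inter> G" using fb S[of k] g unfolding filter_base_def by meson
      moreover have "C \<noteq> {}" using \<open>C \<in> \<G>\<close> fb by (auto simp: filter_base_def)
      ultimately show "\<exists>c. c \<in> S k \<inter> G" by blast
    qed
    then obtain c where c: "\<And>k. c k \<in> S k \<inter> G" by metis
    have cG: "concat_rv a c \<in> G" by (rule stable_setD(4)[OF st[OF g] a]) (use c in blast)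
    moreover have "concat_rv a c \<in> concat_sets M a S"
      using c cG stable_setD(2)[OF st[OF g]] by (auto simp: concat_sets_def)
    ultimately show "concat_sets M a S \<inter> G \<noteq> {}" by blast
  qed
  show ?thesis
  proof (intro exI[of _ \<G>] conjI allI impI ballI)
    show "T \<in> \<G>" if "stable_set M F T \<and> T \<subseteq> V \<and> (\<forall>G\<in>\<G>. T \<inter> G \<noteq> {})" for T using mem that by blast
    show "concat_sets M a S \<in> \<G>" if "(\<forall>k. S k \<in> \<G>) \<and> event_partition F a" for S a using cc that by blast
  qed (use BG fb st sv in auto)
qed

section \<open>Neighbourhoods in the stable weak topology\<close>

text \<open>On each piece the supremum runs over a finite nonempty set and is a maximum, so the
  strict inequality holds exactly when it holds for each member.\<close>

lemma stable_weak_nhd_iff: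
  assumes a: "event_partition F a" and \<Phi>: "\<And>k. \<Phi> k \<subseteq> X" "\<And>k. finite (\<Phi> k)" "\<And>k. \<Phi> k \<noteq> {}"
  shows "v \<in> stable_weak_nhd M F L1F \<Phi> a \<epsilon> \<longleftrightarrow>
    v \<in> L1F \<and> (AE \<omega> in M. \<forall>k. \<omega> \<in> a k \<longrightarrow> (\<forall>x\<in>\<Phi> k. \<bar>CE (\<lambda>w. x w * v w) \<omega>\<bar> < \<epsilon> \<omega>))"
proof (cases "v \<in> L1F")
  case True
  have "AE \<omega> in M. \<forall>k. \<forall>x\<in>\<Phi> k. cond_exp_ext M F (\<lambda>w. x w * v w) \<omega> = ereal (CE (\<lambda>w. x w * v w) \<omega>)"
    unfolding AE_all_countable
  proof
    fix k show "AE \<omega> in M. \<forall>x\<in>\<Phi> k. cond_exp_ext M F (\<lambda>w. x w * v w) \<omega> = ereal (CE (\<lambda>w. x w * v w) \<omega>)"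
      by (rule AE_finite_allI[OF \<Phi>(2)]) (use \<Phi>(1) in \<open>blast intro: cond_exp_ext_eq L1F_multX True\<close>)
  qed
  then have eq: "AE \<omega> in M. (concat_rv a (\<lambda>k w. SUP x\<in>\<Phi> k. \<bar>cond_exp_ext M F (\<lambda>u. x u * v u) w\<bar>) \<omega> < ereal (\<epsilon> \<omega>)) =
     (\<forall>k. \<omega> \<in> a k \<longrightarrow> (\<forall>x\<in>\<Phi> k. \<bar>CE (\<lambda>w. x w * v w) \<omega>\<bar> < \<epsilon> \<omega>))" using AE_space
  proof eventually_elim
    case (elim \<omega>)
    obtain k where k: "\<omega> \<in> a k" using event_partitionD(3)[OF a elim(2)] by blast
    have u: "j = k" if "\<omega> \<in> a j" for j
      using that k event_partitionD(2)[OF a] by (auto simp: disjoint_family_on_def)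
    have "concat_rv a (\<lambda>k w. SUP x\<in>\<Phi> k. \<bar>cond_exp_ext M F (\<lambda>u. x u * v u) w\<bar>) \<omega> = (SUP x\<in>\<Phi> k. ereal \<bar>CE (\<lambda>w. x w * v w) \<omega>\<bar>)"
      unfolding concat_rv_ereal_eq[of a, OF event_partitionD(2)[OF a] k] using elim(1) by (intro SUP_cong) auto
    also have "\<dots> = Max ((\<lambda>x. ereal \<bar>CE (\<lambda>w. x w * v w) \<omega>\<bar>) ` \<Phi> k)" using \<Phi>(2,3)[of k] by (intro cSup_eq_Max) auto
    also have "\<dots> < ereal (\<epsilon> \<omega>) \<longleftrightarrow> (\<forall>x\<in>\<Phi> k. \<bar>CE (\<lambda>w. x w * v w) \<omega>\<bar> < \<epsilon> \<omega>)" using \<Phi>(2,3)[of k] by (subst Max_less_iff) auto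
    finally show ?case using k u by (metis (no_types, lifting))
  qed
  have "(AE \<omega> in M. concat_rv a (\<lambda>k w. SUP x\<in>\<Phi> k. \<bar>cond_exp_ext M F (\<lambda>u. x u * v u) w\<bar>) \<omega> < ereal (\<epsilon> \<omega>)) \<longleftrightarrow>
     (AE \<omega> in M. \<forall>k. \<omega> \<in> a k \<longrightarrow> (\<forall>x\<in>\<Phi> k. \<bar>CE (\<lambda>w. x w * v w) \<omega>\<bar> < \<epsilon> \<omega>))"
    by (rule eventually_subst[OF eq])
  then show ?thesis using True by (simp add: stable_weak_nhd_def)
qed (simp add: stable_weak_nhd_def)

lemma trivial_partition: "event_partition F (\<lambda>k::nat. if k = 0 then space F else {})"
  unfolding event_partition_def disjoint_family_on_def by auto

text \<open>The trivial partition turns one finite set of tests into a basic neighbourhood. Closure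
  statements will be exploited through such neighbourhoods.\<close>

lemma open_weak_nhd:
  assumes y: "y \<in> L1F" and \<Phi>: "\<Phi> \<subseteq> X" "finite \<Phi>" "\<Phi> \<noteq> {}" and \<epsilon>: "\<epsilon> \<in> borel_measurable F" "AE \<omega> in M. 0 < \<epsilon> \<omega>"
  shows "\<exists>Q. openin (stable_weak_topology M F L1F X) Q \<and> y \<in> Q \<and>
    (\<forall>z\<in>Q. z \<in> L1F \<and> (AE \<omega> in M. \<forall>x\<in>\<Phi>. \<bar>CE (\<lambda>w. x w * z w) \<omega> - CE (\<lambda>w. x w * y w) \<omega>\<bar> < \<epsilon> \<omega>))"
proof -
  let ?a = "\<lambda>k::nat. if k = 0 then space F else {}"
  let ?Q = "(\<lambda>u \<omega>. y \<omega> + u \<omega>) ` stable_weak_nhd M F L1F (\<lambda>_. \<Phi>) ?a \<epsilon>"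
  note iff = stable_weak_nhd_iff[OF trivial_partition, of "\<lambda>_. \<Phi>", OF \<Phi>]
  have "?Q \<in> stable_weak_base M F L1F X"
    unfolding stable_weak_base_def mem_Collect_eq
    by (rule exI[of _ y], rule exI[of _ "\<lambda>_. \<Phi>"], rule exI[of _ ?a], rule exI[of _ \<epsilon>])
      (use y \<Phi> \<epsilon> trivial_partition in blast)
  then have "openin (stable_weak_topology M F L1F X) ?Q"
    unfolding stable_weak_topology_def by (rule topology_generated_by_Basis)
  moreover have "y \<in> ?Q"
  proof
    have "AE \<omega> in M. CE (\<lambda>_. 0) \<omega> = 0" by (rule CE_const)
    then have "AE \<omega> in M. \<forall>k. \<omega> \<in> ?a k \<longrightarrow> (\<forall>x\<in>\<Phi>. \<bar>CE (\<lambda>w. x w * 0) \<omega>\<bar> < \<epsilon> \<omega>)"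
      using \<epsilon>(2) by eventually_elim simp
    then show "(\<lambda>_. 0) \<in> stable_weak_nhd M F L1F (\<lambda>_. \<Phi>) ?a \<epsilon>" unfolding iff by (simp add: integrable_L1F)
  qed simp
  moreover have "z \<in> L1F \<and> (AE \<omega> in M. \<forall>x\<in>\<Phi>. \<bar>CE (\<lambda>w. x w * z w) \<omega> - CE (\<lambda>w. x w * y w) \<omega>\<bar> < \<epsilon> \<omega>)" if "z \<in> ?Q" for z
  proof -
    from that obtain u where z: "z = (\<lambda>\<omega>. y \<omega> + u \<omega>)" and n: "u \<in> stable_weak_nhd M F L1F (\<lambda>_. \<Phi>) ?a \<epsilon>" by blast
    from n[unfolded iff] have u: "u \<in> L1F"
      and l: "AE \<omega> in M. \<forall>k. \<omega> \<in> ?a k \<longrightarrow> (\<forall>x\<in>\<Phi>. \<bar>CE (\<lambda>w. x w * u w) \<omega>\<bar> < \<epsilon> \<omega>)" by blast+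
    have "AE \<omega> in M. \<forall>x\<in>\<Phi>. CE (\<lambda>w. x w * z w) \<omega> = CE (\<lambda>w. x w * y w) \<omega> + CE (\<lambda>w. x w * u w) \<omega>"
    proof (rule AE_finite_allI[OF \<Phi>(2)])
      fix x assume "x \<in> \<Phi>"
      then have "x \<in> X" using \<Phi> by blast
      from CE_add[OF L1F_multX[OF this y] L1F_multX[OF this u]]
      show "AE \<omega> in M. CE (\<lambda>w. x w * z w) \<omega> = CE (\<lambda>w. x w * y w) \<omega> + CE (\<lambda>w. x w * u w) \<omega>"
        unfolding z by (simp add: distrib_left)
    qed
    then have "AE \<omega> in M. \<forall>x\<in>\<Phi>. \<bar>CE (\<lambda>w. x w * z w) \<omega> - CE (\<lambda>w. x w * y w) \<omega>\<bar> < \<epsilon> \<omega>"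
      using l AE_space
    proof eventually_elim
      case (elim \<omega>)
      from elim(2)[rule_format, of 0] elim(1,3) show ?case by (simp add: space_F)
    qed
    then show ?thesis unfolding z using L1F_add[OF y u] by simp
  qed
  ultimately show ?thesis by blast
qed

end

context conditional_risk
begin

text \<open>By linearity the additive slack \<open>\<eta>\<close> disappears in the limit \<open>t \<rightarrow> \<infinity>\<close> of \<open>L(tx)/t\<close>, so the Lebesgue
  property makes \<open>A \<mapsto> - E[L(1\<^sub>A)]\<close> a measure, and \<open>- y\<close> is its density.\<close>

lemma dominated_functional_representation:
  assumes leb: "lebesgue_property M X \<rho>"
    and LF: "\<And>x. x \<in> X \<Longrightarrow> L x \<in> borel_measurable F"
    and Ladd: "\<And>x x'. x \<in> X \<Longrightarrow> x' \<in> X \<Longrightarrow> AE \<omega> in M. L (\<lambda>w. x w + x' w) \<omega> = L x \<omega> + L x' \<omega>"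
    and Lmult: "\<And>g x. g \<in> borel_measurable F \<Longrightarrow> x \<in> X \<Longrightarrow> AE \<omega> in M. L (\<lambda>w. g w * x w) \<omega> = g \<omega> * L x \<omega>"
    and Lle: "\<And>x. x \<in> X \<Longrightarrow> AE \<omega> in M. L x \<omega> \<le> \<rho> x \<omega> + \<eta> \<omega>"
  shows "\<exists>y\<in>L1F. \<forall>x\<in>X. AE \<omega> in M. CE (\<lambda>w. x w * y w) \<omega> = L x \<omega>"
proof -
  note z = zero_X[of 0]
  have Lc: "AE \<omega> in M. L (\<lambda>w. c * x w) \<omega> = c * L x \<omega>" if "x \<in> X" for x and c :: real
    using Lmult[of "\<lambda>_. c", OF _ that] by simp
  have cX: "(\<lambda>w. c * x w) \<in> X" if "x \<in> X" for x and c :: real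
    using X_multF[of "\<lambda>_. c", OF _ that] by simp
  have Lneg: "AE \<omega> in M. L x \<omega> \<le> 0" if x: "x \<in> X" and nn: "AE \<omega> in M. 0 \<le> x \<omega>" for x
  proof -
    have "AE \<omega> in M. \<forall>n. real n * L x \<omega> \<le> \<rho> (\<lambda>_. 0) \<omega> + \<eta> \<omega>" unfolding AE_all_countable
    proof
      fix n :: nat
      have "AE \<omega> in M. \<rho> (\<lambda>w. real n * x w) \<omega> \<le> \<rho> (\<lambda>_. 0) \<omega>"
        by (rule rho_mono[OF z cX[OF x]]) (use nn in \<open>eventually_elim, simp\<close>)
      with Lc[OF x, of "real n"] Lle[OF cX[OF x], of "real n"]
      show "AE \<omega> in M. real n * L x \<omega> \<le> \<rho> (\<lambda>_. 0) \<omega> + \<eta> \<omega>" by eventually_elim linarith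
    qed
    then show ?thesis by eventually_elim (rule le_zero_of_multiples_bounded, blast)
  qed
  have Lanti: "AE \<omega> in M. L x' \<omega> \<le> L x \<omega>" if x: "x \<in> X" "x' \<in> X" "AE \<omega> in M. x \<omega> \<le> x' \<omega>" for x x'
  proof -
    have "AE \<omega> in M. L (\<lambda>w. x' w - x w) \<omega> \<le> 0"
      by (rule Lneg[OF X_diff[OF x(2,1)]]) (use x(3) in \<open>eventually_elim, simp\<close>)
    moreover have "AE \<omega> in M. L (\<lambda>w. x w + (x' w - x w)) \<omega> = L x \<omega> + L (\<lambda>w. x' w - x w) \<omega>"
      by (rule Ladd[OF x(1) X_diff[OF x(2,1)]])
    ultimately show ?thesis by eventually_elim simp
  qed
  have Lcong: "AE \<omega> in M. L x \<omega> = L x' \<omega>" if x: "x \<in> X" "x' \<in> X" "AE \<omega> in M. x \<omega> = x' \<omega>" for x x'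
  proof -
    have "AE \<omega> in M. L x' \<omega> \<le> L x \<omega>" by (rule Lanti[OF x(1,2)]) (use x(3) in \<open>eventually_elim, simp\<close>)
    moreover have "AE \<omega> in M. L x \<omega> \<le> L x' \<omega>" by (rule Lanti[OF x(2,1)]) (use x(3) in \<open>eventually_elim, simp\<close>)
    ultimately show ?thesis by eventually_elim simp
  qed
  have L1: "AE \<omega> in M. L (\<lambda>_. 1) \<omega> = -1"
  proof -
    have *: "AE \<omega> in M. \<forall>n::nat. real n * (s * (L (\<lambda>_. 1) \<omega> + 1)) \<le> \<rho> (\<lambda>_. 0) \<omega> + \<eta> \<omega>" for s :: real
      unfolding AE_all_countable
    proof
      fix n :: nat
      let ?c = "real n * s"
      have "AE \<omega> in M. \<rho> (\<lambda>w. 0 + ?c) \<omega> = \<rho> (\<lambda>_. 0) \<omega> - ?c" by (rule rho_cash[OF _ z]) auto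
      with Lc[OF zero_X[of 1], of ?c] Lle[OF zero_X[of ?c]]
      show "AE \<omega> in M. real n * (s * (L (\<lambda>_. 1) \<omega> + 1)) \<le> \<rho> (\<lambda>_. 0) \<omega> + \<eta> \<omega>"
        by eventually_elim (simp add: algebra_simps)
    qed
    have "AE \<omega> in M. 1 * (L (\<lambda>_. 1) \<omega> + 1) \<le> 0" using *[of 1] by eventually_elim (rule le_zero_of_multiples_bounded, blast)
    moreover have "AE \<omega> in M. (-1) * (L (\<lambda>_. 1) \<omega> + 1) \<le> 0" using *[of "-1"] by eventually_elim (rule le_zero_of_multiples_bounded, blast)
    ultimately show ?thesis by eventually_elim simp
  qed
  have Lconst: "AE \<omega> in M. L (\<lambda>_. c) \<omega> = - c" for c
    using Lc[OF zero_X[of 1], of c] L1 by eventually_elim simp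
  have Lbd: "AE \<omega> in M. \<bar>L x \<omega>\<bar> \<le> R" if x: "x \<in> X" "AE \<omega> in M. \<bar>x \<omega>\<bar> \<le> R" for x R
  proof -
    have "AE \<omega> in M. L (\<lambda>_. R) \<omega> \<le> L x \<omega>" by (rule Lanti[OF x(1) zero_X]) (use x(2) in \<open>eventually_elim, simp\<close>)
    moreover have "AE \<omega> in M. L x \<omega> \<le> L (\<lambda>_. - R) \<omega>" by (rule Lanti[OF zero_X x(1)]) (use x(2) in \<open>eventually_elim, simp\<close>)
    ultimately show ?thesis using Lconst[of R] Lconst[of "- R"] by eventually_elim simp
  qed
  have LM: "L x \<in> borel_measurable M" if "x \<in> X" for x by (rule meas_F_M[OF LF[OF that]])
  have Li: "integrable M (L x)" if x: "x \<in> X" "AE \<omega> in M. \<bar>x \<omega>\<bar> \<le> R" for x R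
    by (rule integrable_const_bound[of _ R]) (use Lbd[OF x] LM[OF x(1)] in auto)
  \<comment> \<open>The Lebesgue property is applied to \<open>- t us n\<close> for each fixed
    \<open>t\<close>: the bound on \<open>t\<close> times \<open>- L (us n)\<close> tends to
    \<open>\<rho> 0 + \<eta>\<close> regardless of \<open>t\<close>, so \<open>- L (us n)\<close>
    tends to 0 a.e. Dominated convergence then passes to the integral.\<close>
  have Lcont: "(\<lambda>n. \<integral>\<omega>. L (us n) \<omega> \<partial>M) \<longlonglongrightarrow> 0"
    if us: "\<And>n. us n \<in> X" "\<And>n. AE \<omega> in M. \<bar>us n \<omega>\<bar> \<le> R" "\<And>n. AE \<omega> in M. 0 \<le> us n \<omega>"
      and lim: "AE \<omega> in M. (\<lambda>n. us n \<omega>) \<longlonglongrightarrow> 0" for us :: "nat \<Rightarrow> 'a \<Rightarrow> real" and R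
  proof -
    have "AE \<omega> in M. \<forall>t. (\<lambda>n. \<rho> (\<lambda>w. - real t * us n w) \<omega> + \<eta> \<omega>) \<longlonglongrightarrow> \<rho> (\<lambda>_. 0) \<omega> + \<eta> \<omega>"
      unfolding AE_all_countable
    proof
      fix t :: nat
      have "AE \<omega> in M. (\<lambda>n. \<rho> (\<lambda>w. - real t * us n w) \<omega>) \<longlonglongrightarrow> \<rho> (\<lambda>_. 0) \<omega>"
      proof (rule leb[unfolded lebesgue_property_def, rule_format, of _ _ "\<lambda>_. real t * R"], intro conjI allI)
        show "(\<lambda>w. - real t * us n w) \<in> X" for n by (rule cX[OF us(1)])
        show "AE \<omega> in M. (\<lambda>n. - real t * us n \<omega>) \<longlonglongrightarrow> 0" using lim
          by eventually_elim (rule tendsto_mult_right_zero)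
        show "AE \<omega> in M. \<bar>- real t * us n \<omega>\<bar> \<le> real t * R" for n using us(2)[of n]
          by eventually_elim (simp add: abs_mult mult_left_mono)
      qed (rule zero_X)+
      then show "AE \<omega> in M. (\<lambda>n. \<rho> (\<lambda>w. - real t * us n w) \<omega> + \<eta> \<omega>) \<longlonglongrightarrow> \<rho> (\<lambda>_. 0) \<omega> + \<eta> \<omega>"
        by eventually_elim (intro tendsto_intros)
    qed
    moreover have "AE \<omega> in M. \<forall>t n. real t * (- L (us n) \<omega>) \<le> \<rho> (\<lambda>w. - real t * us n w) \<omega> + \<eta> \<omega>"
      unfolding AE_all_countable
    proof (intro allI)
      fix t n :: nat
      from Lc[OF us(1)[of n], of "- real t"] Lle[OF cX[OF us(1)[of n]], of "- real t"]
      show "AE \<omega> in M. real t * (- L (us n) \<omega>) \<le> \<rho> (\<lambda>w. - real t * us n w) \<omega> + \<eta> \<omega>" by eventually_elim simp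
    qed
    moreover have "AE \<omega> in M. \<forall>n. 0 \<le> - L (us n) \<omega>" unfolding AE_all_countable
      using Lneg[OF us(1,3)] by simp
    ultimately have "AE \<omega> in M. (\<lambda>n. - L (us n) \<omega>) \<longlonglongrightarrow> 0"
    proof eventually_elim
      case (elim \<omega>)
      show ?case
        by (rule tendsto_zero_of_scaled_bounds[where b = "\<lambda>t n. \<rho> (\<lambda>w. - real t * us n w) \<omega> + \<eta> \<omega>" and c = "\<rho> (\<lambda>_. 0) \<omega> + \<eta> \<omega>"])
          (use elim in blast)+
    qed
    then have "AE \<omega> in M. (\<lambda>n. L (us n) \<omega>) \<longlonglongrightarrow> 0"
      by eventually_elim (use tendsto_minus in fastforce)
    then have "(\<lambda>n. \<integral>\<omega>. L (us n) \<omega> \<partial>M) \<longlonglongrightarrow> (\<integral>\<omega>. 0 \<partial>M)"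
      by (rule integral_dominated_convergence[where w = "\<lambda>_. R", rotated 3])
        (use LM[OF us(1)] Lbd[OF us(1,2)] in auto)
    then show ?thesis by simp
  qed
  have indX: "indicator A \<in> X" if "A \<in> sets M" for A
    by (rule X_bounded[of _ 1]) (use that in \<open>auto split: split_indicator\<close>)
  have indb: "AE \<omega> in M. \<bar>indicator A \<omega>\<bar> \<le> (1::real)" for A by (auto split: split_indicator)
  define \<nu> where "\<nu> A = - (\<integral>\<omega>. L (indicator A) \<omega> \<partial>M)" for A
  have \<nu>0: "0 \<le> \<nu> A" if "A \<in> sets M" for A
  proof -
    have "AE \<omega> in M. 0 \<le> - L (indicator A) \<omega>" using Lneg[OF indX[OF that]] by auto
    then have "0 \<le> (\<integral>\<omega>. - L (indicator A) \<omega> \<partial>M)" by (rule integral_nonneg_AE)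
    then show ?thesis by (simp add: \<nu>_def)
  qed
  have \<nu>add: "\<nu> (A \<union> B) = \<nu> A + \<nu> B" if "A \<in> sets M" "B \<in> sets M" "A \<inter> B = {}" for A B
  proof -
    have "(indicator (A \<union> B) :: 'a \<Rightarrow> real) = (\<lambda>w. indicator A w + indicator B w)"
      using that(3) by (auto simp: fun_eq_iff split: split_indicator)
    then have "AE \<omega> in M. L (indicator (A \<union> B)) \<omega> = L (indicator A) \<omega> + L (indicator B) \<omega>"
      using Ladd[OF indX[OF that(1)] indX[OF that(2)]] by simp
    then have "(\<integral>\<omega>. L (indicator (A \<union> B)) \<omega> \<partial>M) = (\<integral>\<omega>. L (indicator A) \<omega> + L (indicator B) \<omega> \<partial>M)"
      by (rule integral_cong_AE[rotated 2]) (use LM[OF indX] that in auto)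
    then show ?thesis using Li[OF indX[OF that(1)] indb] Li[OF indX[OF that(2)] indb] by (simp add: \<nu>_def)
  qed
  have \<nu>null: "\<nu> A = 0" if "A \<in> null_sets M" for A
  proof -
    have A: "A \<in> sets M" using that by auto
    have "AE \<omega> in M. L (indicator A) \<omega> = L (\<lambda>_. 0) \<omega>"
      by (rule Lcong[OF indX[OF A] z]) (use AE_not_in[OF that] in \<open>eventually_elim, simp\<close>)
    with Lconst[of 0] have "AE \<omega> in M. L (indicator A) \<omega> = 0" by eventually_elim simp
    then show ?thesis unfolding \<nu>_def by (simp add: integral_eq_zero_AE)
  qed
  define N where "N = measure_of (space M) (sets M) (\<lambda>A. ennreal (\<nu> A))"
  have sN: "sets N = sets M" and spN: "space N = space M" unfolding N_def by (auto simp: sets.sigma_sets_eq)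
  \<comment> \<open>Continuity at the empty set is \<open>Lcont\<close> for the indicators of a
    decreasing sequence of events with empty intersection.\<close>
  have ca: "countably_additive (sets M) (\<lambda>A. ennreal (\<nu> A))"
  proof (rule sets.empty_continuous_imp_countably_additive)
    show "positive (sets M) (\<lambda>A. ennreal (\<nu> A))" using \<nu>null[of "{}"] by (simp add: positive_def)
    show "additive (sets M) (\<lambda>A. ennreal (\<nu> A))" unfolding additive_def using \<nu>add \<nu>0 by (auto simp: ennreal_plus[symmetric] simp del: ennreal_plus)
    fix A :: "nat \<Rightarrow> 'a set" assume A: "range A \<subseteq> sets M" "decseq A" "(\<Inter>i. A i) = {}"
    have "AE \<omega> in M. (\<lambda>n. indicator (A n) \<omega> :: real) \<longlonglongrightarrow> 0"
      using LIMSEQ_indicator_decseq[OF A(2)] A(3) by auto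
    then have "(\<lambda>n. \<integral>\<omega>. L (indicator (A n)) \<omega> \<partial>M) \<longlonglongrightarrow> 0"
      by (rule Lcont[OF indX indb, rotated 2]) (use A(1) in auto)
    then have "(\<lambda>n. \<nu> (A n)) \<longlonglongrightarrow> 0" unfolding \<nu>_def using tendsto_minus by fastforce
    then show "(\<lambda>n. ennreal (\<nu> (A n))) \<longlonglongrightarrow> 0" using tendsto_ennrealI by fastforce
  qed auto
  have eN: "emeasure N A = ennreal (\<nu> A)" if "A \<in> sets M" for A
    using emeasure_measure_of_sigma[OF sets.sigma_algebra_axioms _ ca that] \<nu>null[of "{}"]
    by (simp add: N_def positive_def)
  have "absolutely_continuous M N" unfolding absolutely_continuous_def
    using eN \<nu>null by (auto simp: null_sets_def sN)
  from Radon_Nikodym[OF this sN] obtain f where fm[measurable]: "f \<in> borel_measurable M" and f: "density M f = N" by blast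
  have fint: "(\<integral>\<^sup>+\<omega>. f \<omega> * indicator A \<omega> \<partial>M) = ennreal (\<nu> A)" if "A \<in> sets M" for A
    using eN[OF that] emeasure_density[OF fm that] unfolding f by simp
  have ffin: "AE \<omega> in M. f \<omega> \<noteq> \<infinity>"
  proof (rule nn_integral_PInf_AE[OF fm])
    have "(\<integral>\<^sup>+\<omega>. f \<omega> \<partial>M) = (\<integral>\<^sup>+\<omega>. f \<omega> * indicator (space M) \<omega> \<partial>M)" by (rule nn_integral_cong) simp
    then show "(\<integral>\<^sup>+\<omega>. f \<omega> \<partial>M) \<noteq> \<infinity>" using fint[of "space M"] by simp
  qed
  define y where "y \<omega> = - enn2real (f \<omega>)" for \<omega>
  have [measurable]: "y \<in> borel_measurable M" unfolding y_def by measurable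
  have fy: "AE \<omega> in M. f \<omega> = ennreal (- y \<omega>)" using ffin by eventually_elim (simp add: y_def less_top)
  have y0: "y \<omega> \<le> 0" for \<omega> by (simp add: y_def)
  have yA: "(\<integral>\<^sup>+\<omega>. ennreal (- y \<omega> * indicator A \<omega>) \<partial>M) = ennreal (\<nu> A)" if "A \<in> sets M" for A
  proof -
    have "(\<integral>\<^sup>+\<omega>. ennreal (- y \<omega> * indicator A \<omega>) \<partial>M) = (\<integral>\<^sup>+\<omega>. f \<omega> * indicator A \<omega> \<partial>M)"
      by (rule nn_integral_cong_AE) (use fy in \<open>eventually_elim, auto split: split_indicator\<close>)
    then show ?thesis using fint[OF that] by simp
  qed
  have yi: "integrable M y"
  proof -
    have "(\<integral>\<^sup>+\<omega>. ennreal (norm (y \<omega>)) \<partial>M) = (\<integral>\<^sup>+\<omega>. ennreal (- y \<omega> * indicator (space M) \<omega>) \<partial>M)"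
      using y0 by (intro nn_integral_cong) (simp add: abs_of_nonpos)
    then show ?thesis using yA[of "space M"] by (intro integrableI_bounded) auto
  qed
  have yL: "y \<in> L1F" by (rule integrable_L1F[OF yi])
  have xyi: "integrable M (\<lambda>\<omega>. x \<omega> * y \<omega>)" if x: "x \<in> X" "AE \<omega> in M. \<bar>x \<omega>\<bar> \<le> R" for x R
  proof (rule Bochner_Integration.integrable_bound)
    show "integrable M (\<lambda>\<omega>. R * y \<omega>)" using yi by simp
    show "(\<lambda>\<omega>. x \<omega> * y \<omega>) \<in> borel_measurable M" using X_meas[OF x(1)] by measurable
    show "AE \<omega> in M. norm (x \<omega> * y \<omega>) \<le> norm (R * y \<omega>)" using x(2)
      by eventually_elim (auto simp: abs_mult intro!: mult_right_mono)
  qed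
  \<comment> \<open>Agreement on indicators is extended by the standard induction on nonnegative
    measurable functions. In the step for increasing sequences the differences to the limit decrease
    to 0, where \<open>Lcont\<close> is available; the bound \<open>R\<close> is generalised because
    rescaling changes it.\<close>
  have nonneg_case: "u \<in> X \<Longrightarrow> (AE \<omega> in M. \<bar>u \<omega>\<bar> \<le> R) \<Longrightarrow> (\<integral>\<omega>. u \<omega> * y \<omega> \<partial>M) = (\<integral>\<omega>. L u \<omega> \<partial>M)"
    if "u \<in> borel_measurable M" "\<And>\<omega>. 0 \<le> u \<omega>" for u R
    using that
  proof (induction u arbitrary: R rule: borel_measurable_induct_real)
    case (set A)
    have "(\<integral>\<omega>. - y \<omega> * indicator A \<omega> \<partial>M) = \<nu> A"
      using yA[OF set.hyps(1)] set.hyps(1) y0 \<nu>0[OF set.hyps(1)] by (subst integral_eq_nn_integral) (auto split: split_indicator)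
    then show ?case by (simp add: \<nu>_def mult.commute)
  next
    case (mult u c)
    show ?case
    proof (cases "c = 0")
      case True
      have "(\<integral>\<omega>. L (\<lambda>_. 0) \<omega> \<partial>M) = 0" using Lconst[of 0] by (simp add: integral_eq_zero_AE)
      then show ?thesis using True by simp
    next
      case False
      then have c: "0 < c" using mult.hyps(1) by simp
      have ue: "(\<lambda>w. (1 / c) * (c * u w)) = u" using c by auto
      have uX: "u \<in> X" using cX[OF mult.prems(1), of "1 / c"] unfolding ue .
      have ub: "AE \<omega> in M. \<bar>u \<omega>\<bar> \<le> R / c" using mult.prems(2)
        by eventually_elim (use c in \<open>simp add: abs_mult field_simps\<close>)
      have "(\<integral>\<omega>. L (\<lambda>w. c * u w) \<omega> \<partial>M) = (\<integral>\<omega>. c * L u \<omega> \<partial>M)"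
        by (rule integral_cong_AE) (use Lc[OF uX] LM uX mult.prems(1) in auto)
      moreover have "(\<integral>\<omega>. c * u \<omega> * y \<omega> \<partial>M) = c * (\<integral>\<omega>. u \<omega> * y \<omega> \<partial>M)" by (simp add: mult.assoc)
      ultimately show ?thesis using mult.IH[OF uX ub] by simp
    qed
  next
    case (add u v)
    have b: "AE \<omega> in M. \<bar>u \<omega>\<bar> \<le> R" "AE \<omega> in M. \<bar>v \<omega>\<bar> \<le> R"
    proof -
      show "AE \<omega> in M. \<bar>u \<omega>\<bar> \<le> R" using add.prems(2)
      proof eventually_elim
        case (elim \<omega>) then show ?case using add.hyps(2)[of \<omega>] add.hyps(4)[of \<omega>] by simp
      qed
      show "AE \<omega> in M. \<bar>v \<omega>\<bar> \<le> R" using add.prems(2)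
      proof eventually_elim
        case (elim \<omega>) then show ?case using add.hyps(2)[of \<omega>] add.hyps(4)[of \<omega>] by simp
      qed
    qed
    have uX: "u \<in> X" "v \<in> X" using X_I[OF add.hyps(1) _ b(1)] X_I[OF add.hyps(3) _ b(2)] by auto
    have "(\<integral>\<omega>. L (\<lambda>w. v w + u w) \<omega> \<partial>M) = (\<integral>\<omega>. L v \<omega> + L u \<omega> \<partial>M)"
      by (rule integral_cong_AE) (use Ladd[OF uX(2,1)] LM[OF uX(1)] LM[OF uX(2)] LM[OF add.prems(1)] in auto)
    also have "\<dots> = (\<integral>\<omega>. v \<omega> * y \<omega> \<partial>M) + (\<integral>\<omega>. u \<omega> * y \<omega> \<partial>M)"
      using add.IH(1)[OF uX(1) b(1)] add.IH(2)[OF uX(2) b(2)] Li[OF uX(1) b(1)] Li[OF uX(2) b(2)] by simp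
    also have "\<dots> = (\<integral>\<omega>. (v \<omega> + u \<omega>) * y \<omega> \<partial>M)"
      unfolding distrib_right by (rule Bochner_Integration.integral_add[symmetric, OF xyi[OF uX(2) b(2)] xyi[OF uX(1) b(1)]])
    finally show ?case by simp
  next
    case (seq U)
    have Ule: "U i \<omega> \<le> u \<omega>" if "\<omega> \<in> space M" for i \<omega>
      by (rule incseq_le[OF _ seq.hyps(4)[OF that]]) (use seq.hyps(3) in \<open>auto simp: incseq_def le_fun_def\<close>)
    have Ub: "AE \<omega> in M. \<bar>U i \<omega>\<bar> \<le> R" for i using seq.prems(2) AE_space
    proof eventually_elim
      case (elim \<omega>) then show ?case using Ule[of \<omega> i] seq.hyps(2)[of i \<omega>] by simp
    qed
    have UX: "U i \<in> X" for i using X_I[OF seq.hyps(1) _ Ub] by auto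
    define d where "d i \<omega> = u \<omega> - U i \<omega>" for i \<omega>
    have dX: "d i \<in> X" for i unfolding d_def by (rule X_diff[OF seq.prems(1) UX])
    have d0: "AE \<omega> in M. 0 \<le> d i \<omega>" for i using AE_space by eventually_elim (simp add: d_def Ule)
    have db: "AE \<omega> in M. \<bar>d i \<omega>\<bar> \<le> R" for i using seq.prems(2) AE_space
    proof eventually_elim
      case (elim \<omega>) then show ?case using Ule[of \<omega> i] seq.hyps(2)[of i \<omega>] by (simp add: d_def)
    qed
    have dl: "AE \<omega> in M. (\<lambda>i. d i \<omega>) \<longlonglongrightarrow> 0" using AE_space
    proof eventually_elim
      case (elim \<omega>) from tendsto_diff[OF tendsto_const[of "u \<omega>"] seq.hyps(4)[OF elim]] show ?case by (simp add: d_def)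
    qed
    have "(\<lambda>i. (\<integral>\<omega>. L u \<omega> \<partial>M) - (\<integral>\<omega>. L (d i) \<omega> \<partial>M)) \<longlonglongrightarrow> (\<integral>\<omega>. L u \<omega> \<partial>M) - 0"
      by (intro tendsto_intros Lcont[OF dX db d0 dl])
    moreover have "(\<integral>\<omega>. L u \<omega> \<partial>M) - (\<integral>\<omega>. L (d i) \<omega> \<partial>M) = (\<integral>\<omega>. U i \<omega> * y \<omega> \<partial>M)" for i
    proof -
      have "AE \<omega> in M. L (\<lambda>w. U i w + d i w) \<omega> = L (U i) \<omega> + L (d i) \<omega>" by (rule Ladd[OF UX dX])
      then have "(\<integral>\<omega>. L u \<omega> \<partial>M) = (\<integral>\<omega>. L (U i) \<omega> + L (d i) \<omega> \<partial>M)"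
        by (intro integral_cong_AE) (use LM[OF UX] LM[OF dX] LM[OF seq.prems(1)] in \<open>auto simp: d_def\<close>)
      then show ?thesis using Li[OF UX Ub] Li[OF dX db] seq.IH[OF UX Ub] by simp
    qed
    ultimately have 1: "(\<lambda>i. \<integral>\<omega>. U i \<omega> * y \<omega> \<partial>M) \<longlonglongrightarrow> (\<integral>\<omega>. L u \<omega> \<partial>M)" by simp
    have "(\<lambda>i. \<integral>\<omega>. U i \<omega> * y \<omega> \<partial>M) \<longlonglongrightarrow> (\<integral>\<omega>. u \<omega> * y \<omega> \<partial>M)"
    proof (rule integral_dominated_convergence)
      show "integrable M (\<lambda>\<omega>. R * \<bar>y \<omega>\<bar>)" using yi by simp
      show "AE \<omega> in M. (\<lambda>i. U i \<omega> * y \<omega>) \<longlonglongrightarrow> u \<omega> * y \<omega>" using AE_space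
        by eventually_elim (intro tendsto_intros seq.hyps(4))
      show "AE \<omega> in M. norm (U i \<omega> * y \<omega>) \<le> R * \<bar>y \<omega>\<bar>" for i using Ub[of i]
        by eventually_elim (auto simp: abs_mult intro!: mult_right_mono)
    qed (use X_meas[OF UX] X_meas[OF seq.prems(1)] in measurable)
    from LIMSEQ_unique[OF this 1] show ?case .
  qed
  have bounded_case: "(\<integral>\<omega>. x \<omega> * y \<omega> \<partial>M) = (\<integral>\<omega>. L x \<omega> \<partial>M)" if x: "x \<in> X" "AE \<omega> in M. \<bar>x \<omega>\<bar> \<le> R" for x R
  proof -
    note [measurable] = X_meas[OF x(1)]
    let ?p = "\<lambda>\<omega>. max (x \<omega>) 0" and ?m = "\<lambda>\<omega>. max (- x \<omega>) 0"
    have "AE \<omega> in M. \<bar>?p \<omega>\<bar> \<le> R \<and> \<bar>?m \<omega>\<bar> \<le> R" using x(2) by eventually_elim auto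
    then have pb: "AE \<omega> in M. \<bar>?p \<omega>\<bar> \<le> R" "AE \<omega> in M. \<bar>?m \<omega>\<bar> \<le> R" by (simp_all add: AE_conj_iff)
    have pX: "?p \<in> X" "?m \<in> X" using X_I[OF _ _ pb(1)] X_I[OF _ _ pb(2)] by auto
    have p: "(\<integral>\<omega>. ?p \<omega> * y \<omega> \<partial>M) = (\<integral>\<omega>. L ?p \<omega> \<partial>M)" by (rule nonneg_case[OF _ _ pX(1) pb(1)]) auto
    have m: "(\<integral>\<omega>. ?m \<omega> * y \<omega> \<partial>M) = (\<integral>\<omega>. L ?m \<omega> \<partial>M)" by (rule nonneg_case[OF _ _ pX(2) pb(2)]) auto
    have e: "(\<lambda>w. x w + ?m w) = ?p" by (auto simp: max_def)
    have "AE \<omega> in M. L (\<lambda>w. x w + ?m w) \<omega> = L x \<omega> + L ?m \<omega>" by (rule Ladd[OF x(1) pX(2)])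
    then have "(\<integral>\<omega>. L ?p \<omega> \<partial>M) = (\<integral>\<omega>. L x \<omega> + L ?m \<omega> \<partial>M)" unfolding e
      by (intro integral_cong_AE) (use LM[OF pX(1)] LM[OF pX(2)] LM[OF x(1)] in auto)
    also have "\<dots> = (\<integral>\<omega>. L x \<omega> \<partial>M) + (\<integral>\<omega>. L ?m \<omega> \<partial>M)" by (rule Bochner_Integration.integral_add[OF Li[OF x] Li[OF pX(2) pb(2)]])
    finally have 1: "(\<integral>\<omega>. L x \<omega> \<partial>M) = (\<integral>\<omega>. L ?p \<omega> \<partial>M) - (\<integral>\<omega>. L ?m \<omega> \<partial>M)" by simp
    have "(\<integral>\<omega>. x \<omega> * y \<omega> \<partial>M) = (\<integral>\<omega>. ?p \<omega> * y \<omega> - ?m \<omega> * y \<omega> \<partial>M)"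
      by (rule Bochner_Integration.integral_cong) (auto simp: max_def)
    also have "\<dots> = (\<integral>\<omega>. ?p \<omega> * y \<omega> \<partial>M) - (\<integral>\<omega>. ?m \<omega> * y \<omega> \<partial>M)"
      by (rule Bochner_Integration.integral_diff[OF xyi[OF pX(1) pb(1)] xyi[OF pX(2) pb(2)]])
    finally show ?thesis using 1 p m by simp
  qed
  \<comment> \<open>Equality of integrals becomes equality of conditional expectations by testing
    with \<open>1\<^sub>A x\<close> for \<open>A\<close> in F and using homogeneity of
    \<open>L\<close> under F-measurable factors.\<close>
  have CEb: "AE \<omega> in M. CE (\<lambda>w. x w * y w) \<omega> = L x \<omega>" if x: "x \<in> X" "AE \<omega> in M. \<bar>x \<omega>\<bar> \<le> R" for x R
  proof (rule real_cond_exp_charact[OF _ xyi[OF x] Li[OF x] LF[OF x(1)]])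
    fix A assume A[measurable]: "A \<in> sets F"
    have iF: "(indicator A :: 'a \<Rightarrow> real) \<in> borel_measurable F" by measurable
    have iX: "(\<lambda>w. indicator A w * x w) \<in> X" by (rule X_multF[OF iF x(1)])
    have ib: "AE \<omega> in M. \<bar>indicator A \<omega> * x \<omega>\<bar> \<le> R" using x(2) by eventually_elim (auto split: split_indicator)
    have "(\<integral>\<omega>\<in>A. x \<omega> * y \<omega> \<partial>M) = (\<integral>\<omega>. (indicator A \<omega> * x \<omega>) * y \<omega> \<partial>M)" by (simp add: set_lebesgue_integral_def mult.assoc)
    also have "\<dots> = (\<integral>\<omega>. L (\<lambda>w. indicator A w * x w) \<omega> \<partial>M)" by (rule bounded_case[OF iX ib])
    also have "\<dots> = (\<integral>\<omega>. indicator A \<omega> * L x \<omega> \<partial>M)"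
      by (rule integral_cong_AE) (use LM[OF iX] LM[OF x(1)] meas_F_M[OF iF] Lmult[OF iF x(1)] in auto)
    finally show "(\<integral>\<omega>\<in>A. x \<omega> * y \<omega> \<partial>M) = (\<integral>\<omega>\<in>A. L x \<omega> \<partial>M)" by (simp add: set_lebesgue_integral_def)
  qed
  have "AE \<omega> in M. CE (\<lambda>w. x w * y w) \<omega> = L x \<omega>" if x: "x \<in> X" for x
  proof -
    obtain h where h[measurable]: "h \<in> borel_measurable F" and h0: "\<And>\<omega>. 0 \<le> h \<omega>" and hb: "AE \<omega> in M. \<bar>x \<omega>\<bar> \<le> h \<omega>"
      using X_bound[OF x] by blast
    \<comment> \<open>Scaling by a positive F-measurable factor makes \<open>x\<close> bounded; the
      factor comes out of both sides and is cancelled.\<close>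
    define k where "k \<omega> = 1 / (1 + h \<omega>)" for \<omega>
    have kF: "k \<in> borel_measurable F" unfolding k_def by measurable
    have k0: "0 < k \<omega>" for \<omega> using h0[of \<omega>] by (simp add: k_def)
    have kX: "(\<lambda>w. k w * x w) \<in> X" by (rule X_multF[OF kF x])
    have "AE \<omega> in M. \<bar>k \<omega> * x \<omega>\<bar> \<le> 1" using hb
    proof eventually_elim
      case (elim \<omega>) then show ?case using h0[of \<omega>] by (simp add: k_def abs_div field_simps)
    qed
    from CEb[OF kX this] have "AE \<omega> in M. CE (\<lambda>w. (k w * x w) * y w) \<omega> = L (\<lambda>w. k w * x w) \<omega>" .
    moreover have "AE \<omega> in M. CE (\<lambda>w. k w * (x w * y w)) \<omega> = k \<omega> * CE (\<lambda>w. x w * y w) \<omega>"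
      by (rule CE_mult[OF kF L1F_multX[OF x yL]])
    ultimately show ?thesis using Lmult[OF kF x] unfolding mult.assoc
    proof eventually_elim
      case (elim \<omega>)
      then have "k \<omega> * CE (\<lambda>w. x w * y w) \<omega> = k \<omega> * L x \<omega>" by simp
      then show ?case using k0[of \<omega>] by simp
    qed
  qed
  then show ?thesis using yL by blast
qed

end

section \<open>Stable compactness of sublevel sets\<close>

lemma filter_base_finite_Inter:
  assumes "filter_base \<G>" "finite I" "\<And>i. i \<in> I \<Longrightarrow> T i \<in> \<G>"
  shows "\<exists>S\<in>\<G>. \<forall>i\<in>I. S \<subseteq> T i"
  using assms(2,3)
proof (induction I)
  case empty
  then show ?case using assms(1) by (auto simp: filter_base_def)
next
  case (insert i I)
  then obtain S where S: "S \<in> \<G>" "\<forall>i\<in>I. S \<subseteq> T i" by auto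
  then obtain S' where S': "S' \<in> \<G>" "S' \<subseteq> S \<inter> T i"
    using assms(1) insert.prems[of i] unfolding filter_base_def by (metis insertI1)
  then show ?case using S(2) by (intro bexI[of _ S']) auto
qed

context conditional_risk
begin

lemma CE_local_mult:
  assumes "x \<in> X" "y \<in> L1F" "y' \<in> L1F" "A \<in> sets F" "AE \<omega> in M. \<omega> \<in> A \<longrightarrow> y \<omega> = y' \<omega>"
  shows "AE \<omega> in M. \<omega> \<in> A \<longrightarrow> CE (\<lambda>w. x w * y w) \<omega> = CE (\<lambda>w. x w * y' w) \<omega>"
  by (rule CE_local[OF L1F_multX[OF assms(1,2)] L1F_multX[OF assms(1,3)] assms(4)])
     (use assms(5) in \<open>eventually_elim, simp\<close>)

lemma CE_cong_mult:
  assumes "x \<in> X" "y \<in> L1F" "y' \<in> L1F" "AE \<omega> in M. y \<omega> = y' \<omega>"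
  shows "AE \<omega> in M. CE (\<lambda>w. x w * y w) \<omega> = CE (\<lambda>w. x w * y' w) \<omega>"
  by (rule real_cond_exp_cong)
     (use assms(4) L1F_meas[OF L1F_multX[OF assms(1,2)]] L1F_meas[OF L1F_multX[OF assms(1,3)]] in auto)

text \<open>The bound \<open>h\<close> may depend on \<open>y\<close> as long as it does so locally.
  This covers the ordinary sublevel sets and the sets of nearly optimal densities, whose bound
  contains a pairing with \<open>y\<close>.\<close>

lemma fen_sublevel_stable:
  assumes ne: "{y \<in> L1F. AE \<omega> in M. fen y \<omega> \<le> ereal (h y \<omega>)} \<noteq> {}"
    and loc: "\<And>y y' A. y \<in> L1F \<Longrightarrow> y' \<in> L1F \<Longrightarrow> A \<in> sets F \<Longrightarrow> AE \<omega> in M. \<omega> \<in> A \<longrightarrow> y \<omega> = y' \<omega> \<Longrightarrow>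
       AE \<omega> in M. \<omega> \<in> A \<longrightarrow> h y \<omega> = h y' \<omega>"
  shows "stable_set M F {y \<in> L1F. AE \<omega> in M. fen y \<omega> \<le> ereal (h y \<omega>)}" (is "stable_set M F ?S")
proof (rule stable_setI[OF ne])
  show "?S \<subseteq> borel_measurable M" using L1F_meas by auto
  have transfer: "AE \<omega> in M. \<omega> \<in> A \<longrightarrow> fen y' \<omega> \<le> ereal (h y' \<omega>)"
    if "y \<in> ?S" "y' \<in> L1F" "A \<in> sets F" "AE \<omega> in M. \<omega> \<in> A \<longrightarrow> y \<omega> = y' \<omega>" for y y' A
  proof -
    have y: "y \<in> L1F" "AE \<omega> in M. fen y \<omega> \<le> ereal (h y \<omega>)" using that(1) by auto
    show ?thesis using y(2) loc[OF y(1) that(2-4)] fen_local[OF y(1) that(2-4)]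
      by eventually_elim auto
  qed
  show "y' \<in> ?S" if y: "y \<in> ?S" "y' \<in> borel_measurable M" "AE \<omega> in M. y' \<omega> = y \<omega>" for y y'
  proof -
    have y': "y' \<in> L1F" using L1F_AE[OF _ y(2,3)] y(1) by auto
    have "AE \<omega> in M. \<omega> \<in> space F \<longrightarrow> fen y' \<omega> \<le> ereal (h y' \<omega>)"
      by (rule transfer[OF y(1) y']) (use y(3) in \<open>auto elim: eventually_mono\<close>)
    then have "AE \<omega> in M. fen y' \<omega> \<le> ereal (h y' \<omega>)" using AE_space by eventually_elim (simp add: space_F)
    then show ?thesis using y' by simp
  qed
  show "concat_rv a y \<in> ?S" if a: "event_partition F a" and y: "\<And>k. y k \<in> ?S" for a y
  proof -
    have yL: "y k \<in> L1F" for k using y by auto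
    have c: "concat_rv a y \<in> L1F" by (rule L1F_concat[OF a yL])
    have "AE \<omega> in M. fen (concat_rv a y) \<omega> \<le> ereal (h (concat_rv a y) \<omega>)"
    proof (rule partition_AE[OF a])
      fix k
      show "AE \<omega> in M. \<omega> \<in> a k \<longrightarrow> fen (concat_rv a y) \<omega> \<le> ereal (h (concat_rv a y) \<omega>)"
        by (rule transfer[OF y[of k] c event_partitionD(1)[OF a]]) (simp add: concat_rv_on[OF a])
    qed
    then show ?thesis using c by simp
  qed
qed

lemma sublevel_densities: "y \<in> L1F \<Longrightarrow> AE \<omega> in M. fen y \<omega> \<le> ereal (\<eta> \<omega>) \<Longrightarrow> y \<in> densities"
proof -
  assume y: "y \<in> L1F" "AE \<omega> in M. fen y \<omega> \<le> ereal (\<eta> \<omega>)"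
  have "AE \<omega> in M. fen y \<omega> < \<infinity>" using y(2) by eventually_elim auto
  then show ?thesis using y(1) fen_finite_imp by (simp add: densities_def)
qed

text \<open>The limit \<open>r\<close> is the conditional limes superior of \<open>E[xz|F]\<close> along the filter base.\<close>

lemma maximal_filter_limit:
  assumes V: "stable_set M F V" "V \<subseteq> densities"
    and fb: "filter_base \<G>" and GV: "\<And>S. S \<in> \<G> \<Longrightarrow> stable_set M F S" "\<And>S. S \<in> \<G> \<Longrightarrow> S \<subseteq> V"
    and mem: "\<And>T. stable_set M F T \<Longrightarrow> T \<subseteq> V \<Longrightarrow> (\<And>G. G \<in> \<G> \<Longrightarrow> T \<inter> G \<noteq> {}) \<Longrightarrow> T \<in> \<G>"
    and cc: "\<And>S a. (\<And>k. S k \<in> \<G>) \<Longrightarrow> event_partition F a \<Longrightarrow> concat_sets M a S \<in> \<G>"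
    and x: "x \<in> X"
  shows "\<exists>r\<in>borel_measurable F. \<forall>\<epsilon>\<in>borel_measurable F. (\<forall>\<omega>. 0 < \<epsilon> \<omega>) \<longrightarrow>
    {z \<in> V. AE \<omega> in M. \<bar>CE (\<lambda>w. x w * z w) \<omega> - r \<omega>\<bar> \<le> \<epsilon> \<omega>} \<in> \<G>"
proof -
  have VL: "z \<in> L1F" if "z \<in> V" for z using that V(2) densitiesD(1) by blast
  obtain b where b[measurable]: "b \<in> borel_measurable F" and bx: "AE \<omega> in M. \<bar>x \<omega>\<bar> \<le> b \<omega>" using X_bound[OF x] by blast
  have CEb: "AE \<omega> in M. \<bar>CE (\<lambda>w. x w * z w) \<omega>\<bar> \<le> b \<omega>" if "z \<in> V" for z
    using CE_mult_bound[OF x b bx] densitiesD that V(2) by blast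
  define H where "H z \<omega> = ereal (CE (\<lambda>w. x w * z w) \<omega>)" for z \<omega>
  have Hm: "H z \<in> borel_measurable F" for z unfolding H_def by measurable
  have Hr: "AE \<omega> in M. H z \<omega> = H z \<omega>" for z by simp
  define h where "h B = ess_sup_family M F (H ` B)" for B
  have ne: "B \<noteq> {}" if "B \<in> \<G>" for B using stable_setD(1)[OF GV(1)[OF that]] .
  have hm: "h B \<in> borel_measurable F" if "B \<in> \<G>" for B
    unfolding h_def by (rule ess_sup_family_meas[where H = H and H' = H, OF ne[OF that] Hm Hr])
  have hge: "AE \<omega> in M. H z \<omega> \<le> h B \<omega>" if "B \<in> \<G>" "z \<in> B" for B z
    unfolding h_def by (rule ess_sup_family_ge[where H = H and H' = H, OF ne[OF that(1)] Hm Hr that(2)])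
  have hle: "AE \<omega> in M. h B \<omega> \<le> ereal (b \<omega>)" if "B \<in> \<G>" for B
    unfolding h_def
  proof (rule ess_sup_family_le[where H = H and H' = H, OF ne[OF that] Hm Hr])
    fix z assume "z \<in> B"
    then have "z \<in> V" using GV(2)[OF that] by blast
    from CEb[OF this] show "AE \<omega> in M. H z \<omega> \<le> ereal (b \<omega>)" by eventually_elim (simp add: H_def abs_le_iff)
  qed measurable
  have hlo: "AE \<omega> in M. ereal (- b \<omega>) \<le> h B \<omega>" if "B \<in> \<G>" for B
  proof -
    obtain z where z: "z \<in> B" using ne[OF \<open>B \<in> \<G>\<close>] by blast
    then have "z \<in> V" using GV(2)[OF that] by blast
    from CEb[OF this] hge[OF that z] show ?thesis
    proof eventually_elim
      case (elim \<omega>)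
      then have "ereal (- b \<omega>) \<le> H z \<omega>" by (simp add: H_def abs_le_iff)
      then show ?case using elim(2) by (rule order_trans)
    qed
  qed
  \<comment> \<open>The essential infimum over the filter of the suprema \<open>h B\<close> is taken
    as the negative of an essential supremum, so that the selection lemma applies to it as
    well.\<close>
  define N where "N B \<omega> = - h B \<omega>" for B \<omega>
  have Nm: "N B \<in> borel_measurable F" if "B \<in> \<G>" for B
  proof -
    note [measurable] = hm[OF that]
    show ?thesis unfolding N_def by measurable
  qed
  have Nr: "AE \<omega> in M. N B \<omega> = N B \<omega>" for B by simp
  have Gne: "\<G> \<noteq> {}" using fb by (auto simp: filter_base_def)
  then obtain B1 where B1: "B1 \<in> \<G>" by blast
  define g where "g = ess_sup_family M F (N ` \<G>)"
  have gm[measurable]: "g \<in> borel_measurable F"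
    unfolding g_def by (rule ess_sup_family_meas[where H = N and H' = N, OF Gne Nm Nr])
  have gge: "AE \<omega> in M. N B \<omega> \<le> g \<omega>" if "B \<in> \<G>" for B
    unfolding g_def by (rule ess_sup_family_ge[where H = N and H' = N, OF Gne Nm Nr that])
  have gle: "AE \<omega> in M. g \<omega> \<le> ereal (b \<omega>)"
    unfolding g_def
  proof (rule ess_sup_family_le[where H = N and H' = N, OF Gne Nm Nr])
    fix B assume "B \<in> \<G>"
    from hlo[OF this] show "AE \<omega> in M. N B \<omega> \<le> ereal (b \<omega>)"
    proof eventually_elim
      case (elim \<omega>)
      then show ?case unfolding N_def by (cases "h B \<omega>") auto
    qed
  qed measurable
  define r where "r \<omega> = - real_of_ereal (g \<omega>)" for \<omega>
  have rm[measurable]: "r \<in> borel_measurable F" unfolding r_def by measurable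
  have gr: "AE \<omega> in M. g \<omega> = ereal (- r \<omega>)"
    using gle gge[OF B1] hle[OF B1]
  proof eventually_elim
    case (elim \<omega>)
    have "g \<omega> \<noteq> \<infinity>" using elim(1) by auto
    moreover have "g \<omega> \<noteq> -\<infinity>" using elim(2,3) unfolding N_def by (cases "h B1 \<omega>") auto
    ultimately show ?case by (cases "g \<omega>") (auto simp: r_def)
  qed
  have "{z \<in> V. AE \<omega> in M. \<bar>CE (\<lambda>w. x w * z w) \<omega> - r \<omega>\<bar> \<le> \<epsilon> \<omega>} \<in> \<G>" (is "?T \<in> \<G>")
    if \<epsilon>[measurable]: "\<epsilon> \<in> borel_measurable F" and \<epsilon>0: "\<And>\<omega>. 0 < \<epsilon> \<omega>" for \<epsilon>
  proof -
    \<comment> \<open>Members whose suprema lie below \<open>r + \<epsilon>\<close> on the pieces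
      are glued by \<open>cc\<close> into one member, which bounds the pairing from above. Inside
      its intersection with \<open>B\<close> there is a member \<open>C\<close> with supremum at
      least \<open>r\<close>; near-maximisers from \<open>C\<close> are glued to satisfy the lower
      bound.\<close>
    have meets: "?T \<inter> B \<noteq> {}" if B: "B \<in> \<G>" for B
    proof -
      have "AE \<omega> in M. ereal (- r \<omega> - \<epsilon> \<omega>) < g \<omega>" using gr by eventually_elim (simp add: \<epsilon>0)
      then obtain a Bs where a: "event_partition F a" and Bs: "\<And>k. Bs k \<in> \<G>"
        and up: "AE \<omega> in M. \<forall>k. \<omega> \<in> a k \<longrightarrow> ereal (- r \<omega> - \<epsilon> \<omega>) < N (Bs k) \<omega>"
        using ess_sup_family_select[where H = N and H' = N and f = "\<lambda>\<omega>. ereal (- r \<omega> - \<epsilon> \<omega>)", OF Gne Nm Nr]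
        unfolding g_def by auto
      have B0: "concat_sets M a Bs \<in> \<G>" by (rule cc[OF Bs a])
      obtain C where C: "C \<in> \<G>" "C \<subseteq> B \<inter> concat_sets M a Bs" using fb B B0 unfolding filter_base_def by meson
      have "AE \<omega> in M. ereal (r \<omega> - \<epsilon> \<omega>) < ess_sup_family M F (H ` C) \<omega>"
        using gge[OF C(1)] gr unfolding h_def[symmetric]
      proof eventually_elim
        case (elim \<omega>)
        then show ?case using \<epsilon>0[of \<omega>] unfolding N_def by (cases "h C \<omega>") auto
      qed
      then obtain d zs where d: "event_partition F d" and zs: "\<And>k. zs k \<in> C"
        and lo: "AE \<omega> in M. \<forall>k. \<omega> \<in> d k \<longrightarrow> ereal (r \<omega> - \<epsilon> \<omega>) < H (zs k) \<omega>"
        using ess_sup_family_select[where H = H and H' = H and S = C and f = "\<lambda>\<omega>. ereal (r \<omega> - \<epsilon> \<omega>)", OF ne[OF C(1)] Hm Hr]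
        by auto
      define z where "z = concat_rv d zs"
      have zC: "z \<in> C" unfolding z_def by (rule stable_setD(4)[OF GV(1)[OF C(1)] d zs])
      have zV: "z \<in> V" using zC GV(2)[OF C(1)] by blast
      have zsV: "zs k \<in> V" for k using zs GV(2)[OF C(1)] by blast
      have "AE \<omega> in M. r \<omega> - \<epsilon> \<omega> < CE (\<lambda>w. x w * z w) \<omega>"
      proof (rule partition_AE[OF d])
        fix k
        have "AE \<omega> in M. \<omega> \<in> d k \<longrightarrow> CE (\<lambda>w. x w * z w) \<omega> = CE (\<lambda>w. x w * zs k w) \<omega>"
          by (rule CE_local_mult[OF x VL[OF zV] VL[OF zsV] event_partitionD(1)[OF d]])
            (simp add: z_def concat_rv_on[OF d])
        with lo show "AE \<omega> in M. \<omega> \<in> d k \<longrightarrow> r \<omega> - \<epsilon> \<omega> < CE (\<lambda>w. x w * z w) \<omega>"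
          by eventually_elim (auto simp: H_def)
      qed
      moreover have "AE \<omega> in M. CE (\<lambda>w. x w * z w) \<omega> < r \<omega> + \<epsilon> \<omega>"
      proof -
        have "z \<in> concat_sets M a Bs" using zC C(2) by blast
        then obtain ws where ws: "\<And>k. ws k \<in> Bs k" and zw: "AE \<omega> in M. z \<omega> = concat_rv a ws \<omega>"
          by (auto simp: concat_sets_def)
        have wV: "ws k \<in> V" for k using ws GV(2)[OF Bs] by blast
        show ?thesis
        proof (rule partition_AE[OF a])
          fix k
          have "AE \<omega> in M. \<omega> \<in> a k \<longrightarrow> CE (\<lambda>w. x w * z w) \<omega> = CE (\<lambda>w. x w * ws k w) \<omega>"
            by (rule CE_local_mult[OF x VL[OF zV] VL[OF wV] event_partitionD(1)[OF a]])
              (use zw in \<open>eventually_elim, simp add: concat_rv_on[OF a]\<close>)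
          with up hge[OF Bs[of k] ws[of k]] show "AE \<omega> in M. \<omega> \<in> a k \<longrightarrow> CE (\<lambda>w. x w * z w) \<omega> < r \<omega> + \<epsilon> \<omega>"
          proof eventually_elim
            case (elim \<omega>)
            show ?case
            proof
              assume w: "\<omega> \<in> a k"
              then have "ereal (- r \<omega> - \<epsilon> \<omega>) < N (Bs k) \<omega>" using elim(1) by blast
              with elim(2,3) w show "CE (\<lambda>w. x w * z w) \<omega> < r \<omega> + \<epsilon> \<omega>"
                unfolding N_def H_def by (cases "h (Bs k) \<omega>") auto
            qed
          qed
        qed
      qed
      ultimately have "AE \<omega> in M. \<bar>CE (\<lambda>w. x w * z w) \<omega> - r \<omega>\<bar> \<le> \<epsilon> \<omega>" by eventually_elim auto
      then show ?thesis using zC zV C(2) by blast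
    qed
    show ?thesis
    proof (rule mem)
      show "?T \<inter> G \<noteq> {}" if "G \<in> \<G>" for G by (rule meets[OF that])
      show "?T \<subseteq> V" by auto
      show "stable_set M F ?T"
      proof (rule stable_setI)
        show "?T \<noteq> {}" using meets[OF B1] by blast
        show "?T \<subseteq> borel_measurable M" using VL L1F_meas by blast
        show "y \<in> ?T" if "z \<in> ?T" "y \<in> borel_measurable M" "AE \<omega> in M. y \<omega> = z \<omega>" for z y
        proof -
          have z: "z \<in> V" "AE \<omega> in M. \<bar>CE (\<lambda>w. x w * z w) \<omega> - r \<omega>\<bar> \<le> \<epsilon> \<omega>" using that(1) by auto
          have y: "y \<in> V" by (rule stable_setD(3)[OF V(1) z(1) that(2,3)])
          from z(2) CE_cong_mult[OF x VL[OF y] VL[OF z(1)] that(3)]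
          have "AE \<omega> in M. \<bar>CE (\<lambda>w. x w * y w) \<omega> - r \<omega>\<bar> \<le> \<epsilon> \<omega>" by eventually_elim simp
          then show ?thesis using y by simp
        qed
        show "concat_rv a z \<in> ?T" if a: "event_partition F a" and z: "\<And>k. z k \<in> ?T" for a z
        proof -
          have zV: "z k \<in> V" for k using z by auto
          have c: "concat_rv a z \<in> V" by (rule stable_setD(4)[OF V(1) a zV])
          have "AE \<omega> in M. \<bar>CE (\<lambda>w. x w * concat_rv a z w) \<omega> - r \<omega>\<bar> \<le> \<epsilon> \<omega>"
          proof (rule partition_AE[OF a])
            fix k
            have "AE \<omega> in M. \<omega> \<in> a k \<longrightarrow> CE (\<lambda>w. x w * concat_rv a z w) \<omega> = CE (\<lambda>w. x w * z k w) \<omega>"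
              by (rule CE_local_mult[OF x VL[OF c] VL[OF zV] event_partitionD(1)[OF a]]) (simp add: concat_rv_on[OF a])
            moreover have "AE \<omega> in M. \<bar>CE (\<lambda>w. x w * z k w) \<omega> - r \<omega>\<bar> \<le> \<epsilon> \<omega>" using z[of k] by simp
            ultimately show "AE \<omega> in M. \<omega> \<in> a k \<longrightarrow> \<bar>CE (\<lambda>w. x w * concat_rv a z w) \<omega> - r \<omega>\<bar> \<le> \<epsilon> \<omega>"
              by eventually_elim auto
          qed
          then show ?thesis using c by simp
        qed
      qed
    qed
  qed
  then show ?thesis using rm by blast
qed

text \<open>The filter yields limits of pairings, not a density. The bound
  \<open>L x \<le> \<rho> x + \<eta>\<close> serves twice: it admits \<open>L\<close> to the
  representation by a density, and it puts this density back into the sublevel set.\<close>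

lemma lebesgue_imp_stably_inf_compact:
  assumes leb: "lebesgue_property M X \<rho>"
  shows "stably_inf_compact M F L1F (stable_weak_topology M F L1F X) fen"
  unfolding stably_inf_compact_def
proof (intro ballI impI)
  fix \<eta> :: "'a \<Rightarrow> real" assume \<eta>[measurable]: "\<eta> \<in> borel_measurable F"
  define V where "V = {y \<in> L1F. AE \<omega> in M. fen y \<omega> \<le> ereal (\<eta> \<omega>)}"
  assume "{y \<in> L1F. AE \<omega> in M. fen y \<omega> \<le> ereal (\<eta> \<omega>)} \<noteq> {}"
  then have Vst: "stable_set M F V" unfolding V_def by (intro fen_sublevel_stable) auto
  have VL: "y \<in> L1F" if "y \<in> V" for y using that by (simp add: V_def)
  have Vd: "V \<subseteq> densities" using sublevel_densities by (auto simp: V_def)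
  have "\<exists>x\<in>V. \<forall>B\<in>\<B>. x \<in> stable_weak_topology M F L1F X closure_of B"
    if B: "stable_filter_base M F \<B>" "\<forall>B\<in>\<B>. B \<subseteq> V" for \<B>
  proof -
    have Bb: "filter_base \<B>" "\<forall>S\<in>\<B>. stable_set M F S \<and> S \<subseteq> V"
      using B by (auto simp: stable_filter_base_def)
    from maximal_stable_filter[OF Bb Vst]
    obtain \<G> where BG: "\<B> \<subseteq> \<G>" and fb: "filter_base \<G>"
      and G1: "\<forall>S\<in>\<G>. stable_set M F S \<and> S \<subseteq> V"
      and G2: "\<forall>T. stable_set M F T \<and> T \<subseteq> V \<and> (\<forall>G\<in>\<G>. T \<inter> G \<noteq> {}) \<longrightarrow> T \<in> \<G>"
      and G3: "\<forall>S a. (\<forall>k. S k \<in> \<G>) \<and> event_partition F a \<longrightarrow> concat_sets M a S \<in> \<G>"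
      by (elim exE conjE) (rule that)
    have GV: "\<And>S. S \<in> \<G> \<Longrightarrow> stable_set M F S" "\<And>S. S \<in> \<G> \<Longrightarrow> S \<subseteq> V" using G1 by simp_all
    have mem: "T \<in> \<G>" if "stable_set M F T" "T \<subseteq> V" "\<And>G. G \<in> \<G> \<Longrightarrow> T \<inter> G \<noteq> {}" for T
      using G2[rule_format, of T] that by simp
    have cc: "concat_sets M a S \<in> \<G>" if "\<And>k. S k \<in> \<G>" "event_partition F a" for S a
      using G3[rule_format, of S a] that by simp
    define T where "T x r \<epsilon> = {z \<in> V. AE \<omega> in M. \<bar>CE (\<lambda>w. x w * z w) \<omega> - r \<omega>\<bar> \<le> \<epsilon> \<omega>}" for x r \<epsilon> :: "'a \<Rightarrow> real"
    have "\<forall>x\<in>X. \<exists>r. r \<in> borel_measurable F \<and> (\<forall>\<epsilon>\<in>borel_measurable F. (\<forall>\<omega>. 0 < \<epsilon> \<omega>) \<longrightarrow> T x r \<epsilon> \<in> \<G>)"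
      using maximal_filter_limit[OF Vst Vd fb GV mem cc] unfolding T_def by blast
    from bchoice[OF this] obtain L where LF: "\<And>x. x \<in> X \<Longrightarrow> L x \<in> borel_measurable F"
      and LT: "\<And>x \<epsilon>. x \<in> X \<Longrightarrow> \<epsilon> \<in> borel_measurable F \<Longrightarrow> (\<And>\<omega>. 0 < \<epsilon> \<omega>) \<Longrightarrow> T x (L x) \<epsilon> \<in> \<G>" by blast
    \<comment> \<open>Finitely many limits are approximated by the pairings with one
      \<open>z\<close> in \<open>V\<close>. Linear relations and bounds that hold for every
      \<open>z\<close> thereby pass to \<open>L\<close>.\<close>
    have common: "\<exists>z\<in>V. \<forall>x\<in>I. AE \<omega> in M. \<bar>CE (\<lambda>w. x w * z w) \<omega> - L x \<omega>\<bar> \<le> e x \<omega>"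
      if "finite I" "I \<subseteq> X" "\<And>x. x \<in> I \<Longrightarrow> e x \<in> borel_measurable F" "\<And>x \<omega>. x \<in> I \<Longrightarrow> 0 < e x \<omega>" for I and e :: "('a \<Rightarrow> real) \<Rightarrow> 'a \<Rightarrow> real"
    proof -
      have "\<exists>S\<in>\<G>. \<forall>x\<in>I. S \<subseteq> T x (L x) (e x)"
        by (rule filter_base_finite_Inter[OF fb that(1)]) (use LT that in blast)
      then obtain S where S: "S \<in> \<G>" "\<forall>x\<in>I. S \<subseteq> T x (L x) (e x)" by blast
      obtain z where "z \<in> S" using stable_setD(1)[OF GV(1)[OF S(1)]] by blast
      then show ?thesis using S(2) GV(2)[OF S(1)] unfolding T_def by (intro bexI[of _ z]) auto
    qed
    have LTle: "AE \<omega> in M. L x \<omega> \<le> \<rho> x \<omega> + \<eta> \<omega>" if x: "x \<in> X" for x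
    proof (rule AE_le_of_arbitrarily_close)
      fix e :: real assume e: "0 < e"
      obtain z where z: "z \<in> V" "AE \<omega> in M. \<bar>CE (\<lambda>w. x w * z w) \<omega> - L x \<omega>\<bar> \<le> e"
        using common[of "{x}" "\<lambda>_ _. e"] x e by auto
      have "AE \<omega> in M. fen z \<omega> \<le> ereal (\<eta> \<omega>)" using z(1) by (simp add: V_def)
      with z(2) fen_ge[OF VL[OF z(1)] x] show "AE \<omega> in M. L x \<omega> \<le> \<rho> x \<omega> + \<eta> \<omega> + e"
      proof eventually_elim
        case (elim \<omega>)
        then have "ereal (CE (\<lambda>w. x w * z w) \<omega> - \<rho> x \<omega>) \<le> ereal (\<eta> \<omega>)" by (metis order_trans)
        then show ?case using elim(1) by simp
      qed
    qed
    have "\<exists>y\<in>L1F. \<forall>x\<in>X. AE \<omega> in M. CE (\<lambda>w. x w * y w) \<omega> = L x \<omega>"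
    proof (rule dominated_functional_representation[OF leb LF, where \<eta> = \<eta>])
      fix x x' assume x: "x \<in> X" "x' \<in> X"
      let ?s = "\<lambda>w. x w + x' w"
      have s: "?s \<in> X" by (rule X_add[OF x])
      show "AE \<omega> in M. L ?s \<omega> = L x \<omega> + L x' \<omega>"
      proof (rule AE_eq_of_arbitrarily_close)
        fix e :: real assume e: "0 < e"
        obtain z where z: "z \<in> V" "\<And>u. u \<in> {x, x', ?s} \<Longrightarrow> AE \<omega> in M. \<bar>CE (\<lambda>w. u w * z w) \<omega> - L u \<omega>\<bar> \<le> e / 3"
          using common[of "{x, x', ?s}" "\<lambda>_ _. e / 3"] x s e by auto
        have "AE \<omega> in M. CE (\<lambda>w. ?s w * z w) \<omega> = CE (\<lambda>w. x w * z w) \<omega> + CE (\<lambda>w. x' w * z w) \<omega>"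
          using CE_add[OF L1F_multX[OF x(1) VL[OF z(1)]] L1F_multX[OF x(2) VL[OF z(1)]]] by (simp add: distrib_right)
        moreover have "AE \<omega> in M. \<bar>CE (\<lambda>w. x w * z w) \<omega> - L x \<omega>\<bar> \<le> e / 3" by (rule z(2)) simp
        moreover have "AE \<omega> in M. \<bar>CE (\<lambda>w. x' w * z w) \<omega> - L x' \<omega>\<bar> \<le> e / 3" by (rule z(2)) simp
        moreover have "AE \<omega> in M. \<bar>CE (\<lambda>w. ?s w * z w) \<omega> - L ?s \<omega>\<bar> \<le> e / 3" by (rule z(2)) simp
        ultimately show "AE \<omega> in M. \<bar>L ?s \<omega> - (L x \<omega> + L x' \<omega>)\<bar> \<le> e"
          by eventually_elim linarith
      qed
    next
      fix g x :: "'a \<Rightarrow> real" assume g[measurable]: "g \<in> borel_measurable F" and x: "x \<in> X"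
      let ?s = "\<lambda>w. g w * x w"
      have s: "?s \<in> X" by (rule X_multF[OF g x])
      show "AE \<omega> in M. L ?s \<omega> = g \<omega> * L x \<omega>"
      proof (rule AE_eq_of_arbitrarily_close)
        fix e :: real assume e: "0 < e"
        \<comment> \<open>The tolerance is random so that even after multiplication by the unbounded
          \<open>|g|\<close> it stays below \<open>e / 2\<close>. Homogeneity under F-measurable
          factors rests on this.\<close>
        define d where "d \<omega> = e / 2 / (1 + \<bar>g \<omega>\<bar>)" for \<omega>
        have dF: "d \<in> borel_measurable F" unfolding d_def by measurable
        have d0: "0 < d \<omega>" for \<omega> using e by (simp add: d_def add_pos_nonneg)
        have de: "d \<omega> \<le> e / 2" "\<bar>g \<omega>\<bar> * d \<omega> \<le> e / 2" for \<omega> using e by (auto simp: d_def field_simps)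
        obtain z where z: "z \<in> V" "\<And>u. u \<in> {x, ?s} \<Longrightarrow> AE \<omega> in M. \<bar>CE (\<lambda>w. u w * z w) \<omega> - L u \<omega>\<bar> \<le> d \<omega>"
          using common[of "{x, ?s}" "\<lambda>_. d"] x s dF d0 by auto
        have "AE \<omega> in M. CE (\<lambda>w. g w * (x w * z w)) \<omega> = g \<omega> * CE (\<lambda>w. x w * z w) \<omega>"
          by (rule CE_mult[OF g L1F_multX[OF x VL[OF z(1)]]])
        then have c: "AE \<omega> in M. CE (\<lambda>w. ?s w * z w) \<omega> = g \<omega> * CE (\<lambda>w. x w * z w) \<omega>" by (simp add: mult.assoc)
        have zx: "AE \<omega> in M. \<bar>CE (\<lambda>w. x w * z w) \<omega> - L x \<omega>\<bar> \<le> d \<omega>" and zs: "AE \<omega> in M. \<bar>CE (\<lambda>w. ?s w * z w) \<omega> - L ?s \<omega>\<bar> \<le> d \<omega>"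
          using z(2)[of x] z(2)[of ?s] by simp_all
        from c zx zs show "AE \<omega> in M. \<bar>L ?s \<omega> - g \<omega> * L x \<omega>\<bar> \<le> e"
        proof eventually_elim
          case (elim \<omega>)
          have "\<bar>g \<omega> * CE (\<lambda>w. x w * z w) \<omega> - g \<omega> * L x \<omega>\<bar> = \<bar>g \<omega>\<bar> * \<bar>CE (\<lambda>w. x w * z w) \<omega> - L x \<omega>\<bar>"
            by (simp add: right_diff_distrib[symmetric] abs_mult)
          also have "\<dots> \<le> \<bar>g \<omega>\<bar> * d \<omega>" by (rule mult_left_mono[OF elim(2)]) simp
          also have "\<dots> \<le> e / 2" by (rule de(2))
          finally show ?case using elim(3) de(1)[of \<omega>] unfolding elim(1) by linarith
        qed
      qed
    next
      fix x assume "x \<in> X"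
      then show "AE \<omega> in M. L x \<omega> \<le> \<rho> x \<omega> + \<eta> \<omega>" by (rule LTle)
    qed
    then obtain y where y: "y \<in> L1F" and yL: "\<And>x. x \<in> X \<Longrightarrow> AE \<omega> in M. CE (\<lambda>w. x w * y w) \<omega> = L x \<omega>" by blast
    have yV: "y \<in> V"
    proof -
      have "AE \<omega> in M. fen y \<omega> \<le> ereal (\<eta> \<omega>)"
      proof (rule fen_le[OF y])
        fix x assume x: "x \<in> X"
        from yL[OF x] LTle[OF x] show "AE \<omega> in M. ereal (CE (\<lambda>w. x w * y w) \<omega> - \<rho> x \<omega>) \<le> ereal (\<eta> \<omega>)"
          by eventually_elim simp
      qed measurable
      then show ?thesis using y by (simp add: V_def)
    qed
    have basic: "\<exists>S\<in>\<G>. S \<subseteq> Q" if Q: "Q \<in> stable_weak_base M F L1F X" and yQ: "y \<in> Q" for Q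
    proof -
      from Q obtain y0 \<Phi> a \<epsilon> where Qe: "Q = (\<lambda>u \<omega>. y0 \<omega> + u \<omega>) ` stable_weak_nhd M F L1F \<Phi> a \<epsilon>"
        and y0: "y0 \<in> L1F" and a: "event_partition F a"
        and \<Phi>: "\<And>k. \<Phi> k \<subseteq> X" "\<And>k. finite (\<Phi> k)" "\<And>k. \<Phi> k \<noteq> {}"
        and \<epsilon>[measurable]: "\<epsilon> \<in> borel_measurable F"
        unfolding stable_weak_base_def by blast
      note iff = stable_weak_nhd_iff[where \<Phi> = \<Phi> and \<epsilon> = \<epsilon>, OF a \<Phi>]
      obtain u where u: "y = (\<lambda>\<omega>. y0 \<omega> + u \<omega>)" and un: "u \<in> stable_weak_nhd M F L1F \<Phi> a \<epsilon>" using yQ unfolding Qe by blast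
      from un[unfolded iff] have uL: "u \<in> L1F"
        and ul: "AE \<omega> in M. \<forall>k. \<omega> \<in> a k \<longrightarrow> (\<forall>x\<in>\<Phi> k. \<bar>CE (\<lambda>w. x w * u w) \<omega>\<bar> < \<epsilon> \<omega>)" by blast+
      \<comment> \<open>Half of the gap that the strict inequality for \<open>u\<close> leaves. The
        value 1 elsewhere only keeps the tolerance positive everywhere.\<close>
      define e where "e x \<omega> = (if \<bar>CE (\<lambda>w. x w * u w) \<omega>\<bar> < \<epsilon> \<omega> then (\<epsilon> \<omega> - \<bar>CE (\<lambda>w. x w * u w) \<omega>\<bar>) / 2 else 1)" for x \<omega>
      have eF: "e x \<in> borel_measurable F" for x unfolding e_def by measurable
      have e0: "0 < e x \<omega>" for x \<omega> by (simp add: e_def)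
      have "\<exists>S\<in>\<G>. \<forall>x\<in>\<Phi> k. S \<subseteq> T x (L x) (e x)" for k
        by (rule filter_base_finite_Inter[OF fb \<Phi>(2)]) (use LT eF e0 \<Phi>(1) in blast)
      then obtain S where S: "\<And>k. S k \<in> \<G>" "\<And>k x. x \<in> \<Phi> k \<Longrightarrow> S k \<subseteq> T x (L x) (e x)" by metis
      \<comment> \<open>A neighbourhood imposes a finite set of tests on each of countably many
        pieces. One member per piece is available, and closure under concatenation merges them into
        a single member.\<close>
      have cG: "concat_sets M a S \<in> \<G>" by (rule cc[OF S(1) a])
      have "concat_sets M a S \<subseteq> Q"
      proof
        fix z assume z: "z \<in> concat_sets M a S"
        have zV: "z \<in> V" using z GV(2)[OF cG] by blast
        obtain ws where ws: "\<And>k. ws k \<in> S k" and zw: "AE \<omega> in M. z \<omega> = concat_rv a ws \<omega>"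
          using z by (auto simp: concat_sets_def)
        have wV: "ws k \<in> V" for k using ws GV(2)[OF S(1)] by blast
        let ?v = "\<lambda>w. z w - y0 w"
        have vL: "?v \<in> L1F" by (rule L1F_diff[OF VL[OF zV] y0])
        have one: "AE \<omega> in M. \<omega> \<in> a k \<longrightarrow> \<bar>CE (\<lambda>w. x w * ?v w) \<omega>\<bar> < \<epsilon> \<omega>" if xk: "x \<in> \<Phi> k" for x k
        proof -
          have x: "x \<in> X" using xk \<Phi>(1) by blast
          have 1: "AE \<omega> in M. \<omega> \<in> a k \<longrightarrow> CE (\<lambda>w. x w * z w) \<omega> = CE (\<lambda>w. x w * ws k w) \<omega>"
            by (rule CE_local_mult[OF x VL[OF zV] VL[OF wV] event_partitionD(1)[OF a]])
              (use zw in \<open>eventually_elim, simp add: concat_rv_on[OF a]\<close>)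
          have 2: "AE \<omega> in M. \<bar>CE (\<lambda>w. x w * ws k w) \<omega> - L x \<omega>\<bar> \<le> e x \<omega>"
            using S(2)[OF xk] ws[of k] by (auto simp: T_def)
          have 3: "AE \<omega> in M. CE (\<lambda>w. x w * ?v w) \<omega> = CE (\<lambda>w. x w * z w) \<omega> - CE (\<lambda>w. x w * y0 w) \<omega>"
            using CE_diff[OF L1F_multX[OF x VL[OF zV]] L1F_multX[OF x y0]] by (simp add: right_diff_distrib)
          have 4: "AE \<omega> in M. CE (\<lambda>w. x w * y w) \<omega> = CE (\<lambda>w. x w * y0 w) \<omega> + CE (\<lambda>w. x w * u w) \<omega>"
            using CE_add[OF L1F_multX[OF x y0] L1F_multX[OF x uL]] unfolding u by (simp add: distrib_left)
          show ?thesis using 1 2 3 4 yL[OF x] ul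
          proof eventually_elim
            case (elim \<omega>)
            show ?case
            proof
              assume w: "\<omega> \<in> a k"
              then have lt: "\<bar>CE (\<lambda>w. x w * u w) \<omega>\<bar> < \<epsilon> \<omega>" using elim(6) xk by blast
              have "\<bar>CE (\<lambda>w. x w * z w) \<omega> - L x \<omega>\<bar> \<le> (\<epsilon> \<omega> - \<bar>CE (\<lambda>w. x w * u w) \<omega>\<bar>) / 2"
                using elim(1,2) w lt by (simp add: e_def)
              moreover have "CE (\<lambda>w. x w * ?v w) \<omega> = CE (\<lambda>w. x w * u w) \<omega> + (CE (\<lambda>w. x w * z w) \<omega> - L x \<omega>)"
                using elim(3,4,5) by simp
              moreover have "\<bar>p + q\<bar> < s" if "\<bar>p\<bar> < s" "\<bar>q\<bar> \<le> (s - \<bar>p\<bar>) / 2" for p q s :: real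
                using that abs_triangle_ineq[of p q] by argo
              ultimately show "\<bar>CE (\<lambda>w. x w * ?v w) \<omega>\<bar> < \<epsilon> \<omega>" using lt by metis
            qed
          qed
        qed
        have "AE \<omega> in M. \<forall>k. \<forall>x\<in>\<Phi> k. \<omega> \<in> a k \<longrightarrow> \<bar>CE (\<lambda>w. x w * ?v w) \<omega>\<bar> < \<epsilon> \<omega>"
          unfolding AE_all_countable by (intro allI AE_finite_allI[OF \<Phi>(2)] one)
        then have "?v \<in> stable_weak_nhd M F L1F \<Phi> a \<epsilon>"
          unfolding iff using vL by (auto elim: eventually_mono)
        then show "z \<in> Q" unfolding Qe by (rule rev_image_eqI) simp
      qed
      then show ?thesis using cG by blast
    qed
    \<comment> \<open>The topology is given by generators, so the passage from basic sets to all
      open sets is an induction on generation; for intersections two members of the filter base are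
      refined to a common one.\<close>
    have nhds: "y \<in> Q \<longrightarrow> (\<exists>S\<in>\<G>. S \<subseteq> Q)" if "generate_topology_on (stable_weak_base M F L1F X) Q" for Q
      using that
    proof (induction rule: generate_topology_on.induct)
      case (Int A B)
      show ?case
      proof
        assume "y \<in> A \<inter> B"
        then obtain S S' where "S \<in> \<G>" "S \<subseteq> A" "S' \<in> \<G>" "S' \<subseteq> B" using Int.IH by blast
        moreover from this obtain S'' where "S'' \<in> \<G>" "S'' \<subseteq> S \<inter> S'" using fb unfolding filter_base_def by meson
        ultimately show "\<exists>S\<in>\<G>. S \<subseteq> A \<inter> B" by (intro bexI[of _ S'']) auto
      qed
    next
      case (UN K)
      show ?case
      proof
        assume "y \<in> \<Union>K"
        then obtain k where "k \<in> K" "y \<in> k" by blast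
        then obtain S where "S \<in> \<G>" "S \<subseteq> k" using UN.IH by blast
        then show "\<exists>S\<in>\<G>. S \<subseteq> \<Union>K" using \<open>k \<in> K\<close> by (intro bexI[of _ S]) auto
      qed
    next
      case (Basis Q)
      then show ?case using basic by blast
    qed simp
    have "y \<in> stable_weak_topology M F L1F X closure_of B" if B: "B \<in> \<B>" for B
      unfolding in_closure_of
    proof (intro conjI allI impI)
      obtain Q where "openin (stable_weak_topology M F L1F X) Q" "y \<in> Q"
        using open_weak_nhd[OF y, of "{\<lambda>_. 0}" "\<lambda>_. 1"] zero_X by auto
      then show "y \<in> topspace (stable_weak_topology M F L1F X)" using openin_subset by blast
      fix Q assume "y \<in> Q \<and> openin (stable_weak_topology M F L1F X) Q"
      then have "generate_topology_on (stable_weak_base M F L1F X) Q" "y \<in> Q"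
        by (auto simp: stable_weak_topology_def openin_topology_generated_by_iff)
      then obtain S where S: "S \<in> \<G>" "S \<subseteq> Q" using nhds by blast
      have "B \<in> \<G>" using B BG by blast
      then obtain C where "C \<in> \<G>" "C \<subseteq> S \<inter> B" using fb S(1) unfolding filter_base_def by meson
      moreover then have "C \<noteq> {}" using stable_setD(1)[OF GV(1)] by blast
      ultimately show "\<exists>z. z \<in> B \<and> z \<in> Q" using S(2) by blast
    qed
    then show ?thesis using yV by blast
  qed
  then show "stably_compact M F (stable_weak_topology M F L1F X) {y \<in> L1F. AE \<omega> in M. fen y \<omega> \<le> ereal (\<eta> \<omega>)}"
    using Vst unfolding stably_compact_def V_def by blast
qed

section \<open>Optimal densities from compactness\<close>

text \<open>Optimality of the cluster point is checked for one test \<open>x\<close> at a time: the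
  inequality involves only the pairings with \<open>x\<close> and \<open>x0\<close>, which one
  neighbourhood controls. The essential supremum over \<open>x\<close> is taken afterwards.\<close>

lemma stably_inf_compact_imp_attains:
  assumes rep: "\<And>x. x \<in> X \<Longrightarrow> AE \<omega> in M. ereal (\<rho> x \<omega>) = rep_sup x \<omega>"
    and sic: "stably_inf_compact M F L1F (stable_weak_topology M F L1F X) fen"
  shows "attains_representation M F X \<rho>"
  unfolding attains_representation_def koethe_dual_Linf_cond[OF prob_space_axioms subalg]
proof
  fix x0 assume x0: "x0 \<in> X"
  note [measurable] = rho_meas[OF x0]
  obtain b where b[measurable]: "b \<in> borel_measurable F" and bx: "AE \<omega> in M. \<bar>x0 \<omega>\<bar> \<le> b \<omega>" using X_bound[OF x0] by blast
  define D where "D e = {y \<in> L1F. AE \<omega> in M. fen y \<omega> \<le> ereal (CE (\<lambda>w. x0 w * y w) \<omega> - \<rho> x0 \<omega> + e \<omega>)}" for e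
  \<comment> \<open>Tolerances are capped at 1, so that all sets \<open>D e\<close> lie in the
    single sublevel set with bound \<open>b + |\<rho> x0| + 1\<close>, to which compactness is
    applied.\<close>
  define E where "E = {e \<in> borel_measurable F. \<forall>\<omega>\<in>space M. 0 < e \<omega> \<and> e \<omega> \<le> (1::real)}"
  define \<eta> where "\<eta> \<omega> = b \<omega> + \<bar>\<rho> x0 \<omega>\<bar> + 1" for \<omega>
  define V where "V = {y \<in> L1F. AE \<omega> in M. fen y \<omega> \<le> ereal (\<eta> \<omega>)}"
  have \<eta>F: "\<eta> \<in> borel_measurable F" unfolding \<eta>_def by measurable
  have Dne: "D e \<noteq> {}" if e: "e \<in> E" for e
  proof -
    have [measurable]: "e \<in> borel_measurable F" using e by (simp add: E_def)
    have "AE \<omega> in M. ereal (\<rho> x0 \<omega> - e \<omega>) < rep_sup x0 \<omega>"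
      using rep[OF x0] AE_space
    proof eventually_elim
      case (elim \<omega>)
      have "0 < e \<omega>" using e elim(2) by (simp add: E_def)
      then show ?case unfolding elim(1)[symmetric] by simp
    qed
    from rep_sup_select[OF x0 _ this] obtain a y where a: "event_partition F a" and y: "\<And>k. y k \<in> densities"
      and l: "AE \<omega> in M. \<forall>k. \<omega> \<in> a k \<longrightarrow> ereal (\<rho> x0 \<omega> - e \<omega>) < rep_value x0 (y k) \<omega>" by auto
    have yL: "y k \<in> L1F" for k by (rule densitiesD(1)[OF y])
    have c: "concat_rv a y \<in> L1F" by (rule L1F_concat[OF a yL])
    have "AE \<omega> in M. fen (concat_rv a y) \<omega> \<le> ereal (CE (\<lambda>w. x0 w * concat_rv a y w) \<omega> - \<rho> x0 \<omega> + e \<omega>)"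
    proof (rule partition_AE[OF a])
      fix k
      have "AE \<omega> in M. \<omega> \<in> a k \<longrightarrow> CE (\<lambda>w. x0 w * concat_rv a y w) \<omega> = CE (\<lambda>w. x0 w * y k w) \<omega>"
        by (rule CE_local_mult[OF x0 c yL event_partitionD(1)[OF a]]) (simp add: concat_rv_on[OF a])
      with l fen_concat[where y = y and k = k, OF a yL] fen_gt_MInf[OF yL[of k]]
      show "AE \<omega> in M. \<omega> \<in> a k \<longrightarrow> fen (concat_rv a y) \<omega> \<le> ereal (CE (\<lambda>w. x0 w * concat_rv a y w) \<omega> - \<rho> x0 \<omega> + e \<omega>)"
      proof eventually_elim
        case (elim \<omega>)
        show ?case
        proof
          assume w: "\<omega> \<in> a k"
          then have "ereal (\<rho> x0 \<omega> - e \<omega>) < rep_value x0 (y k) \<omega>" using elim(1) by blast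
          with elim(2,3,4) w show "fen (concat_rv a y) \<omega> \<le> ereal (CE (\<lambda>w. x0 w * concat_rv a y w) \<omega> - \<rho> x0 \<omega> + e \<omega>)"
            unfolding rep_value_def by (cases "fen (y k) \<omega>") auto
        qed
      qed
    qed
    then show ?thesis using c unfolding D_def by blast
  qed
  have Dst: "stable_set M F (D e)" if e: "e \<in> E" for e
  proof -
    have "stable_set M F {y \<in> L1F. AE \<omega> in M. fen y \<omega> \<le> ereal (CE (\<lambda>w. x0 w * y w) \<omega> - \<rho> x0 \<omega> + e \<omega>)}"
    proof (rule fen_sublevel_stable)
      fix y y' A assume "y \<in> L1F" "y' \<in> L1F" "A \<in> sets F" "AE \<omega> in M. \<omega> \<in> A \<longrightarrow> y \<omega> = y' \<omega>"
      from CE_local_mult[OF x0 this]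
      show "AE \<omega> in M. \<omega> \<in> A \<longrightarrow> CE (\<lambda>w. x0 w * y w) \<omega> - \<rho> x0 \<omega> + e \<omega> = CE (\<lambda>w. x0 w * y' w) \<omega> - \<rho> x0 \<omega> + e \<omega>"
        by eventually_elim simp
    qed (use Dne[OF e] in \<open>simp add: D_def\<close>)
    then show ?thesis by (simp add: D_def)
  qed
  have DV: "D e \<subseteq> V" if e: "e \<in> E" for e
  proof
    fix y assume "y \<in> D e"
    then have y: "y \<in> L1F" "AE \<omega> in M. fen y \<omega> \<le> ereal (CE (\<lambda>w. x0 w * y w) \<omega> - \<rho> x0 \<omega> + e \<omega>)" by (auto simp: D_def)
    note yd = densitiesD[OF sublevel_densities[OF y]]
    have "AE \<omega> in M. fen y \<omega> \<le> ereal (\<eta> \<omega>)"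
      using y(2) CE_mult_bound[OF x0 b bx yd(1-3)] AE_space
    proof eventually_elim
      case (elim \<omega>)
      have "e \<omega> \<le> 1" using e elim(3) by (simp add: E_def)
      then have "CE (\<lambda>w. x0 w * y w) \<omega> - \<rho> x0 \<omega> + e \<omega> \<le> \<eta> \<omega>" using elim(2) unfolding \<eta>_def by linarith
      then have "ereal (CE (\<lambda>w. x0 w * y w) \<omega> - \<rho> x0 \<omega> + e \<omega>) \<le> ereal (\<eta> \<omega>)" by simp
      with elim(1) show ?case by (rule order_trans)
    qed
    then show "y \<in> V" using y(1) by (simp add: V_def)
  qed
  have one: "(\<lambda>_. 1) \<in> E" by (simp add: E_def)
  have Vne: "V \<noteq> {}" using Dne[OF one] DV[OF one] by blast
  define \<B> where "\<B> = D ` E"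
  have "filter_base \<B>" unfolding filter_base_def
  proof (intro conjI ballI)
    show "\<B> \<noteq> {}" using one by (auto simp: \<B>_def)
    show "{} \<notin> \<B>" using Dne by (auto simp: \<B>_def)
    fix A B assume "A \<in> \<B>" "B \<in> \<B>"
    then obtain e e' where e: "e \<in> E" "e' \<in> E" "A = D e" "B = D e'" by (auto simp: \<B>_def)
    let ?m = "\<lambda>\<omega>. min (e \<omega>) (e' \<omega>)"
    have "?m \<in> E" using e(1,2) by (auto simp: E_def)
    moreover have "D ?m \<subseteq> D e \<inter> D e'"
    proof
      fix y assume y: "y \<in> D ?m"
      have le: "AE \<omega> in M. fen y \<omega> \<le> ereal (CE (\<lambda>w. x0 w * y w) \<omega> - \<rho> x0 \<omega> + e'' \<omega>)" if "\<And>\<omega>. ?m \<omega> \<le> e'' \<omega>" for e''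
      proof -
        have "AE \<omega> in M. fen y \<omega> \<le> ereal (CE (\<lambda>w. x0 w * y w) \<omega> - \<rho> x0 \<omega> + ?m \<omega>)" using y by (simp add: D_def)
        then show ?thesis
        proof eventually_elim
          case (elim \<omega>)
          moreover have "ereal (CE (\<lambda>w. x0 w * y w) \<omega> - \<rho> x0 \<omega> + ?m \<omega>) \<le> ereal (CE (\<lambda>w. x0 w * y w) \<omega> - \<rho> x0 \<omega> + e'' \<omega>)"
            using that[of \<omega>] by simp
          ultimately show ?case by (rule order_trans)
        qed
      qed
      have "y \<in> L1F" using y by (simp add: D_def)
      then show "y \<in> D e \<inter> D e'" using le[of e] le[of e'] by (simp add: D_def)
    qed
    ultimately show "\<exists>C\<in>\<B>. C \<subseteq> A \<inter> B" unfolding e(3,4) \<B>_def by blast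
  qed
  moreover have "stable_collection M F \<B>" unfolding stable_collection_def
  proof (intro conjI allI impI ballI)
    show "S \<noteq> {}" "L0_subset M S" if "S \<in> \<B>" for S using that Dst unfolding \<B>_def stable_set_def by auto
    fix S :: "nat \<Rightarrow> ('a \<Rightarrow> real) set" and a assume "(\<forall>k. S k \<in> \<B>) \<and> event_partition F a"
    then have a: "event_partition F a" and "\<forall>k. \<exists>e. e \<in> E \<and> S k = D e" by (auto simp: \<B>_def)
    then obtain e :: "nat \<Rightarrow> 'a \<Rightarrow> real" where e: "\<And>k. e k \<in> E" "\<And>k. S k = D (e k)" by metis
    let ?c = "concat_rv a e"
    have cE: "?c \<in> E" unfolding E_def
    proof (intro CollectI conjI ballI)
      show "?c \<in> borel_measurable F" by (rule concat_rv_meas_F[OF a]) (use e(1) in \<open>simp add: E_def\<close>)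
      fix \<omega> assume w: "\<omega> \<in> space M"
      obtain k where "\<omega> \<in> a k" using event_partitionD(3)[OF a w] by blast
      then have "?c \<omega> = e k \<omega>" by (rule concat_rv_on[OF a])
      then show "0 < ?c \<omega>" "?c \<omega> \<le> 1" using e(1)[of k] w by (auto simp: E_def)
    qed
    \<comment> \<open>Concatenating the sets amounts to concatenating their tolerances. This is why
      the tolerances range over F-measurable functions: constants would not give a stable
      collection.\<close>
    have "concat_sets M a S = D ?c"
    proof
      show "concat_sets M a S \<subseteq> D ?c"
      proof
        fix z assume "z \<in> concat_sets M a S"
        then obtain y where zm: "z \<in> borel_measurable M" and y: "\<And>k. y k \<in> D (e k)" and zy: "AE \<omega> in M. z \<omega> = concat_rv a y \<omega>"
          unfolding concat_sets_def e(2) by blast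
        have yL: "y k \<in> L1F" for k using y by (simp add: D_def)
        have zL: "z \<in> L1F" by (rule L1F_AE[OF L1F_concat[OF a yL] zm zy])
        have "AE \<omega> in M. fen z \<omega> \<le> ereal (CE (\<lambda>w. x0 w * z w) \<omega> - \<rho> x0 \<omega> + ?c \<omega>)"
        proof (rule partition_AE[OF a])
          fix k
          have l: "AE \<omega> in M. \<omega> \<in> a k \<longrightarrow> z \<omega> = y k \<omega>" using zy by eventually_elim (simp add: concat_rv_on[OF a])
          have "AE \<omega> in M. fen (y k) \<omega> \<le> ereal (CE (\<lambda>w. x0 w * y k w) \<omega> - \<rho> x0 \<omega> + e k \<omega>)" using y by (simp add: D_def)
          with CE_local_mult[OF x0 zL yL event_partitionD(1)[OF a] l] fen_local[OF zL yL event_partitionD(1)[OF a] l]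
          show "AE \<omega> in M. \<omega> \<in> a k \<longrightarrow> fen z \<omega> \<le> ereal (CE (\<lambda>w. x0 w * z w) \<omega> - \<rho> x0 \<omega> + ?c \<omega>)"
            by eventually_elim (auto simp: concat_rv_on[OF a])
        qed
        then show "z \<in> D ?c" using zL by (simp add: D_def)
      qed
      show "D ?c \<subseteq> concat_sets M a S"
      proof
        fix z assume z: "z \<in> D ?c"
        then have zL: "z \<in> L1F" and zle: "AE \<omega> in M. fen z \<omega> \<le> ereal (CE (\<lambda>w. x0 w * z w) \<omega> - \<rho> x0 \<omega> + ?c \<omega>)" by (auto simp: D_def)
        have "\<forall>k. \<exists>y. y \<in> D (e k)" using Dne[OF e(1)] by blast
        then obtain y where y: "\<And>k. y k \<in> D (e k)" by metis
        \<comment> \<open>Only the values of \<open>z\<close> on \<open>a k\<close> are known to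
          meet the tolerance \<open>e k\<close>; off \<open>a k\<close> they are replaced by those
          of some element of \<open>D (e k)\<close>.\<close>
        define v where "v k \<omega> = (if \<omega> \<in> a k then z \<omega> else y k \<omega>)" for k \<omega>
        have vD: "v k \<in> D (e k)" for k
        proof -
          note ak = event_partitionD(1)[OF a, of k]
          have yL: "y k \<in> L1F" and yle: "AE \<omega> in M. fen (y k) \<omega> \<le> ereal (CE (\<lambda>w. x0 w * y k w) \<omega> - \<rho> x0 \<omega> + e k \<omega>)"
            using y[of k] by (auto simp: D_def)
          have vL: "v k \<in> L1F" unfolding v_def by (rule L1F_glue[OF zL yL ak])
          have ac: "space F - a k \<in> sets F" using ak by auto
          have l1: "AE \<omega> in M. \<omega> \<in> a k \<longrightarrow> v k \<omega> = z \<omega>" and l2: "AE \<omega> in M. \<omega> \<in> space F - a k \<longrightarrow> v k \<omega> = y k \<omega>" by (auto simp: v_def)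
          have "AE \<omega> in M. fen (v k) \<omega> \<le> ereal (CE (\<lambda>w. x0 w * v k w) \<omega> - \<rho> x0 \<omega> + e k \<omega>)"
            using zle yle CE_local_mult[OF x0 vL zL ak l1] fen_local[OF vL zL ak l1]
              CE_local_mult[OF x0 vL yL ac l2] fen_local[OF vL yL ac l2] AE_space
          proof eventually_elim
            case (elim \<omega>)
            show ?case
            proof (cases "\<omega> \<in> a k")
              case True
              then show ?thesis using elim(1,3,4) by (simp add: concat_rv_on[OF a])
            next
              case False
              then show ?thesis using elim(2,5,6,7) by (simp add: space_F)
            qed
          qed
          then show ?thesis using vL by (simp add: D_def)
        qed
        have "AE \<omega> in M. z \<omega> = concat_rv a v \<omega>"
          by (rule partition_AE[OF a]) (simp add: concat_rv_on[OF a] v_def)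
        then show "z \<in> concat_sets M a S" unfolding concat_sets_def e(2) using vD L1F_meas[OF zL] by blast
      qed
    qed
    then show "concat_sets M a S \<in> \<B>" using cE by (simp add: \<B>_def)
  qed
  moreover have "\<forall>S\<in>\<B>. stable_set M F S" using Dst by (auto simp: \<B>_def)
  ultimately have sfb: "stable_filter_base M F \<B>" by (simp add: stable_filter_base_def)
  have "stably_compact M F (stable_weak_topology M F L1F X) V"
    using sic \<eta>F Vne unfolding stably_inf_compact_def V_def by blast
  moreover have "\<forall>B\<in>\<B>. B \<subseteq> V" using DV by (auto simp: \<B>_def)
  ultimately obtain y where yV: "y \<in> V" and cl: "\<forall>B\<in>\<B>. y \<in> stable_weak_topology M F L1F X closure_of B"
    using sfb unfolding stably_compact_def by blast
  have y: "y \<in> L1F" using yV by (simp add: V_def)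
  have "AE \<omega> in M. fen y \<omega> \<le> ereal (CE (\<lambda>w. x0 w * y w) \<omega> - \<rho> x0 \<omega>)"
  proof (rule fen_le[OF y])
    fix x assume x: "x \<in> X"
    have "AE \<omega> in M. CE (\<lambda>w. x w * y w) \<omega> - \<rho> x \<omega> \<le> CE (\<lambda>w. x0 w * y w) \<omega> - \<rho> x0 \<omega>"
    proof (rule AE_le_of_arbitrarily_close)
      fix e :: real assume e: "0 < e"
      \<comment> \<open>Three errors of size \<open>c\<close> occur: the tolerance of
        \<open>D\<close> and one for each of the two pairings. The cap at 1 puts the constant
        \<open>c\<close> into \<open>E\<close>.\<close>
      define c where "c = min (e / 3) 1"
      have c: "0 < c" "c \<le> 1" "3 * c \<le> e" using e by (auto simp: c_def)
      have "(\<lambda>_. c) \<in> E" using c by (simp add: E_def)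
      then have "y \<in> stable_weak_topology M F L1F X closure_of D (\<lambda>_. c)" using cl by (simp add: \<B>_def)
      moreover obtain Q where Q: "openin (stable_weak_topology M F L1F X) Q" "y \<in> Q"
        "\<And>z. z \<in> Q \<Longrightarrow> z \<in> L1F \<and> (AE \<omega> in M. \<forall>u\<in>{x0, x}. \<bar>CE (\<lambda>w. u w * z w) \<omega> - CE (\<lambda>w. u w * y w) \<omega>\<bar> < c)"
        using open_weak_nhd[OF y, of "{x0, x}" "\<lambda>_. c"] x x0 c by auto
      ultimately obtain z where zD: "z \<in> D (\<lambda>_. c)" and zQ: "z \<in> Q" unfolding in_closure_of by blast
      have z: "z \<in> L1F" "AE \<omega> in M. \<forall>u\<in>{x0, x}. \<bar>CE (\<lambda>w. u w * z w) \<omega> - CE (\<lambda>w. u w * y w) \<omega>\<bar> < c" using Q(3)[OF zQ] by auto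
      have "AE \<omega> in M. fen z \<omega> \<le> ereal (CE (\<lambda>w. x0 w * z w) \<omega> - \<rho> x0 \<omega> + c)" using zD by (simp add: D_def)
      with z(2) fen_ge[OF z(1) x]
      show "AE \<omega> in M. CE (\<lambda>w. x w * y w) \<omega> - \<rho> x \<omega> \<le> CE (\<lambda>w. x0 w * y w) \<omega> - \<rho> x0 \<omega> + e"
      proof eventually_elim
        case (elim \<omega>)
        have "ereal (CE (\<lambda>w. x w * z w) \<omega> - \<rho> x \<omega>) \<le> ereal (CE (\<lambda>w. x0 w * z w) \<omega> - \<rho> x0 \<omega> + c)"
          using elim(2,3) by (rule order_trans)
        moreover have "\<bar>CE (\<lambda>w. x0 w * z w) \<omega> - CE (\<lambda>w. x0 w * y w) \<omega>\<bar> < c" "\<bar>CE (\<lambda>w. x w * z w) \<omega> - CE (\<lambda>w. x w * y w) \<omega>\<bar> < c"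
          using elim(1) by auto
        ultimately show ?case using c(3) unfolding ereal_less_eq(3) by linarith
      qed
    qed
    then show "AE \<omega> in M. ereal (CE (\<lambda>w. x w * y w) \<omega> - \<rho> x \<omega>) \<le> ereal (CE (\<lambda>w. x0 w * y w) \<omega> - \<rho> x0 \<omega>)" by simp
  qed measurable
  with fen_ge[OF y x0] cond_exp_ext_mult_eq[OF x0 y]
  have "AE \<omega> in M. ereal (\<rho> x0 \<omega>) = cond_exp_ext M F (\<lambda>w. x0 w * y w) \<omega> - fen y \<omega>"
  proof eventually_elim
    case (elim \<omega>)
    have "fen y \<omega> = ereal (CE (\<lambda>w. x0 w * y w) \<omega> - \<rho> x0 \<omega>)" using elim(1,3) by (rule antisym[rotated])
    then show ?case unfolding elim(2) by simp
  qed
  then show "\<exists>y\<in>L1F. AE \<omega> in M. ereal (\<rho> x0 \<omega>) = cond_exp_ext M F (\<lambda>w. x0 w * y w) \<omega> - fen y \<omega>" using y by blast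
qed

lemma fatou_iff_representation:
  "fatou_property M X \<rho> \<longleftrightarrow> (\<forall>x\<in>X. AE \<omega> in M. ereal (\<rho> x \<omega>) = rep_sup x \<omega>)"
  using fatou_imp_representation representation_imp_fatou by blast

end

theorem theorem3p4:
  fixes M F :: "'a measure" and \<rho> :: "('a \<Rightarrow> real) \<Rightarrow> 'a \<Rightarrow> real"
  assumes "prob_space M"
    and "subalgebra M F"
    and "cond_risk_measure M F (Linf_cond M F) \<rho>"
  shows "(fatou_property M (Linf_cond M F) \<rho> \<longleftrightarrow>
            (\<forall>x\<in>Linf_cond M F. AE \<omega> in M. ereal (\<rho> x \<omega>) =
               ess_sup_family M F
                 {(\<lambda>w. cond_exp_ext M F (\<lambda>v. x v * y v) w - fenchel M F (Linf_cond M F) \<rho> y w) | y.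
                    y \<in> L1_cond M F \<and> (AE w in M. y w \<le> 0) \<and>
                    (AE w in M. cond_exp_ext M F y w = -1)} \<omega>)) \<and>
         (fatou_property M (Linf_cond M F) \<rho> \<longrightarrow>
            (attains_representation M F (Linf_cond M F) \<rho> \<longleftrightarrow>
               lebesgue_property M (Linf_cond M F) \<rho>) \<and>
            (lebesgue_property M (Linf_cond M F) \<rho> \<longleftrightarrow>
               stably_inf_compact M F (L1_cond M F)
                 (stable_weak_topology M F (L1_cond M F) (Linf_cond M F))
                 (fenchel M F (Linf_cond M F) \<rho>)))"
proof -
  interpret prob_space M by fact
  interpret conditional_risk M F \<rho> by unfold_locales (fact assms)+
  \<comment> \<open>Three implications close the circle; the Fatou property enters the first
    directly and the last in the form of the representation.\<close>
  show ?thesis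
    using fatou_iff_representation attains_imp_lebesgue lebesgue_imp_stably_inf_compact
      stably_inf_compact_imp_attains fatou_imp_representation
    unfolding rep_sup_def by blast
qed

end
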